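(* Let $\Bbbk$ be a field, and let $Q$ be a pointed affine semigroup of dimension $r$, with a given embedding into $\mathbb{N}^r$ and with canonical minimal generators $a_1,\dots,a_n$. Consider $\Bbbk[Q]$ as a $\mathbb{Z}^r$-graded module over the $\mathbb{Z}^r$-graded polynomial ring $R=\Bbbk[x_1,\dots,x_n]$ (with $\deg x_i=a_i$), and as a module over the corresponding action category $\mathbb{N}^n\!\int\!\mathbb{Z}^r$. Let $\mathcal{B}(\Bbbk[Q])$ be its Betti category, let $\varrho\colon\mathcal{B}(\Bbbk[Q])\to\mathbb{N}^n\!\int\!\mathbb{Z}^r$ be the inclusion functor, and let $B_\bullet(\operatorname{const}_\Bbbk)$ be the normalized bar resolution of the constant $\Bbbk\mathcal{B}(\Bbbk[Q])$-module $\operatorname{const}_\Bbbk$. Then $\operatorname{ind}_\varrho B_\bullet(\operatorname{const}_\Bbbk)$ is a free resolution of $\Bbbk[Q]$ as a module over $\mathbb{N}^n\!\int\!\mathbb{Z}^r$. In particular, applying to it the equivalence $M\mapsto\bigoplus_{\gamma\in\mathbb{Z}^r}M(\gamma)$ from modules over $\mathbb{N}^n\!\int\!\mathbb{Z}^r$ to $\mathbb{Z}^r$-graded $R$-modules produces a canonical finite free $\mathbb{Z}^r$-graded resolution of the $\mathbb{Z}^r$-graded $R$-module $\Bbbk[Q]$.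
   Context: Modules over categories. For a small category $\mathcal{C}$, a $\Bbbk\mathcal{C}$-module is a functor $\mathcal{C}\to\Bbbk\text{-Mod}$; homomorphisms are natural transformations; exactness is objectwise. A $\Bbbk\mathcal{C}$-module is free if it is isomorphic to a direct sum of modules $\Bbbk[\operatorname{mor}_{\mathcal{C}}(c,-)]$, $c\in\operatorname{obj}\mathcal{C}$. The constant module $\operatorname{const}_\Bbbk$ sends every object to $\Bbbk$ and every morphism to $\mathrm{id}_\Bbbk$. For a functor $\alpha\colon\mathcal{C}\to\mathcal{D}$, $\operatorname{res}_\alpha L=L\circ\alpha$, and $\operatorname{ind}_\alpha$ is the left adjoint of $\operatorname{res}_\alpha$ (left Kan extension), applied degreewise to complexes. Affine semigroups. A finitely generated abelian semigroup (with identity) $Q$ is affine if it is isomorphic to a subsemigroup of $\mathbb{Z}^r$ for some positive integer $r$; the smallest such $r$ is its dimension. It is pointed if its only invertible element is the identity. A pointed affine semigroup $Q$ of dimension $r$ embeds in $\mathbb{N}^r$ and has a canonical (unique) minimal generating set $\{a_1,\dots,a_n\}$, regarded as nonzero elements of $\mathbb{N}^r$. Let $A=(a_1\cdots a_n)$ also denote the monoid homomorphism $\mathbb{N}^n\to\mathbb{Z}^r$ with $e_i\mapsto a_i$. $\Bbbk[Q]$ is an $R$-module via $x_i\mapsto t^{a_i}$, and is $\mathbb{Z}^r$-graded. Action category. $\mathbb{N}^n\!\int\!\mathbb{Z}^r$ has object set $\mathbb{Z}^r$, morphisms $c\to d$ the $\lambda\in\mathbb{N}^n$ with $A\lambda=d-c$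 (equivalently, monomials of $R$ of degree $d-c$), and composition given by addition in $\mathbb{N}^n$ (multiplication of monomials). The functor $M\mapsto\bigoplus_{\gamma\in\mathbb{Z}^r}M(\gamma)$ is an equivalence between modules over $\mathbb{N}^n\!\int\!\mathbb{Z}^r$ and $\mathbb{Z}^r$-graded $R$-modules; via it $\Bbbk[Q]$ is viewed as a functor. Betti category. For a module $P$ over a small category $\mathcal{C}$ and an object $c$, let $\mathfrak{S}P(c)$ be the quotient of $P(c)$ by the sum of the images of all $P(u)$ with $u\colon b\to c$ a non-isomorphism. An epimorphism $f\colon L\to M$ is superfluous if for every $g\colon K\to L$, $g$ is epic iff $fg$ is epic; a projective cover is a superfluous epimorphism from a projective; a projective resolution is minimal if $P_0\to M$ and all $P_n\to\ker(d_{n-1})$ are projective covers. Finitely generated modules over $\mathbb{N}^n\!\int\!\mathbb{Z}^r$ have minimal projective resolutions, and these are free. $\mathcal{B}(\Bbbk[Q])$ is the full subcategory of $\mathbb{N}^n\!\int\!\mathbb{Z}^r$ whose objects are those $c$ with $\mathfrak{S}P_i(c)\ne0$ for some $i$, where $P_\bullet$ is the minimal free resolution of $\Bbbk[Q]$; i.e. the degrees of the basis elements of the minimal $\mathbb{Z}^r$-graded free resolution of $\Bbbk[Q]$ over $R$. Normalized bar resolution. For a $\Bbbk\mathcal{C}$-module $M$, let $F^u_n(-)=\bigoplus_{c_0\to\cdots\to c_n}\Bbbk[\operatorname{mor}_{\mathcal{C}}(c_n,-)]\otimes_\Bbbk M(c_0)$, summed over all $n$-tuples of composable morphisms $c_0\xrightarrow{u_1}c_1\to\cdots\xrightarrow{u_n}c_n$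 of $\mathcal{C}$, with differential $\sum_{i=0}^n(-1)^i\partial^i_n$. Here $\partial_n^i$ for $0<i<n$ maps the summand of the tuple identically to the summand of the tuple obtained by composing $u_{i+1}u_i$; $\partial_n^0$ drops $c_0$ using $\mathrm{id}\otimes M(u_1)$; $\partial_n^n$ drops $c_n$ using $u_n^*\otimes\mathrm{id}$. The augmentation $F_0^u\to M$ is given by $w\otimes m\mapsto M(w)(m)$. $B_\bullet(M)$ is the quotient of this complex by the subcomplex spanned by the summands whose tuple contains an identity morphism; so $B_n(M)$ is the analogous sum over tuples of composable non-identity morphisms. *)

theory Defs
  imports "HOL-Algebra.Module" "HOL-Algebra.AbelCoset"
begin

section \<open>Linear algebra\<close>

text \<open>The record \<^typ>\<open>('k, 'v) module\<close> extends the ring record; for modules that are not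
  rings the fields \<^const>\<open>mult\<close> and \<^const>\<open>one\<close> are junk and are set to \<^const>\<open>undefined\<close>.\<close>

definition mod_hom ::
  "('k, 'x) ring_scheme \<Rightarrow> ('k, 'v, 'y) module_scheme \<Rightarrow> ('k, 'w, 'z) module_scheme \<Rightarrow> ('v \<Rightarrow> 'w) set"
  where "mod_hom k M N =
    {f \<in> carrier M \<rightarrow> carrier N.
       (\<forall>x\<in>carrier M. \<forall>y\<in>carrier M. f (x \<oplus>\<^bsub>M\<^esub> y) = f x \<oplus>\<^bsub>N\<^esub> f y) \<and>
       (\<forall>a\<in>carrier k. \<forall>x\<in>carrier M. f (a \<odot>\<^bsub>M\<^esub> x) = a \<odot>\<^bsub>N\<^esub> f x)}"

definition mod_span :: "('k, 'x) ring_scheme \<Rightarrow> ('k, 'v, 'y) module_scheme \<Rightarrow> 'v set \<Rightarrow> 'v set"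
  where "mod_span k M S = \<Inter>{H. submodule H k M \<and> S \<subseteq> H}"

definition quot_mod :: "('k, 'v, 'y) module_scheme \<Rightarrow> 'v set \<Rightarrow> ('k, 'v set) module"
  where "quot_mod M H =
    \<lparr>carrier = a_rcosets\<^bsub>M\<^esub> H, mult = undefined, one = undefined,
     zero = H, add = (\<lambda>X Y. X <+>\<^bsub>M\<^esub> Y),
     smult = (\<lambda>a X. \<Union>x\<in>X. H +>\<^bsub>M\<^esub> (a \<odot>\<^bsub>M\<^esub> x))\<rparr>"

text \<open>The map induced on quotients, into the quotient of \<open>N\<close> by \<open>K\<close>. If \<open>f\<close> respects the
  submodules then all cosets in the union are equal.\<close>

definition quot_map ::
  "('k, 'w, 'y) module_scheme \<Rightarrow> 'w set \<Rightarrow> ('v \<Rightarrow> 'w) \<Rightarrow> 'v set \<Rightarrow> 'w set"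
  where "quot_map N K f X = (\<Union>x\<in>X. K +>\<^bsub>N\<^esub> f x)"

definition self_mod :: "('k, 'x) ring_scheme \<Rightarrow> ('k, 'k) module"
  where "self_mod k =
    \<lparr>carrier = carrier k, mult = mult k, one = \<one>\<^bsub>k\<^esub>, zero = \<zero>\<^bsub>k\<^esub>, add = add k, smult = mult k\<rparr>"

definition dsum_mod ::
  "'i set \<Rightarrow> ('i \<Rightarrow> ('k, 'v, 'y) module_scheme) \<Rightarrow> ('k, 'i \<Rightarrow> 'v) module"
  where "dsum_mod I F =
    \<lparr>carrier = {f \<in> \<Pi>\<^sub>E i\<in>I. carrier (F i). finite {i \<in> I. f i \<noteq> \<zero>\<^bsub>F i\<^esub>}},
     mult = undefined, one = undefined,
     zero = (\<lambda>i\<in>I. \<zero>\<^bsub>F i\<^esub>),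
     add = (\<lambda>f g. \<lambda>i\<in>I. f i \<oplus>\<^bsub>F i\<^esub> g i),
     smult = (\<lambda>a f. \<lambda>i\<in>I. a \<odot>\<^bsub>F i\<^esub> f i)\<rparr>"

definition dsum_in ::
  "'i set \<Rightarrow> ('i \<Rightarrow> ('k, 'v, 'y) module_scheme) \<Rightarrow> 'i \<Rightarrow> 'v \<Rightarrow> 'i \<Rightarrow> 'v"
  where "dsum_in I F j x = (\<lambda>i\<in>I. if i = j then x else \<zero>\<^bsub>F i\<^esub>)"

text \<open>The linear map out of a direct sum given by linear maps \<open>\<phi> i\<close> on the summands.\<close>

definition dsum_lift ::
  "'i set \<Rightarrow> ('i \<Rightarrow> ('k, 'v, 'y) module_scheme) \<Rightarrow> ('k, 'w, 'z) module_scheme \<Rightarrow>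
   ('i \<Rightarrow> 'v \<Rightarrow> 'w) \<Rightarrow> ('i \<Rightarrow> 'v) \<Rightarrow> 'w"
  where "dsum_lift I F N \<phi> f = (\<Oplus>\<^bsub>N\<^esub> i\<in>{i \<in> I. f i \<noteq> \<zero>\<^bsub>F i\<^esub>}. \<phi> i (f i))"

text \<open>Exactness of \<open>\<dots> \<rightarrow> F 1 \<rightarrow> F 0 \<rightarrow> M \<rightarrow> 0\<close>, where \<open>d i : F (i + 1) \<rightarrow> F i\<close> and
  \<open>e : F 0 \<rightarrow> M\<close>.\<close>

definition exact_augmented ::
  "(nat \<Rightarrow> ('k, 'v, 'y) module_scheme) \<Rightarrow> (nat \<Rightarrow> 'v \<Rightarrow> 'v) \<Rightarrow> ('v \<Rightarrow> 'w) \<Rightarrow>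
   ('k, 'w, 'z) module_scheme \<Rightarrow> bool"
  where "exact_augmented F d e M \<longleftrightarrow>
    e ` carrier (F 0) = carrier M \<and>
    d 0 ` carrier (F 1) = a_kernel (F 0) M e \<and>
    (\<forall>i. d (Suc i) ` carrier (F (Suc (Suc i))) = a_kernel (F (Suc i)) (F i) (d i))"


section \<open>Categories and functors\<close>

text \<open>Morphism sets of different pairs of objects need not be disjoint, so a morphism is
  determined by its source, its target and an element of \<open>'m\<close>. \<open>Comp C v u\<close> is \<open>v \<circ> u\<close>.\<close>

record ('o, 'm) cat =
  Obj :: "'o set"
  Mor :: "'o \<Rightarrow> 'o \<Rightarrow> 'm set"
  Id :: "'o \<Rightarrow> 'm"
  Comp :: "'m \<Rightarrow> 'm \<Rightarrow> 'm"

definition category :: "('o, 'm) cat \<Rightarrow> bool"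
  where "category C \<longleftrightarrow>
    (\<forall>c\<in>Obj C. Id C c \<in> Mor C c c) \<and>
    (\<forall>b\<in>Obj C. \<forall>c\<in>Obj C. \<forall>d\<in>Obj C. \<forall>u\<in>Mor C b c. \<forall>v\<in>Mor C c d. Comp C v u \<in> Mor C b d) \<and>
    (\<forall>c\<in>Obj C. \<forall>d\<in>Obj C. \<forall>u\<in>Mor C c d. Comp C u (Id C c) = u \<and> Comp C (Id C d) u = u) \<and>
    (\<forall>a\<in>Obj C. \<forall>b\<in>Obj C. \<forall>c\<in>Obj C. \<forall>d\<in>Obj C.
       \<forall>u\<in>Mor C a b. \<forall>v\<in>Mor C b c. \<forall>w\<in>Mor C c d. Comp C w (Comp C v u) = Comp C (Comp C w v) u)"

definition iso_mor :: "('o, 'm) cat \<Rightarrow> 'o \<Rightarrow> 'o \<Rightarrow> 'm \<Rightarrow> bool"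
  where "iso_mor C b c u \<longleftrightarrow>
    u \<in> Mor C b c \<and> (\<exists>v\<in>Mor C c b. Comp C v u = Id C b \<and> Comp C u v = Id C c)"

definition full_subcat :: "('o, 'm) cat \<Rightarrow> 'o set \<Rightarrow> ('o, 'm) cat"
  where "full_subcat C S = C\<lparr>Obj := Obj C \<inter> S\<rparr>"

definition is_functor ::
  "('o, 'm) cat \<Rightarrow> ('p, 'l) cat \<Rightarrow> ('o \<Rightarrow> 'p) \<Rightarrow> ('o \<Rightarrow> 'o \<Rightarrow> 'm \<Rightarrow> 'l) \<Rightarrow> bool"
  where "is_functor C D \<alpha>o \<alpha>m \<longleftrightarrow>
    (\<forall>c\<in>Obj C. \<alpha>o c \<in> Obj D \<and> \<alpha>m c c (Id C c) = Id D (\<alpha>o c)) \<and>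
    (\<forall>b\<in>Obj C. \<forall>c\<in>Obj C. \<forall>u\<in>Mor C b c. \<alpha>m b c u \<in> Mor D (\<alpha>o b) (\<alpha>o c)) \<and>
    (\<forall>b\<in>Obj C. \<forall>c\<in>Obj C. \<forall>d\<in>Obj C. \<forall>u\<in>Mor C b c. \<forall>v\<in>Mor C c d.
       \<alpha>m b d (Comp C v u) = Comp D (\<alpha>m c d v) (\<alpha>m b c u))"


section \<open>Modules over categories\<close>

text \<open>\<open>Act M c d u\<close> is the linear map \<open>M(u) : M(c) \<rightarrow> M(d)\<close> of a morphism \<open>u : c \<rightarrow> d\<close>.\<close>

record ('o, 'm, 'k, 'v) fmod =
  At :: "'o \<Rightarrow> ('k, 'v) module"
  Act :: "'o \<Rightarrow> 'o \<Rightarrow> 'm \<Rightarrow> 'v \<Rightarrow> 'v"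

definition is_kCmod :: "('k, 'x) ring_scheme \<Rightarrow> ('o, 'm) cat \<Rightarrow> ('o, 'm, 'k, 'v) fmod \<Rightarrow> bool"
  where "is_kCmod k C M \<longleftrightarrow>
    (\<forall>c\<in>Obj C. Module.module k (At M c)) \<and>
    (\<forall>c\<in>Obj C. \<forall>d\<in>Obj C. \<forall>u\<in>Mor C c d. Act M c d u \<in> mod_hom k (At M c) (At M d)) \<and>
    (\<forall>c\<in>Obj C. \<forall>x\<in>carrier (At M c). Act M c c (Id C c) x = x) \<and>
    (\<forall>b\<in>Obj C. \<forall>c\<in>Obj C. \<forall>d\<in>Obj C. \<forall>u\<in>Mor C b c. \<forall>v\<in>Mor C c d. \<forall>x\<in>carrier (At M b).
       Act M b d (Comp C v u) x = Act M c d v (Act M b c u x))"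

definition nat_trans ::
  "('k, 'x) ring_scheme \<Rightarrow> ('o, 'm) cat \<Rightarrow> ('o, 'm, 'k, 'v) fmod \<Rightarrow> ('o, 'm, 'k, 'w) fmod \<Rightarrow>
   ('o \<Rightarrow> 'v \<Rightarrow> 'w) set"
  where "nat_trans k C M N =
    {f. (\<forall>c\<in>Obj C. f c \<in> mod_hom k (At M c) (At N c)) \<and>
        (\<forall>c\<in>Obj C. \<forall>d\<in>Obj C. \<forall>u\<in>Mor C c d. \<forall>x\<in>carrier (At M c).
           f d (Act M c d u x) = Act N c d u (f c x))}"

definition epic ::
  "('o, 'm) cat \<Rightarrow> ('o, 'm, 'k, 'v) fmod \<Rightarrow> ('o, 'm, 'k, 'w) fmod \<Rightarrow> ('o \<Rightarrow> 'v \<Rightarrow> 'w) \<Rightarrow> bool"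
  where "epic C M N f \<longleftrightarrow> (\<forall>c\<in>Obj C. f c ` carrier (At M c) = carrier (At N c))"

definition dsum_fmod ::
  "'i set \<Rightarrow> ('i \<Rightarrow> ('o, 'm, 'k, 'v) fmod) \<Rightarrow> ('o, 'm, 'k, 'i \<Rightarrow> 'v) fmod"
  where "dsum_fmod I F =
    \<lparr>At = (\<lambda>c. dsum_mod I (\<lambda>i. At (F i) c)),
     Act = (\<lambda>c d u x. \<lambda>i\<in>I. Act (F i) c d u (x i))\<rparr>"

definition quot_fmod ::
  "('o, 'm, 'k, 'v) fmod \<Rightarrow> ('o \<Rightarrow> 'v set) \<Rightarrow> ('o, 'm, 'k, 'v set) fmod"
  where "quot_fmod M H =
    \<lparr>At = (\<lambda>c. quot_mod (At M c) (H c)),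
     Act = (\<lambda>c d u. quot_map (At M d) (H d) (Act M c d u))\<rparr>"

definition ker_fmod ::
  "('o, 'm, 'k, 'v) fmod \<Rightarrow> ('o, 'm, 'k, 'w) fmod \<Rightarrow> ('o \<Rightarrow> 'v \<Rightarrow> 'w) \<Rightarrow> ('o, 'm, 'k, 'v) fmod"
  where "ker_fmod M N f =
    \<lparr>At = (\<lambda>c. (At M c)\<lparr>carrier := a_kernel (At M c) (At N c) (f c)\<rparr>), Act = Act M\<rparr>"

definition const_fmod :: "('k, 'x) ring_scheme \<Rightarrow> ('o, 'm, 'k, 'k) fmod"
  where "const_fmod k = \<lparr>At = (\<lambda>c. self_mod k), Act = (\<lambda>c d u x. x)\<rparr>"

text \<open>The functor \<open>k[mor(c,-)] \<otimes> V\<close>. The tensor product of the free module \<open>k[S]\<close> with \<open>V\<close>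
  is realised as the direct sum of copies of \<open>V\<close> indexed by \<open>S\<close>; the summand inclusion
  \<open>dsum_in S (\<lambda>_. V) w x\<close> is \<open>w \<otimes> x\<close>. A morphism \<open>u\<close> sends \<open>w \<otimes> x\<close> to \<open>(u \<circ> w) \<otimes> x\<close>.\<close>

definition rep_tensor ::
  "('o, 'm) cat \<Rightarrow> 'o \<Rightarrow> ('k, 'v) module \<Rightarrow> ('o, 'm, 'k, 'm \<Rightarrow> 'v) fmod"
  where "rep_tensor C c V =
    \<lparr>At = (\<lambda>d. dsum_mod (Mor C c d) (\<lambda>_. V)),
     Act = (\<lambda>d e u.
       dsum_lift (Mor C c d) (\<lambda>_. V) (dsum_mod (Mor C c e) (\<lambda>_. V))
         (\<lambda>w x. dsum_in (Mor C c e) (\<lambda>_. V) (Comp C u w) x))\<rparr>"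

abbreviation rep_fmod ::
  "('k, 'x) ring_scheme \<Rightarrow> ('o, 'm) cat \<Rightarrow> 'o \<Rightarrow> ('o, 'm, 'k, 'm \<Rightarrow> 'k) fmod"
  where "rep_fmod k C c \<equiv> rep_tensor C c (self_mod k)"

text \<open>Taking the index set of the direct sum inside \<^typ>\<open>'o \<times> 'v\<close> is no restriction: an index
  can be replaced by the object \<open>c\<close> and the basis element of \<open>M(c)\<close> that belong to it.\<close>

definition is_free :: "('k, 'x) ring_scheme \<Rightarrow> ('o, 'm) cat \<Rightarrow> ('o, 'm, 'k, 'v) fmod \<Rightarrow> bool"
  where "is_free k C M \<longleftrightarrow> is_kCmod k C M \<and>
    (\<exists>(J :: ('o \<times> 'v) set) c. c \<in> J \<rightarrow> Obj C \<and>
       (\<exists>f\<in>nat_trans k C M (dsum_fmod J (\<lambda>j. rep_fmod k C (c j))).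
          \<forall>d\<in>Obj C. bij_betw (f d) (carrier (At M d))
            (carrier (At (dsum_fmod J (\<lambda>j. rep_fmod k C (c j))) d))))"

definition free_resolution ::
  "('k, 'x) ring_scheme \<Rightarrow> ('o, 'm) cat \<Rightarrow> (nat \<Rightarrow> ('o, 'm, 'k, 'v) fmod) \<Rightarrow>
   (nat \<Rightarrow> 'o \<Rightarrow> 'v \<Rightarrow> 'v) \<Rightarrow> ('o, 'm, 'k, 'w) fmod \<Rightarrow> bool"
  where "free_resolution k C F d M \<longleftrightarrow>
    is_kCmod k C M \<and> (\<forall>i. is_free k C (F i)) \<and> (\<forall>i. d i \<in> nat_trans k C (F (Suc i)) (F i)) \<and>
    (\<exists>e\<in>nat_trans k C (F 0) M.
       \<forall>c\<in>Obj C. exact_augmented (\<lambda>i. At (F i) c) (\<lambda>i. d i c) (e c) (At M c))"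


subsection \<open>Minimal resolutions\<close>

text \<open>It suffices to test with modules \<open>K\<close> over the element type of \<open>L\<close>, since \<open>g\<close> may be
  replaced by the inclusion of its image.\<close>

definition superfluous_epi ::
  "('k, 'x) ring_scheme \<Rightarrow> ('o, 'm) cat \<Rightarrow> ('o, 'm, 'k, 'v) fmod \<Rightarrow> ('o, 'm, 'k, 'w) fmod \<Rightarrow>
   ('o \<Rightarrow> 'v \<Rightarrow> 'w) \<Rightarrow> bool"
  where "superfluous_epi k C L M f \<longleftrightarrow>
    f \<in> nat_trans k C L M \<and> epic C L M f \<and>
    (\<forall>K :: ('o, 'm, 'k, 'v) fmod. \<forall>g\<in>nat_trans k C K L. is_kCmod k C K \<longrightarrow>
       (epic C K L g \<longleftrightarrow> epic C K M (\<lambda>c. f c \<circ> g c)))"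

text \<open>The lifting property can only be tested against modules over some fixed type of elements.
  Below, projectivity is only used together with \<^const>\<open>is_free\<close>, which implies the lifting
  property against modules over every type.\<close>

definition is_projective ::
  "('k, 'x) ring_scheme \<Rightarrow> ('o, 'm) cat \<Rightarrow> ('o, 'm, 'k, 'v) fmod \<Rightarrow> bool"
  where "is_projective k C P \<longleftrightarrow> is_kCmod k C P \<and>
    (\<forall>(L :: ('o, 'm, 'k, 'v) fmod) (M :: ('o, 'm, 'k, 'v) fmod).
       is_kCmod k C L \<longrightarrow> is_kCmod k C M \<longrightarrow>
       (\<forall>f\<in>nat_trans k C L M. epic C L M f \<longrightarrow>
         (\<forall>h\<in>nat_trans k C P M. \<exists>h'\<in>nat_trans k C P L.
            \<forall>c\<in>Obj C. \<forall>x\<in>carrier (At P c). f c (h' c x) = h c x)))"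

definition projective_cover ::
  "('k, 'x) ring_scheme \<Rightarrow> ('o, 'm) cat \<Rightarrow> ('o, 'm, 'k, 'v) fmod \<Rightarrow> ('o, 'm, 'k, 'w) fmod \<Rightarrow>
   ('o \<Rightarrow> 'v \<Rightarrow> 'w) \<Rightarrow> bool"
  where "projective_cover k C P M f \<longleftrightarrow>
    is_projective k C P \<and> is_kCmod k C M \<and> superfluous_epi k C P M f"

definition minimal_free_resolution ::
  "('k, 'x) ring_scheme \<Rightarrow> ('o, 'm) cat \<Rightarrow> (nat \<Rightarrow> ('o, 'm, 'k, 'v) fmod) \<Rightarrow>
   (nat \<Rightarrow> 'o \<Rightarrow> 'v \<Rightarrow> 'v) \<Rightarrow> ('o \<Rightarrow> 'v \<Rightarrow> 'w) \<Rightarrow> ('o, 'm, 'k, 'w) fmod \<Rightarrow> bool"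
  where "minimal_free_resolution k C P d e M \<longleftrightarrow>
    (\<forall>i. is_free k C (P i)) \<and>
    projective_cover k C (P 0) M e \<and>
    projective_cover k C (P 1) (ker_fmod (P 0) M e) (d 0) \<and>
    (\<forall>i. projective_cover k C (P (Suc (Suc i))) (ker_fmod (P (Suc i)) (P i) (d i)) (d (Suc i)))"

definition S_quot ::
  "('k, 'x) ring_scheme \<Rightarrow> ('o, 'm) cat \<Rightarrow> ('o, 'm, 'k, 'v) fmod \<Rightarrow> 'o \<Rightarrow> ('k, 'v set) module"
  where "S_quot k C P c =
    quot_mod (At P c) (mod_span k (At P c)
      (\<Union>b\<in>Obj C. \<Union>u\<in>{u \<in> Mor C b c. \<not> iso_mor C b c u}. Act P b c u ` carrier (At P b)))"

definition betti_category ::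
  "('k, 'x) ring_scheme \<Rightarrow> ('o, 'm) cat \<Rightarrow> (nat \<Rightarrow> ('o, 'm, 'k, 'v) fmod) \<Rightarrow> ('o, 'm) cat"
  where "betti_category k C P =
    full_subcat C {c \<in> Obj C. \<exists>i. carrier (S_quot k C (P i) c) \<noteq> {\<zero>\<^bsub>S_quot k C (P i) c\<^esub>}}"


subsection \<open>Restriction and left Kan extension\<close>

definition res_fmod ::
  "('o \<Rightarrow> 'p) \<Rightarrow> ('o \<Rightarrow> 'o \<Rightarrow> 'm \<Rightarrow> 'l) \<Rightarrow> ('p, 'l, 'k, 'v) fmod \<Rightarrow> ('o, 'm, 'k, 'v) fmod"
  where "res_fmod \<alpha>o \<alpha>m M =
    \<lparr>At = (\<lambda>c. At M (\<alpha>o c)), Act = (\<lambda>c d u. Act M (\<alpha>o c) (\<alpha>o d) (\<alpha>m c d u))\<rparr>"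

text \<open>The pointwise formula: \<open>ind L (d)\<close> is the colimit of \<open>L(c)\<close> over the comma category
  of all \<open>(c, w : \<alpha>(c) \<rightarrow> d)\<close>, that is, the quotient of the direct sum by the relations that
  identify \<open>x\<close> in the summand \<open>(b, w \<circ> \<alpha>(u))\<close> with \<open>L(u)(x)\<close> in the summand \<open>(c, w)\<close>,
  for \<open>u : b \<rightarrow> c\<close>.\<close>

definition comma ::
  "('o, 'm) cat \<Rightarrow> ('p, 'l) cat \<Rightarrow> ('o \<Rightarrow> 'p) \<Rightarrow> 'p \<Rightarrow> ('o \<times> 'l) set"
  where "comma C D \<alpha>o d = (SIGMA c:Obj C. Mor D (\<alpha>o c) d)"

definition ind_sum ::
  "('o, 'm) cat \<Rightarrow> ('p, 'l) cat \<Rightarrow> ('o \<Rightarrow> 'p) \<Rightarrow> ('o, 'm, 'k, 'v) fmod \<Rightarrow> 'p \<Rightarrow>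
   ('k, 'o \<times> 'l \<Rightarrow> 'v) module"
  where "ind_sum C D \<alpha>o L d = dsum_mod (comma C D \<alpha>o d) (\<lambda>(c, w). At L c)"

abbreviation ind_in ::
  "('o, 'm) cat \<Rightarrow> ('p, 'l) cat \<Rightarrow> ('o \<Rightarrow> 'p) \<Rightarrow> ('o, 'm, 'k, 'v) fmod \<Rightarrow> 'p \<Rightarrow>
   'o \<Rightarrow> 'l \<Rightarrow> 'v \<Rightarrow> 'o \<times> 'l \<Rightarrow> 'v"
  where "ind_in C D \<alpha>o L d c w \<equiv> dsum_in (comma C D \<alpha>o d) (\<lambda>(c, w). At L c) (c, w)"

definition ind_rel ::
  "('k, 'x) ring_scheme \<Rightarrow> ('o, 'm) cat \<Rightarrow> ('p, 'l) cat \<Rightarrow> ('o \<Rightarrow> 'p) \<Rightarrow> ('o \<Rightarrow> 'o \<Rightarrow> 'm \<Rightarrow> 'l) \<Rightarrow>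
   ('o, 'm, 'k, 'v) fmod \<Rightarrow> 'p \<Rightarrow> ('o \<times> 'l \<Rightarrow> 'v) set"
  where "ind_rel k C D \<alpha>o \<alpha>m L d = mod_span k (ind_sum C D \<alpha>o L d)
    {ind_in C D \<alpha>o L d b (Comp D w (\<alpha>m b c u)) x
       \<ominus>\<^bsub>ind_sum C D \<alpha>o L d\<^esub> ind_in C D \<alpha>o L d c w (Act L b c u x) | b c u w x.
     b \<in> Obj C \<and> c \<in> Obj C \<and> u \<in> Mor C b c \<and> w \<in> Mor D (\<alpha>o c) d \<and> x \<in> carrier (At L b)}"

definition ind_fmod ::
  "('k, 'x) ring_scheme \<Rightarrow> ('o, 'm) cat \<Rightarrow> ('p, 'l) cat \<Rightarrow> ('o \<Rightarrow> 'p) \<Rightarrow> ('o \<Rightarrow> 'o \<Rightarrow> 'm \<Rightarrow> 'l) \<Rightarrow>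
   ('o, 'm, 'k, 'v) fmod \<Rightarrow> ('p, 'l, 'k, ('o \<times> 'l \<Rightarrow> 'v) set) fmod"
  where "ind_fmod k C D \<alpha>o \<alpha>m L =
    \<lparr>At = (\<lambda>d. quot_mod (ind_sum C D \<alpha>o L d) (ind_rel k C D \<alpha>o \<alpha>m L d)),
     Act = (\<lambda>d e v. quot_map (ind_sum C D \<alpha>o L e) (ind_rel k C D \<alpha>o \<alpha>m L e)
       (dsum_lift (comma C D \<alpha>o d) (\<lambda>(c, w). At L c) (ind_sum C D \<alpha>o L e)
         (\<lambda>(c, w) x. ind_in C D \<alpha>o L e c (Comp D v w) x)))\<rparr>"

definition ind_map ::
  "('k, 'x) ring_scheme \<Rightarrow> ('o, 'm) cat \<Rightarrow> ('p, 'l) cat \<Rightarrow> ('o \<Rightarrow> 'p) \<Rightarrow> ('o \<Rightarrow> 'o \<Rightarrow> 'm \<Rightarrow> 'l) \<Rightarrow>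
   ('o, 'm, 'k, 'v) fmod \<Rightarrow> ('o, 'm, 'k, 'w) fmod \<Rightarrow> ('o \<Rightarrow> 'v \<Rightarrow> 'w) \<Rightarrow>
   'p \<Rightarrow> ('o \<times> 'l \<Rightarrow> 'v) set \<Rightarrow> ('o \<times> 'l \<Rightarrow> 'w) set"
  where "ind_map k C D \<alpha>o \<alpha>m L L' f d =
    quot_map (ind_sum C D \<alpha>o L' d) (ind_rel k C D \<alpha>o \<alpha>m L' d)
      (dsum_lift (comma C D \<alpha>o d) (\<lambda>(c, w). At L c) (ind_sum C D \<alpha>o L' d)
        (\<lambda>(c, w) x. ind_in C D \<alpha>o L' d c w (f c x)))"


subsection \<open>The normalized bar resolution\<close>

text \<open>A chain \<open>c0 \<rightarrow> \<dots> \<rightarrow> cn\<close> is the pair of the lists \<open>[c0, \<dots>, cn]\<close> and \<open>[u1, \<dots>, un]\<close>.\<close>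

type_synonym ('o, 'm) chain = "'o list \<times> 'm list"

definition chains :: "('o, 'm) cat \<Rightarrow> nat \<Rightarrow> ('o, 'm) chain set"
  where "chains C n =
    {(cs, us). length cs = Suc n \<and> length us = n \<and> set cs \<subseteq> Obj C \<and>
       (\<forall>i<n. us ! i \<in> Mor C (cs ! i) (cs ! Suc i))}"

definition has_identity :: "('o, 'm) cat \<Rightarrow> ('o, 'm) chain \<Rightarrow> bool"
  where "has_identity C t \<longleftrightarrow>
    (\<exists>i<length (snd t). fst t ! i = fst t ! Suc i \<and> snd t ! i = Id C (fst t ! i))"

definition bar_summand ::
  "('o, 'm) cat \<Rightarrow> ('o, 'm, 'k, 'v) fmod \<Rightarrow> ('o, 'm) chain \<Rightarrow> ('o, 'm, 'k, 'm \<Rightarrow> 'v) fmod"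
  where "bar_summand C M t = rep_tensor C (last (fst t)) (At M (hd (fst t)))"

definition ubar ::
  "('o, 'm) cat \<Rightarrow> ('o, 'm, 'k, 'v) fmod \<Rightarrow> nat \<Rightarrow> ('o, 'm, 'k, ('o, 'm) chain \<Rightarrow> 'm \<Rightarrow> 'v) fmod"
  where "ubar C M n = dsum_fmod (chains C n) (bar_summand C M)"

text \<open>The element \<open>w \<otimes> x\<close> of the summand of the chain \<open>t\<close>, evaluated at the object \<open>d\<close>.\<close>

definition ubar_in ::
  "('o, 'm) cat \<Rightarrow> ('o, 'm, 'k, 'v) fmod \<Rightarrow> nat \<Rightarrow> 'o \<Rightarrow> ('o, 'm) chain \<Rightarrow> 'm \<Rightarrow> 'v \<Rightarrow>
   ('o, 'm) chain \<Rightarrow> 'm \<Rightarrow> 'v"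
  where "ubar_in C M n d t w x =
    dsum_in (chains C n) (\<lambda>t. At (bar_summand C M t) d) t
      (dsum_in (Mor C (last (fst t)) d) (\<lambda>_. At M (hd (fst t))) w x)"

definition bar_lift ::
  "('o, 'm) cat \<Rightarrow> ('o, 'm, 'k, 'v) fmod \<Rightarrow> nat \<Rightarrow> 'o \<Rightarrow> ('k, 'w, 'z) module_scheme \<Rightarrow>
   (('o, 'm) chain \<Rightarrow> 'm \<Rightarrow> 'v \<Rightarrow> 'w) \<Rightarrow> (('o, 'm) chain \<Rightarrow> 'm \<Rightarrow> 'v) \<Rightarrow> 'w"
  where "bar_lift C M n d N \<phi> =
    dsum_lift (chains C n) (\<lambda>t. At (bar_summand C M t) d) N
      (\<lambda>t. dsum_lift (Mor C (last (fst t)) d) (\<lambda>_. At M (hd (fst t))) N (\<phi> t))"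

text \<open>The face \<open>\<partial>\<^sub>n\<^sup>i : F\<^sub>n \<rightarrow> F\<^sub>n\<^sub>-\<^sub>1\<close> for \<open>n \<ge> 1\<close> and \<open>i \<le> n\<close>. Lists are indexed from \<open>0\<close>, so
  \<open>u\<^sub>i\<close> is \<open>us ! (i - 1)\<close> and \<open>u\<^sub>i\<^sub>+\<^sub>1 \<circ> u\<^sub>i\<close> is \<open>Comp C (us ! i) (us ! (i - 1))\<close>.\<close>

definition bar_face ::
  "('o, 'm) cat \<Rightarrow> ('o, 'm, 'k, 'v) fmod \<Rightarrow> nat \<Rightarrow> nat \<Rightarrow> 'o \<Rightarrow>
   (('o, 'm) chain \<Rightarrow> 'm \<Rightarrow> 'v) \<Rightarrow> (('o, 'm) chain \<Rightarrow> 'm \<Rightarrow> 'v)"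
  where "bar_face C M n i d =
    bar_lift C M n d (At (ubar C M (n - 1)) d)
      (\<lambda>(cs, us) w x.
        if i = 0 then
          ubar_in C M (n - 1) d (tl cs, tl us) w (Act M (cs ! 0) (cs ! 1) (us ! 0) x)
        else if i < n then
          ubar_in C M (n - 1) d
            (take i cs @ drop (Suc i) cs,
             take (i - 1) us @ [Comp C (us ! i) (us ! (i - 1))] @ drop (Suc i) us) w x
        else
          ubar_in C M (n - 1) d (butlast cs, butlast us) (Comp C w (last us)) x)"

text \<open>The differential \<open>F\<^sub>n\<^sub>+\<^sub>1 \<rightarrow> F\<^sub>n\<close>.\<close>

definition ubar_diff ::
  "('o, 'm) cat \<Rightarrow> ('o, 'm, 'k, 'v) fmod \<Rightarrow> nat \<Rightarrow> 'o \<Rightarrow>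
   (('o, 'm) chain \<Rightarrow> 'm \<Rightarrow> 'v) \<Rightarrow> (('o, 'm) chain \<Rightarrow> 'm \<Rightarrow> 'v)"
  where "ubar_diff C M n d f =
    (\<Oplus>\<^bsub>At (ubar C M n) d\<^esub> i\<in>{..Suc n}.
       if even i then bar_face C M (Suc n) i d f
       else \<ominus>\<^bsub>At (ubar C M n) d\<^esub> bar_face C M (Suc n) i d f)"

definition degenerate ::
  "('o, 'm) cat \<Rightarrow> ('o, 'm, 'k, 'v) fmod \<Rightarrow> nat \<Rightarrow> 'o \<Rightarrow> (('o, 'm) chain \<Rightarrow> 'm \<Rightarrow> 'v) set"
  where "degenerate C M n d =
    {f \<in> carrier (At (ubar C M n) d).
       \<forall>t\<in>chains C n. \<not> has_identity C t \<longrightarrow> f t = \<zero>\<^bsub>At (bar_summand C M t) d\<^esub>}"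

definition nbar ::
  "('o, 'm) cat \<Rightarrow> ('o, 'm, 'k, 'v) fmod \<Rightarrow> nat \<Rightarrow>
   ('o, 'm, 'k, (('o, 'm) chain \<Rightarrow> 'm \<Rightarrow> 'v) set) fmod"
  where "nbar C M n = quot_fmod (ubar C M n) (degenerate C M n)"

definition nbar_diff ::
  "('o, 'm) cat \<Rightarrow> ('o, 'm, 'k, 'v) fmod \<Rightarrow> nat \<Rightarrow> 'o \<Rightarrow>
   (('o, 'm) chain \<Rightarrow> 'm \<Rightarrow> 'v) set \<Rightarrow> (('o, 'm) chain \<Rightarrow> 'm \<Rightarrow> 'v) set"
  where "nbar_diff C M n d =
    quot_map (At (ubar C M n) d) (degenerate C M n d) (ubar_diff C M n d)"


section \<open>Graded modules\<close>

text \<open>The grading group \<open>G\<close> is written multiplicatively.\<close>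

definition is_graded_module ::
  "('g, 'c) monoid_scheme \<Rightarrow> ('a, 'x) ring_scheme \<Rightarrow> ('g \<Rightarrow> 'a set) \<Rightarrow>
   ('a, 'v, 'y) module_scheme \<Rightarrow> ('g \<Rightarrow> 'v set) \<Rightarrow> bool"
  where "is_graded_module G R Rgr M Mgr \<longleftrightarrow>
    Module.module R M \<and>
    (\<forall>\<gamma>\<in>carrier G. additive_subgroup (Mgr \<gamma>) M) \<and>
    (\<forall>m\<in>carrier M. \<exists>!h. h \<in> (\<Pi>\<^sub>E \<gamma>\<in>carrier G. Mgr \<gamma>) \<and> finite {\<gamma> \<in> carrier G. h \<gamma> \<noteq> \<zero>\<^bsub>M\<^esub>} \<and>
       m = (\<Oplus>\<^bsub>M\<^esub> \<gamma>\<in>{\<gamma> \<in> carrier G. h \<gamma> \<noteq> \<zero>\<^bsub>M\<^esub>}. h \<gamma>)) \<and>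
    (\<forall>\<gamma>\<in>carrier G. \<forall>\<delta>\<in>carrier G. \<forall>f\<in>Rgr \<gamma>. \<forall>m\<in>Mgr \<delta>. f \<odot>\<^bsub>M\<^esub> m \<in> Mgr (\<gamma> \<otimes>\<^bsub>G\<^esub> \<delta>))"

definition graded_hom ::
  "('g, 'c) monoid_scheme \<Rightarrow> ('a, 'x) ring_scheme \<Rightarrow>
   ('a, 'v, 'y) module_scheme \<Rightarrow> ('g \<Rightarrow> 'v set) \<Rightarrow> ('a, 'w, 'z) module_scheme \<Rightarrow> ('g \<Rightarrow> 'w set) \<Rightarrow>
   ('v \<Rightarrow> 'w) set"
  where "graded_hom G R M Mgr N Ngr =
    {f \<in> mod_hom R M N. \<forall>\<gamma>\<in>carrier G. f ` Mgr \<gamma> \<subseteq> Ngr \<gamma>}"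

text \<open>The finite direct sum of the shifts \<open>R(-c i)\<close>, whose \<open>i\<close>-th basis element has degree \<open>c i\<close>.\<close>

definition shift_sum :: "('a, 'x) ring_scheme \<Rightarrow> nat \<Rightarrow> ('a, nat \<Rightarrow> 'a) module"
  where "shift_sum R m = dsum_mod {..<m} (\<lambda>_. self_mod R)"

definition shift_sum_grading ::
  "('g, 'c) monoid_scheme \<Rightarrow> ('a, 'x) ring_scheme \<Rightarrow> ('g \<Rightarrow> 'a set) \<Rightarrow> nat \<Rightarrow> (nat \<Rightarrow> 'g) \<Rightarrow>
   'g \<Rightarrow> (nat \<Rightarrow> 'a) set"
  where "shift_sum_grading G R Rgr m c \<gamma> =
    {f \<in> carrier (shift_sum R m). \<forall>i<m. f i \<in> Rgr (\<gamma> \<otimes>\<^bsub>G\<^esub> inv\<^bsub>G\<^esub> c i)}"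

definition is_finite_free_graded ::
  "('g, 'c) monoid_scheme \<Rightarrow> ('a, 'x) ring_scheme \<Rightarrow> ('g \<Rightarrow> 'a set) \<Rightarrow>
   ('a, 'v, 'y) module_scheme \<Rightarrow> ('g \<Rightarrow> 'v set) \<Rightarrow> bool"
  where "is_finite_free_graded G R Rgr M Mgr \<longleftrightarrow>
    is_graded_module G R Rgr M Mgr \<and>
    (\<exists>m c. c \<in> {..<m} \<rightarrow> carrier G \<and>
       (\<exists>f\<in>graded_hom G R M Mgr (shift_sum R m) (shift_sum_grading G R Rgr m c).
          bij_betw f (carrier M) (carrier (shift_sum R m)) \<and>
          (\<forall>\<gamma>\<in>carrier G. f ` Mgr \<gamma> = shift_sum_grading G R Rgr m c \<gamma>)))"

text \<open>Finite means of finite length and with finitely generated terms.\<close>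

definition finite_free_graded_resolution ::
  "('g, 'c) monoid_scheme \<Rightarrow> ('a, 'x) ring_scheme \<Rightarrow> ('g \<Rightarrow> 'a set) \<Rightarrow>
   (nat \<Rightarrow> ('a, 'v, 'y) module_scheme) \<Rightarrow> (nat \<Rightarrow> 'g \<Rightarrow> 'v set) \<Rightarrow> (nat \<Rightarrow> 'v \<Rightarrow> 'v) \<Rightarrow>
   ('a, 'w, 'z) module_scheme \<Rightarrow> ('g \<Rightarrow> 'w set) \<Rightarrow> bool"
  where "finite_free_graded_resolution G R Rgr F Fgr d M Mgr \<longleftrightarrow>
    is_graded_module G R Rgr M Mgr \<and>
    (\<forall>i. is_finite_free_graded G R Rgr (F i) (Fgr i)) \<and>
    (\<exists>l. \<forall>i>l. carrier (F i) = {\<zero>\<^bsub>F i\<^esub>}) \<and>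
    (\<forall>i. d i \<in> graded_hom G R (F (Suc i)) (Fgr (Suc i)) (F i) (Fgr i)) \<and>
    (\<exists>e\<in>graded_hom G R (F 0) (Fgr 0) M Mgr. exact_augmented F d e M)"


section \<open>Affine semigroups\<close>

text \<open>\<open>vec_monoid m\<close> is \<open>\<nat>\<^sup>m\<close> or \<open>\<int>\<^sup>m\<close>, depending on the type of the entries, written
  multiplicatively.\<close>

definition vec_monoid :: "nat \<Rightarrow> (nat \<Rightarrow> 'a::comm_monoid_add) monoid"
  where "vec_monoid m =
    \<lparr>carrier = {v. \<forall>i\<ge>m. v i = 0}, mult = (\<lambda>v w i. v i + w i), one = (\<lambda>i. 0)\<rparr>"

abbreviation Nat_vec :: "nat \<Rightarrow> (nat \<Rightarrow> nat) monoid"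
  where "Nat_vec \<equiv> vec_monoid"

abbreviation Int_vec :: "nat \<Rightarrow> (nat \<Rightarrow> int) monoid"
  where "Int_vec \<equiv> vec_monoid"

definition monoid_span :: "('q, 'y) monoid_scheme \<Rightarrow> 'q set \<Rightarrow> 'q set"
  where "monoid_span Q S = \<Inter>{H. submonoid H Q \<and> S \<subseteq> H}"

definition minimal_generating_set :: "('q, 'y) monoid_scheme \<Rightarrow> 'q set \<Rightarrow> bool"
  where "minimal_generating_set Q S \<longleftrightarrow>
    S \<subseteq> carrier Q \<and> monoid_span Q S = carrier Q \<and> (\<forall>T. T \<subset> S \<longrightarrow> monoid_span Q T \<noteq> carrier Q)"

text \<open>Homomorphisms of semigroups with identity; \<^const>\<open>hom\<close> does not ask for the identity to be
  preserved, but this is automatic when the target is cancellative.\<close>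

definition embeds_in_Int_vec :: "('q, 'y) monoid_scheme \<Rightarrow> nat \<Rightarrow> bool"
  where "embeds_in_Int_vec Q r \<longleftrightarrow> (\<exists>f\<in>hom Q (Int_vec r). inj_on f (carrier Q))"

definition affine_semigroup :: "('q, 'y) monoid_scheme \<Rightarrow> bool"
  where "affine_semigroup Q \<longleftrightarrow>
    comm_monoid Q \<and> (\<exists>S\<subseteq>carrier Q. finite S \<and> monoid_span Q S = carrier Q) \<and>
    (\<exists>r>0. embeds_in_Int_vec Q r)"

definition affine_dim :: "('q, 'y) monoid_scheme \<Rightarrow> nat"
  where "affine_dim Q = (LEAST r. r > 0 \<and> embeds_in_Int_vec Q r)"

definition pointed :: "('q, 'y) monoid_scheme \<Rightarrow> bool"
  where "pointed Q \<longleftrightarrow> Units Q = {\<one>\<^bsub>Q\<^esub>}"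


subsection \<open>Semigroup algebras\<close>

text \<open>The polynomial ring in \<open>n\<close> variables is \<open>semigroup_algebra k (Nat_vec n)\<close>.\<close>

definition semigroup_algebra ::
  "('k, 'x) ring_scheme \<Rightarrow> ('s, 'y) monoid_scheme \<Rightarrow> ('k, 's \<Rightarrow> 'k) module"
  where "semigroup_algebra k S =
    \<lparr>carrier = {f \<in> carrier S \<rightarrow>\<^sub>E carrier k. finite {s \<in> carrier S. f s \<noteq> \<zero>\<^bsub>k\<^esub>}},
     mult = (\<lambda>f g. \<lambda>s\<in>carrier S.
       \<Oplus>\<^bsub>k\<^esub> p\<in>{p \<in> carrier S \<times> carrier S. fst p \<otimes>\<^bsub>S\<^esub> snd p = s \<and>
                       f (fst p) \<noteq> \<zero>\<^bsub>k\<^esub> \<and> g (snd p) \<noteq> \<zero>\<^bsub>k\<^esub>}. f (fst p) \<otimes>\<^bsub>k\<^esub> g (snd p)),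
     one = (\<lambda>s\<in>carrier S. if s = \<one>\<^bsub>S\<^esub> then \<one>\<^bsub>k\<^esub> else \<zero>\<^bsub>k\<^esub>),
     zero = (\<lambda>s\<in>carrier S. \<zero>\<^bsub>k\<^esub>),
     add = (\<lambda>f g. \<lambda>s\<in>carrier S. f s \<oplus>\<^bsub>k\<^esub> g s),
     smult = (\<lambda>a f. \<lambda>s\<in>carrier S. a \<otimes>\<^bsub>k\<^esub> f s)\<rparr>"

definition monomial :: "('k, 'x) ring_scheme \<Rightarrow> ('s, 'y) monoid_scheme \<Rightarrow> 's \<Rightarrow> 's \<Rightarrow> 'k"
  where "monomial k S s = (\<lambda>t\<in>carrier S. if t = s then \<one>\<^bsub>k\<^esub> else \<zero>\<^bsub>k\<^esub>)"

text \<open>The grading in which the monomial of \<open>s\<close> has degree \<open>deg s\<close>.\<close>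

definition algebra_grading ::
  "('k, 'x) ring_scheme \<Rightarrow> ('s, 'y) monoid_scheme \<Rightarrow> ('s \<Rightarrow> 'g) \<Rightarrow> 'g \<Rightarrow> ('s \<Rightarrow> 'k) set"
  where "algebra_grading k S deg \<gamma> =
    {f \<in> carrier (semigroup_algebra k S). \<forall>s\<in>carrier S. f s \<noteq> \<zero>\<^bsub>k\<^esub> \<longrightarrow> deg s = \<gamma>}"

text \<open>The algebra homomorphism \<open>k[S] \<rightarrow> k[T]\<close> induced by a monoid homomorphism \<open>h : S \<rightarrow> T\<close>.\<close>

definition algebra_map ::
  "('k, 'x) ring_scheme \<Rightarrow> ('s, 'y) monoid_scheme \<Rightarrow> ('t, 'z) monoid_scheme \<Rightarrow> ('s \<Rightarrow> 't) \<Rightarrow>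
   ('s \<Rightarrow> 'k) \<Rightarrow> 't \<Rightarrow> 'k"
  where "algebra_map k S T h f =
    (\<lambda>t\<in>carrier T. \<Oplus>\<^bsub>k\<^esub> s\<in>{s \<in> carrier S. f s \<noteq> \<zero>\<^bsub>k\<^esub> \<and> h s = t}. f s)"

text \<open>\<open>k[Q]\<close> as a module over \<open>k[x\<^sub>0, \<dots>, x\<^sub>n\<^sub>-\<^sub>1]\<close>, where \<open>x\<^sub>i\<close> acts as multiplication by
  \<open>t\<^sup>g\<^sup>i\<close>. The monomial of exponent \<open>l\<close> is sent to that of the product of the \<open>(g i)\<^sup>l\<^sup>i\<close> in \<open>Q\<close>.\<close>

definition semigroup_ring_module ::
  "('k, 'x) ring_scheme \<Rightarrow> ('q, 'y) monoid_scheme \<Rightarrow> nat \<Rightarrow> (nat \<Rightarrow> 'q) \<Rightarrow>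
   ((nat \<Rightarrow> nat) \<Rightarrow> 'k, 'q \<Rightarrow> 'k) module"
  where "semigroup_ring_module k Q n g =
    (let A = semigroup_algebra k Q in
     \<lparr>carrier = carrier A, mult = mult A, one = \<one>\<^bsub>A\<^esub>, zero = \<zero>\<^bsub>A\<^esub>, add = add A,
      smult = (\<lambda>f x.
        algebra_map k (Nat_vec n) Q (\<lambda>l. \<Otimes>\<^bsub>Q\<^esub> i\<in>{..<n}. g i [^]\<^bsub>Q\<^esub> l i) f \<otimes>\<^bsub>A\<^esub> x)\<rparr>)"


subsection \<open>The action category\<close>

definition lin_comb :: "nat \<Rightarrow> (nat \<Rightarrow> nat \<Rightarrow> int) \<Rightarrow> (nat \<Rightarrow> nat) \<Rightarrow> nat \<Rightarrow> int"
  where "lin_comb n a l = (\<lambda>j. \<Sum>i<n. int (l i) * a i j)"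

definition action_category :: "nat \<Rightarrow> nat \<Rightarrow> (nat \<Rightarrow> nat \<Rightarrow> int) \<Rightarrow> (nat \<Rightarrow> int, nat \<Rightarrow> nat) cat"
  where "action_category r n a =
    \<lparr>Obj = carrier (Int_vec r),
     Mor = (\<lambda>c d. {l \<in> carrier (Nat_vec n). lin_comb n a l = (\<lambda>j. d j - c j)}),
     Id = (\<lambda>c. \<one>\<^bsub>Nat_vec n\<^esub>),
     Comp = (\<lambda>v u. v \<otimes>\<^bsub>Nat_vec n\<^esub> u)\<rparr>"

text \<open>The equivalence between modules over the action category and \<open>\<int>\<^sup>r\<close>-graded modules over
  the polynomial ring. A graded module \<open>M\<close> becomes the functor \<open>\<gamma> \<mapsto> M\<^sub>\<gamma>\<close> on which a morphism
  \<open>l\<close> acts as the monomial with exponent \<open>l\<close>.\<close>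

definition functor_of_graded ::
  "('k, 'x) ring_scheme \<Rightarrow> nat \<Rightarrow> ((nat \<Rightarrow> nat) \<Rightarrow> 'k, 'v, 'y) module_scheme \<Rightarrow>
   ((nat \<Rightarrow> int) \<Rightarrow> 'v set) \<Rightarrow> (nat \<Rightarrow> int, nat \<Rightarrow> nat, 'k, 'v) fmod"
  where "functor_of_graded k n M Mgr =
    (let R = semigroup_algebra k (Nat_vec n) in
     \<lparr>At = (\<lambda>\<gamma>. \<lparr>carrier = Mgr \<gamma>, mult = undefined, one = undefined,
               zero = \<zero>\<^bsub>M\<^esub>, add = add M, smult = (\<lambda>b m. (b \<odot>\<^bsub>R\<^esub> \<one>\<^bsub>R\<^esub>) \<odot>\<^bsub>M\<^esub> m)\<rparr>),
      Act = (\<lambda>c d l m. monomial k (Nat_vec n) l \<odot>\<^bsub>M\<^esub> m)\<rparr>)"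

definition total_module ::
  "('k, 'x) ring_scheme \<Rightarrow> nat \<Rightarrow> nat \<Rightarrow> (nat \<Rightarrow> nat \<Rightarrow> int) \<Rightarrow>
   (nat \<Rightarrow> int, nat \<Rightarrow> nat, 'k, 'v) fmod \<Rightarrow> ((nat \<Rightarrow> nat) \<Rightarrow> 'k, (nat \<Rightarrow> int) \<Rightarrow> 'v) module"
  where "total_module k r n a M =
    (let D = dsum_mod (carrier (Int_vec r)) (At M) in
     \<lparr>carrier = carrier D, mult = undefined, one = undefined, zero = \<zero>\<^bsub>D\<^esub>, add = add D,
      smult = (\<lambda>f m. \<lambda>\<delta>\<in>carrier (Int_vec r).
        \<Oplus>\<^bsub>At M \<delta>\<^esub> l\<in>{l \<in> carrier (Nat_vec n). f l \<noteq> \<zero>\<^bsub>k\<^esub>}.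
          let \<gamma> = (\<lambda>j. \<delta> j - lin_comb n a l j) in f l \<odot>\<^bsub>At M \<delta>\<^esub> Act M \<gamma> \<delta> l (m \<gamma>))\<rparr>)"

definition total_grading ::
  "nat \<Rightarrow> (nat \<Rightarrow> int, nat \<Rightarrow> nat, 'k, 'v) fmod \<Rightarrow> (nat \<Rightarrow> int) \<Rightarrow> ((nat \<Rightarrow> int) \<Rightarrow> 'v) set"
  where "total_grading r M \<gamma> =
    {m \<in> carrier (dsum_mod (carrier (Int_vec r)) (At M)).
       \<forall>\<delta>\<in>carrier (Int_vec r). \<delta> \<noteq> \<gamma> \<longrightarrow> m \<delta> = \<zero>\<^bsub>At M \<delta>\<^esub>}"

definition total_map ::
  "nat \<Rightarrow> ((nat \<Rightarrow> int) \<Rightarrow> 'v \<Rightarrow> 'w) \<Rightarrow> ((nat \<Rightarrow> int) \<Rightarrow> 'v) \<Rightarrow> (nat \<Rightarrow> int) \<Rightarrow> 'w"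
  where "total_map r f m = (\<lambda>\<gamma>\<in>carrier (Int_vec r). f \<gamma> (m \<gamma>))"

section \<open>\<open>ind\<close> is left adjoint to \<open>res\<close>\<close>

text \<open>The pointwise formula satisfies the universal property of the left Kan extension, against
  target modules over an arbitrary type of elements.\<close>

lemma mod_homI:
  assumes "\<And>x. x \<in> carrier M \<Longrightarrow> f x \<in> carrier N"
    and "\<And>x y. x \<in> carrier M \<Longrightarrow> y \<in> carrier M \<Longrightarrow> f (x \<oplus>\<^bsub>M\<^esub> y) = f x \<oplus>\<^bsub>N\<^esub> f y"
    and "\<And>a x. a \<in> carrier k \<Longrightarrow> x \<in> carrier M \<Longrightarrow> f (a \<odot>\<^bsub>M\<^esub> x) = a \<odot>\<^bsub>N\<^esub> f x"
  shows "f \<in> mod_hom k M N"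
  using assms by (auto simp: mod_hom_def)

lemma mod_homD:
  assumes "f \<in> mod_hom k M N"
  shows "x \<in> carrier M \<Longrightarrow> f x \<in> carrier N"
    and "x \<in> carrier M \<Longrightarrow> y \<in> carrier M \<Longrightarrow> f (x \<oplus>\<^bsub>M\<^esub> y) = f x \<oplus>\<^bsub>N\<^esub> f y"
    and "a \<in> carrier k \<Longrightarrow> x \<in> carrier M \<Longrightarrow> f (a \<odot>\<^bsub>M\<^esub> x) = a \<odot>\<^bsub>N\<^esub> f x"
  using assms by (auto simp: mod_hom_def)

lemma mod_hom_zero:
  assumes "Module.module k M" "Module.module k N" "f \<in> mod_hom k M N"
  shows "f \<zero>\<^bsub>M\<^esub> = \<zero>\<^bsub>N\<^esub>"
proof -
  interpret M: Module.module k M by fact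
  interpret N: Module.module k N by fact
  have "f \<zero>\<^bsub>M\<^esub> = f (\<zero>\<^bsub>M\<^esub> \<oplus>\<^bsub>M\<^esub> \<zero>\<^bsub>M\<^esub>)" by simp
  also have "\<dots> = f \<zero>\<^bsub>M\<^esub> \<oplus>\<^bsub>N\<^esub> f \<zero>\<^bsub>M\<^esub>" using mod_homD(2)[OF assms(3), of "\<zero>\<^bsub>M\<^esub>" "\<zero>\<^bsub>M\<^esub>"] by simp
  finally show ?thesis using mod_homD(1)[OF assms(3)]
    by (metis M.M.zero_closed N.M.add.r_cancel_one')
qed

lemma mod_hom_minus:
  assumes "Module.module k M" "Module.module k N" "f \<in> mod_hom k M N" "x \<in> carrier M"
  shows "f (\<ominus>\<^bsub>M\<^esub> x) = \<ominus>\<^bsub>N\<^esub> f x"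
proof -
  interpret M: Module.module k M by fact
  interpret N: Module.module k N by fact
  have "f (\<ominus>\<^bsub>M\<^esub> x) \<oplus>\<^bsub>N\<^esub> f x = \<zero>\<^bsub>N\<^esub>"
    using mod_homD(2)[OF assms(3), of "\<ominus>\<^bsub>M\<^esub> x" x] assms(4) mod_hom_zero[OF assms(1-3)]
    by (simp add: M.M.l_neg)
  then show ?thesis using mod_homD(1)[OF assms(3)] assms(4)
    by (metis M.M.a_inv_closed N.M.minus_equality)
qed

lemma mod_hom_finsum:
  assumes "Module.module k M" "Module.module k N" "f \<in> mod_hom k M N"
    and "finite S" "\<And>i. i \<in> S \<Longrightarrow> x i \<in> carrier M"
  shows "f (\<Oplus>\<^bsub>M\<^esub> i\<in>S. x i) = (\<Oplus>\<^bsub>N\<^esub> i\<in>S. f (x i))"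
proof -
  interpret M: Module.module k M by fact
  interpret N: Module.module k N by fact
  show ?thesis using assms(4,5)
  proof (induction S rule: finite_induct)
    case empty
    then show ?case using mod_hom_zero[OF assms(1-3)] by simp
  next
    case (insert i S)
    have "f (\<Oplus>\<^bsub>M\<^esub> i\<in>insert i S. x i) = f (x i \<oplus>\<^bsub>M\<^esub> (\<Oplus>\<^bsub>M\<^esub> i\<in>S. x i))"
      using insert by (subst M.M.finsum_insert) auto
    also have "\<dots> = f (x i) \<oplus>\<^bsub>N\<^esub> f (\<Oplus>\<^bsub>M\<^esub> i\<in>S. x i)"
      using insert by (intro mod_homD(2)[OF assms(3)]) (auto intro!: M.M.finsum_closed)
    also have "\<dots> = f (x i) \<oplus>\<^bsub>N\<^esub> (\<Oplus>\<^bsub>N\<^esub> i\<in>S. f (x i))" using insert by simp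
    also have "\<dots> = (\<Oplus>\<^bsub>N\<^esub> i\<in>insert i S. f (x i))"
      using insert mod_homD(1)[OF assms(3)] by (subst N.M.finsum_insert) auto
    finally show ?case .
  qed
qed

lemma mod_hom_comp:
  assumes "f \<in> mod_hom k M N" "g \<in> mod_hom k N L"
  shows "(\<lambda>x. g (f x)) \<in> mod_hom k M L"
  using assms by (auto simp: mod_hom_def Pi_iff)

lemma mod_span_submodule:
  assumes "Module.module k M" "S \<subseteq> carrier M"
  shows "submodule (mod_span k M S) k M" "S \<subseteq> mod_span k M S"
proof -
  interpret M: Module.module k M by fact
  have c: "carrier M \<in> {H. submodule H k M \<and> S \<subseteq> H}" using assms M.carrier_is_submodule by auto
  show "submodule (mod_span k M S) k M"
  proof (rule M.submoduleI)
    show "mod_span k M S \<subseteq> carrier M" using c unfolding mod_span_def by blast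
    show "\<zero>\<^bsub>M\<^esub> \<in> mod_span k M S" unfolding mod_span_def
      using M.submoduleE(2-6) by (auto simp: submodule_def dest: subgroup.one_closed)
    show "\<ominus>\<^bsub>M\<^esub> a \<in> mod_span k M S" if "a \<in> mod_span k M S" for a
      using that unfolding mod_span_def by (auto dest: M.submoduleE)
    show "a \<oplus>\<^bsub>M\<^esub> b \<in> mod_span k M S" if "a \<in> mod_span k M S" "b \<in> mod_span k M S" for a b
      using that unfolding mod_span_def by (auto dest: M.submoduleE)
    show "a \<odot>\<^bsub>M\<^esub> b \<in> mod_span k M S" if "a \<in> carrier k" "b \<in> mod_span k M S" for a b
      using that unfolding mod_span_def by (auto dest: M.submoduleE)
  qed
  show "S \<subseteq> mod_span k M S" by (auto simp: mod_span_def)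
qed

lemma mod_span_least: "submodule H k M \<Longrightarrow> S \<subseteq> H \<Longrightarrow> mod_span k M S \<subseteq> H"
  by (auto simp: mod_span_def)

lemma submodule_zero: "submodule H k M \<Longrightarrow> \<zero>\<^bsub>M\<^esub> \<in> H"
  by (auto simp: submodule_def dest: subgroup.one_closed)

lemma submodule_vimage:
  assumes "Module.module k M" "Module.module k N" "f \<in> mod_hom k M N" "submodule K k N"
  shows "submodule {x \<in> carrier M. f x \<in> K} k M"
proof -
  interpret M: Module.module k M by fact
  interpret N: Module.module k N by fact
  note E = N.submoduleE[OF assms(4)]
  show ?thesis
    by (rule M.submoduleI)
      (use mod_homD[OF assms(3)] mod_hom_minus[OF assms(1-3)] mod_hom_zero[OF assms(1-3)] E submodule_zero[OF assms(4)] in auto)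
qed

lemma mod_span_image:
  assumes "Module.module k M" "Module.module k N" "f \<in> mod_hom k M N" "submodule K k N"
    and "S \<subseteq> carrier M" "\<And>s. s \<in> S \<Longrightarrow> f s \<in> K" "x \<in> mod_span k M S"
  shows "f x \<in> K"
  using mod_span_least[OF submodule_vimage[OF assms(1-4)], of S] assms(5-7) by auto

lemma zero_submodule: "Module.module k M \<Longrightarrow> submodule {\<zero>\<^bsub>M\<^esub>} k M"
proof -
  assume "Module.module k M"
  then interpret M: Module.module k M .
  show ?thesis by (rule M.submoduleI) auto
qed

locale quotient_module = Module.module k M for k and M (structure) +
  fixes H assumes sub: "submodule H k M"
begin

sublocale Q: abelian_subgroup H M
  using sub by (intro abelian_subgroupI3 additive_subgroupI M.abelian_group_axioms) (simp_all add: submodule_def)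

lemma coset_carrier: "X \<in> carrier (quot_mod M H) \<longleftrightarrow> (\<exists>x\<in>carrier M. X = H +> x)"
  by (auto simp: quot_mod_def A_RCOSETS_def RCOSETS_def a_r_coset_def)

lemma coset_self: "x \<in> carrier M \<Longrightarrow> x \<in> H +> x"
  by (rule Q.a_rcos_self)

lemma coset_elem: "x \<in> carrier M \<Longrightarrow> y \<in> H +> x \<longleftrightarrow> y \<in> carrier M \<and> y \<ominus> x \<in> H"
  unfolding M.minus_eq
  using Q.a_elemrcos_carrier[of x y] Q.a_rcos_module_imp[of x y] Q.a_rcos_module_rev[of x y]
  by blast

lemma coset_eqI: "x \<in> carrier M \<Longrightarrow> y \<in> H +> x \<Longrightarrow> H +> y = H +> x"
  by (rule M.a_repr_independence[OF _ _ Q.a_subgroup, symmetric])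

lemma coset_add: "x \<in> carrier M \<Longrightarrow> y \<in> carrier M \<Longrightarrow>
    (H +> x) \<oplus>\<^bsub>quot_mod M H\<^esub> (H +> y) = H +> (x \<oplus> y)"
  by (simp add: quot_mod_def Q.a_rcos_sum)

lemma coset_smult: assumes "x \<in> carrier M" "a \<in> carrier k" 
  shows "a \<odot>\<^bsub>quot_mod M H\<^esub> (H +> x) = H +> (a \<odot> x)"
proof -
  have "H +> (a \<odot> y) = H +> (a \<odot> x)" if "y \<in> H +> x" for y
  proof (rule coset_eqI)
    have y: "y \<in> carrier M" "y \<ominus> x \<in> H" using that coset_elem assms by auto
    have "a \<odot> (y \<ominus> x) \<in> H" using y assms submoduleE[OF sub] by auto
    also have "a \<odot> (y \<ominus> x) = a \<odot> y \<ominus> a \<odot> x" using assms y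
      by (simp add: M.minus_eq smult_r_distr smult_r_minus)
    finally show "a \<odot> y \<in> H +> (a \<odot> x)" using assms y coset_elem by auto
  qed (use assms in auto)
  then have "(\<Union>y\<in>H +> x. H +> (a \<odot> y)) = (\<Union>y\<in>H +> x. H +> (a \<odot> x))" by (rule SUP_cong[OF refl])
  also have "\<dots> = H +> (a \<odot> x)" using coset_self[OF assms(1)] by blast
  finally show ?thesis by (simp add: quot_mod_def)
qed

lemma coset_eq: "x \<in> carrier M \<Longrightarrow> y \<in> carrier M \<Longrightarrow> H +> x = H +> y \<longleftrightarrow> x \<ominus> y \<in> H"
  using coset_elem[of y x] coset_eqI[of y x] coset_self[of x] by metis

lemma zero_quot: "\<zero>\<^bsub>quot_mod M H\<^esub> = H +> \<zero>" 
  using M.a_coset_add_zero[OF Q.a_subset] by (simp add: quot_mod_def)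

lemma quot_module: "Module.module k (quot_mod M H)"
proof (rule moduleI)
  show "cring k" by (rule R.cring_axioms)
  show "abelian_group (quot_mod M H)"
  proof (rule abelian_groupI)
    fix X Y Z assume "X \<in> carrier (quot_mod M H)" "Y \<in> carrier (quot_mod M H)" "Z \<in> carrier (quot_mod M H)"
    then show "X \<oplus>\<^bsub>quot_mod M H\<^esub> Y \<oplus>\<^bsub>quot_mod M H\<^esub> Z = X \<oplus>\<^bsub>quot_mod M H\<^esub> (Y \<oplus>\<^bsub>quot_mod M H\<^esub> Z)"
      unfolding coset_carrier by (auto simp: coset_add M.a_assoc)
  next
    fix X assume "X \<in> carrier (quot_mod M H)"
    then obtain x where "x \<in> carrier M" "X = H +> x" unfolding coset_carrier by blast
    then show "\<exists>y\<in>carrier (quot_mod M H). y \<oplus>\<^bsub>quot_mod M H\<^esub> X = \<zero>\<^bsub>quot_mod M H\<^esub>"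
      by (intro bexI[of _ "H +> (\<ominus> x)"]) (auto simp: coset_carrier coset_add zero_quot M.l_neg)
  qed (auto simp: coset_carrier coset_add zero_quot M.a_comm)
qed (auto simp: coset_carrier coset_add coset_smult smult_l_distr smult_r_distr smult_assoc1 R.cring_axioms)

lemma proj_hom: "(\<lambda>x. H +> x) \<in> mod_hom k M (quot_mod M H)"
  by (rule mod_homI) (auto simp: coset_carrier coset_add coset_smult)

lemma proj_eq_zero: "x \<in> carrier M \<Longrightarrow> H +> x = \<zero>\<^bsub>quot_mod M H\<^esub> \<longleftrightarrow> x \<in> H"
proof -
  assume x: "x \<in> carrier M"
  have "x \<ominus> \<zero> = x" using x by (simp add: M.minus_eq)
  then show ?thesis using coset_eq[OF x M.zero_closed] unfolding zero_quot by simp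
qed

end

lemma quot_map_coset:
  assumes "quotient_module k M H" "quotient_module k N K" "f \<in> mod_hom k M N"
    and "\<And>x. x \<in> H \<Longrightarrow> f x \<in> K" "x \<in> carrier M"
  shows "quot_map N K f (H +>\<^bsub>M\<^esub> x) = K +>\<^bsub>N\<^esub> f x"
proof -
  interpret M: quotient_module k M H by fact
  interpret N: quotient_module k N K by fact
  note h = mod_homD[OF assms(3)]
  have "K +>\<^bsub>N\<^esub> f y = K +>\<^bsub>N\<^esub> f x" if "y \<in> H +>\<^bsub>M\<^esub> x" for y
  proof -
    have y: "y \<in> carrier M" "y \<ominus>\<^bsub>M\<^esub> x \<in> H" using that M.coset_elem assms by auto
    have "f (y \<ominus>\<^bsub>M\<^esub> x) = f y \<ominus>\<^bsub>N\<^esub> f x"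
      using h y assms(5) mod_hom_minus[OF M.module_axioms N.module_axioms assms(3)]
      by (simp add: M.M.minus_eq N.M.minus_eq)
    then show ?thesis using N.coset_eq h y assms(4,5) by metis
  qed
  then have "(\<Union>y\<in>H +>\<^bsub>M\<^esub> x. K +>\<^bsub>N\<^esub> f y) = (\<Union>y\<in>H +>\<^bsub>M\<^esub> x. K +>\<^bsub>N\<^esub> f x)" by (rule SUP_cong[OF refl])
  also have "\<dots> = K +>\<^bsub>N\<^esub> f x" using M.coset_self[OF assms(5)] by blast
  finally show ?thesis by (simp add: quot_map_def)
qed

lemma quot_map_hom:
  assumes "quotient_module k M H" "quotient_module k N K" "f \<in> mod_hom k M N"
    and "\<And>x. x \<in> H \<Longrightarrow> f x \<in> K"
  shows "quot_map N K f \<in> mod_hom k (quot_mod M H) (quot_mod N K)"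
proof -
  interpret M: quotient_module k M H by fact
  interpret N: quotient_module k N K by fact
  note h = mod_homD[OF assms(3)]
  show ?thesis
    by (rule mod_homI) (auto simp: M.coset_carrier N.coset_carrier M.coset_add N.coset_add
      M.coset_smult N.coset_smult quot_map_coset[OF assms] h)
qed

lemma dsum_sel [simp]:
  "carrier (dsum_mod I F) = {f \<in> \<Pi>\<^sub>E i\<in>I. carrier (F i). finite {i \<in> I. f i \<noteq> \<zero>\<^bsub>F i\<^esub>}}"
  "\<zero>\<^bsub>dsum_mod I F\<^esub> = (\<lambda>i\<in>I. \<zero>\<^bsub>F i\<^esub>)"
  "f \<oplus>\<^bsub>dsum_mod I F\<^esub> g = (\<lambda>i\<in>I. f i \<oplus>\<^bsub>F i\<^esub> g i)"
  "a \<odot>\<^bsub>dsum_mod I F\<^esub> f = (\<lambda>i\<in>I. a \<odot>\<^bsub>F i\<^esub> f i)"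
  by (simp_all add: dsum_mod_def)

lemma dsum_module:
  assumes "cring k" and F: "\<And>i. i \<in> I \<Longrightarrow> Module.module k (F i)"
  shows "Module.module k (dsum_mod I F)"
proof (rule moduleI)
  have ag: "abelian_group (F i)" if "i \<in> I" for i using F[OF that] by (simp add: module_def)
  have am: "abelian_monoid (F i)" if "i \<in> I" for i using ag[OF that] by (simp add: abelian_group_def)
  note M = am[THEN abelian_monoid.a_closed] am[THEN abelian_monoid.zero_closed]
     am[THEN abelian_monoid.l_zero] am[THEN abelian_monoid.r_zero]
     am[THEN abelian_monoid.a_assoc] am[THEN abelian_monoid.a_comm] am[THEN abelian_monoid.a_lcomm]
     ag[THEN abelian_group.a_inv_closed] ag[THEN abelian_group.l_neg] ag[THEN abelian_group.r_neg]
  note S = F[THEN module.smult_closed] F[THEN module.smult_l_distr] F[THEN module.smult_r_distr]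
     F[THEN module.smult_assoc1] F[THEN module.smult_one] F[THEN module.smult_r_null]
  have mz: "\<ominus>\<^bsub>F i\<^esub> \<zero>\<^bsub>F i\<^esub> = \<zero>\<^bsub>F i\<^esub>" if "i \<in> I" for i
    using monoid.inv_one[OF group.is_monoid[OF abelian_group.a_group[OF ag[OF that]]]] by (simp add: a_inv_def)
  show "cring k" by fact
  have fadd: "finite {i \<in> I. f i \<oplus>\<^bsub>F i\<^esub> g i \<noteq> \<zero>\<^bsub>F i\<^esub>}"
    if "finite {i \<in> I. f i \<noteq> \<zero>\<^bsub>F i\<^esub>}" "finite {i \<in> I. g i \<noteq> \<zero>\<^bsub>F i\<^esub>}" for f g
    by (rule finite_subset[OF _ finite_UnI[OF that]]) (auto simp: M)
  show "abelian_group (dsum_mod I F)"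
  proof (rule abelian_groupI)
    fix x y assume "x \<in> carrier (dsum_mod I F)" "y \<in> carrier (dsum_mod I F)"
    then show "x \<oplus>\<^bsub>dsum_mod I F\<^esub> y \<in> carrier (dsum_mod I F)"
      using fadd[of x y] by (auto simp: M PiE_iff cong: conj_cong)
  next
    fix x assume x: "x \<in> carrier (dsum_mod I F)"
    have "finite {i \<in> I. \<ominus>\<^bsub>F i\<^esub> x i \<noteq> \<zero>\<^bsub>F i\<^esub>}"
      using x mz by (auto elim!: rev_finite_subset)
    then show "\<exists>y\<in>carrier (dsum_mod I F). y \<oplus>\<^bsub>dsum_mod I F\<^esub> x = \<zero>\<^bsub>dsum_mod I F\<^esub>"
      using x by (intro bexI[of _ "\<lambda>i\<in>I. \<ominus>\<^bsub>F i\<^esub> x i"]) (auto simp: M PiE_iff cong: conj_cong intro!: restrict_ext)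
  qed (auto simp: M PiE_iff extensional_def fun_eq_iff)
  fix a b x y assume a: "a \<in> carrier k" "b \<in> carrier k"
    and x: "x \<in> carrier (dsum_mod I F)" "y \<in> carrier (dsum_mod I F)"
  have "finite {i \<in> I. a \<odot>\<^bsub>F i\<^esub> x i \<noteq> \<zero>\<^bsub>F i\<^esub>}"
    using x(1) a(1) by (auto elim!: rev_finite_subset simp: S)
  then show "a \<odot>\<^bsub>dsum_mod I F\<^esub> x \<in> carrier (dsum_mod I F)"
    using x a by (auto simp: S PiE_iff cong: conj_cong)
qed (auto simp: F[THEN module.smult_l_distr] F[THEN module.smult_r_distr] PiE_iff
     F[THEN module.smult_assoc1] F[THEN module.smult_one] F[THEN module.smult_closed] extensional_def fun_eq_iff)

lemma mod_zero: "Module.module k M \<Longrightarrow> \<zero>\<^bsub>M\<^esub> \<in> carrier M"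
  by (simp add: module_def abelian_group_def abelian_monoid.zero_closed)

lemma dsum_in_hom:
  assumes "cring k" and F: "\<And>i. i \<in> I \<Longrightarrow> Module.module k (F i)" and "j \<in> I"
  shows "dsum_in I F j \<in> mod_hom k (F j) (dsum_mod I F)"
proof -
  have ag: "abelian_group (F i)" if "i \<in> I" for i using F[OF that] by (simp add: module_def)
  have am: "abelian_monoid (F i)" if "i \<in> I" for i using ag[OF that] by (simp add: abelian_group_def)
  note M = am[THEN abelian_monoid.zero_closed] am[THEN abelian_monoid.l_zero]
  show ?thesis
    by (rule mod_homI) (auto simp: dsum_in_def M F[THEN module.smult_r_null] PiE_iff intro!: restrict_ext
        intro: rev_finite_subset[of "{j}"])
qed

context
  fixes k I F N \<phi>
  assumes k: "cring k" and F: "\<And>i. i \<in> I \<Longrightarrow> Module.module k (F i)" and N: "Module.module k N"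
    and ph: "\<And>i. i \<in> I \<Longrightarrow> \<phi> i \<in> mod_hom k (F i) N"
begin

interpretation N: Module.module k N by (rule N)

lemma dsum_lift_superset:
  assumes "f \<in> carrier (dsum_mod I F)" "finite S" "{i \<in> I. f i \<noteq> \<zero>\<^bsub>F i\<^esub>} \<subseteq> S" "S \<subseteq> I"
  shows "dsum_lift I F N \<phi> f = (\<Oplus>\<^bsub>N\<^esub> i\<in>S. \<phi> i (f i))"
  unfolding dsum_lift_def
proof (rule N.M.add.finprod_mono_neutral_cong_left)
  show "\<And>i. i \<in> S - {i \<in> I. f i \<noteq> \<zero>\<^bsub>F i\<^esub>} \<Longrightarrow> \<phi> i (f i) = \<zero>\<^bsub>N\<^esub>"
    using assms(4) mod_hom_zero[OF F N ph] by fastforce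
  show "(\<lambda>i. \<phi> i (f i)) \<in> S \<rightarrow> carrier N"
    using assms mod_homD(1)[OF ph] by (fastforce simp: PiE_iff)
qed (use assms in auto)

lemma dsum_lift_hom: "dsum_lift I F N \<phi> \<in> mod_hom k (dsum_mod I F) N"
proof (rule mod_homI)
  note D = dsum_module[OF k F, of I]
  fix f g a assume f: "f \<in> carrier (dsum_mod I F)" and g: "g \<in> carrier (dsum_mod I F)"
  let ?s = "\<lambda>f. {i \<in> I. f i \<noteq> \<zero>\<^bsub>F i\<^esub>}"
  have fi: "\<And>i. i \<in> I \<Longrightarrow> \<phi> i (f i) \<in> carrier N" "\<And>i. i \<in> I \<Longrightarrow> \<phi> i (g i) \<in> carrier N"
    using f g mod_homD(1)[OF ph] by (auto simp: PiE_iff)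
  show "dsum_lift I F N \<phi> f \<in> carrier N"
    unfolding dsum_lift_def using fi by (intro N.M.finsum_closed) auto
  have fg: "f \<oplus>\<^bsub>dsum_mod I F\<^esub> g \<in> carrier (dsum_mod I F)"
    using abelian_monoid.a_closed[OF abelian_group.axioms(1)[OF module.axioms(2)[OF D]] f g] .
  let ?S = "?s f \<union> ?s g \<union> ?s (f \<oplus>\<^bsub>dsum_mod I F\<^esub> g)"
  have S: "finite ?S" using f g fg by (simp del: dsum_sel(3))
  have 1: "dsum_lift I F N \<phi> f = (\<Oplus>\<^bsub>N\<^esub> i\<in>?S. \<phi> i (f i))" 
    by (rule dsum_lift_superset[OF f S]) auto
  have 2: "dsum_lift I F N \<phi> g = (\<Oplus>\<^bsub>N\<^esub> i\<in>?S. \<phi> i (g i))" 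
    by (rule dsum_lift_superset[OF g S]) auto
  have 3: "dsum_lift I F N \<phi> (f \<oplus>\<^bsub>dsum_mod I F\<^esub> g) = (\<Oplus>\<^bsub>N\<^esub> i\<in>?S. \<phi> i ((f \<oplus>\<^bsub>dsum_mod I F\<^esub> g) i))" 
    by (rule dsum_lift_superset[OF fg S]) auto
  have "(\<Oplus>\<^bsub>N\<^esub> i\<in>?S. \<phi> i ((f \<oplus>\<^bsub>dsum_mod I F\<^esub> g) i)) = (\<Oplus>\<^bsub>N\<^esub> i\<in>?S. \<phi> i (f i) \<oplus>\<^bsub>N\<^esub> \<phi> i (g i))"
    using fi f g by (intro N.M.finsum_cong') (auto simp: mod_homD(2)[OF ph] PiE_iff)
  also have "\<dots> = (\<Oplus>\<^bsub>N\<^esub> i\<in>?S. \<phi> i (f i)) \<oplus>\<^bsub>N\<^esub> (\<Oplus>\<^bsub>N\<^esub> i\<in>?S. \<phi> i (g i))"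
    using fi by (intro N.M.finsum_addf) auto
  finally show "dsum_lift I F N \<phi> (f \<oplus>\<^bsub>dsum_mod I F\<^esub> g) = dsum_lift I F N \<phi> f \<oplus>\<^bsub>N\<^esub> dsum_lift I F N \<phi> g"
    unfolding 1 2 3 .
  assume a: "a \<in> carrier k"
  have af: "a \<odot>\<^bsub>dsum_mod I F\<^esub> f \<in> carrier (dsum_mod I F)"
    using module.smult_closed[OF D a f] .
  have "dsum_lift I F N \<phi> (a \<odot>\<^bsub>dsum_mod I F\<^esub> f) = (\<Oplus>\<^bsub>N\<^esub> i\<in>?s f. \<phi> i ((a \<odot>\<^bsub>dsum_mod I F\<^esub> f) i))"
    by (rule dsum_lift_superset[OF af]) (use f in \<open>auto simp: F[THEN module.smult_r_null] a\<close>)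
  also have "\<dots> = (\<Oplus>\<^bsub>N\<^esub> i\<in>?s f. a \<odot>\<^bsub>N\<^esub> \<phi> i (f i))"
    using fi f a by (intro N.M.finsum_cong') (auto simp: mod_homD(3)[OF ph] PiE_iff)
  also have "\<dots> = a \<odot>\<^bsub>N\<^esub> dsum_lift I F N \<phi> f"
    unfolding dsum_lift_def using fi f a by (intro N.finsum_smult_ldistr[symmetric]) auto
  finally show "dsum_lift I F N \<phi> (a \<odot>\<^bsub>dsum_mod I F\<^esub> f) = a \<odot>\<^bsub>N\<^esub> dsum_lift I F N \<phi> f" .
qed

lemma dsum_lift_in:
  assumes "j \<in> I" "x \<in> carrier (F j)"
  shows "dsum_lift I F N \<phi> (dsum_in I F j x) = \<phi> j x"
proof -
  have "dsum_in I F j x \<in> carrier (dsum_mod I F)"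
    using mod_homD(1)[OF dsum_in_hom[where I = I and F = F, OF k F assms(1)] assms(2)] by auto
  then have "dsum_lift I F N \<phi> (dsum_in I F j x) = (\<Oplus>\<^bsub>N\<^esub> i\<in>{j}. \<phi> i (dsum_in I F j x i))"
    by (rule dsum_lift_superset) (use assms in \<open>auto simp: dsum_in_def\<close>)
  also have "\<dots> = \<phi> j x"
    using assms mod_homD(1)[OF ph[OF assms(1)]] by (simp add: dsum_in_def)
  finally show ?thesis .
qed
end

lemma dsum_expand:
  assumes k: "cring k" and F: "\<And>i. i \<in> I \<Longrightarrow> Module.module k (F i)"
    and f: "f \<in> carrier (dsum_mod I F)"
  shows "f = (\<Oplus>\<^bsub>dsum_mod I F\<^esub> i\<in>{i \<in> I. f i \<noteq> \<zero>\<^bsub>F i\<^esub>}. dsum_in I F i (f i))"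
proof -
  have D: "Module.module k (dsum_mod I F)" by (rule dsum_module[OF k F])
  interpret D: Module.module k "dsum_mod I F" by (rule D)
  let ?g = "\<Oplus>\<^bsub>dsum_mod I F\<^esub> i\<in>{i \<in> I. f i \<noteq> \<zero>\<^bsub>F i\<^esub>}. dsum_in I F i (f i)"
  have inc: "\<And>i. i \<in> I \<Longrightarrow> dsum_in I F i (f i) \<in> carrier (dsum_mod I F)"
    using f by (intro mod_homD(1)[OF dsum_in_hom[where I = I and F = F, OF k F]]) (auto simp: PiE_iff)
  have gc: "?g \<in> carrier (dsum_mod I F)"
    using inc by (intro D.M.finsum_closed) (auto simp del: dsum_sel)
  have "f j = ?g j" if j: "j \<in> I" for j
  proof -
    interpret Fj: Module.module k "F j" by (rule F[OF j])
    have ev: "(\<lambda>f. f j) \<in> mod_hom k (dsum_mod I F) (F j)"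
      by (rule mod_homI) (use j in auto)
    have "?g j = (\<Oplus>\<^bsub>F j\<^esub> i\<in>{i \<in> I. f i \<noteq> \<zero>\<^bsub>F i\<^esub>}. dsum_in I F i (f i) j)"
      by (rule mod_hom_finsum[OF D F[OF j] ev]) (use f inc in \<open>auto simp del: dsum_sel(2-)\<close>)
    also have "\<dots> = (\<Oplus>\<^bsub>F j\<^esub> i\<in>{i \<in> I. f i \<noteq> \<zero>\<^bsub>F i\<^esub>}. if i = j then f i else \<zero>\<^bsub>F j\<^esub>)"
      using f j by (intro Fj.M.finsum_cong') (auto simp: dsum_in_def PiE_iff)
    also have "\<dots> = f j"
    proof (cases "f j = \<zero>\<^bsub>F j\<^esub>")
      case True
      have "(\<Oplus>\<^bsub>F j\<^esub> i\<in>{i \<in> I. f i \<noteq> \<zero>\<^bsub>F i\<^esub>}. if i = j then f i else \<zero>\<^bsub>F j\<^esub>) = (\<Oplus>\<^bsub>F j\<^esub> i\<in>{i \<in> I. f i \<noteq> \<zero>\<^bsub>F i\<^esub>}. \<zero>\<^bsub>F j\<^esub>)"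
        using True by (intro Fj.M.finsum_cong') auto
      then show ?thesis using True by simp
    next
      case False
      have "(\<Oplus>\<^bsub>F j\<^esub> i\<in>{i \<in> I. f i \<noteq> \<zero>\<^bsub>F i\<^esub>}. if i = j then f i else \<zero>\<^bsub>F j\<^esub>) = (\<Oplus>\<^bsub>F j\<^esub> i\<in>{j}. f i)"
        using f j False by (intro Fj.M.add.finprod_mono_neutral_cong_right) (auto simp: PiE_iff)
      then show ?thesis using f j by (simp add: PiE_iff)
    qed
    finally show ?thesis by simp
  qed
  then show ?thesis using f gc by (intro PiE_ext[of f I "\<lambda>i. carrier (F i)"]) auto
qed

lemma dsum_hom_ext:
  assumes k: "cring k" and F: "\<And>i. i \<in> I \<Longrightarrow> Module.module k (F i)" and N: "Module.module k N"
    and p: "p \<in> mod_hom k (dsum_mod I F) N" and q: "q \<in> mod_hom k (dsum_mod I F) N"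
    and eq: "\<And>i x. i \<in> I \<Longrightarrow> x \<in> carrier (F i) \<Longrightarrow> p (dsum_in I F i x) = q (dsum_in I F i x)"
    and f: "f \<in> carrier (dsum_mod I F)"
  shows "p f = q f"
proof -
  have D: "Module.module k (dsum_mod I F)" by (rule dsum_module[OF k F])
  interpret N: Module.module k N by (rule N)
  have inc: "\<And>i. i \<in> I \<Longrightarrow> dsum_in I F i (f i) \<in> carrier (dsum_mod I F)"
    using f by (intro mod_homD(1)[OF dsum_in_hom[where I = I and F = F, OF k F]]) (auto simp: PiE_iff)
  let ?S = "{i \<in> I. f i \<noteq> \<zero>\<^bsub>F i\<^esub>}"
  have S: "finite ?S" using f by simp
  have "p (\<Oplus>\<^bsub>dsum_mod I F\<^esub> i\<in>?S. dsum_in I F i (f i)) = (\<Oplus>\<^bsub>N\<^esub> i\<in>?S. p (dsum_in I F i (f i)))"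
    by (rule mod_hom_finsum[OF D N p S]) (use inc in \<open>auto simp del: dsum_sel\<close>)
  also have "\<dots> = (\<Oplus>\<^bsub>N\<^esub> i\<in>?S. q (dsum_in I F i (f i)))"
    using eq f mod_homD(1)[OF q inc] by (intro N.M.finsum_cong') (auto simp: PiE_iff)
  also have "\<dots> = q (\<Oplus>\<^bsub>dsum_mod I F\<^esub> i\<in>?S. dsum_in I F i (f i))"
    by (rule mod_hom_finsum[OF D N q S, symmetric]) (use inc in \<open>auto simp del: dsum_sel\<close>)
  finally show ?thesis using dsum_expand[OF k F f] by simp
qed

declare dsum_sel [simp del]

definition ind_unit ::
  "('k, 'x) ring_scheme \<Rightarrow> ('o, 'm) cat \<Rightarrow> ('p, 'l) cat \<Rightarrow> ('o \<Rightarrow> 'p) \<Rightarrow> ('o \<Rightarrow> 'o \<Rightarrow> 'm \<Rightarrow> 'l) \<Rightarrow>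
   ('o, 'm, 'k, 'v) fmod \<Rightarrow> 'o \<Rightarrow> 'v \<Rightarrow> ('o \<times> 'l \<Rightarrow> 'v) set"
  where "ind_unit k C D \<alpha>o \<alpha>m L c x =
    ind_rel k C D \<alpha>o \<alpha>m L (\<alpha>o c) +>\<^bsub>ind_sum C D \<alpha>o L (\<alpha>o c)\<^esub> ind_in C D \<alpha>o L (\<alpha>o c) c (Id D (\<alpha>o c)) x"

locale kan_ext =
  fixes k :: "('k, 'x) ring_scheme" and C :: "('o, 'm) cat" and D :: "('p, 'l) cat"
    and \<alpha>o \<alpha>m and L :: "('o, 'm, 'k, 'v) fmod"
  assumes k: "cring k" and catC: "category C" and catD: "category D"
    and func: "is_functor C D \<alpha>o \<alpha>m" and L: "is_kCmod k C L"
begin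

lemma D_comp: "\<lbrakk>b \<in> Obj D; c \<in> Obj D; d \<in> Obj D; u \<in> Mor D b c; v \<in> Mor D c d\<rbrakk> \<Longrightarrow> Comp D v u \<in> Mor D b d"
  using catD unfolding category_def by meson
lemma D_idl: "\<lbrakk>c \<in> Obj D; d \<in> Obj D; u \<in> Mor D c d\<rbrakk> \<Longrightarrow> Comp D (Id D d) u = u"
  using catD unfolding category_def by meson
lemma D_idr: "\<lbrakk>c \<in> Obj D; d \<in> Obj D; u \<in> Mor D c d\<rbrakk> \<Longrightarrow> Comp D u (Id D c) = u"
  using catD unfolding category_def by meson
lemma D_id: "c \<in> Obj D \<Longrightarrow> Id D c \<in> Mor D c c"
  using catD unfolding category_def by meson
lemma D_assoc: "\<lbrakk>a \<in> Obj D; b \<in> Obj D; c \<in> Obj D; d \<in> Obj D; u \<in> Mor D a b; v \<in> Mor D b c; w \<in> Mor D c d\<rbrakk>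
   \<Longrightarrow> Comp D w (Comp D v u) = Comp D (Comp D w v) u"
  using catD unfolding category_def by meson
lemma ob: "c \<in> Obj C \<Longrightarrow> \<alpha>o c \<in> Obj D"
  using func unfolding is_functor_def by meson
lemma fm: "\<lbrakk>b \<in> Obj C; c \<in> Obj C; u \<in> Mor C b c\<rbrakk> \<Longrightarrow> \<alpha>m b c u \<in> Mor D (\<alpha>o b) (\<alpha>o c)"
  using func unfolding is_functor_def by meson
lemma idD: "c \<in> Obj C \<Longrightarrow> Id D (\<alpha>o c) \<in> Mor D (\<alpha>o c) (\<alpha>o c)"
  by (rule D_id[OF ob])

abbreviation "I \<equiv> comma C D \<alpha>o"
abbreviation "X \<equiv> ind_sum C D \<alpha>o L"
abbreviation "H \<equiv> ind_rel k C D \<alpha>o \<alpha>m L"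
abbreviation "\<iota> \<equiv> ind_in C D \<alpha>o L"

lemma modL: "c \<in> Obj C \<Longrightarrow> Module.module k (At L c)"
  using L by (simp add: is_kCmod_def)

lemma actL: "b \<in> Obj C \<Longrightarrow> c \<in> Obj C \<Longrightarrow> u \<in> Mor C b c \<Longrightarrow> Act L b c u \<in> mod_hom k (At L b) (At L c)"
  using L by (simp add: is_kCmod_def)

lemma modF: "i \<in> I d \<Longrightarrow> Module.module k ((\<lambda>(c, w). At L c) i)"
  using modL by (auto simp: comma_def)

lemma modX: "Module.module k (X d)"
  unfolding ind_sum_def by (rule dsum_module[OF k]) (rule modF)

lemma in_hom: "c \<in> Obj C \<Longrightarrow> w \<in> Mor D (\<alpha>o c) d \<Longrightarrow> \<iota> d c w \<in> mod_hom k (At L c) (X d)"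
  using dsum_in_hom[where I = "I d" and F = "\<lambda>(c, w). At L c" and j = "(c, w)", OF k modF]
  by (simp add: ind_sum_def comma_def)

lemma lift_hom:
  assumes "Module.module k N" "\<And>c w. c \<in> Obj C \<Longrightarrow> w \<in> Mor D (\<alpha>o c) d \<Longrightarrow> \<phi> c w \<in> mod_hom k (At L c) N"
  shows "dsum_lift (I d) (\<lambda>(c, w). At L c) N (\<lambda>(c, w). \<phi> c w) \<in> mod_hom k (X d) N"
  unfolding ind_sum_def by (rule dsum_lift_hom[OF k modF assms(1)]) (use assms(2) in \<open>auto simp: comma_def\<close>)

lemma lift_in:
  assumes "Module.module k N" "\<And>c w. c \<in> Obj C \<Longrightarrow> w \<in> Mor D (\<alpha>o c) d \<Longrightarrow> \<phi> c w \<in> mod_hom k (At L c) N"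
    and "c \<in> Obj C" "w \<in> Mor D (\<alpha>o c) d" "x \<in> carrier (At L c)"
  shows "dsum_lift (I d) (\<lambda>(c, w). At L c) N (\<lambda>(c, w). \<phi> c w) (\<iota> d c w x) = \<phi> c w x"
proof -
  have "dsum_lift (I d) (\<lambda>(c, w). At L c) N (\<lambda>(c, w). \<phi> c w) (dsum_in (I d) (\<lambda>(c, w). At L c) (c, w) x)
      = (\<lambda>(c, w). \<phi> c w) (c, w) x"
  proof (rule dsum_lift_in[OF k _ assms(1)])
    show "\<And>i. i \<in> I d \<Longrightarrow> Module.module k (case i of (c, w) \<Rightarrow> At L c)" by (rule modF)
  qed (use assms in \<open>auto simp: comma_def\<close>)
  then show ?thesis by simp
qed

lemma hom_ext:
  assumes "Module.module k N" "p \<in> mod_hom k (X d) N" "q \<in> mod_hom k (X d) N"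
    and "\<And>c w x. c \<in> Obj C \<Longrightarrow> w \<in> Mor D (\<alpha>o c) d \<Longrightarrow> x \<in> carrier (At L c) \<Longrightarrow> p (\<iota> d c w x) = q (\<iota> d c w x)"
    and "f \<in> carrier (X d)"
  shows "p f = q f"
  by (rule dsum_hom_ext[where I = "I d" and F = "\<lambda>(c, w). At L c", OF k modF assms(1)])
    (use assms in \<open>auto simp: ind_sum_def comma_def\<close>)

abbreviation "gens d \<equiv> {\<iota> d b (Comp D w (\<alpha>m b c u)) x \<ominus>\<^bsub>X d\<^esub> \<iota> d c w (Act L b c u x) | b c u w x.
     b \<in> Obj C \<and> c \<in> Obj C \<and> u \<in> Mor C b c \<and> w \<in> Mor D (\<alpha>o c) d \<and> x \<in> carrier (At L b)}"

lemma comp_mor: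
  assumes "b \<in> Obj C" "c \<in> Obj C" "d \<in> Obj D" "u \<in> Mor C b c" "w \<in> Mor D (\<alpha>o c) d"
  shows "Comp D w (\<alpha>m b c u) \<in> Mor D (\<alpha>o b) d"
  by (rule D_comp[OF ob ob assms(3) fm]) (use assms in auto)

lemma gens_closed: assumes "d \<in> Obj D" shows "gens d \<subseteq> carrier (X d)"
proof -
  interpret X: Module.module k "X d" by (rule modX)
  show ?thesis
    using comp_mor[OF _ _ assms] mod_homD(1)[OF in_hom] mod_homD(1)[OF actL] by fastforce
qed

lemma quotX: assumes "d \<in> Obj D" shows "quotient_module k (X d) (H d)"
  unfolding ind_rel_def quotient_module_def quotient_module_axioms_def
  using mod_span_submodule(1)[OF modX gens_closed[OF assms]] modX by blast

lemma glue:
  assumes d: "d \<in> Obj D" and "b \<in> Obj C" "c \<in> Obj C" "u \<in> Mor C b c" "w \<in> Mor D (\<alpha>o c) d" "x \<in> carrier (At L b)"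
  shows "H d +>\<^bsub>X d\<^esub> \<iota> d b (Comp D w (\<alpha>m b c u)) x = H d +>\<^bsub>X d\<^esub> \<iota> d c w (Act L b c u x)"
proof -
  interpret Q: quotient_module k "X d" "H d" by (rule quotX[OF d])
  have "\<iota> d b (Comp D w (\<alpha>m b c u)) x \<ominus>\<^bsub>X d\<^esub> \<iota> d c w (Act L b c u x) \<in> H d"
    unfolding ind_rel_def
    by (rule subsetD[OF mod_span_submodule(2)[OF modX gens_closed[OF d]]]) (use assms in blast)
  then show ?thesis
    using Q.coset_eq comp_mor[OF assms(2,3) d assms(4,5)] mod_homD(1)[OF in_hom] mod_homD(1)[OF actL] assms by metis
qed

definition "T d e v = dsum_lift (I d) (\<lambda>(c, w). At L c) (X e) (\<lambda>(c, w) x. \<iota> e c (Comp D v w) x)"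

lemma comp_mor':
  assumes "c \<in> Obj C" "d \<in> Obj D" "e \<in> Obj D" "w \<in> Mor D (\<alpha>o c) d" "v \<in> Mor D d e"
  shows "Comp D v w \<in> Mor D (\<alpha>o c) e"
  by (rule D_comp[OF ob]) (use assms in auto)

lemma Tph: assumes "d \<in> Obj D" "e \<in> Obj D" "v \<in> Mor D d e" "c \<in> Obj C" "w \<in> Mor D (\<alpha>o c) d"
  shows "\<iota> e c (Comp D v w) \<in> mod_hom k (At L c) (X e)"
  by (rule in_hom) (use assms comp_mor' in auto)

lemma T_hom: assumes "d \<in> Obj D" "e \<in> Obj D" "v \<in> Mor D d e" shows "T d e v \<in> mod_hom k (X d) (X e)"
  unfolding T_def by (rule lift_hom[OF modX Tph[OF assms]])

lemma T_in: assumes "d \<in> Obj D" "e \<in> Obj D" "v \<in> Mor D d e" "c \<in> Obj C" "w \<in> Mor D (\<alpha>o c) d" "x \<in> carrier (At L c)"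
  shows "T d e v (\<iota> d c w x) = \<iota> e c (Comp D v w) x"
  unfolding T_def by (rule lift_in[OF modX Tph[OF assms(1-3)] assms(4-)])

lemma assocD: "\<lbrakk>b \<in> Obj C; c \<in> Obj C; d \<in> Obj D; e \<in> Obj D; u \<in> Mor C b c; w \<in> Mor D (\<alpha>o c) d; v \<in> Mor D d e\<rbrakk>
  \<Longrightarrow> Comp D v (Comp D w (\<alpha>m b c u)) = Comp D (Comp D v w) (\<alpha>m b c u)"
  by (rule D_assoc[OF ob ob _ _ fm]) auto

lemma hom_diff:
  assumes "Module.module k M" "Module.module k N" "f \<in> mod_hom k M N" "x \<in> carrier M" "y \<in> carrier M"
  shows "f (x \<ominus>\<^bsub>M\<^esub> y) = f x \<ominus>\<^bsub>N\<^esub> f y"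
proof -
  interpret M: Module.module k M by fact
  show ?thesis using assms mod_homD(2)[OF assms(3)] mod_hom_minus[OF assms(1-3)] 
    by (simp add: a_minus_def)
qed

lemma T_rel:
  assumes d: "d \<in> Obj D" "e \<in> Obj D" "v \<in> Mor D d e" and h: "h \<in> H d"
  shows "T d e v h \<in> H e"
proof -
  interpret Q: quotient_module k "X e" "H e" by (rule quotX[OF d(2)])
  show ?thesis
  proof (rule mod_span_image[OF modX modX T_hom[OF d] Q.sub gens_closed[OF d(1)] _ h[unfolded ind_rel_def]])
    fix s assume "s \<in> gens d"
    then obtain b c u w x where s: "s = \<iota> d b (Comp D w (\<alpha>m b c u)) x \<ominus>\<^bsub>X d\<^esub> \<iota> d c w (Act L b c u x)"
      and a: "b \<in> Obj C" "c \<in> Obj C" "u \<in> Mor C b c" "w \<in> Mor D (\<alpha>o c) d" "x \<in> carrier (At L b)" by blast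
    note m = comp_mor[OF a(1,2) d(1) a(3,4)] mod_homD(1)[OF actL[OF a(1-3)] a(5)]
    have "T d e v s = \<iota> e b (Comp D v (Comp D w (\<alpha>m b c u))) x \<ominus>\<^bsub>X e\<^esub> \<iota> e c (Comp D v w) (Act L b c u x)"
      unfolding s by (subst hom_diff[OF modX modX T_hom[OF d]])
        (use a m mod_homD(1)[OF in_hom] T_in[OF d] in auto)
    also have "Comp D v (Comp D w (\<alpha>m b c u)) = Comp D (Comp D v w) (\<alpha>m b c u)"
      by (rule assocD) (use a d in auto)
    finally have "T d e v s \<in> gens e" using a d comp_mor' by blast
    then show "T d e v s \<in> H e"
      unfolding ind_rel_def using mod_span_submodule(2)[OF modX gens_closed[OF d(2)]] by blast
  qed
qed

abbreviation "J \<equiv> ind_fmod k C D \<alpha>o \<alpha>m L"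

lemma AtJ: "At J d = quot_mod (X d) (H d)" by (simp add: ind_fmod_def)
lemma ActJ: "Act J d e v = quot_map (X e) (H e) (T d e v)" by (simp add: ind_fmod_def T_def)

lemma ActJ_hom: assumes "d \<in> Obj D" "e \<in> Obj D" "v \<in> Mor D d e" 
  shows "Act J d e v \<in> mod_hom k (At J d) (At J e)"
  unfolding AtJ ActJ by (rule quot_map_hom[OF quotX[OF assms(1)] quotX[OF assms(2)] T_hom[OF assms] T_rel[OF assms]])

lemma ActJ_coset: assumes "d \<in> Obj D" "e \<in> Obj D" "v \<in> Mor D d e" "f \<in> carrier (X d)"
  shows "Act J d e v (H d +>\<^bsub>X d\<^esub> f) = H e +>\<^bsub>X e\<^esub> T d e v f"
  unfolding AtJ ActJ by (rule quot_map_coset[OF quotX[OF assms(1)] quotX[OF assms(2)] T_hom[OF assms(1-3)] T_rel[OF assms(1-3)] assms(4)])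

lemma modJ: "d \<in> Obj D \<Longrightarrow> Module.module k (At J d)"
  unfolding AtJ by (rule quotient_module.quot_module[OF quotX])

lemma carrierJ: "d \<in> Obj D \<Longrightarrow> Y \<in> carrier (At J d) \<longleftrightarrow> (\<exists>f\<in>carrier (X d). Y = H d +>\<^bsub>X d\<^esub> f)"
  unfolding AtJ by (rule quotient_module.coset_carrier[OF quotX])

lemma idX: "(\<lambda>x. x) \<in> mod_hom k (X d) (X d)" by (rule mod_homI) auto

theorem ind_is_kCmod: "is_kCmod k D J"
  unfolding is_kCmod_def
proof (intro conjI ballI)
  fix d assume d: "d \<in> Obj D"
  show "Module.module k (At J d)" by (rule modJ[OF d])
  have i: "Id D d \<in> Mor D d d" by (rule D_id[OF d])
  fix Y assume "Y \<in> carrier (At J d)"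
  then obtain f where f: "f \<in> carrier (X d)" "Y = H d +>\<^bsub>X d\<^esub> f" using carrierJ[OF d] by blast
  have "T d d (Id D d) f = f"
  proof (rule hom_ext[OF modX T_hom[OF d d i] idX _ f(1)])
    fix c w x assume a: "c \<in> Obj C" "w \<in> Mor D (\<alpha>o c) d" "x \<in> carrier (At L c)"
    have "Comp D (Id D d) w = w" by (rule D_idl[OF ob[OF a(1)] d a(2)])
    then show "T d d (Id D d) (\<iota> d c w x) = \<iota> d c w x" using T_in[OF d d i a] by simp
  qed
  then show "Act J d d (Id D d) Y = Y" using ActJ_coset[OF d d i f(1)] f by simp
next
  fix d e v assume "d \<in> Obj D" "e \<in> Obj D" "v \<in> Mor D d e"
  then show "Act J d e v \<in> mod_hom k (At J d) (At J e)" by (rule ActJ_hom)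
next
  fix b c d u v Y assume o: "b \<in> Obj D" "c \<in> Obj D" "d \<in> Obj D" and u: "u \<in> Mor D b c" and v: "v \<in> Mor D c d"
    and Y: "Y \<in> carrier (At J b)"
  then obtain f where f: "f \<in> carrier (X b)" "Y = H b +>\<^bsub>X b\<^esub> f" using carrierJ by blast
  have vu: "Comp D v u \<in> Mor D b d" by (rule D_comp[OF o u v])
  have "T b d (Comp D v u) f = T c d v (T b c u f)"
  proof (rule hom_ext[OF modX T_hom[OF o(1,3) vu] mod_hom_comp[OF T_hom[OF o(1,2) u] T_hom[OF o(2,3) v]] _ f(1)])
    fix a w x assume a: "a \<in> Obj C" "w \<in> Mor D (\<alpha>o a) b" "x \<in> carrier (At L a)"
    have "Comp D (Comp D v u) w = Comp D v (Comp D u w)"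
      by (rule D_assoc[symmetric, OF ob[OF a(1)] o a(2) u v])
    then show "T b d (Comp D v u) (\<iota> b a w x) = T c d v (T b c u (\<iota> b a w x))"
      using T_in[OF o(1,3) vu a] T_in[OF o(1,2) u a] T_in[OF o(2,3) v a(1) comp_mor'[OF a(1) o(1,2) a(2) u] a(3)] by simp
  qed
  then show "Act J b d (Comp D v u) Y = Act J c d v (Act J b c u Y)"
    using ActJ_coset[OF o(1,3) vu f(1)] ActJ_coset[OF o(1,2) u f(1)]
      ActJ_coset[OF o(2,3) v mod_homD(1)[OF T_hom[OF o(1,2) u] f(1)]] f(2) by simp
qed

abbreviation "\<eta> \<equiv> ind_unit k C D \<alpha>o \<alpha>m L"

lemma cosetin_hom: assumes "d \<in> Obj D" "c \<in> Obj C" "w \<in> Mor D (\<alpha>o c) d"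
  shows "(\<lambda>x. H d +>\<^bsub>X d\<^esub> \<iota> d c w x) \<in> mod_hom k (At L c) (At J d)"
  unfolding AtJ
  by (rule mod_hom_comp[OF in_hom[OF assms(2,3)] quotient_module.proj_hom[OF quotX[OF assms(1)]]])

lemma act_unit: assumes "d \<in> Obj D" "c \<in> Obj C" "w \<in> Mor D (\<alpha>o c) d" "x \<in> carrier (At L c)"
  shows "Act J (\<alpha>o c) d w (\<eta> c x) = H d +>\<^bsub>X d\<^esub> \<iota> d c w x"
proof -
  have "Comp D w (Id D (\<alpha>o c)) = w" by (rule D_idr[OF ob[OF assms(2)] assms(1,3)])
  then show ?thesis unfolding ind_unit_def
    using ActJ_coset[OF ob[OF assms(2)] assms(1,3) mod_homD(1)[OF in_hom[OF assms(2) idD[OF assms(2)]] assms(4)]]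
     T_in[OF ob[OF assms(2)] assms(1,3,2) idD[OF assms(2)] assms(4)] by simp
qed

theorem ind_unit_nat_trans: "\<eta> \<in> nat_trans k C L (res_fmod \<alpha>o \<alpha>m J)"
proof -
  have "\<eta> c \<in> mod_hom k (At L c) (At J (\<alpha>o c))" if "c \<in> Obj C" for c
    using cosetin_hom[OF ob[OF that] that idD[OF that]] by (simp add: ind_unit_def[abs_def])
  moreover have "\<eta> c (Act L b c u x) = Act J (\<alpha>o b) (\<alpha>o c) (\<alpha>m b c u) (\<eta> b x)"
    if a: "b \<in> Obj C" "c \<in> Obj C" "u \<in> Mor C b c" "x \<in> carrier (At L b)" for b c u x
  proof -
    have m: "\<alpha>m b c u \<in> Mor D (\<alpha>o b) (\<alpha>o c)" by (rule fm[OF a(1-3)])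
    have "Comp D (Id D (\<alpha>o c)) (\<alpha>m b c u) = \<alpha>m b c u"
      by (rule D_idl[OF ob[OF a(1)] ob[OF a(2)] m])
    then show ?thesis
      using act_unit[OF ob[OF a(2)] a(1) m a(4)] glue[OF ob[OF a(2)] a(1-3) idD[OF a(2)] a(4)]
      by (simp add: ind_unit_def)
  qed
  ultimately show ?thesis by (simp add: nat_trans_def res_fmod_def)
qed

theorem ind_universal:
  fixes M :: "('p, 'l, 'k, 'w) fmod"
  assumes M: "is_kCmod k D M" and \<phi>: "\<phi> \<in> nat_trans k C L (res_fmod \<alpha>o \<alpha>m M)"
  shows "\<exists>\<psi>\<in>nat_trans k D J M.
    (\<forall>c\<in>Obj C. \<forall>x\<in>carrier (At L c). \<psi> (\<alpha>o c) (\<eta> c x) = \<phi> c x) \<and>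
    (\<forall>\<psi>'\<in>nat_trans k D J M. (\<forall>c\<in>Obj C. \<forall>x\<in>carrier (At L c). \<psi>' (\<alpha>o c) (\<eta> c x) = \<phi> c x) \<longrightarrow>
       (\<forall>d\<in>Obj D. \<forall>Y\<in>carrier (At J d). \<psi>' d Y = \<psi> d Y))"
proof -
  have modM: "d \<in> Obj D \<Longrightarrow> Module.module k (At M d)" for d using M by (simp add: is_kCmod_def)
  have actM: "\<And>c d u. c \<in> Obj D \<Longrightarrow> d \<in> Obj D \<Longrightarrow> u \<in> Mor D c d \<Longrightarrow> Act M c d u \<in> mod_hom k (At M c) (At M d)"
    using M by (simp add: is_kCmod_def)
  have phh: "c \<in> Obj C \<Longrightarrow> \<phi> c \<in> mod_hom k (At L c) (At M (\<alpha>o c))" for c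
    using \<phi> by (simp add: nat_trans_def res_fmod_def)
  have phn: "\<phi> c (Act L b c u x) = Act M (\<alpha>o b) (\<alpha>o c) (\<alpha>m b c u) (\<phi> b x)"
    if "b \<in> Obj C" "c \<in> Obj C" "u \<in> Mor C b c" "x \<in> carrier (At L b)" for b c u x
    using \<phi> that by (simp add: nat_trans_def res_fmod_def)
  define \<Phi> where "\<Phi> d = dsum_lift (I d) (\<lambda>(c, w). At L c) (At M d) (\<lambda>(c, w). (\<lambda>x. Act M (\<alpha>o c) d w (\<phi> c x)))" for d
  have ph: "(\<lambda>x. Act M (\<alpha>o c) d w (\<phi> c x)) \<in> mod_hom k (At L c) (At M d)"
    if "d \<in> Obj D" "c \<in> Obj C" "w \<in> Mor D (\<alpha>o c) d" for c d w
    by (rule mod_hom_comp[OF phh actM]) (use that ob in auto)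
  have Phom: "\<Phi> d \<in> mod_hom k (X d) (At M d)" if d: "d \<in> Obj D" for d
    unfolding \<Phi>_def by (rule lift_hom[OF modM[OF d] ph[OF d]])
  have Pin: "\<Phi> d (\<iota> d c w x) = Act M (\<alpha>o c) d w (\<phi> c x)"
    if d: "d \<in> Obj D" "c \<in> Obj C" "w \<in> Mor D (\<alpha>o c) d" "x \<in> carrier (At L c)" for d c w x
    unfolding \<Phi>_def by (rule lift_in[OF modM[OF d(1)] ph[OF d(1)] d(2-)])
  have P0: "\<Phi> d h = \<zero>\<^bsub>At M d\<^esub>" if d: "d \<in> Obj D" and h: "h \<in> H d" for d h
  proof -
    interpret Md: Module.module k "At M d" by (rule modM[OF d])
    have "\<Phi> d h \<in> {\<zero>\<^bsub>At M d\<^esub>}"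
    proof (rule mod_span_image[OF modX modM[OF d] Phom[OF d] zero_submodule[OF modM[OF d]] gens_closed[OF d] _ h[unfolded ind_rel_def]])
      fix s assume "s \<in> gens d"
      then obtain b c u w x where s: "s = \<iota> d b (Comp D w (\<alpha>m b c u)) x \<ominus>\<^bsub>X d\<^esub> \<iota> d c w (Act L b c u x)"
        and a: "b \<in> Obj C" "c \<in> Obj C" "u \<in> Mor C b c" "w \<in> Mor D (\<alpha>o c) d" "x \<in> carrier (At L b)" by blast
      note m = comp_mor[OF a(1,2) d a(3,4)] mod_homD(1)[OF actL[OF a(1-3)] a(5)]
      have mm: "\<alpha>m b c u \<in> Mor D (\<alpha>o b) (\<alpha>o c)" by (rule fm[OF a(1-3)])
      have px: "\<phi> b x \<in> carrier (At M (\<alpha>o b))" using mod_homD(1)[OF phh[OF a(1)] a(5)] .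
      have "\<Phi> d s = Act M (\<alpha>o b) d (Comp D w (\<alpha>m b c u)) (\<phi> b x) \<ominus>\<^bsub>At M d\<^esub> Act M (\<alpha>o c) d w (\<phi> c (Act L b c u x))"
        unfolding s by (subst hom_diff[OF modX modM[OF d] Phom[OF d]])
          (use a m mod_homD(1)[OF in_hom] Pin[OF d] in auto)
      also have "Act M (\<alpha>o b) d (Comp D w (\<alpha>m b c u)) (\<phi> b x) = Act M (\<alpha>o c) d w (Act M (\<alpha>o b) (\<alpha>o c) (\<alpha>m b c u) (\<phi> b x))"
        using M ob[OF a(1)] ob[OF a(2)] d mm a(4) px unfolding is_kCmod_def by blast
      also have "\<dots> = Act M (\<alpha>o c) d w (\<phi> c (Act L b c u x))" using phn[OF a(1-3,5)] by simp
      finally show "\<Phi> d s \<in> {\<zero>\<^bsub>At M d\<^esub>}"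
        using mod_homD(1)[OF ph[OF d a(2,4)] m(2)] by (simp add: a_minus_def Md.M.r_neg)
    qed
    then show ?thesis by simp
  qed
  define \<psi> where "\<psi> d Y = \<Phi> d (SOME y. y \<in> Y)" for d Y
  have psi: "\<psi> d (H d +>\<^bsub>X d\<^esub> f) = \<Phi> d f" if d: "d \<in> Obj D" and f: "f \<in> carrier (X d)" for d f
  proof -
    interpret Q: quotient_module k "X d" "H d" by (rule quotX[OF d])
    interpret Md: Module.module k "At M d" by (rule modM[OF d])
    define y where "y = (SOME y. y \<in> H d +>\<^bsub>X d\<^esub> f)"
    have "y \<in> H d +>\<^bsub>X d\<^esub> f" unfolding y_def using Q.coset_self[OF f] by (metis someI)
    then have y: "y \<in> carrier (X d)" "y \<ominus>\<^bsub>X d\<^esub> f \<in> H d" using Q.coset_elem[OF f] by auto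
    have c: "\<Phi> d y \<in> carrier (At M d)" "\<Phi> d f \<in> carrier (At M d)" using mod_homD(1)[OF Phom[OF d]] y f by auto
    have "\<Phi> d y \<ominus>\<^bsub>At M d\<^esub> \<Phi> d f = \<zero>\<^bsub>At M d\<^esub>"
      using P0[OF d y(2)] hom_diff[OF modX modM[OF d] Phom[OF d] y(1) f] by simp
    then have "\<Phi> d y = \<Phi> d f" using c unfolding a_minus_def by (metis Md.M.a_inv_closed Md.M.minus_equality Md.M.minus_minus)
    then show ?thesis by (simp add: \<psi>_def y_def)
  qed
  have psihom: "\<psi> d \<in> mod_hom k (At J d) (At M d)" if d: "d \<in> Obj D" for d
  proof -
    interpret Q: quotient_module k "X d" "H d" by (rule quotX[OF d])
    show ?thesis unfolding AtJ
      by (rule mod_homI)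
        (auto simp: Q.coset_carrier Q.coset_add Q.coset_smult psi[OF d] mod_homD[OF Phom[OF d]])
  qed
  have psinat: "\<psi> e (Act J d e v Y) = Act M d e v (\<psi> d Y)"
    if de: "d \<in> Obj D" "e \<in> Obj D" "v \<in> Mor D d e" and Y: "Y \<in> carrier (At J d)" for d e v Y
  proof -
    obtain f where f: "f \<in> carrier (X d)" "Y = H d +>\<^bsub>X d\<^esub> f" using Y carrierJ[OF de(1)] by blast
    have "\<Phi> e (T d e v f) = Act M d e v (\<Phi> d f)"
    proof (rule hom_ext[OF modM[OF de(2)] mod_hom_comp[OF T_hom[OF de] Phom[OF de(2)]] mod_hom_comp[OF Phom[OF de(1)] actM[OF de]] _ f(1)])
      fix c w x assume a: "c \<in> Obj C" "w \<in> Mor D (\<alpha>o c) d" "x \<in> carrier (At L c)"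
      have "Act M (\<alpha>o c) e (Comp D v w) (\<phi> c x) = Act M d e v (Act M (\<alpha>o c) d w (\<phi> c x))"
        using M ob[OF a(1)] de a(2) mod_homD(1)[OF phh[OF a(1)] a(3)] unfolding is_kCmod_def by blast
      then show "\<Phi> e (T d e v (\<iota> d c w x)) = Act M d e v (\<Phi> d (\<iota> d c w x))"
        using T_in[OF de a] Pin[OF de(1) a] Pin[OF de(2) a(1) comp_mor'[OF a(1) de(1,2) a(2) de(3)] a(3)] by simp
    qed
    then show ?thesis
      using f ActJ_coset[OF de f(1)] psi[OF de(1) f(1)] psi[OF de(2) mod_homD(1)[OF T_hom[OF de] f(1)]] by simp
  qed
  have 1: "\<psi> \<in> nat_trans k D J M" using psihom psinat by (simp add: nat_trans_def)
  have 2: "\<psi> (\<alpha>o c) (\<eta> c x) = \<phi> c x" if a: "c \<in> Obj C" "x \<in> carrier (At L c)" for c x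
  proof -
    have "\<psi> (\<alpha>o c) (\<eta> c x) = Act M (\<alpha>o c) (\<alpha>o c) (Id D (\<alpha>o c)) (\<phi> c x)"
      unfolding ind_unit_def
      using psi[OF ob[OF a(1)] mod_homD(1)[OF in_hom[OF a(1) idD[OF a(1)]] a(2)]] Pin[OF ob[OF a(1)] a(1) idD[OF a(1)] a(2)] by simp
    also have "\<dots> = \<phi> c x" using M ob[OF a(1)] mod_homD(1)[OF phh[OF a(1)] a(2)] unfolding is_kCmod_def by blast
    finally show ?thesis .
  qed
  have 3: "\<psi>' d Y = \<psi> d Y" if p: "\<psi>' \<in> nat_trans k D J M"
    and eq: "\<forall>c\<in>Obj C. \<forall>x\<in>carrier (At L c). \<psi>' (\<alpha>o c) (\<eta> c x) = \<phi> c x"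
    and d: "d \<in> Obj D" and Y: "Y \<in> carrier (At J d)" for \<psi>' d Y
  proof -
    interpret Q: quotient_module k "X d" "H d" by (rule quotX[OF d])
    obtain f where f: "f \<in> carrier (X d)" "Y = H d +>\<^bsub>X d\<^esub> f" using Y carrierJ[OF d] by blast
    have ph': "\<psi>' d \<in> mod_hom k (At J d) (At M d)" using p d by (simp add: nat_trans_def)
    have "\<psi>' d (H d +>\<^bsub>X d\<^esub> f) = \<psi> d (H d +>\<^bsub>X d\<^esub> f)"
    proof (rule hom_ext[OF modM[OF d] mod_hom_comp[OF Q.proj_hom ph'[unfolded AtJ]] mod_hom_comp[OF Q.proj_hom psihom[OF d, unfolded AtJ]] _ f(1)])
      fix c w x assume a: "c \<in> Obj C" "w \<in> Mor D (\<alpha>o c) d" "x \<in> carrier (At L c)"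
      have ec: "\<eta> c x \<in> carrier (At J (\<alpha>o c))"
        using cosetin_hom[OF ob[OF a(1)] a(1) idD[OF a(1)], THEN mod_homD(1), OF a(3)] by (simp add: ind_unit_def)
      have "\<psi>' d (Act J (\<alpha>o c) d w (\<eta> c x)) = Act M (\<alpha>o c) d w (\<psi>' (\<alpha>o c) (\<eta> c x))"
        using p ob[OF a(1)] d a(2) ec by (simp add: nat_trans_def)
      also have "\<dots> = Act M (\<alpha>o c) d w (\<psi> (\<alpha>o c) (\<eta> c x))" using eq 2 a by simp
      also have "\<dots> = \<psi> d (Act J (\<alpha>o c) d w (\<eta> c x))"
        using psinat[OF ob[OF a(1)] d a(2) ec] by simp
      finally show "\<psi>' d (H d +>\<^bsub>X d\<^esub> \<iota> d c w x) = \<psi> d (H d +>\<^bsub>X d\<^esub> \<iota> d c w x)"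
        using act_unit[OF d a] by simp
    qed
    then show ?thesis using f by simp
  qed
  show ?thesis using 1 2 3 by blast
qed
end

end

theory Submission imports Defs begin

text \<open>Let \<open>S\<close> be the set of Betti degrees. Evaluated at \<open>d\<close>, the induced bar resolution has a basis
  of lists \<open>\<mu>\<^sub>0 > \<dots> > \<mu>\<^sub>p\<close> of exponents with all \<open>d - A\<mu>\<^sub>i\<close> in \<open>S\<close>, and the boundary deletes entries.
  For a functor \<open>M\<close>, give the list the coefficients \<open>M(d - A\<mu>\<^sub>0)\<close>, and the empty list \<open>M(d)\<close>. On \<open>S\<close> the
  functor \<open>k[Q]\<close> is constant, so for \<open>M = k[Q]\<close> this is the augmented complex to be proved exact.
  If \<open>M\<close> is free on generators with degrees in \<open>S\<close>, then the complex is contracted by prepending the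
  exponent that leads from the degree of the generator to \<open>d\<close>. The terms of the minimal resolution of
  \<open>k[Q]\<close> are such functors, and exactness passes to \<open>k[Q]\<close> by shifting dimensions along the syzygies.

  The resolution is finite because \<open>S\<close> is: a degree \<open>c\<close> is not a Betti degree if the complex of all \<open>F\<close>
  with \<open>c - a\<^sub>F \<in> A(\<nat>\<^sup>n)\<close> is a cone, and by the pigeonhole principle and Dickson's lemma this
  happens in every infinite set of degrees.\<close>

section \<open>Bases of modules\<close>

text \<open>The dimension shift runs over the homological degree and treats all syzygies at once:
  exactness for \<open>M\<close> in degree \<open>p + 1\<close> follows from exactness in that
  degree for a free cover and in degree \<open>p\<close> for its kernel. In degree 0 exactness means
  that the augmentation is onto, which every quotient of a free functor inherits. So the shift works
  along a resolution of any length. The cone criterion for Betti degrees uses the shift in the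
  opposite direction. The complex of all \<open>F\<close> computes Tor with the residue field: for a
  free functor it is exact in positive degrees, while its degree 0 homology at \<open>c\<close>
  counts the generators of degree \<open>c\<close>. Minimality enters there: the kernel of a cover
  has no components on generators, hence consists of boundaries. So exactness at \<open>c\<close>
  climbs from \<open>k[Q]\<close> to every syzygy and leaves no generator of degree
  \<open>c\<close>. Nearly everything is checked on bases with dual functionals, on which the maps
  in question delete entries of lists or translate generators; this replaces computations with
  coefficients.\<close>

lemma self_mod_sel [simp]:
  "carrier (self_mod k) = carrier k" "\<zero>\<^bsub>self_mod k\<^esub> = \<zero>\<^bsub>k\<^esub>"
  "x \<oplus>\<^bsub>self_mod k\<^esub> y = x \<oplus>\<^bsub>k\<^esub> y" "a \<odot>\<^bsub>self_mod k\<^esub> x = a \<otimes>\<^bsub>k\<^esub> x"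
  by (simp_all add: self_mod_def)

lemma self_mod_module:
  assumes "cring k" shows "Module.module k (self_mod k)"
proof -
  interpret k: cring k by fact
  show ?thesis
  proof (rule moduleI)
    show "abelian_group (self_mod k)"
      by (rule abelian_groupI) (auto simp: k.a_ac intro: k.l_neg)
  qed (auto simp: k.l_distr k.r_distr k.m_assoc assms)
qed

lemma submodule_equalizer:
  assumes M: "Module.module k M" and N: "Module.module k N"
    and p: "p \<in> mod_hom k M N" and q: "q \<in> mod_hom k M N"
  shows "submodule {x \<in> carrier M. p x = q x} k M"
proof -
  interpret M: Module.module k M by fact
  show ?thesis
    by (rule M.submoduleI)
      (auto simp: mod_homD[OF p] mod_homD[OF q] mod_hom_zero[OF M N p] mod_hom_zero[OF M N q]
         mod_hom_minus[OF M N p] mod_hom_minus[OF M N q])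
qed

lemma mod_hom_ext_span:
  assumes "Module.module k M" "Module.module k N" "p \<in> mod_hom k M N" "q \<in> mod_hom k M N"
    and "X \<subseteq> carrier M" "\<And>x. x \<in> X \<Longrightarrow> p x = q x" "x \<in> mod_span k M X"
  shows "p x = q x"
  using mod_span_least[OF submodule_equalizer[OF assms(1-4)], of X] assms(5-7) by blast

lemma submodule_image:
  assumes M: "Module.module k M" and N: "Module.module k N" and p: "p \<in> mod_hom k M N"
  shows "submodule (p ` carrier M) k N"
proof -
  interpret M: Module.module k M by fact
  interpret N: Module.module k N by fact
  show ?thesis
  proof (rule N.submoduleI)
    show "\<zero>\<^bsub>N\<^esub> \<in> p ` carrier M"
      using imageI[of "\<zero>\<^bsub>M\<^esub>" "carrier M" p] mod_hom_zero[OF M N p] by simp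
    fix x assume "x \<in> p ` carrier M"
    then obtain u where u: "u \<in> carrier M" "x = p u" by blast
    show "\<ominus>\<^bsub>N\<^esub> x \<in> p ` carrier M"
      using imageI[of "\<ominus>\<^bsub>M\<^esub> u" "carrier M" p] mod_hom_minus[OF M N p u(1)] u by simp
    show "b \<odot>\<^bsub>N\<^esub> x \<in> p ` carrier M" if "b \<in> carrier k" for b
      using imageI[of "b \<odot>\<^bsub>M\<^esub> u" "carrier M" p] mod_homD(3)[OF p that u(1)] u that by simp
    fix y assume "y \<in> p ` carrier M"
    then obtain v where v: "v \<in> carrier M" "y = p v" by blast
    show "x \<oplus>\<^bsub>N\<^esub> y \<in> p ` carrier M"
      using imageI[of "u \<oplus>\<^bsub>M\<^esub> v" "carrier M" p] mod_homD(2)[OF p u(1) v(1)] u v by simp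
  qed (use mod_homD(1)[OF p] in auto)
qed

lemma mod_hom_smult_left:
  assumes "Module.module k M" "x \<in> carrier M"
  shows "(\<lambda>b. b \<odot>\<^bsub>M\<^esub> x) \<in> mod_hom k (self_mod k) M"
proof -
  interpret M: Module.module k M by fact
  show ?thesis by (rule mod_homI) (auto simp: assms M.smult_l_distr M.smult_assoc1)
qed

lemma mod_hom_const_zero:
  assumes "Module.module k M" "Module.module k N"
  shows "(\<lambda>_. \<zero>\<^bsub>N\<^esub>) \<in> mod_hom k M N"
proof -
  interpret N: Module.module k N by fact
  show ?thesis by (rule mod_homI) auto
qed

lemma mod_hom_add:
  assumes "Module.module k M" and N: "Module.module k N" and p: "p \<in> mod_hom k M N" and q: "q \<in> mod_hom k M N"
  shows "(\<lambda>x. p x \<oplus>\<^bsub>N\<^esub> q x) \<in> mod_hom k M N"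
proof -
  interpret N: Module.module k N by fact
  show ?thesis by (rule mod_homI)
      (auto simp: mod_homD[OF p] mod_homD[OF q] N.M.a_ac N.smult_r_distr)
qed

lemma mod_hom_uminus:
  assumes "Module.module k M" and N: "Module.module k N" and p: "p \<in> mod_hom k M N"
  shows "(\<lambda>x. \<ominus>\<^bsub>N\<^esub> p x) \<in> mod_hom k M N"
proof -
  interpret N: Module.module k N by fact
  show ?thesis by (rule mod_homI)
      (auto simp: mod_homD[OF p] N.M.minus_add N.smult_r_minus)
qed

lemma mod_hom_diff:
  assumes M: "Module.module k M" and N: "Module.module k N" and p: "p \<in> mod_hom k M N" and q: "q \<in> mod_hom k M N"
  shows "(\<lambda>x. p x \<ominus>\<^bsub>N\<^esub> q x) \<in> mod_hom k M N"
  unfolding a_minus_def by (rule mod_hom_add[OF M N p mod_hom_uminus[OF M N q]])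

lemma mod_hom_minus':
  assumes M: "Module.module k M" and N: "Module.module k N" and f: "f \<in> mod_hom k M N"
    and x: "x \<in> carrier M" "y \<in> carrier M"
  shows "f (x \<ominus>\<^bsub>M\<^esub> y) = f x \<ominus>\<^bsub>N\<^esub> f y"
proof -
  interpret M: Module.module k M by fact
  show ?thesis using x mod_homD(2)[OF f] mod_hom_minus[OF M N f] by (simp add: a_minus_def)
qed

lemma mod_hom_inv_into:
  assumes "Module.module k M" "Module.module k N" and p: "p \<in> mod_hom k M N"
    and b: "bij_betw p (carrier M) (carrier N)"
  shows "inv_into (carrier M) p \<in> mod_hom k N M"
proof -
  interpret M: Module.module k M by fact
  interpret N: Module.module k N by fact
  have i: "inv_into (carrier M) p y \<in> carrier M" "p (inv_into (carrier M) p y) = y" if "y \<in> carrier N" for y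
    using that b by (auto simp: bij_betw_def inv_into_into f_inv_into_f)
  have e: "inv_into (carrier M) p (p x) = x" if "x \<in> carrier M" for x
    using that b by (simp add: bij_betw_def)
  show ?thesis
  proof (rule mod_homI)
    fix x y assume xy: "x \<in> carrier N" "y \<in> carrier N"
    have "x \<oplus>\<^bsub>N\<^esub> y = p (inv_into (carrier M) p x \<oplus>\<^bsub>M\<^esub> inv_into (carrier M) p y)"
      using xy i mod_homD(2)[OF p] by simp
    then show "inv_into (carrier M) p (x \<oplus>\<^bsub>N\<^esub> y) = inv_into (carrier M) p x \<oplus>\<^bsub>M\<^esub> inv_into (carrier M) p y"
      using e i xy by simp
  next
    fix c x assume xy: "c \<in> carrier k" "x \<in> carrier N"
    have "c \<odot>\<^bsub>N\<^esub> x = p (c \<odot>\<^bsub>M\<^esub> inv_into (carrier M) p x)"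
      using xy i mod_homD(3)[OF p] by simp
    then show "inv_into (carrier M) p (c \<odot>\<^bsub>N\<^esub> x) = c \<odot>\<^bsub>M\<^esub> inv_into (carrier M) p x"
      using e i xy by simp
  qed (use i in auto)
qed

text \<open>Since \<open>p\<close> is constant on the cosets of \<open>H\<close>, evaluating it at
  an arbitrarily chosen representative is already linear.\<close>

lemma quot_lift:
  assumes Q: "quotient_module k M H" and N: "Module.module k N" and p: "p \<in> mod_hom k M N"
    and H: "\<And>h. h \<in> H \<Longrightarrow> p h = \<zero>\<^bsub>N\<^esub>"
  shows "\<exists>g\<in>mod_hom k (quot_mod M H) N. \<forall>x\<in>carrier M. g (H +>\<^bsub>M\<^esub> x) = p x"
proof -
  interpret Q: quotient_module k M H by fact
  interpret N: Module.module k N by fact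
  define g where "g Y = p (SOME y. y \<in> Y)" for Y
  have g: "g (H +>\<^bsub>M\<^esub> x) = p x" if x: "x \<in> carrier M" for x
  proof -
    define y where "y = (SOME y. y \<in> H +>\<^bsub>M\<^esub> x)"
    have "y \<in> H +>\<^bsub>M\<^esub> x" unfolding y_def using Q.coset_self[OF x] by (metis someI)
    then have y: "y \<in> carrier M" "y \<ominus>\<^bsub>M\<^esub> x \<in> H" using Q.coset_elem[OF x] by auto
    have "p y \<ominus>\<^bsub>N\<^esub> p x = \<zero>\<^bsub>N\<^esub>"
      using H[OF y(2)] mod_hom_minus'[OF Q.module_axioms N p y(1) x] by simp
    then have "p y = p x" using mod_homD(1)[OF p x] mod_homD(1)[OF p y(1)] unfolding a_minus_def
      by (metis N.M.a_inv_closed N.M.minus_equality N.M.minus_minus)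
    then show ?thesis by (simp add: g_def y_def)
  qed
  have "g \<in> mod_hom k (quot_mod M H) N"
    by (rule mod_homI) (auto simp: Q.coset_carrier Q.coset_add Q.coset_smult g mod_homD[OF p])
  then show ?thesis using g by blast
qed

text \<open>Linear independence is expressed by the existence of dual functionals.\<close>

definition lbasis :: "('k, 'x) ring_scheme \<Rightarrow> ('k, 'v, 'y) module_scheme \<Rightarrow> 'i set \<Rightarrow> ('i \<Rightarrow> 'v) \<Rightarrow> bool"
  where "lbasis k V I \<beta> \<longleftrightarrow> Module.module k V \<and> \<beta> \<in> I \<rightarrow> carrier V \<and> carrier V \<subseteq> mod_span k V (\<beta> ` I) \<and>
    (\<forall>i\<in>I. \<exists>\<kappa>\<in>mod_hom k V (self_mod k). \<forall>j\<in>I. \<kappa> (\<beta> j) = (if j = i then \<one>\<^bsub>k\<^esub> else \<zero>\<^bsub>k\<^esub>))"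

lemma lbasisI:
  assumes "Module.module k V" "\<And>i. i \<in> I \<Longrightarrow> \<beta> i \<in> carrier V"
    and "\<And>v. v \<in> carrier V \<Longrightarrow> v \<in> mod_span k V (\<beta> ` I)"
    and "\<And>i. i \<in> I \<Longrightarrow> \<exists>\<kappa>\<in>mod_hom k V (self_mod k). \<forall>j\<in>I. \<kappa> (\<beta> j) = (if j = i then \<one>\<^bsub>k\<^esub> else \<zero>\<^bsub>k\<^esub>)"
  shows "lbasis k V I \<beta>"
  using assms unfolding lbasis_def by blast

lemma lbasis_module: "lbasis k V I \<beta> \<Longrightarrow> Module.module k V"
  and lbasis_closed: "lbasis k V I \<beta> \<Longrightarrow> i \<in> I \<Longrightarrow> \<beta> i \<in> carrier V"
  by (auto simp: lbasis_def)

lemma lbasis_ext: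
  assumes "lbasis k V I \<beta>" "Module.module k N" "p \<in> mod_hom k V N" "q \<in> mod_hom k V N"
    and "\<And>i. i \<in> I \<Longrightarrow> p (\<beta> i) = q (\<beta> i)" "v \<in> carrier V"
  shows "p v = q v"
  by (rule mod_hom_ext_span[OF _ assms(2-4), of "\<beta> ` I"]) (use assms in \<open>auto simp: lbasis_def\<close>)

lemma lbasis_induct_submodule:
  assumes "lbasis k V I \<beta>" "submodule H k V" "\<And>i. i \<in> I \<Longrightarrow> \<beta> i \<in> H" "v \<in> carrier V"
  shows "v \<in> H"
  using mod_span_least[OF assms(2), of "\<beta> ` I"] assms unfolding lbasis_def by blast

lemma lbasis_dual:
  assumes "lbasis k V I \<beta>"
  shows "\<exists>\<kappa>. \<forall>i\<in>I. \<kappa> i \<in> mod_hom k V (self_mod k) \<and> (\<forall>j\<in>I. \<kappa> i (\<beta> j) = (if j = i then \<one>\<^bsub>k\<^esub> else \<zero>\<^bsub>k\<^esub>))"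
  by (rule bchoice) (use assms in \<open>auto simp: lbasis_def Bex_def\<close>)

text \<open>The dual functional of \<open>i\<close> takes the value 1 at \<open>\<beta> i\<close>
  and 0 at every other member; if 1 were equal to 0 this would separate nothing.\<close>

lemma lbasis_inj:
  assumes "lbasis k V I \<beta>" "\<one>\<^bsub>k\<^esub> \<noteq> \<zero>\<^bsub>k\<^esub>"
  shows "inj_on \<beta> I"
proof (rule inj_onI)
  fix i j assume ij: "i \<in> I" "j \<in> I" "\<beta> i = \<beta> j"
  obtain \<kappa> where "\<And>i. i \<in> I \<Longrightarrow> \<kappa> i \<in> mod_hom k V (self_mod k)" and d: "\<And>i j. i \<in> I \<Longrightarrow> j \<in> I \<Longrightarrow> \<kappa> i (\<beta> j) = (if j = i then \<one>\<^bsub>k\<^esub> else \<zero>\<^bsub>k\<^esub>)"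
    using lbasis_dual[OF assms(1)] by blast
  from d[of i i] d[of i j] show "i = j" using ij assms(2) by metis
qed

text \<open>A dual functional of the sum is evaluation at a summand followed by a dual functional
  there. For spanning, an element is the finite sum of its components, and each component lies in
  the span of the basis of its summand.\<close>

lemma lbasis_dsum:
  assumes k: "cring k" and B: "\<And>t. t \<in> N \<Longrightarrow> lbasis k (F t) (I t) (\<beta> t)"
  shows "lbasis k (dsum_mod N F) (SIGMA t:N. I t) (\<lambda>(t, i). dsum_in N F t (\<beta> t i))"
proof (rule lbasisI)
  note F = lbasis_module[OF B]
  have D: "Module.module k (dsum_mod N F)" by (rule dsum_module[OF k F])
  show "Module.module k (dsum_mod N F)" by (rule D)
  interpret D: Module.module k "dsum_mod N F" by (rule D)
  have inh: "dsum_in N F t \<in> mod_hom k (F t) (dsum_mod N F)" if "t \<in> N" for t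
    by (rule dsum_in_hom[OF k F that])
  show inc: "(\<lambda>(t, i). dsum_in N F t (\<beta> t i)) z \<in> carrier (dsum_mod N F)" if "z \<in> (SIGMA t:N. I t)" for z
    using that mod_homD(1)[OF inh] lbasis_closed[OF B] by auto
  let ?X = "(\<lambda>(t, i). dsum_in N F t (\<beta> t i)) ` (SIGMA t:N. I t)"
  have X: "?X \<subseteq> carrier (dsum_mod N F)" using inc by blast
  have sub: "submodule (mod_span k (dsum_mod N F) ?X) k (dsum_mod N F)" by (rule mod_span_submodule[OF D X])
  have step: "dsum_in N F t x \<in> mod_span k (dsum_mod N F) ?X" if t: "t \<in> N" "x \<in> carrier (F t)" for t x
  proof -
    have "x \<in> {x \<in> carrier (F t). dsum_in N F t x \<in> mod_span k (dsum_mod N F) ?X}"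
    proof (rule lbasis_induct_submodule[OF B[OF t(1)] submodule_vimage[OF F[OF t(1)] D inh[OF t(1)] sub] _ t(2)])
      fix i assume i: "i \<in> I t"
      have "dsum_in N F t (\<beta> t i) \<in> ?X" using i t by force
      then show "\<beta> t i \<in> {x \<in> carrier (F t). dsum_in N F t x \<in> mod_span k (dsum_mod N F) ?X}"
        using mod_span_submodule(2)[OF D X] lbasis_closed[OF B[OF t(1)] i] by blast
    qed
    then show ?thesis by simp
  qed
  fix v assume v: "v \<in> carrier (dsum_mod N F)"
  have fs: "(\<Oplus>\<^bsub>dsum_mod N F\<^esub> i\<in>S. f i) \<in> mod_span k (dsum_mod N F) ?X"
    if "finite S" "S \<subseteq> N" "\<And>i. i \<in> S \<Longrightarrow> f i \<in> mod_span k (dsum_mod N F) ?X" for S f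
    using that
  proof (induction S rule: finite_induct)
    case empty
    then show ?case using submodule_zero[OF sub] by simp
  next
    case (insert x S)
    have "f \<in> insert x S \<rightarrow> carrier (dsum_mod N F)"
      using insert.prems D.submoduleE(1)[OF sub] by auto
    then show ?case using insert D.submoduleE(5)[OF sub] by (subst D.M.finsum_insert) auto
  qed
  have "(\<Oplus>\<^bsub>dsum_mod N F\<^esub> i\<in>{i \<in> N. v i \<noteq> \<zero>\<^bsub>F i\<^esub>}. dsum_in N F i (v i)) \<in> mod_span k (dsum_mod N F) ?X"
    by (rule fs) (use v step in \<open>auto simp: dsum_sel PiE_iff\<close>)
  then show "v \<in> mod_span k (dsum_mod N F) ?X" using dsum_expand[OF k F v] by simp
next
  note F = lbasis_module[OF B]
  fix z assume "z \<in> (SIGMA t:N. I t)"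
  then obtain t i where z: "z = (t, i)" "t \<in> N" "i \<in> I t" by auto
  obtain \<kappa> where \<kappa>: "\<kappa> \<in> mod_hom k (F t) (self_mod k)" "\<forall>j\<in>I t. \<kappa> (\<beta> t j) = (if j = i then \<one>\<^bsub>k\<^esub> else \<zero>\<^bsub>k\<^esub>)"
    using B[OF z(2)] z(3) unfolding lbasis_def by blast
  have ev: "(\<lambda>f. f t) \<in> mod_hom k (dsum_mod N F) (F t)"
    by (rule mod_homI) (use z in \<open>auto simp: dsum_sel\<close>)
  have "\<kappa> \<zero>\<^bsub>F t\<^esub> = \<zero>\<^bsub>k\<^esub>"
    using mod_hom_zero[OF F[OF z(2)] self_mod_module[OF k] \<kappa>(1)] by simp
  then show "\<exists>\<kappa>\<in>mod_hom k (dsum_mod N F) (self_mod k).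
     \<forall>j\<in>SIGMA t:N. I t. \<kappa> ((\<lambda>(t, i). dsum_in N F t (\<beta> t i)) j) = (if j = z then \<one>\<^bsub>k\<^esub> else \<zero>\<^bsub>k\<^esub>)"
    by (intro bexI[OF _ mod_hom_comp[OF ev \<kappa>(1)]]) (use z \<kappa>(2) in \<open>auto simp: dsum_in_def\<close>)
qed

lemma lbasis_self: assumes "cring k" shows "lbasis k (self_mod k) {()} (\<lambda>_. \<one>\<^bsub>k\<^esub>)"
proof (rule lbasisI)
  interpret k: cring k by fact
  have M: "Module.module k (self_mod k)" by (rule self_mod_module[OF assms])
  show "Module.module k (self_mod k)" by (rule M)
  show "\<one>\<^bsub>k\<^esub> \<in> carrier (self_mod k)" by simp
  have sp: "\<one>\<^bsub>k\<^esub> \<in> mod_span k (self_mod k) ((\<lambda>_. \<one>\<^bsub>k\<^esub>) ` {()})"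
    using mod_span_submodule(2)[OF M, of "(\<lambda>_. \<one>\<^bsub>k\<^esub>) ` {()}"] by auto
  fix v assume "v \<in> carrier (self_mod k)"
  then show "v \<in> mod_span k (self_mod k) ((\<lambda>_. \<one>\<^bsub>k\<^esub>) ` {()})"
    using Module.module.submoduleE(4)[OF M mod_span_submodule(1)[OF M], of "(\<lambda>_. \<one>\<^bsub>k\<^esub>) ` {()}" v "\<one>\<^bsub>k\<^esub>"] sp by simp
next
  show "\<exists>\<kappa>\<in>mod_hom k (self_mod k) (self_mod k). \<forall>j\<in>{()}. \<kappa> \<one>\<^bsub>k\<^esub> = (if j = i then \<one>\<^bsub>k\<^esub> else \<zero>\<^bsub>k\<^esub>)" for i :: unit
    by (intro bexI[of _ "\<lambda>x. x"]) (auto simp: mod_hom_def)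
qed

lemma lbasis_reindex:
  assumes B: "lbasis k V I \<beta>" and s: "bij_betw \<sigma> I' I"
  shows "lbasis k V I' (\<lambda>i. \<beta> (\<sigma> i))"
proof -
  have "(\<lambda>i. \<beta> (\<sigma> i)) ` I' = \<beta> ` I" using s by (auto simp: bij_betw_def)
  moreover have "\<exists>\<kappa>\<in>mod_hom k V (self_mod k). \<forall>j\<in>I'. \<kappa> (\<beta> (\<sigma> j)) = (if j = i then \<one>\<^bsub>k\<^esub> else \<zero>\<^bsub>k\<^esub>)" if "i \<in> I'" for i
  proof -
    have si: "\<sigma> i \<in> I" using that s by (auto simp: bij_betw_def)
    obtain \<kappa> where \<kappa>: "\<kappa> \<in> mod_hom k V (self_mod k)" "\<forall>j\<in>I. \<kappa> (\<beta> j) = (if j = \<sigma> i then \<one>\<^bsub>k\<^esub> else \<zero>\<^bsub>k\<^esub>)"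
      using B si unfolding lbasis_def by blast
    show ?thesis
      by (rule bexI[OF _ \<kappa>(1)]) (use that s \<kappa>(2) in \<open>auto simp: bij_betw_def inj_on_eq_iff\<close>)
  qed
  moreover have "\<beta> (\<sigma> i) \<in> carrier V" if "i \<in> I'" for i
    using B s that unfolding lbasis_def bij_betw_def by blast
  ultimately show ?thesis using B unfolding lbasis_def by auto
qed

lemma lbasis_cong:
  assumes "\<And>i. i \<in> I \<Longrightarrow> \<beta> i = \<beta>' i" "lbasis k V I \<beta>"
  shows "lbasis k V I \<beta>'"
proof -
  have "\<beta>' ` I = \<beta> ` I" using assms(1) by (auto simp: image_iff)
  then show ?thesis using assms unfolding lbasis_def by (auto simp: Pi_iff)
qed

lemma lbasis_dsum_self:
  assumes k: "cring k"
  shows "lbasis k (dsum_mod I (\<lambda>_. self_mod k)) I (\<lambda>i. dsum_in I (\<lambda>_. self_mod k) i \<one>\<^bsub>k\<^esub>)"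
proof -
  \<comment> \<open>The one-element basis of \<open>k\<close> over itself is indexed by
    \<open>()\<close>, a factor that is dropped here.\<close>
  have b: "bij_betw (\<lambda>i. (i, ())) I (SIGMA i:I. {()})" by (rule bij_betwI[where g = fst]) auto
  show ?thesis
    using lbasis_reindex[OF lbasis_dsum[OF k lbasis_self[OF k], of I] b] by simp
qed

text \<open>The dual functionals together form a coordinate map \<open>K\<close> into the direct sum
  of copies of \<open>k\<close>, out of which linear maps can be prescribed freely; the extension is
  the composite.\<close>

lemma lbasis_lift:
  assumes k: "cring k" and B: "lbasis k V I \<beta>" and N: "Module.module k N" and n: "\<And>i. i \<in> I \<Longrightarrow> n i \<in> carrier N"
  shows "\<exists>f\<in>mod_hom k V N. \<forall>i\<in>I. f (\<beta> i) = n i"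
proof -
  interpret k: cring k by (rule k)
  note V = lbasis_module[OF B]
  interpret V: Module.module k V by (rule V)
  interpret N: Module.module k N by (rule N)
  obtain \<kappa> where \<kappa>: "\<And>i. i \<in> I \<Longrightarrow> \<kappa> i \<in> mod_hom k V (self_mod k)"
    "\<And>i j. i \<in> I \<Longrightarrow> j \<in> I \<Longrightarrow> \<kappa> i (\<beta> j) = (if j = i then \<one>\<^bsub>k\<^esub> else \<zero>\<^bsub>k\<^esub>)"
    using lbasis_dual[OF B] by blast
  let ?F = "\<lambda>_. self_mod k"
  let ?D = "dsum_mod I ?F"
  note S = self_mod_module[OF k]
  have kz: "\<kappa> i \<zero>\<^bsub>V\<^esub> = \<zero>\<^bsub>k\<^esub>" "x \<in> carrier V \<Longrightarrow> \<kappa> i (\<ominus>\<^bsub>V\<^esub> x) = \<ominus>\<^bsub>k\<^esub> \<kappa> i x"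
    if "i \<in> I" for i x
  proof -
    show "\<kappa> i \<zero>\<^bsub>V\<^esub> = \<zero>\<^bsub>k\<^esub>" using mod_hom_zero[OF V S \<kappa>(1)[OF that]] by simp
    assume x: "x \<in> carrier V"
    have "\<kappa> i (\<ominus>\<^bsub>V\<^esub> x) \<oplus>\<^bsub>k\<^esub> \<kappa> i x = \<zero>\<^bsub>k\<^esub>"
      using mod_homD(2)[OF \<kappa>(1)[OF that], of "\<ominus>\<^bsub>V\<^esub> x" x] x \<open>\<kappa> i \<zero>\<^bsub>V\<^esub> = \<zero>\<^bsub>k\<^esub>\<close> by (simp add: V.M.l_neg)
    then show "\<kappa> i (\<ominus>\<^bsub>V\<^esub> x) = \<ominus>\<^bsub>k\<^esub> \<kappa> i x"
      using mod_homD(1)[OF \<kappa>(1)[OF that]] x by (metis V.M.a_inv_closed k.minus_equality self_mod_sel(1))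
  qed
  \<comment> \<open>\<open>lbasis\<close> does not state that a vector has only finitely many
    nonzero coordinates. The vectors with this property form a submodule that contains the
    basis.\<close>
  have fin: "finite {i \<in> I. \<kappa> i v \<noteq> \<zero>\<^bsub>k\<^esub>}" if v: "v \<in> carrier V" for v
  proof -
    let ?H = "{v \<in> carrier V. finite {i \<in> I. \<kappa> i v \<noteq> \<zero>\<^bsub>k\<^esub>}}"
    have "submodule ?H k V"
    proof (rule V.submoduleI)
      fix x y assume "x \<in> ?H" "y \<in> ?H"
      moreover from this have "{i \<in> I. \<kappa> i (x \<oplus>\<^bsub>V\<^esub> y) \<noteq> \<zero>\<^bsub>k\<^esub>} \<subseteq> {i \<in> I. \<kappa> i x \<noteq> \<zero>\<^bsub>k\<^esub>} \<union> {i \<in> I. \<kappa> i y \<noteq> \<zero>\<^bsub>k\<^esub>}"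
        using mod_homD(2)[OF \<kappa>(1)] by auto
      ultimately show "x \<oplus>\<^bsub>V\<^esub> y \<in> ?H" using finite_subset by auto
    next
      fix b x assume b: "b \<in> carrier k" "x \<in> ?H"
      then have "{i \<in> I. \<kappa> i (b \<odot>\<^bsub>V\<^esub> x) \<noteq> \<zero>\<^bsub>k\<^esub>} \<subseteq> {i \<in> I. \<kappa> i x \<noteq> \<zero>\<^bsub>k\<^esub>}"
        using mod_homD(3)[OF \<kappa>(1)] by auto
      then show "b \<odot>\<^bsub>V\<^esub> x \<in> ?H" using b finite_subset by auto
    next
      fix x assume x: "x \<in> ?H"
      then have "{i \<in> I. \<kappa> i (\<ominus>\<^bsub>V\<^esub> x) \<noteq> \<zero>\<^bsub>k\<^esub>} \<subseteq> {i \<in> I. \<kappa> i x \<noteq> \<zero>\<^bsub>k\<^esub>}"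
        using kz by auto
      then show "\<ominus>\<^bsub>V\<^esub> x \<in> ?H" using x finite_subset by auto
    qed (auto simp: kz cong: conj_cong)
    then have "v \<in> ?H"
    proof (rule lbasis_induct_submodule[OF B _ _ v])
      fix j assume j: "j \<in> I"
      have "{i \<in> I. \<kappa> i (\<beta> j) \<noteq> \<zero>\<^bsub>k\<^esub>} \<subseteq> {j}" using \<kappa>(2)[OF _ j] by (auto split: if_splits)
      then show "\<beta> j \<in> ?H" using finite_subset lbasis_closed[OF B j] by auto
    qed
    then show ?thesis by simp
  qed
  define K where "K v = (\<lambda>i\<in>I. \<kappa> i v)" for v
  have cl: "\<kappa> i v \<in> carrier k" if "i \<in> I" "v \<in> carrier V" for i v
    using mod_homD(1)[OF \<kappa>(1)[OF that(1)] that(2)] by simp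
  have K: "K \<in> mod_hom k V ?D"
  proof (rule mod_homI)
    fix v assume v: "v \<in> carrier V"
    show "K v \<in> carrier ?D"
      using fin[OF v] cl v by (auto simp: K_def dsum_sel cong: conj_cong)
  next
    fix x y assume "x \<in> carrier V" "y \<in> carrier V"
    then show "K (x \<oplus>\<^bsub>V\<^esub> y) = K x \<oplus>\<^bsub>?D\<^esub> K y"
      using mod_homD(2)[OF \<kappa>(1)] by (auto simp: K_def dsum_sel intro!: restrict_ext)
  next
    fix b x assume "b \<in> carrier k" "x \<in> carrier V"
    then show "K (b \<odot>\<^bsub>V\<^esub> x) = b \<odot>\<^bsub>?D\<^esub> K x"
      using mod_homD(3)[OF \<kappa>(1)] by (auto simp: K_def dsum_sel intro!: restrict_ext)
  qed
  have Kb: "K (\<beta> j) = dsum_in I ?F j \<one>\<^bsub>k\<^esub>" if "j \<in> I" for j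
    using that \<kappa>(2) by (auto simp: K_def dsum_in_def)
  define g where "g = dsum_lift I ?F N (\<lambda>i x. x \<odot>\<^bsub>N\<^esub> n i)"
  have ph: "(\<lambda>x. x \<odot>\<^bsub>N\<^esub> n i) \<in> mod_hom k (self_mod k) N" if "i \<in> I" for i
    by (rule mod_hom_smult_left[OF N n[OF that]])
  have g: "g \<in> mod_hom k ?D N" unfolding g_def
    by (rule dsum_lift_hom[OF k S N ph])
  have gb: "g (K (\<beta> j)) = n j" if "j \<in> I" for j
  proof -
    have "g (dsum_in I ?F j \<one>\<^bsub>k\<^esub>) = \<one>\<^bsub>k\<^esub> \<odot>\<^bsub>N\<^esub> n j"
      unfolding g_def by (rule dsum_lift_in[OF k S N ph that]) auto
    then show ?thesis using Kb[OF that] n[OF that] by simp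
  qed
  show ?thesis by (rule bexI[OF _ mod_hom_comp[OF K g]]) (simp add: gb)
qed

text \<open>The inverse is the linear extension of the inverse bijection of the bases; both
  composites fix a basis.\<close>

lemma lbasis_bij:
  assumes k: "cring k" and B: "lbasis k V I \<beta>" and B': "lbasis k V' I' \<beta>'"
    and f: "f \<in> mod_hom k V V'" and s: "bij_betw \<sigma> I I'" and fs: "\<And>i. i \<in> I \<Longrightarrow> f (\<beta> i) = \<beta>' (\<sigma> i)"
  shows "bij_betw f (carrier V) (carrier V')"
proof -
  have t: "inv_into I \<sigma> j \<in> I" "\<sigma> (inv_into I \<sigma> j) = j" if "j \<in> I'" for j
    using that s by (auto simp: bij_betw_def inv_into_into f_inv_into_f)
  have "\<exists>g\<in>mod_hom k V' V. \<forall>j\<in>I'. g (\<beta>' j) = \<beta> (inv_into I \<sigma> j)"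
    by (rule lbasis_lift[OF k B' lbasis_module[OF B]]) (rule lbasis_closed[OF B t(1)])
  then obtain g where g: "g \<in> mod_hom k V' V" "\<And>j. j \<in> I' \<Longrightarrow> g (\<beta>' j) = \<beta> (inv_into I \<sigma> j)" by blast
  note V = lbasis_module[OF B] and V' = lbasis_module[OF B']
  have idh: "(\<lambda>x. x) \<in> mod_hom k M M" for M by (rule mod_homI) auto
  have 1: "g (f v) = v" if "v \<in> carrier V" for v
    by (rule lbasis_ext[OF B V mod_hom_comp[OF f g(1)] idh _ that])
      (use s g(2) fs in \<open>auto simp: bij_betw_def\<close>)
  have 2: "f (g v) = v" if "v \<in> carrier V'" for v
    by (rule lbasis_ext[OF B' V' mod_hom_comp[OF g(1) f] idh _ that])
      (use s g(2) fs t in \<open>auto simp: bij_betw_def\<close>)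
  show ?thesis
    by (rule bij_betwI[where g = g]) (use 1 2 mod_homD(1)[OF f] mod_homD(1)[OF g(1)] in auto)
qed

lemma lbasis_transfer:
  assumes B: "lbasis k V I \<beta>" and V': "Module.module k V'" and f: "f \<in> mod_hom k V V'"
    and b: "bij_betw f (carrier V) (carrier V')"
  shows "lbasis k V' I (\<lambda>i. f (\<beta> i))"
proof (rule lbasisI[OF V'])
  note V = lbasis_module[OF B]
  show c: "f (\<beta> i) \<in> carrier V'" if "i \<in> I" for i
    using mod_homD(1)[OF f lbasis_closed[OF B that]] .
  let ?X = "(\<lambda>i. f (\<beta> i)) ` I"
  have X: "?X \<subseteq> carrier V'" using c by auto
  fix v assume "v \<in> carrier V'"
  then obtain u where u: "u \<in> carrier V" "v = f u" using b by (auto simp: bij_betw_def)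
  have "u \<in> {x \<in> carrier V. f x \<in> mod_span k V' ?X}"
    by (rule lbasis_induct_submodule[OF B submodule_vimage[OF V V' f mod_span_submodule(1)[OF V' X]] _ u(1)])
      (use mod_span_submodule(2)[OF V' X] lbasis_closed[OF B] in auto)
  then show "v \<in> mod_span k V' ?X" using u by simp
next
  note V = lbasis_module[OF B]
  fix i assume "i \<in> I"
  then obtain \<kappa> where \<kappa>: "\<kappa> \<in> mod_hom k V (self_mod k)" "\<forall>j\<in>I. \<kappa> (\<beta> j) = (if j = i then \<one>\<^bsub>k\<^esub> else \<zero>\<^bsub>k\<^esub>)"
    using B unfolding lbasis_def by blast
  show "\<exists>\<kappa>\<in>mod_hom k V' (self_mod k). \<forall>j\<in>I. \<kappa> (f (\<beta> j)) = (if j = i then \<one>\<^bsub>k\<^esub> else \<zero>\<^bsub>k\<^esub>)"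
    by (intro bexI[OF _ mod_hom_comp[OF mod_hom_inv_into[OF V V' f b] \<kappa>(1)]])
      (use \<kappa>(2) b lbasis_closed[OF B] in \<open>auto simp: bij_betw_def\<close>)
qed

text \<open>Basis vectors in \<open>H\<close> become zero, so the remaining ones span. They stay
  independent because their dual functionals are required to vanish on \<open>H\<close> and hence
  descend. The case in view is the normalized bar complex, with \<open>H\<close> the degenerate
  elements.\<close>

lemma lbasis_quot:
  assumes B: "lbasis k V I \<beta>" and Q: "quotient_module k V H" and k: "cring k"
    and I': "I' \<subseteq> I" "\<And>i. i \<in> I \<Longrightarrow> i \<notin> I' \<Longrightarrow> \<beta> i \<in> H"
    and dual: "\<And>i. i \<in> I' \<Longrightarrow> \<exists>\<kappa>\<in>mod_hom k V (self_mod k). (\<forall>h\<in>H. \<kappa> h = \<zero>\<^bsub>k\<^esub>) \<and>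
        (\<forall>j\<in>I'. \<kappa> (\<beta> j) = (if j = i then \<one>\<^bsub>k\<^esub> else \<zero>\<^bsub>k\<^esub>))"
  shows "lbasis k (quot_mod V H) I' (\<lambda>i. H +>\<^bsub>V\<^esub> \<beta> i)"
proof -
  interpret Q: quotient_module k V H by fact
  note V = lbasis_module[OF B]
  have c: "\<beta> i \<in> carrier V" if "i \<in> I'" for i using lbasis_closed[OF B] I' that by blast
  let ?V' = "quot_mod V H"
  let ?X = "(\<lambda>i. H +>\<^bsub>V\<^esub> \<beta> i) ` I'"
  have X: "?X \<subseteq> carrier ?V'" using c Q.coset_carrier by auto
  note sub = mod_span_submodule(1)[OF Q.quot_module X]
  show ?thesis
  proof (rule lbasisI[OF Q.quot_module])
    show "H +>\<^bsub>V\<^esub> \<beta> i \<in> carrier ?V'" if "i \<in> I'" for i using c[OF that] Q.coset_carrier by auto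
    fix v assume "v \<in> carrier ?V'"
    then obtain u where u: "u \<in> carrier V" "v = H +>\<^bsub>V\<^esub> u" using Q.coset_carrier by auto
    have "u \<in> {x \<in> carrier V. H +>\<^bsub>V\<^esub> x \<in> mod_span k ?V' ?X}"
    proof (rule lbasis_induct_submodule[OF B submodule_vimage[OF V Q.quot_module Q.proj_hom sub] _ u(1)])
      fix i assume i: "i \<in> I"
      have bi: "\<beta> i \<in> carrier V" using lbasis_closed[OF B i] .
      show "\<beta> i \<in> {x \<in> carrier V. H +>\<^bsub>V\<^esub> x \<in> mod_span k ?V' ?X}"
      proof (cases "i \<in> I'")
        case True
        then show ?thesis using mod_span_submodule(2)[OF Q.quot_module X] bi by blast
      next
        case False
        then have "H +>\<^bsub>V\<^esub> \<beta> i = \<zero>\<^bsub>?V'\<^esub>" using I'(2)[OF i] Q.proj_eq_zero[OF bi] by blast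
        then show ?thesis using submodule_zero[OF sub] bi by simp
      qed
    qed
    then show "v \<in> mod_span k ?V' ?X" using u by simp
  next
    fix i assume "i \<in> I'"
    then obtain \<kappa> where \<kappa>: "\<kappa> \<in> mod_hom k V (self_mod k)" "\<forall>h\<in>H. \<kappa> h = \<zero>\<^bsub>k\<^esub>"
      "\<forall>j\<in>I'. \<kappa> (\<beta> j) = (if j = i then \<one>\<^bsub>k\<^esub> else \<zero>\<^bsub>k\<^esub>)" using dual by blast
    obtain g where g: "g\<in>mod_hom k ?V' (self_mod k)" "\<forall>x\<in>carrier V. g (H +>\<^bsub>V\<^esub> x) = \<kappa> x"
      using quot_lift[OF Q self_mod_module[OF k] \<kappa>(1)] \<kappa>(2) by auto
    show "\<exists>\<kappa>\<in>mod_hom k ?V' (self_mod k). \<forall>j\<in>I'. \<kappa> (H +>\<^bsub>V\<^esub> \<beta> j) = (if j = i then \<one>\<^bsub>k\<^esub> else \<zero>\<^bsub>k\<^esub>)"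
      by (rule bexI[OF _ g(1)]) (use g(2) \<kappa>(3) c in auto)
  qed
qed

section \<open>Alternating sums\<close>

text \<open>\<open>alt N \<psi> L\<close> is the sum of \<open>(-1)\<^sup>i \<psi>(L\<^sub>i)\<close>, where \<open>L\<^sub>i\<close> arises from \<open>L\<close> by deleting the \<open>i\<close>-th entry.\<close>

fun dels :: "'a list \<Rightarrow> 'a list set" where
  "dels [] = {}"
| "dels (v # L) = insert L ((#) v ` dels L)"

fun alt :: "('v, 'y) ring_scheme \<Rightarrow> ('a list \<Rightarrow> 'v) \<Rightarrow> 'a list \<Rightarrow> 'v" where
  "alt N \<psi> [] = \<zero>\<^bsub>N\<^esub>"
| "alt N \<psi> (v # L) = \<psi> L \<ominus>\<^bsub>N\<^esub> alt N (\<lambda>K. \<psi> (v # K)) L"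

lemma (in abelian_group) a_inv_zero: "\<ominus> \<zero> = \<zero>"
  by (rule minus_equality) auto

lemma dels_length: "K \<in> dels L \<Longrightarrow> length L = Suc (length K)"
  by (induction L arbitrary: K) auto

lemma dels_subset: "K \<in> dels L \<Longrightarrow> set K \<subseteq> set L"
  by (induction L arbitrary: K) fastforce+

lemma alt_map: "alt N \<psi> (map f L) = alt N (\<lambda>K. \<psi> (map f K)) L"
  by (induction L arbitrary: \<psi>) auto

lemma alt_cong: "(\<And>K. K \<in> dels L \<Longrightarrow> \<psi> K = \<chi> K) \<Longrightarrow> alt N \<psi> L = alt N \<chi> L"
proof (induction L arbitrary: \<psi> \<chi>)
  case (Cons v L)
  have "alt N (\<lambda>K. \<psi> (v # K)) L = alt N (\<lambda>K. \<chi> (v # K)) L"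
    by (rule Cons.IH) (use Cons.prems in auto)
  then show ?case using Cons.prems by simp
qed simp

lemma (in abelian_group) alt_closed:
  "(\<And>K. K \<in> dels L \<Longrightarrow> \<psi> K \<in> carrier G) \<Longrightarrow> alt G \<psi> L \<in> carrier G"
proof (induction L arbitrary: \<psi>)
  case (Cons v L)
  have "alt G (\<lambda>K. \<psi> (v # K)) L \<in> carrier G" by (rule Cons.IH) (use Cons.prems in auto)
  then show ?case using Cons.prems by simp
qed simp

lemma mod_hom_alt:
  assumes M: "Module.module k M" and N: "Module.module k N" and f: "f \<in> mod_hom k M N"
    and "\<And>K. K \<in> dels L \<Longrightarrow> \<psi> K \<in> carrier M"
  shows "f (alt M \<psi> L) = alt N (\<lambda>K. f (\<psi> K)) L"
  using assms(4)
proof (induction L arbitrary: \<psi>)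
  case Nil
  then show ?case using mod_hom_zero[OF M N f] by simp
next
  case (Cons v L)
  interpret M: Module.module k M by (rule M)
  have "f (alt M (\<lambda>K. \<psi> (v # K)) L) = alt N (\<lambda>K. f (\<psi> (v # K))) L" by (rule Cons.IH) (use Cons.prems in auto)
  moreover have "alt M (\<lambda>K. \<psi> (v # K)) L \<in> carrier M" by (rule M.alt_closed) (use Cons.prems in auto)
  ultimately show ?case using mod_hom_minus'[OF M N f] Cons.prems by simp
qed

lemma (in abelian_group) alt_minus:
  assumes "\<And>K. K \<in> dels L \<Longrightarrow> \<psi> K \<in> carrier G" "\<And>K. K \<in> dels L \<Longrightarrow> \<chi> K \<in> carrier G"
  shows "alt G (\<lambda>K. \<psi> K \<ominus> \<chi> K) L = alt G \<psi> L \<ominus> alt G \<chi> L"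
  using assms
proof (induction L arbitrary: \<psi> \<chi>)
  case (Cons v L)
  have "alt G (\<lambda>K. \<psi> (v # K) \<ominus> \<chi> (v # K)) L = alt G (\<lambda>K. \<psi> (v # K)) L \<ominus> alt G (\<lambda>K. \<chi> (v # K)) L"
    by (rule Cons.IH) (use Cons.prems in auto)
  moreover have "alt G (\<lambda>K. \<psi> (v # K)) L \<in> carrier G" "alt G (\<lambda>K. \<chi> (v # K)) L \<in> carrier G"
    by (rule alt_closed; use Cons.prems in auto)+
  moreover have "\<psi> L \<in> carrier G" "\<chi> L \<in> carrier G" using Cons.prems by auto
  ultimately show ?case by (simp add: a_minus_def minus_add a_ac)
next
  case Nil
  then show ?case by (simp add: a_minus_def a_inv_zero)
qed

lemma (in abelian_group) alt_zero: "alt G (\<lambda>_. \<zero>) L = \<zero>"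
  by (induction L) (auto simp: a_minus_def)

text \<open>The identity \<open>\<partial>\<partial> = 0\<close>: writing \<open>\<partial>(v L) = L - v \<partial>L\<close>, one has
  \<open>\<partial>\<partial>(v L) = \<partial>L - \<partial>L + v \<partial>\<partial>L\<close>.\<close>

lemma (in abelian_group) alt_alt:
  assumes "\<And>K J. K \<in> dels L \<Longrightarrow> J \<in> dels K \<Longrightarrow> \<psi> J \<in> carrier G"
  shows "alt G (alt G \<psi>) L = \<zero>"
  using assms
proof (induction L arbitrary: \<psi>)
  case (Cons v L)
  let ?\<chi> = "\<lambda>K. alt G (\<lambda>J. \<psi> (v # J)) K"
  have c1: "\<psi> K \<in> carrier G" if "K \<in> dels L" for K using Cons.prems[of "v # K" K] that by auto
  have c3: "alt G \<psi> L \<in> carrier G" by (rule alt_closed) (rule c1)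
  have c2: "?\<chi> K \<in> carrier G" if "K \<in> dels L" for K
  proof (rule alt_closed)
    fix J assume "J \<in> dels K"
    then show "\<psi> (v # J) \<in> carrier G" using Cons.prems[of "v # K" "v # J"] that by auto
  qed
  have "alt G (\<lambda>K. alt G \<psi> (v # K)) L = alt G (\<lambda>K. \<psi> K \<ominus> ?\<chi> K) L" by simp
  also have "\<dots> = alt G \<psi> L \<ominus> alt G ?\<chi> L" by (rule alt_minus[OF c1 c2])
  also have "alt G ?\<chi> L = \<zero>"
  proof (rule Cons.IH)
    fix K J assume "K \<in> dels L" "J \<in> dels K"
    then show "\<psi> (v # J) \<in> carrier G" using Cons.prems[of "v # K" "v # J"] by auto
  qed
  finally have "alt G (\<lambda>K. alt G \<psi> (v # K)) L = alt G \<psi> L"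
    using c3 by (simp add: a_minus_def a_inv_zero)
  then show ?case using c3 by (simp add: a_minus_def r_neg)
qed simp

section \<open>Complexes of functions on lists\<close>

text \<open>The degree is the length of the list, one more than the dimension of the simplex; the term in
  degree \<open>0\<close> is that of the empty list and serves as the target of the augmentation.\<close>

definition Tm :: "'a list set \<Rightarrow> ('a list \<Rightarrow> ('k, 'v) module) \<Rightarrow> nat \<Rightarrow> ('k, 'a list \<Rightarrow> 'v) module"
  where "Tm A G p = dsum_mod {L \<in> A. length L = p} G"

abbreviation Tin :: "'a list set \<Rightarrow> ('a list \<Rightarrow> ('k, 'v) module) \<Rightarrow> nat \<Rightarrow> 'a list \<Rightarrow> 'v \<Rightarrow> 'a list \<Rightarrow> 'v"
  where "Tin A G p \<equiv> dsum_in {L \<in> A. length L = p} G"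

definition bd :: "'a list set \<Rightarrow> ('a list \<Rightarrow> ('k, 'v) module) \<Rightarrow> ('a list \<Rightarrow> 'a list \<Rightarrow> 'v \<Rightarrow> 'v) \<Rightarrow>
   nat \<Rightarrow> ('a list \<Rightarrow> 'v) \<Rightarrow> 'a list \<Rightarrow> 'v"
  where "bd A G act p = dsum_lift {L \<in> A. length L = Suc p} G (Tm A G p)
     (\<lambda>L x. alt (Tm A G p) (\<lambda>K. Tin A G p K (act L K x)) L)"

text \<open>In degree 0 the condition is void: every element is a cycle, so \<open>Tex\<close> at 0
  says that the augmentation is onto.\<close>

definition Tcyc :: "'a list set \<Rightarrow> ('a list \<Rightarrow> ('k, 'v) module) \<Rightarrow> ('a list \<Rightarrow> 'a list \<Rightarrow> 'v \<Rightarrow> 'v) \<Rightarrow>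
   nat \<Rightarrow> ('a list \<Rightarrow> 'v) set"
  where "Tcyc A G act p = {z \<in> carrier (Tm A G p). \<forall>q. p = Suc q \<longrightarrow> bd A G act q z = \<zero>\<^bsub>Tm A G q\<^esub>}"

definition Tex :: "'a list set \<Rightarrow> ('a list \<Rightarrow> ('k, 'v) module) \<Rightarrow> ('a list \<Rightarrow> 'a list \<Rightarrow> 'v \<Rightarrow> 'v) \<Rightarrow> nat \<Rightarrow> bool"
  where "Tex A G act p \<longleftrightarrow> Tcyc A G act p \<subseteq> bd A G act p ` carrier (Tm A G (Suc p))"

lemma TexD: "Tex A G act p \<Longrightarrow> z \<in> Tcyc A G act p \<Longrightarrow> \<exists>y. y \<in> carrier (Tm A G (Suc p)) \<and> bd A G act p y = z"
  unfolding Tex_def by (drule subsetD, assumption) auto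

definition Tmap :: "'a list set \<Rightarrow> nat \<Rightarrow> ('a list \<Rightarrow> 'v \<Rightarrow> 'w) \<Rightarrow> ('a list \<Rightarrow> 'v) \<Rightarrow> 'a list \<Rightarrow> 'w"
  where "Tmap A p f x = (\<lambda>L\<in>{L \<in> A. length L = p}. f L (x L))"

text \<open>A coefficient system on lists that are closed under deletion. \<open>act_hom2\<close> is
  stated separately because a list with two entries deleted is never among the \<open>dels\<close>
  of \<open>L\<close>, yet \<open>act L J\<close> occurs in the square of the boundary.\<close>

locale lsys =
  fixes k :: "('k, 'x) ring_scheme" and A :: "'a list set" and G :: "'a list \<Rightarrow> ('k, 'v) module" and act
  assumes k: "cring k" and closed: "L \<in> A \<Longrightarrow> K \<in> dels L \<Longrightarrow> K \<in> A"
    and modG: "L \<in> A \<Longrightarrow> Module.module k (G L)"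
    and act_hom: "L \<in> A \<Longrightarrow> K \<in> dels L \<Longrightarrow> act L K \<in> mod_hom k (G L) (G K)"
    and act_act: "L \<in> A \<Longrightarrow> K \<in> dels L \<Longrightarrow> J \<in> dels K \<Longrightarrow> x \<in> carrier (G L) \<Longrightarrow>
      act K J (act L K x) = act L J x"
    and act_hom2: "L \<in> A \<Longrightarrow> K \<in> dels L \<Longrightarrow> J \<in> dels K \<Longrightarrow> act L J \<in> mod_hom k (G L) (G J)"
begin

abbreviation "A' p \<equiv> {L \<in> A. length L = p}"

lemma modT: "Module.module k (Tm A G p)"
  unfolding Tm_def by (rule dsum_module[OF k]) (simp add: modG)

lemma Tin_hom: "L \<in> A \<Longrightarrow> length L = p \<Longrightarrow> Tin A G p L \<in> mod_hom k (G L) (Tm A G p)"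
  unfolding Tm_def by (rule dsum_in_hom[OF k]) (auto simp: modG)

lemma Tin_closed: "L \<in> A \<Longrightarrow> length L = p \<Longrightarrow> x \<in> carrier (G L) \<Longrightarrow> Tin A G p L x \<in> carrier (Tm A G p)"
  by (rule mod_homD(1)[OF Tin_hom])

lemma mod_hom_alt_family:
  assumes N: "Module.module k N" and M: "Module.module k M"
    and "\<And>K. K \<in> dels L \<Longrightarrow> \<psi> K \<in> mod_hom k M N"
  shows "(\<lambda>x. alt N (\<lambda>K. \<psi> K x) L) \<in> mod_hom k M N"
  using assms(3)
proof (induction L arbitrary: \<psi>)
  case Nil
  then show ?case using mod_hom_const_zero[OF M N] by simp
next
  case (Cons v L)
  have "(\<lambda>x. alt N (\<lambda>K. \<psi> (v # K) x) L) \<in> mod_hom k M N" by (rule Cons.IH) (use Cons.prems in auto)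
  moreover have "\<psi> L \<in> mod_hom k M N" using Cons.prems by simp
  ultimately show ?case using mod_hom_diff[OF M N] by simp
qed

lemma bd_ph:
  assumes "L \<in> A' (Suc p)"
  shows "(\<lambda>x. alt (Tm A G p) (\<lambda>K. Tin A G p K (act L K x)) L) \<in> mod_hom k (G L) (Tm A G p)"
  by (rule mod_hom_alt_family[OF modT modG])
    (use assms closed dels_length in \<open>auto intro!: mod_hom_comp[OF act_hom Tin_hom] dest: dels_length\<close>)

lemma bd_hom: "bd A G act p \<in> mod_hom k (Tm A G (Suc p)) (Tm A G p)"
  unfolding bd_def Tm_def[of A G "Suc p"]
  by (rule dsum_lift_hom[OF k modG modT bd_ph]) auto

lemma bd_in:
  assumes "L \<in> A" "length L = Suc p" "x \<in> carrier (G L)"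
  shows "bd A G act p (Tin A G (Suc p) L x) = alt (Tm A G p) (\<lambda>K. Tin A G p K (act L K x)) L"
  unfolding bd_def
  by (rule dsum_lift_in[OF k modG modT bd_ph]) (use assms in auto)

lemma T_ext:
  assumes "Module.module k N" "f \<in> mod_hom k (Tm A G p) N" "g \<in> mod_hom k (Tm A G p) N"
    and "\<And>L x. L \<in> A \<Longrightarrow> length L = p \<Longrightarrow> x \<in> carrier (G L) \<Longrightarrow> f (Tin A G p L x) = g (Tin A G p L x)"
    and "z \<in> carrier (Tm A G p)"
  shows "f z = g z"
  by (rule dsum_hom_ext[OF k modG assms(1), of "A' p"]) (use assms in \<open>auto simp: Tm_def\<close>)

text \<open>By \<open>act_act\<close> the coefficient that reaches a doubly deleted list
  \<open>J\<close> does not depend on the list in between, so on a generator the double sum is the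
  one that vanishes by \<open>alt_alt\<close>.\<close>

lemma bd_bd: assumes "z \<in> carrier (Tm A G (Suc (Suc p)))" shows "bd A G act p (bd A G act (Suc p) z) = \<zero>\<^bsub>Tm A G p\<^esub>"
proof -
  interpret T: Module.module k "Tm A G p" by (rule modT)
  show ?thesis
  proof (rule T_ext[OF modT mod_hom_comp[OF bd_hom bd_hom] mod_hom_const_zero[OF modT modT] _ assms])
    fix L x assume L: "L \<in> A" "length L = Suc (Suc p)" and x: "x \<in> carrier (G L)"
    have 1: "act L K x \<in> carrier (G K)" "K \<in> A" "length K = Suc p" if "K \<in> dels L" for K
      using mod_homD(1)[OF act_hom[OF L(1) that] x] closed[OF L(1) that] dels_length[OF that] L(2) by auto
    have "bd A G act p (bd A G act (Suc p) (Tin A G (Suc (Suc p)) L x))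
        = alt (Tm A G p) (\<lambda>K. bd A G act p (Tin A G (Suc p) K (act L K x))) L"
      unfolding bd_in[OF L x] by (rule mod_hom_alt[OF modT modT bd_hom]) (rule Tin_closed; rule 1)
    also have "\<dots> = alt (Tm A G p) (\<lambda>K. alt (Tm A G p) (\<lambda>J. Tin A G p J (act L J x)) K) L"
    proof (rule alt_cong)
      fix K assume K: "K \<in> dels L"
      have "bd A G act p (Tin A G (Suc p) K (act L K x)) = alt (Tm A G p) (\<lambda>J. Tin A G p J (act K J (act L K x))) K"
        by (rule bd_in) (use 1[OF K] in auto)
      also have "\<dots> = alt (Tm A G p) (\<lambda>J. Tin A G p J (act L J x)) K"
        by (rule alt_cong) (simp add: act_act[OF L(1) K _ x])
      finally show "bd A G act p (Tin A G (Suc p) K (act L K x)) = alt (Tm A G p) (\<lambda>J. Tin A G p J (act L J x)) K" .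
    qed
    also have "\<dots> = \<zero>\<^bsub>Tm A G p\<^esub>"
    proof (rule T.alt_alt)
      fix K J assume KJ: "K \<in> dels L" "J \<in> dels K"
      have "length J = p" "J \<in> A" using 1[OF KJ(1)] dels_length[OF KJ(2)] closed[OF _ KJ(2)] by auto
      then show "Tin A G p J (act L J x) \<in> carrier (Tm A G p)"
        by (intro Tin_closed mod_homD(1)[OF act_hom2[OF L(1) KJ]] x)
    qed
    finally show "bd A G act p (bd A G act (Suc p) (Tin A G (Suc (Suc p)) L x)) = \<zero>\<^bsub>Tm A G p\<^esub>" .
  qed
qed

end

section \<open>Maps and short exact sequences of coefficient systems\<close>

lemma Tm_carrier: "x \<in> carrier (Tm A G p) \<longleftrightarrow> x \<in> (\<Pi>\<^sub>E L\<in>{L \<in> A. length L = p}. carrier (G L)) \<and>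
    finite {L \<in> A. length L = p \<and> x L \<noteq> \<zero>\<^bsub>G L\<^esub>}"
  by (simp add: Tm_def dsum_sel)

locale lsys_map = G: lsys k A G act + G': lsys k A G' act' for k A G act G' act' +
  fixes f
  assumes f_hom: "L \<in> A \<Longrightarrow> f L \<in> mod_hom k (G L) (G' L)"
    and f_act: "L \<in> A \<Longrightarrow> K \<in> dels L \<Longrightarrow> x \<in> carrier (G L) \<Longrightarrow> f K (act L K x) = act' L K (f L x)"
begin

lemma f_zero: "L \<in> A \<Longrightarrow> f L \<zero>\<^bsub>G L\<^esub> = \<zero>\<^bsub>G' L\<^esub>"
  by (rule mod_hom_zero[OF G.modG G'.modG f_hom])

lemma Tmap_hom: "Tmap A p f \<in> mod_hom k (Tm A G p) (Tm A G' p)"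
proof (rule mod_homI)
  fix x assume x: "x \<in> carrier (Tm A G p)"
  have "finite {L \<in> A. length L = p \<and> f L (x L) \<noteq> \<zero>\<^bsub>G' L\<^esub>}"
    by (rule finite_subset[of _ "{L \<in> A. length L = p \<and> x L \<noteq> \<zero>\<^bsub>G L\<^esub>}"])
       (use x f_zero in \<open>auto simp: Tm_carrier\<close>)
  then show "Tmap A p f x \<in> carrier (Tm A G' p)"
    using x mod_homD(1)[OF f_hom] by (auto simp: Tm_carrier Tmap_def PiE_iff cong: conj_cong)
qed (auto simp: Tmap_def Tm_def dsum_sel mod_homD[OF f_hom] PiE_iff intro!: restrict_ext)

lemma Tmap_in: "L \<in> A \<Longrightarrow> length L = p \<Longrightarrow> Tmap A p f (Tin A G p L x) = Tin A G' p L (f L x)"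
  by (auto simp: Tmap_def dsum_in_def f_zero intro!: restrict_ext)

lemma Tmap_bd:
  assumes z: "z \<in> carrier (Tm A G (Suc p))"
  shows "Tmap A p f (bd A G act p z) = bd A G' act' p (Tmap A (Suc p) f z)"
proof (rule G.T_ext[OF G'.modT mod_hom_comp[OF G.bd_hom Tmap_hom] mod_hom_comp[OF Tmap_hom G'.bd_hom] _ z])
  fix L x assume L: "L \<in> A" "length L = Suc p" and x: "x \<in> carrier (G L)"
  have 1: "act L K x \<in> carrier (G K)" "K \<in> A" "length K = p" if "K \<in> dels L" for K
    using mod_homD(1)[OF G.act_hom[OF L(1) that] x] G.closed[OF L(1) that] dels_length[OF that] L(2) by auto
  have "Tmap A p f (bd A G act p (Tin A G (Suc p) L x)) = alt (Tm A G' p) (\<lambda>K. Tmap A p f (Tin A G p K (act L K x))) L"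
    unfolding G.bd_in[OF L x] by (rule mod_hom_alt[OF G.modT G'.modT Tmap_hom]) (rule G.Tin_closed; rule 1)
  also have "\<dots> = alt (Tm A G' p) (\<lambda>K. Tin A G' p K (act' L K (f L x))) L"
    by (rule alt_cong) (simp add: Tmap_in 1 f_act[OF L(1) _ x])
  also have "\<dots> = bd A G' act' p (Tmap A (Suc p) f (Tin A G (Suc p) L x))"
    using Tmap_in[OF L] G'.bd_in[OF L mod_homD(1)[OF f_hom[OF L(1)] x]] by simp
  finally show "Tmap A p f (bd A G act p (Tin A G (Suc p) L x)) = bd A G' act' p (Tmap A (Suc p) f (Tin A G (Suc p) L x))" .
qed

lemma Tmap_surj:
  assumes s: "\<And>L. L \<in> A \<Longrightarrow> f L ` carrier (G L) = carrier (G' L)" and y: "y \<in> carrier (Tm A G' p)"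
  shows "\<exists>x\<in>carrier (Tm A G p). Tmap A p f x = y"
proof -
  \<comment> \<open>Zero is lifted to zero, so that the preimage again has finite support.\<close>
  define x where "x = (\<lambda>L\<in>{L \<in> A. length L = p}. if y L = \<zero>\<^bsub>G' L\<^esub> then \<zero>\<^bsub>G L\<^esub> else inv_into (carrier (G L)) (f L) (y L))"
  have 1: "x L \<in> carrier (G L)" "f L (x L) = y L" if L: "L \<in> A" "length L = p" for L
  proof -
    have "y L \<in> f L ` carrier (G L)" using y L s by (auto simp: Tm_carrier PiE_iff)
    then show "x L \<in> carrier (G L)" "f L (x L) = y L"
      using L mod_zero[OF G.modG] f_zero by (auto simp: x_def inv_into_into f_inv_into_f)
  qed
  have "finite {L \<in> A. length L = p \<and> x L \<noteq> \<zero>\<^bsub>G L\<^esub>}"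
    by (rule finite_subset[of _ "{L \<in> A. length L = p \<and> y L \<noteq> \<zero>\<^bsub>G' L\<^esub>}"])
      (use y in \<open>auto simp: Tm_carrier x_def\<close>)
  then have "x \<in> carrier (Tm A G p)" using 1 by (auto simp: Tm_carrier PiE_iff x_def)
  moreover have "Tmap A p f x = y" using 1 y by (auto simp: Tmap_def Tm_carrier fun_eq_iff PiE_iff extensional_def)
  ultimately show ?thesis by blast
qed

end

locale lsys_ses = i: lsys_map k A G1 act1 G act i + f: lsys_map k A G act G2 act2 f
  for k A G1 act1 G act G2 act2 i f +
  assumes inj: "L \<in> A \<Longrightarrow> inj_on (i L) (carrier (G1 L))"
    and mid: "L \<in> A \<Longrightarrow> i L ` carrier (G1 L) = {x \<in> carrier (G L). f L x = \<zero>\<^bsub>G2 L\<^esub>}"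
    and surj: "L \<in> A \<Longrightarrow> f L ` carrier (G L) = carrier (G2 L)"
begin

lemma Tmap_inj: assumes "x \<in> carrier (Tm A G1 p)" "y \<in> carrier (Tm A G1 p)" "Tmap A p i x = Tmap A p i y" shows "x = y"
proof (rule ext)
  fix L show "x L = y L"
  proof (cases "L \<in> A \<and> length L = p")
    case True
    then have "i L (x L) = i L (y L)" using fun_cong[OF assms(3), of L] by (simp add: Tmap_def)
    then show ?thesis using True assms(1,2) inj_onD[OF inj] by (auto simp: Tm_carrier PiE_iff)
  next
    case False
    then show ?thesis using assms(1,2) by (auto simp: Tm_carrier PiE_iff extensional_def)
  qed
qed

lemma Tmap_exact:
  assumes y: "y \<in> carrier (Tm A G p)" and z: "Tmap A p f y = \<zero>\<^bsub>Tm A G2 p\<^esub>"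
  shows "\<exists>x\<in>carrier (Tm A G1 p). Tmap A p i x = y"
proof -
  define x where "x = (\<lambda>L\<in>{L \<in> A. length L = p}. inv_into (carrier (G1 L)) (i L) (y L))"
  have 1: "x L \<in> carrier (G1 L)" "i L (x L) = y L" if L: "L \<in> A" "length L = p" for L
  proof -
    have "f L (y L) = \<zero>\<^bsub>G2 L\<^esub>" using fun_cong[OF z, of L] L by (simp add: Tmap_def Tm_def dsum_sel)
    then have "y L \<in> i L ` carrier (G1 L)" using y L mid[OF L(1)] by (auto simp: Tm_carrier PiE_iff)
    then show "x L \<in> carrier (G1 L)" "i L (x L) = y L"
      using L by (auto simp: x_def inv_into_into f_inv_into_f)
  qed
  \<comment> \<open>Injectivity sends zero back to zero, so the support does not grow.\<close>
  have "x L = \<zero>\<^bsub>G1 L\<^esub>" if L: "L \<in> A" "length L = p" "y L = \<zero>\<^bsub>G L\<^esub>" for L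
    using inj_onD[OF inj[OF L(1)], of "x L" "\<zero>\<^bsub>G1 L\<^esub>"] 1[OF L(1,2)] L(3) i.f_zero[OF L(1)] mod_zero[OF i.G.modG[OF L(1)]] by simp
  then have "{L \<in> A. length L = p \<and> x L \<noteq> \<zero>\<^bsub>G1 L\<^esub>} \<subseteq> {L \<in> A. length L = p \<and> y L \<noteq> \<zero>\<^bsub>G L\<^esub>}" by blast
  moreover have "finite {L \<in> A. length L = p \<and> y L \<noteq> \<zero>\<^bsub>G L\<^esub>}" using y by (simp add: Tm_carrier)
  ultimately have "finite {L \<in> A. length L = p \<and> x L \<noteq> \<zero>\<^bsub>G1 L\<^esub>}" by (rule finite_subset)
  then have "x \<in> carrier (Tm A G1 p)" using 1 by (auto simp: Tm_carrier PiE_iff x_def)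
  moreover have "Tmap A p i x = y" using 1 y by (auto simp: Tmap_def Tm_carrier fun_eq_iff PiE_iff extensional_def)
  ultimately show ?thesis by blast
qed

lemma Tmap_comp_zero:
  assumes "x \<in> carrier (Tm A G1 p)" shows "Tmap A p f (Tmap A p i x) = \<zero>\<^bsub>Tm A G2 p\<^esub>"
proof -
  have "f L (i L (x L)) = \<zero>\<^bsub>G2 L\<^esub>" if "L \<in> A" "length L = p" for L
    using assms that mid[OF that(1)] by (force simp: Tm_carrier PiE_iff)
  then show ?thesis by (auto simp: Tmap_def Tm_def dsum_sel intro!: restrict_ext)
qed

text \<open>A piece of the long exact homology sequence: a cycle of \<open>G2\<close> lifts to some
  \<open>y\<close>, and the boundary of \<open>y\<close> comes from a cycle of \<open>G1\<close> and
  so bounds there. Correcting \<open>y\<close> by the bounding element gives a cycle of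
  \<open>G\<close> over the same cycle of \<open>G2\<close>.\<close>

lemma exact_quotient:
  assumes ex: "Tex A G act (Suc p)" and ex1: "Tex A G1 act1 p"
  shows "Tex A G2 act2 (Suc p)"
  unfolding Tex_def
proof
  interpret T: Module.module k "Tm A G (Suc p)" by (rule i.G'.modT)
  interpret T0: Module.module k "Tm A G p" by (rule i.G'.modT)
  interpret T2: Module.module k "Tm A G2 (Suc p)" by (rule f.G'.modT)
  fix z assume "z \<in> Tcyc A G2 act2 (Suc p)"
  then have z: "z \<in> carrier (Tm A G2 (Suc p))" "bd A G2 act2 p z = \<zero>\<^bsub>Tm A G2 p\<^esub>" by (auto simp: Tcyc_def)
  obtain y where y: "y \<in> carrier (Tm A G (Suc p))" "Tmap A (Suc p) f y = z" using f.Tmap_surj[OF surj z(1)] by blast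
  have dy: "bd A G act p y \<in> carrier (Tm A G p)" using mod_homD(1)[OF i.G'.bd_hom y(1)] .
  obtain x where x: "x \<in> carrier (Tm A G1 p)" "Tmap A p i x = bd A G act p y"
    using Tmap_exact[OF dy] f.Tmap_bd[OF y(1)] y(2) z(2) by auto
  have "bd A G1 act1 q x = \<zero>\<^bsub>Tm A G1 q\<^esub>" if p: "p = Suc q" for q
  proof (rule Tmap_inj)
    show "bd A G1 act1 q x \<in> carrier (Tm A G1 q)" using mod_homD(1)[OF i.G.bd_hom] x(1) p by simp
    show "\<zero>\<^bsub>Tm A G1 q\<^esub> \<in> carrier (Tm A G1 q)" by (rule mod_zero[OF i.G.modT])
    have "Tmap A q i (bd A G1 act1 q x) = bd A G act q (bd A G act (Suc q) y)"
      using i.Tmap_bd[of x q] x p by simp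
    also have "\<dots> = \<zero>\<^bsub>Tm A G q\<^esub>" by (rule i.G'.bd_bd) (use y p in simp)
    finally show "Tmap A q i (bd A G1 act1 q x) = Tmap A q i \<zero>\<^bsub>Tm A G1 q\<^esub>"
      using mod_hom_zero[OF i.G.modT i.G'.modT i.Tmap_hom] by simp
  qed
  then have "x \<in> Tcyc A G1 act1 p" using x(1) by (simp add: Tcyc_def)
  then obtain w where w: "w \<in> carrier (Tm A G1 (Suc p))" "bd A G1 act1 p w = x" using TexD[OF ex1] by metis
  let ?w = "Tmap A (Suc p) i w"
  have w': "?w \<in> carrier (Tm A G (Suc p))" by (rule mod_homD(1)[OF i.Tmap_hom w(1)])
  have dw: "bd A G act p ?w = bd A G act p y" using i.Tmap_bd[OF w(1)] w(2) x(2) by simp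
  let ?u = "y \<ominus>\<^bsub>Tm A G (Suc p)\<^esub> ?w"
  have "bd A G act p ?u = bd A G act p y \<ominus>\<^bsub>Tm A G p\<^esub> bd A G act p ?w"
    by (rule mod_hom_minus'[OF i.G'.modT i.G'.modT i.G'.bd_hom y(1) w'])
  then have "bd A G act p ?u = \<zero>\<^bsub>Tm A G p\<^esub>" using dw dy by (simp add: a_minus_def T0.M.r_neg)
  then have "?u \<in> Tcyc A G act (Suc p)" using y(1) w' by (simp add: Tcyc_def)
  then obtain v where v: "v \<in> carrier (Tm A G (Suc (Suc p)))" "bd A G act (Suc p) v = ?u" using TexD[OF ex] by metis
  have "bd A G2 act2 (Suc p) (Tmap A (Suc (Suc p)) f v) = Tmap A (Suc p) f ?u"
    using f.Tmap_bd[OF v(1)] v(2) by simp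
  also have "\<dots> = z \<ominus>\<^bsub>Tm A G2 (Suc p)\<^esub> \<zero>\<^bsub>Tm A G2 (Suc p)\<^esub>"
    using mod_hom_minus'[OF i.G'.modT f.G'.modT f.Tmap_hom y(1) w'] Tmap_comp_zero[OF w(1)] y(2) by simp
  also have "\<dots> = z" using z(1) by (simp add: a_minus_def)
  finally show "z \<in> bd A G2 act2 (Suc p) ` carrier (Tm A G2 (Suc (Suc p)))"
    using mod_homD(1)[OF f.Tmap_hom v(1)] by (metis imageI)
qed

text \<open>A cycle of \<open>G1\<close> bounds some \<open>y\<close> in \<open>G\<close>, whose
  image in \<open>G2\<close> is a cycle and so a boundary; subtracting a lift moves \<open>y\<close>
  into \<open>G1\<close>. Only the cycles coming from \<open>G1\<close> are asked to bound in
  \<open>G\<close>, because the Koszul-type complex of a free functor can fail to be exact in degree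
  0.\<close>

lemma exact_sub:
  assumes ex: "Tmap A p i ` Tcyc A G1 act1 p \<subseteq> bd A G act p ` carrier (Tm A G (Suc p))" and ex2: "Tex A G2 act2 (Suc p)"
  shows "Tex A G1 act1 p"
  unfolding Tex_def
proof
  interpret T: Module.module k "Tm A G p" by (rule i.G'.modT)
  interpret T1: Module.module k "Tm A G (Suc p)" by (rule i.G'.modT)
  interpret T2: Module.module k "Tm A G2 (Suc p)" by (rule f.G'.modT)
  fix z assume z': "z \<in> Tcyc A G1 act1 p"
  then have z: "z \<in> carrier (Tm A G1 p)" by (auto simp: Tcyc_def)
  obtain y where y: "y \<in> carrier (Tm A G (Suc p))" "bd A G act p y = Tmap A p i z" using ex z' by (auto simp: image_subset_iff image_iff)
  have "bd A G2 act2 p (Tmap A (Suc p) f y) = \<zero>\<^bsub>Tm A G2 p\<^esub>"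
    using f.Tmap_bd[OF y(1)] y(2) Tmap_comp_zero[OF z] by simp
  then have "Tmap A (Suc p) f y \<in> Tcyc A G2 act2 (Suc p)" using mod_homD(1)[OF f.Tmap_hom y(1)] by (simp add: Tcyc_def)
  then obtain w' where w': "w' \<in> carrier (Tm A G2 (Suc (Suc p)))" "bd A G2 act2 (Suc p) w' = Tmap A (Suc p) f y"
    using TexD[OF ex2] by metis
  obtain w where w: "w \<in> carrier (Tm A G (Suc (Suc p)))" "Tmap A (Suc (Suc p)) f w = w'" using f.Tmap_surj[OF surj w'(1)] by blast
  let ?dw = "bd A G act (Suc p) w"
  have dw: "?dw \<in> carrier (Tm A G (Suc p))" by (rule mod_homD(1)[OF i.G'.bd_hom w(1)])
  let ?u = "y \<ominus>\<^bsub>Tm A G (Suc p)\<^esub> ?dw"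
  have u: "?u \<in> carrier (Tm A G (Suc p))" using y dw by simp
  have "Tmap A (Suc p) f ?u = Tmap A (Suc p) f y \<ominus>\<^bsub>Tm A G2 (Suc p)\<^esub> Tmap A (Suc p) f ?dw"
    by (rule mod_hom_minus'[OF i.G'.modT f.G'.modT f.Tmap_hom y(1) dw])
  also have "Tmap A (Suc p) f ?dw = Tmap A (Suc p) f y" using f.Tmap_bd[OF w(1)] w(2) w'(2) by simp
  finally have "Tmap A (Suc p) f ?u = \<zero>\<^bsub>Tm A G2 (Suc p)\<^esub>"
    using mod_homD(1)[OF f.Tmap_hom y(1)] by (simp add: a_minus_def T2.M.r_neg)
  then obtain v where v: "v \<in> carrier (Tm A G1 (Suc p))" "Tmap A (Suc p) i v = ?u" using Tmap_exact[OF u] by blast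
  have "Tmap A p i (bd A G1 act1 p v) = bd A G act p ?u" using i.Tmap_bd[OF v(1)] v(2) by simp
  also have "\<dots> = Tmap A p i z \<ominus>\<^bsub>Tm A G p\<^esub> \<zero>\<^bsub>Tm A G p\<^esub>"
    using mod_hom_minus'[OF i.G'.modT i.G'.modT i.G'.bd_hom y(1) dw] i.G'.bd_bd[OF w(1)] y(2) by simp
  also have "\<dots> = Tmap A p i z" using mod_homD(1)[OF i.Tmap_hom z] by (simp add: a_minus_def)
  finally have "bd A G1 act1 p v = z" using Tmap_inj[OF mod_homD(1)[OF i.G.bd_hom v(1)] z] by simp
  then show "z \<in> bd A G1 act1 p ` carrier (Tm A G1 (Suc p))" using v(1) by blast
qed

end

section \<open>Contractions\<close>

text \<open>A complex with bases indexed by lists (together with a strand index \<open>s\<close>), in which the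
  boundary is the alternating sum of deletions, is contracted by prepending a vertex \<open>v s\<close>. In the
  normalized case the prepended list is declared to be zero if it is not admissible.\<close>

lemma contract:
  fixes C :: "nat \<Rightarrow> ('k, 'v) module"
  assumes k: "cring k"
    and B: "\<And>q. lbasis k (C q) {(L, s). (L, s) \<in> I \<and> length L = q} \<beta>"
    and d_hom: "\<And>q. d q \<in> mod_hom k (C (Suc q)) (C q)"
    and dB: "\<And>L s q. (L, s) \<in> I \<Longrightarrow> length L = Suc q \<Longrightarrow> d q (\<beta> (L, s)) = alt (C q) (\<lambda>K. \<beta> (K, s)) L"
    and cl: "\<And>L K s. (L, s) \<in> I \<Longrightarrow> K \<in> dels L \<Longrightarrow> (K, s) \<in> I"
    and v: "\<And>L s. (L, s) \<in> I \<Longrightarrow> length L = p \<Longrightarrow>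
       (v s # L, s) \<in> I \<or> (\<exists>L'. L = v s # L') \<and> (\<forall>L''. (v s # v s # L'', s) \<notin> I)"
    and z: "z \<in> carrier (C p)" "\<And>q. p = Suc q \<Longrightarrow> d q z = \<zero>\<^bsub>C q\<^esub>"
  shows "z \<in> d p ` carrier (C (Suc p))"
proof -
  define h where "h q x = (if (v (snd x) # fst x, snd x) \<in> I then \<beta> (v (snd x) # fst x, snd x) else \<zero>\<^bsub>C (Suc q)\<^esub>)" for q x
  note M = lbasis_module[OF B]
  have bc: "\<beta> (L, s) \<in> carrier (C q)" if "(L, s) \<in> I" "length L = q" for L s q
    by (rule lbasis_closed[OF B]) (use that in auto)
  have "\<exists>f\<in>mod_hom k (C q) (C (Suc q)). \<forall>i\<in>{(L, s). (L, s) \<in> I \<and> length L = q}. f (\<beta> i) = h q i" for q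
    by (rule lbasis_lift[OF k B M]) (auto simp: h_def intro!: bc mod_zero[OF M])
  then have "\<forall>q. \<exists>f. f \<in> mod_hom k (C q) (C (Suc q)) \<and> (\<forall>i\<in>{(L, s). (L, s) \<in> I \<and> length L = q}. f (\<beta> i) = h q i)" by blast
  then obtain H where "\<forall>q. H q \<in> mod_hom k (C q) (C (Suc q)) \<and> (\<forall>i\<in>{(L, s). (L, s) \<in> I \<and> length L = q}. H q (\<beta> i) = h q i)"
    by (rule choice[THEN exE])
  then have H: "\<And>q. H q \<in> mod_hom k (C q) (C (Suc q))"
    "\<And>q L s. (L, s) \<in> I \<Longrightarrow> length L = q \<Longrightarrow> H q (\<beta> (L, s)) = h q (L, s)" by auto
  \<comment> \<open>The homotopy identity is \<open>g = id\<close>, checked on the basis; a cycle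
    \<open>z\<close> is then the boundary of \<open>H p z\<close>. In degree 0 the term that uses
    the boundary of \<open>z\<close> is missing.\<close>
  define g where "g z = d p (H p z) \<oplus>\<^bsub>C p\<^esub> (case p of 0 \<Rightarrow> \<zero>\<^bsub>C p\<^esub> | Suc q \<Rightarrow> H q (d q z))" for z
  interpret Cp: Module.module k "C p" by (rule M)
  have gh: "g \<in> mod_hom k (C p) (C p)" unfolding g_def[abs_def]
    by (cases p) (auto intro!: mod_hom_add M mod_hom_comp[OF H(1) d_hom] mod_hom_const_zero mod_hom_comp[OF d_hom H(1)])
  have idh: "(\<lambda>x. x) \<in> mod_hom k (C p) (C p)" by (rule mod_homI) auto
  have "g z = z"
  proof (rule lbasis_ext[OF B M gh idh _ z(1)])
    fix i assume "i \<in> {(L, s). (L, s) \<in> I \<and> length L = p}"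
    then obtain L s where i: "i = (L, s)" "(L, s) \<in> I" "length L = p" by auto
    have b: "\<beta> (L, s) \<in> carrier (C p)" by (rule bc) (use i in auto)
    have hd: "(case p of 0 \<Rightarrow> \<zero>\<^bsub>C p\<^esub> | Suc q \<Rightarrow> H q (d q (\<beta> (L, s)))) = alt (C p) (\<lambda>K. h (length K) (K, s)) L"
    proof (cases p)
      case 0
      then show ?thesis using i by simp
    next
      case (Suc q)
      have "H q (alt (C q) (\<lambda>K. \<beta> (K, s)) L) = alt (C (Suc q)) (\<lambda>K. H q (\<beta> (K, s))) L"
        by (rule mod_hom_alt[OF M M H(1)]) (use i Suc cl dels_length in \<open>auto intro!: bc dest: dels_length\<close>)
      also have "\<dots> = alt (C (Suc q)) (\<lambda>K. h (length K) (K, s)) L"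
        by (rule alt_cong, subst H(2)) (use i Suc cl in \<open>auto dest: dels_length\<close>)
      finally show ?thesis using Suc dB[OF i(2), of q] i by simp
    qed
    show "g (\<beta> i) = \<beta> i"
    proof (cases "(v s # L, s) \<in> I")
      case True
      \<comment> \<open>The boundary of the prepended list is \<open>L\<close> minus the prepended
        boundary of \<open>L\<close>, and the other term of \<open>g\<close> restores what was
        subtracted. The prepended faces are admissible as deletions of an admissible list.\<close>
      let ?t = "alt (C p) (\<lambda>K. \<beta> (v s # K, s)) L"
      have t: "?t \<in> carrier (C p)"
        by (rule Cp.M.alt_closed) (use True i cl[of "v s # L" s] in \<open>auto intro!: bc dest: dels_length\<close>)
      have "d p (H p (\<beta> (L, s))) = \<beta> (L, s) \<ominus>\<^bsub>C p\<^esub> ?t"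
        using True i dB[OF True, of p] by (simp add: H(2) h_def)
      moreover have "alt (C p) (\<lambda>K. h (length K) (K, s)) L = ?t"
        by (rule alt_cong) (use True cl[of "v s # L" s] in \<open>auto simp: h_def\<close>)
      ultimately show ?thesis using hd i b t by (simp add: g_def a_minus_def Cp.M.a_assoc Cp.M.l_neg)
    next
      case False
      \<comment> \<open>Here \<open>L\<close> already starts with the vertex. The homotopy kills
        \<open>L\<close> and all faces that keep this entry; the one face that deletes it is sent
        back to \<open>L\<close>.\<close>
      then obtain L' where L': "L = v s # L'" "\<And>L''. (v s # v s # L'', s) \<notin> I" using v[OF i(2,3)] by blast
      have "d p (H p (\<beta> (L, s))) = \<zero>\<^bsub>C p\<^esub>"
        using False i mod_hom_zero[OF M M d_hom] by (simp add: H(2) h_def)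
      moreover have "alt (C p) (\<lambda>K. h (length (v s # K)) (v s # K, s)) L' = alt (C p) (\<lambda>K. \<zero>\<^bsub>C p\<^esub>) L'"
        by (rule alt_cong) (use L' i in \<open>auto simp: h_def dest: dels_length\<close>)
      moreover have "alt (C p) (\<lambda>K. h (length K) (K, s)) L =
          h (length L') (L', s) \<ominus>\<^bsub>C p\<^esub> alt (C p) (\<lambda>K. h (length (v s # K)) (v s # K, s)) L'"
        unfolding L'(1) by simp
      moreover have "h (length L') (L', s) = \<beta> (L, s)" using L'(1) i(2) by (simp add: h_def)
      ultimately show ?thesis using hd b unfolding g_def i(1) by (simp add: Cp.M.alt_zero a_minus_def Cp.M.a_inv_zero)
    qed
  qed
  moreover have "(case p of 0 \<Rightarrow> \<zero>\<^bsub>C p\<^esub> | Suc q \<Rightarrow> H q (d q z)) = \<zero>\<^bsub>C p\<^esub>"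
    using z(2) mod_hom_zero[OF M M H(1)] by (cases p) auto
  moreover have "H p z \<in> carrier (C (Suc p))" by (rule mod_homD(1)[OF H(1) z(1)])
  ultimately have "z = d p (H p z)" using mod_homD(1)[OF d_hom] by (simp add: g_def)
  then show ?thesis using mod_homD(1)[OF H(1) z(1)] by blast
qed

section \<open>Free functors\<close>

lemma cat_id: "category C \<Longrightarrow> c \<in> Obj C \<Longrightarrow> Id C c \<in> Mor C c c"
  unfolding category_def by meson
lemma cat_comp: "\<lbrakk>category C; b \<in> Obj C; c \<in> Obj C; d \<in> Obj C; u \<in> Mor C b c; v \<in> Mor C c d\<rbrakk> \<Longrightarrow> Comp C v u \<in> Mor C b d"
  unfolding category_def by meson
lemma cat_idl: "\<lbrakk>category C; c \<in> Obj C; d \<in> Obj C; u \<in> Mor C c d\<rbrakk> \<Longrightarrow> Comp C (Id C d) u = u"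
  unfolding category_def by meson
lemma cat_idr: "\<lbrakk>category C; c \<in> Obj C; d \<in> Obj C; u \<in> Mor C c d\<rbrakk> \<Longrightarrow> Comp C u (Id C c) = u"
  unfolding category_def by meson
lemma cat_assoc: "\<lbrakk>category C; a \<in> Obj C; b \<in> Obj C; c \<in> Obj C; d \<in> Obj C; u \<in> Mor C a b; v \<in> Mor C b c; w \<in> Mor C c d\<rbrakk>
   \<Longrightarrow> Comp C w (Comp C v u) = Comp C (Comp C w v) u"
  unfolding category_def by meson

lemma kCmod_module: "is_kCmod k C M \<Longrightarrow> c \<in> Obj C \<Longrightarrow> Module.module k (At M c)"
  by (simp add: is_kCmod_def)
lemma kCmod_act: "is_kCmod k C M \<Longrightarrow> c \<in> Obj C \<Longrightarrow> d \<in> Obj C \<Longrightarrow> u \<in> Mor C c d \<Longrightarrow> Act M c d u \<in> mod_hom k (At M c) (At M d)"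
  by (simp add: is_kCmod_def)
lemma kCmod_id: "is_kCmod k C M \<Longrightarrow> c \<in> Obj C \<Longrightarrow> x \<in> carrier (At M c) \<Longrightarrow> Act M c c (Id C c) x = x"
  by (simp add: is_kCmod_def)
lemma kCmod_comp: "is_kCmod k C M \<Longrightarrow> b \<in> Obj C \<Longrightarrow> c \<in> Obj C \<Longrightarrow> d \<in> Obj C \<Longrightarrow> u \<in> Mor C b c \<Longrightarrow> v \<in> Mor C c d \<Longrightarrow>
   x \<in> carrier (At M b) \<Longrightarrow> Act M b d (Comp C v u) x = Act M c d v (Act M b c u x)"
  unfolding is_kCmod_def by blast

lemma nat_trans_hom: "f \<in> nat_trans k C M N \<Longrightarrow> c \<in> Obj C \<Longrightarrow> f c \<in> mod_hom k (At M c) (At N c)"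
  by (simp add: nat_trans_def)
lemma nat_trans_act: "f \<in> nat_trans k C M N \<Longrightarrow> c \<in> Obj C \<Longrightarrow> d \<in> Obj C \<Longrightarrow> u \<in> Mor C c d \<Longrightarrow>
   x \<in> carrier (At M c) \<Longrightarrow> f d (Act M c d u x) = Act N c d u (f c x)"
  by (simp add: nat_trans_def)

lemma is_kCmodI:
  assumes "\<And>c. c \<in> Obj C \<Longrightarrow> Module.module k (At M c)"
    and "\<And>c d u. c \<in> Obj C \<Longrightarrow> d \<in> Obj C \<Longrightarrow> u \<in> Mor C c d \<Longrightarrow> Act M c d u \<in> mod_hom k (At M c) (At M d)"
    and "\<And>c x. c \<in> Obj C \<Longrightarrow> x \<in> carrier (At M c) \<Longrightarrow> Act M c c (Id C c) x = x"
    and "\<And>b c d u v x. b \<in> Obj C \<Longrightarrow> c \<in> Obj C \<Longrightarrow> d \<in> Obj C \<Longrightarrow> u \<in> Mor C b c \<Longrightarrow> v \<in> Mor C c d \<Longrightarrow>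
      x \<in> carrier (At M b) \<Longrightarrow> Act M b d (Comp C v u) x = Act M c d v (Act M b c u x)"
  shows "is_kCmod k C M"
  using assms by (simp add: is_kCmod_def)

lemma mod_hom_ident: "(\<lambda>x. x) \<in> mod_hom k M M"
  by (rule mod_homI) auto

context
  fixes k :: "('k, 'x) ring_scheme" and C :: "('o, 'm) cat" and c :: 'o and V :: "('k, 'v) module"
  assumes k: "cring k" and C: "category C" and c: "c \<in> Obj C" and V: "Module.module k V"
begin

lemma rep_module: "Module.module k (At (rep_tensor C c V) d)"
  by (simp add: rep_tensor_def dsum_module[OF k V])

lemma rep_act_aux:
  assumes "d \<in> Obj C" "e \<in> Obj C" "u \<in> Mor C d e" "w \<in> Mor C c d"
  shows "dsum_in (Mor C c e) (\<lambda>_. V) (Comp C u w) \<in> mod_hom k V (dsum_mod (Mor C c e) (\<lambda>_. V))"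
  by (rule dsum_in_hom[OF k V]) (use cat_comp[OF C c assms(1,2) assms(4,3)] in auto)

lemma rep_act_hom:
  assumes "d \<in> Obj C" "e \<in> Obj C" "u \<in> Mor C d e"
  shows "Act (rep_tensor C c V) d e u \<in> mod_hom k (At (rep_tensor C c V) d) (At (rep_tensor C c V) e)"
  unfolding rep_tensor_def
  by simp (rule dsum_lift_hom[OF k V dsum_module[OF k V] rep_act_aux[OF assms]])

lemma rep_act_in:
  assumes "d \<in> Obj C" "e \<in> Obj C" "u \<in> Mor C d e" "w \<in> Mor C c d" "x \<in> carrier V"
  shows "Act (rep_tensor C c V) d e u (dsum_in (Mor C c d) (\<lambda>_. V) w x) = dsum_in (Mor C c e) (\<lambda>_. V) (Comp C u w) x"
  unfolding rep_tensor_def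
  by simp (rule dsum_lift_in[OF k V dsum_module[OF k V] rep_act_aux[OF assms(1-3)] assms(4,5)])

lemma rep_ext:
  assumes N: "Module.module k N" and "f \<in> mod_hom k (At (rep_tensor C c V) d) N" "g \<in> mod_hom k (At (rep_tensor C c V) d) N"
    and "\<And>w x. w \<in> Mor C c d \<Longrightarrow> x \<in> carrier V \<Longrightarrow>
      f (dsum_in (Mor C c d) (\<lambda>_. V) w x) = g (dsum_in (Mor C c d) (\<lambda>_. V) w x)"
    and "z \<in> carrier (At (rep_tensor C c V) d)"
  shows "f z = g z"
  by (rule dsum_hom_ext[where I = "Mor C c d", OF k V N]) (use assms in \<open>auto simp: rep_tensor_def\<close>)

lemma rep_kCmod: "is_kCmod k C (rep_tensor C c V)"
proof (rule is_kCmodI[OF rep_module rep_act_hom])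
  fix d x assume d: "d \<in> Obj C" and x: "x \<in> carrier (At (rep_tensor C c V) d)"
  show "Act (rep_tensor C c V) d d (Id C d) x = x"
    by (rule rep_ext[OF rep_module rep_act_hom[OF d d cat_id[OF C d]] mod_hom_ident _ x])
      (simp add: rep_act_in d cat_id[OF C d] cat_idl[OF C c d])
next
  fix a b d u v x assume o: "a \<in> Obj C" "b \<in> Obj C" "d \<in> Obj C" and u: "u \<in> Mor C a b" "v \<in> Mor C b d"
    and x: "x \<in> carrier (At (rep_tensor C c V) a)"
  note vu = cat_comp[OF C o u]
  show "Act (rep_tensor C c V) a d (Comp C v u) x = Act (rep_tensor C c V) b d v (Act (rep_tensor C c V) a b u x)"
  proof (rule rep_ext[OF rep_module rep_act_hom[OF o(1,3) vu] mod_hom_comp[OF rep_act_hom[OF o(1,2) u(1)] rep_act_hom[OF o(2,3) u(2)]] _ x])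
    fix w x assume w: "w \<in> Mor C c a" "x \<in> carrier V"
    show "Act (rep_tensor C c V) a d (Comp C v u) (dsum_in (Mor C c a) (\<lambda>_. V) w x) =
      Act (rep_tensor C c V) b d v (Act (rep_tensor C c V) a b u (dsum_in (Mor C c a) (\<lambda>_. V) w x))"
      using rep_act_in[OF o(1,3) vu w] rep_act_in[OF o(1,2) u(1) w]
        rep_act_in[OF o(2,3) u(2) cat_comp[OF C c o(1,2) w(1) u(1)] w(2)]
        cat_assoc[OF C c o w(1) u] by simp
  qed
qed

end

lemma dsum_fmod_kCmod:
  assumes k: "cring k" and F: "\<And>t. t \<in> N \<Longrightarrow> is_kCmod k C (F t)"
  shows "is_kCmod k C (dsum_fmod N F)"
proof (rule is_kCmodI)
  fix c assume c: "c \<in> Obj C"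
  show "Module.module k (At (dsum_fmod N F) c)"
    by (simp add: dsum_fmod_def dsum_module[OF k kCmod_module[OF F c]])
  fix x assume "x \<in> carrier (At (dsum_fmod N F) c)"
  then show "Act (dsum_fmod N F) c c (Id C c) x = x"
    using kCmod_id[OF F c] by (auto simp: dsum_fmod_def dsum_sel PiE_iff extensional_def fun_eq_iff)
next
  fix c d u assume a: "c \<in> Obj C" "d \<in> Obj C" "u \<in> Mor C c d"
  note h = kCmod_act[OF F a]
  have z: "Act (F t) c d u \<zero>\<^bsub>At (F t) c\<^esub> = \<zero>\<^bsub>At (F t) d\<^esub>" if "t \<in> N" for t
    by (rule mod_hom_zero[OF kCmod_module[OF F[OF that] a(1)] kCmod_module[OF F[OF that] a(2)] h[OF that]])
  show "Act (dsum_fmod N F) c d u \<in> mod_hom k (At (dsum_fmod N F) c) (At (dsum_fmod N F) d)"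
  proof (rule mod_homI)
    fix x assume x: "x \<in> carrier (At (dsum_fmod N F) c)"
    have "finite {t \<in> N. Act (F t) c d u (x t) \<noteq> \<zero>\<^bsub>At (F t) d\<^esub>}"
      by (rule finite_subset[of _ "{t \<in> N. x t \<noteq> \<zero>\<^bsub>At (F t) c\<^esub>}"])
        (use x z in \<open>auto simp: dsum_fmod_def dsum_sel\<close>)
    then show "Act (dsum_fmod N F) c d u x \<in> carrier (At (dsum_fmod N F) d)"
      using x mod_homD(1)[OF h] by (auto simp: dsum_fmod_def dsum_sel PiE_iff cong: conj_cong)
  qed (auto simp: dsum_fmod_def dsum_sel PiE_iff mod_homD[OF h] intro!: restrict_ext)
next
  fix b c d u v x assume a: "b \<in> Obj C" "c \<in> Obj C" "d \<in> Obj C" "u \<in> Mor C b c" "v \<in> Mor C c d"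
    and x: "x \<in> carrier (At (dsum_fmod N F) b)"
  then show "Act (dsum_fmod N F) b d (Comp C v u) x = Act (dsum_fmod N F) c d v (Act (dsum_fmod N F) b c u x)"
    by (auto simp: dsum_fmod_def dsum_sel PiE_iff kCmod_comp[OF F] intro!: restrict_ext)
qed

text \<open>Freeness without reference to a chosen isomorphism: \<open>b t\<close> is a generator at
  the object \<open>c t\<close>, and the translates of the generators along all morphisms form a
  basis at each object. The index type is arbitrary, whereas \<open>is_free\<close> fixes
  it.\<close>

definition fbasis :: "('k, 'x) ring_scheme \<Rightarrow> ('o, 'm) cat \<Rightarrow> ('o, 'm, 'k, 'v) fmod \<Rightarrow> 't set \<Rightarrow> ('t \<Rightarrow> 'o) \<Rightarrow> ('t \<Rightarrow> 'v) \<Rightarrow> bool"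
  where "fbasis k C M N c b \<longleftrightarrow> is_kCmod k C M \<and> c \<in> N \<rightarrow> Obj C \<and> (\<forall>t\<in>N. b t \<in> carrier (At M (c t))) \<and>
    (\<forall>d\<in>Obj C. lbasis k (At M d) (SIGMA t:N. Mor C (c t) d) (\<lambda>(t, w). Act M (c t) d w (b t)))"

abbreviation free_fmod where "free_fmod k C N c \<equiv> dsum_fmod N (\<lambda>t. rep_fmod k C (c t))"

text \<open>This is the element \<open>w \<otimes> 1\<close> of the summand of \<open>t\<close>; it
  is a generator when \<open>w\<close> is an identity.\<close>

definition free_gen :: "('k, 'x) ring_scheme \<Rightarrow> ('o, 'm) cat \<Rightarrow> 't set \<Rightarrow> ('t \<Rightarrow> 'o) \<Rightarrow> 'o \<Rightarrow> 't \<Rightarrow> 'm \<Rightarrow> 't \<Rightarrow> 'm \<Rightarrow> 'k"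
  where "free_gen k C N c d t w =
    dsum_in N (\<lambda>t. At (rep_fmod k C (c t)) d) t (dsum_in (Mor C (c t) d) (\<lambda>_. self_mod k) w \<one>\<^bsub>k\<^esub>)"

context
  fixes k :: "('k, 'x) ring_scheme" and C :: "('o, 'm) cat" and N :: "'t set" and c :: "'t \<Rightarrow> 'o"
  assumes k: "cring k" and C: "category C" and c: "c \<in> N \<rightarrow> Obj C"
begin

lemma free_fmod_kCmod: "is_kCmod k C (free_fmod k C N c)"
  by (rule dsum_fmod_kCmod[OF k rep_kCmod[OF k C _ self_mod_module[OF k]]]) (use c in auto)

lemma free_gen_lbasis:
  "lbasis k (At (free_fmod k C N c) d) (SIGMA t:N. Mor C (c t) d) (\<lambda>(t, w). free_gen k C N c d t w)"
  unfolding dsum_fmod_def free_gen_def rep_tensor_def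
  by simp (rule lbasis_dsum[OF k lbasis_dsum_self[OF k]])

lemma free_gen_act:
  assumes "d \<in> Obj C" "e \<in> Obj C" "u \<in> Mor C d e" "t \<in> N" "w \<in> Mor C (c t) d"
  shows "Act (free_fmod k C N c) d e u (free_gen k C N c d t w) = free_gen k C N c e t (Comp C u w)"
proof -
  have ct: "\<And>s. s \<in> N \<Longrightarrow> c s \<in> Obj C" using c by auto
  note S = self_mod_module[OF k]
  note r = rep_kCmod[OF k C ct S]
  have z: "Act (rep_fmod k C (c s)) d e u \<zero>\<^bsub>At (rep_fmod k C (c s)) d\<^esub> = \<zero>\<^bsub>At (rep_fmod k C (c s)) e\<^esub>" if "s \<in> N" for s
    by (rule mod_hom_zero[OF kCmod_module[OF r[OF that] assms(1)] kCmod_module[OF r[OF that] assms(2)] kCmod_act[OF r[OF that] assms(1-3)]])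
  have "Act (rep_fmod k C (c t)) d e u (dsum_in (Mor C (c t) d) (\<lambda>_. self_mod k) w \<one>\<^bsub>k\<^esub>) =
     dsum_in (Mor C (c t) e) (\<lambda>_. self_mod k) (Comp C u w) \<one>\<^bsub>k\<^esub>"
    by (rule rep_act_in[OF k C ct[OF assms(4)] S assms(1-3,5)]) (simp add: cring.cring_simprules(6)[OF k])
  then show ?thesis using z by (auto simp: free_gen_def dsum_in_def dsum_fmod_def intro!: restrict_ext)
qed

lemma free_fmod_fbasis: "fbasis k C (free_fmod k C N c) N c (\<lambda>t. free_gen k C N c (c t) t (Id C (c t)))"
proof -
  have ct: "\<And>s. s \<in> N \<Longrightarrow> c s \<in> Obj C" using c by auto
  have "lbasis k (At (free_fmod k C N c) d) (SIGMA t:N. Mor C (c t) d)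
     (\<lambda>(t, w). Act (free_fmod k C N c) (c t) d w (free_gen k C N c (c t) t (Id C (c t))))" if d: "d \<in> Obj C" for d
    by (rule lbasis_cong[OF _ free_gen_lbasis])
      (auto simp: free_gen_act ct d cat_id[OF C] cat_idr[OF C ct d])
  then show ?thesis unfolding fbasis_def using free_fmod_kCmod c lbasis_closed[OF free_gen_lbasis] ct cat_id[OF C]
    by (force simp: Pi_iff)
qed

end

lemma fbasis_kCmod: "fbasis k C M N c b \<Longrightarrow> is_kCmod k C M"
  and fbasis_obj: "fbasis k C M N c b \<Longrightarrow> t \<in> N \<Longrightarrow> c t \<in> Obj C"
  and fbasis_in: "fbasis k C M N c b \<Longrightarrow> t \<in> N \<Longrightarrow> b t \<in> carrier (At M (c t))"
  and fbasis_lbasis: "fbasis k C M N c b \<Longrightarrow> d \<in> Obj C \<Longrightarrow>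
    lbasis k (At M d) (SIGMA t:N. Mor C (c t) d) (\<lambda>(t, w). Act M (c t) d w (b t))"
  by (auto simp: fbasis_def)

text \<open>A free functor represents \<open>M \<mapsto> \<Prod>\<^sub>t M(c\<^sub>t)\<close>.\<close>

lemma fbasis_lift:
  assumes k: "cring k" and C: "category C" and B: "fbasis k C M N c b" and L: "is_kCmod k C L"
    and x: "\<And>t. t \<in> N \<Longrightarrow> x t \<in> carrier (At L (c t))"
  shows "\<exists>f\<in>nat_trans k C M L. \<forall>d\<in>Obj C. \<forall>t\<in>N. \<forall>w\<in>Mor C (c t) d. f d (Act M (c t) d w (b t)) = Act L (c t) d w (x t)"
proof -
  note ct = fbasis_obj[OF B]
  have "\<exists>f. d \<in> Obj C \<longrightarrow> f \<in> mod_hom k (At M d) (At L d) \<and> (\<forall>t\<in>N. \<forall>w\<in>Mor C (c t) d. f (Act M (c t) d w (b t)) = Act L (c t) d w (x t))" for d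
  proof (cases "d \<in> Obj C")
    case True
    have "\<exists>f\<in>mod_hom k (At M d) (At L d). \<forall>i\<in>(SIGMA t:N. Mor C (c t) d). f ((\<lambda>(t, w). Act M (c t) d w (b t)) i) = (\<lambda>(t, w). Act L (c t) d w (x t)) i"
      by (rule lbasis_lift[OF k fbasis_lbasis[OF B True] kCmod_module[OF L True]])
        (use mod_homD(1)[OF kCmod_act[OF L ct True] x] in auto)
    then show ?thesis by auto
  qed simp
  then obtain f where f: "\<And>d. d \<in> Obj C \<Longrightarrow> f d \<in> mod_hom k (At M d) (At L d)"
    "\<And>d t w. d \<in> Obj C \<Longrightarrow> t \<in> N \<Longrightarrow> w \<in> Mor C (c t) d \<Longrightarrow> f d (Act M (c t) d w (b t)) = Act L (c t) d w (x t)"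
    by metis
  have "f e (Act M d e u y) = Act L d e u (f d y)" if a: "d \<in> Obj C" "e \<in> Obj C" "u \<in> Mor C d e" and y: "y \<in> carrier (At M d)" for d e u y
  proof (rule lbasis_ext[OF fbasis_lbasis[OF B a(1)] kCmod_module[OF L a(2)]
        mod_hom_comp[OF kCmod_act[OF fbasis_kCmod[OF B] a] f(1)[OF a(2)]] mod_hom_comp[OF f(1)[OF a(1)] kCmod_act[OF L a]] _ y])
    fix i assume "i \<in> (SIGMA t:N. Mor C (c t) d)"
    then obtain t w where i: "i = (t, w)" "t \<in> N" "w \<in> Mor C (c t) d" by auto
    note uw = cat_comp[OF C ct[OF i(2)] a(1,2) i(3) a(3)]
    show "f e (Act M d e u ((\<lambda>(t, w). Act M (c t) d w (b t)) i)) = Act L d e u (f d ((\<lambda>(t, w). Act M (c t) d w (b t)) i))"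
      using kCmod_comp[OF fbasis_kCmod[OF B] ct[OF i(2)] a(1,2) i(3) a(3) fbasis_in[OF B i(2)]]
        kCmod_comp[OF L ct[OF i(2)] a(1,2) i(3) a(3) x[OF i(2)]] f(2)[OF a(2) i(2) uw] f(2)[OF a(1) i(2,3)] i(1) by simp
  qed
  then have "f \<in> nat_trans k C M L" using f(1) by (simp add: nat_trans_def)
  then show ?thesis using f(2) by blast
qed

text \<open>The generators are the preimages of the identity elements under the given isomorphism;
  by naturality their translates are the preimages of the other basis elements.\<close>

lemma is_free_imp_fbasis:
  fixes M :: "('o, 'm, 'k, 'v) fmod"
  assumes k: "cring k" and C: "category C" and F: "is_free k C M"
  shows "\<exists>(N :: ('o \<times> 'v) set) c b. fbasis k C M N c b"
proof -
  obtain J :: "('o \<times> 'v) set" and c f where c: "c \<in> J \<rightarrow> Obj C" and f: "f \<in> nat_trans k C M (free_fmod k C J c)"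
    and b: "\<And>d. d \<in> Obj C \<Longrightarrow> bij_betw (f d) (carrier (At M d)) (carrier (At (free_fmod k C J c) d))"
    using F unfolding is_free_def by blast
  have M: "is_kCmod k C M" using F by (simp add: is_free_def)
  have ct: "\<And>s. s \<in> J \<Longrightarrow> c s \<in> Obj C" using c by auto
  let ?W = "free_fmod k C J c"
  note W = free_fmod_kCmod[OF k C c]
  define b where "b t = inv_into (carrier (At M (c t))) (f (c t)) (free_gen k C J c (c t) t (Id C (c t)))" for t
  have g: "free_gen k C J c (c t) t (Id C (c t)) \<in> carrier (At ?W (c t))" if t: "t \<in> J" for t
    using fbasis_in[OF free_fmod_fbasis[OF k C c] t] .
  have bt: "b t \<in> carrier (At M (c t))" "f (c t) (b t) = free_gen k C J c (c t) t (Id C (c t))" if t: "t \<in> J" for t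
    unfolding b_def using g[OF t] b[OF ct[OF t]] by (auto simp: bij_betw_def inv_into_into f_inv_into_f)
  have "lbasis k (At M d) (SIGMA t:J. Mor C (c t) d) (\<lambda>(t, w). Act M (c t) d w (b t))" if d: "d \<in> Obj C" for d
  proof -
    let ?g = "inv_into (carrier (At M d)) (f d)"
    note Md = kCmod_module[OF M d] and Wd = kCmod_module[OF W d] and h = nat_trans_hom[OF f d]
    have bi: "bij_betw ?g (carrier (At ?W d)) (carrier (At M d))" by (rule bij_betw_inv_into[OF b[OF d]])
    have "lbasis k (At M d) (SIGMA t:J. Mor C (c t) d) (\<lambda>i. ?g ((\<lambda>(t, w). free_gen k C J c d t w) i))"
      by (rule lbasis_transfer[OF free_gen_lbasis[OF k C c] Md mod_hom_inv_into[OF Md Wd h b[OF d]] bi])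
    then show ?thesis
    proof (rule lbasis_cong[rotated])
      fix i assume "i \<in> (SIGMA t:J. Mor C (c t) d)"
      then obtain t w where i: "i = (t, w)" "t \<in> J" "w \<in> Mor C (c t) d" by auto
      have "f d (Act M (c t) d w (b t)) = Act ?W (c t) d w (free_gen k C J c (c t) t (Id C (c t)))"
        using nat_trans_act[OF f ct[OF i(2)] d i(3) bt(1)[OF i(2)]] bt(2)[OF i(2)] by simp
      also have "\<dots> = free_gen k C J c d t w"
        using free_gen_act[OF k C c ct[OF i(2)] d i(3,2) cat_id[OF C ct[OF i(2)]]] cat_idr[OF C ct[OF i(2)] d i(3)] by simp
      finally have "free_gen k C J c d t w = f d (Act M (c t) d w (b t))" by simp
      then show "?g ((\<lambda>(t, w). free_gen k C J c d t w) i) = (\<lambda>(t, w). Act M (c t) d w (b t)) i"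
        using mod_homD(1)[OF kCmod_act[OF M ct[OF i(2)] d i(3)] bt(1)[OF i(2)]] i(1) b[OF d]
        by (simp add: bij_betw_def)
    qed
  qed
  then have "fbasis k C M J c b" unfolding fbasis_def using M c bt(1) by blast
  then show ?thesis by blast
qed

text \<open>\<open>is_free\<close> demands pairs of an object and an element as indices, so
  \<open>t\<close> is renamed to \<open>(c t, b t)\<close>. The renaming is injective because
  \<open>b t\<close> is the basis vector that belongs to \<open>t\<close> and the identity of
  \<open>c t\<close>, and \<open>1 \<noteq> 0\<close> keeps basis vectors with different indices
  apart.\<close>

lemma fbasis_imp_is_free:
  fixes M :: "('o, 'm, 'k, 'v) fmod"
  assumes k: "cring k" and one: "\<one>\<^bsub>k\<^esub> \<noteq> \<zero>\<^bsub>k\<^esub>" and C: "category C" and B: "fbasis k C M N c b"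
  shows "is_free k C M"
proof -
  note ct = fbasis_obj[OF B] and M = fbasis_kCmod[OF B]
  define J where "J = (\<lambda>t. (c t, b t)) ` N"
  have inj: "inj_on (\<lambda>t. (c t, b t)) N"
  proof (rule inj_onI)
    fix s t assume a: "s \<in> N" "t \<in> N" "(c s, b s) = (c t, b t)"
    have "(\<lambda>(t, w). Act M (c t) (c s) w (b t)) (s, Id C (c s)) = (\<lambda>(t, w). Act M (c t) (c s) w (b t)) (t, Id C (c s))"
      using a(3) by simp
    from inj_onD[OF lbasis_inj[OF fbasis_lbasis[OF B ct[OF a(1)]] one] this]
    show "s = t" using a cat_id[OF C ct[OF a(1)]] by auto
  qed
  have c': "fst \<in> J \<rightarrow> Obj C" using ct by (auto simp: J_def)
  let ?W = "free_fmod k C J fst"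
  note W = free_fmod_kCmod[OF k C c'] and WB = free_fmod_fbasis[OF k C c']
  have x: "free_gen k C J fst (c t) (c t, b t) (Id C (c t)) \<in> carrier (At ?W (c t))" if "t \<in> N" for t
    using fbasis_in[OF WB, of "(c t, b t)"] that by (auto simp: J_def)
  obtain f where f: "f \<in> nat_trans k C M ?W" and fb: "\<And>d t w. d \<in> Obj C \<Longrightarrow> t \<in> N \<Longrightarrow> w \<in> Mor C (c t) d \<Longrightarrow>
     f d (Act M (c t) d w (b t)) = Act ?W (c t) d w (free_gen k C J fst (c t) (c t, b t) (Id C (c t)))"
    using fbasis_lift[where L = ?W and x = "\<lambda>t. free_gen k C J fst (c t) (c t, b t) (Id C (c t))", OF k C B W x] by metis
  have "bij_betw (f d) (carrier (At M d)) (carrier (At ?W d))" if d: "d \<in> Obj C" for d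
  proof (rule lbasis_bij[OF k fbasis_lbasis[OF B d] fbasis_lbasis[OF WB d] nat_trans_hom[OF f d]])
    show "bij_betw (\<lambda>(t, w). ((c t, b t), w)) (SIGMA t:N. Mor C (c t) d) (SIGMA t:J. Mor C (fst t) d)"
      using inj by (auto simp: bij_betw_def inj_on_def J_def image_iff)
    fix i assume "i \<in> (SIGMA t:N. Mor C (c t) d)"
    then show "f d ((\<lambda>(t, w). Act M (c t) d w (b t)) i) =
      (\<lambda>(t, w). Act ?W (fst t) d w (free_gen k C J fst (fst t) t (Id C (fst t)))) ((\<lambda>(t, w). ((c t, b t), w)) i)"
      using fb[OF d] by auto
  qed
  then show ?thesis unfolding is_free_def using M c' f by blast
qed

section \<open>The action category\<close>

text \<open>The degrees of the variables are nonnegative and nonzero. This makes the hom sets finite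
  and lets every non-identity morphism increase the sum of the coordinates.\<close>

locale action =
  fixes r n :: nat and a :: "nat \<Rightarrow> nat \<Rightarrow> int"
  assumes a_supp: "i < n \<Longrightarrow> j \<ge> r \<Longrightarrow> a i j = 0" and a_nonneg: "i < n \<Longrightarrow> 0 \<le> a i j"
    and a_nz: "i < n \<Longrightarrow> \<exists>j. a i j \<noteq> 0"
begin

definition "NV = {l :: nat \<Rightarrow> nat. \<forall>i\<ge>n. l i = 0}"
abbreviation "D \<equiv> action_category r n a"
\<comment> \<open>the source of the morphism \<open>l\<close> with target \<open>d\<close>\<close>
definition "obj d l = (\<lambda>j. d j - lin_comb n a l j)"

lemma NV_carrier: "carrier (Nat_vec n) = NV"
  by (simp add: NV_def vec_monoid_def)

lemma lin_comb_add: "lin_comb n a (\<lambda>i. l i + m i) j = lin_comb n a l j + lin_comb n a m j"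
  by (simp add: lin_comb_def algebra_simps sum.distrib)

lemma lin_comb_diff: "m \<le> l \<Longrightarrow> lin_comb n a (\<lambda>i. l i - m i) j = lin_comb n a l j - lin_comb n a m j"
  by (simp add: lin_comb_def le_fun_def of_nat_diff algebra_simps sum_subtractf)

lemma lin_comb_zero: "lin_comb n a (\<lambda>i. 0) j = 0"
  by (simp add: lin_comb_def)

lemma NV_add: "l \<in> NV \<Longrightarrow> m \<in> NV \<Longrightarrow> (\<lambda>i. l i + m i) \<in> NV"
  and NV_diff: "l \<in> NV \<Longrightarrow> (\<lambda>i. l i - m i) \<in> NV"
  and NV_zero: "(\<lambda>i. 0) \<in> NV"
  by (auto simp: NV_def)

lemma ObjD: "c \<in> Obj D \<longleftrightarrow> (\<forall>j\<ge>r. c j = 0)"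
  by (simp add: action_category_def vec_monoid_def)

lemma obj_Obj: "d \<in> Obj D \<Longrightarrow> obj d l \<in> Obj D"
  by (auto simp: ObjD obj_def lin_comb_def a_supp)

text \<open>A morphism into \<open>d\<close> is just an exponent, its source being forced. This is
  what allows chains over \<open>d\<close> to be encoded by lists of exponents.\<close>

lemma MorD: "l \<in> Mor D c d \<longleftrightarrow> l \<in> NV \<and> c = obj d l"
  by (auto simp: action_category_def obj_def NV_carrier fun_eq_iff)

lemma CompD [simp]: "Comp D v u = (\<lambda>i. v i + u i)"
  by (simp add: action_category_def vec_monoid_def)

lemma IdD [simp]: "Id D c = (\<lambda>i. 0)"
  by (simp add: action_category_def vec_monoid_def)

lemma obj_zero [simp]: "obj d (\<lambda>i. 0) = d"
  by (simp add: obj_def lin_comb_zero)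

lemma obj_obj: "obj (obj d l) m = obj d (\<lambda>i. l i + m i)"
  by (simp add: obj_def lin_comb_add fun_eq_iff)

lemma obj_diff: "m \<le> l \<Longrightarrow> obj (obj d m) (\<lambda>i. l i - m i) = obj d l"
  by (simp add: obj_def lin_comb_diff fun_eq_iff)

lemma category_D: "category D"
  unfolding category_def
  by (auto simp: MorD NV_zero NV_add obj_obj add_ac)

lemma diff_mor: "l \<in> NV \<Longrightarrow> m \<le> l \<Longrightarrow> (\<lambda>i. l i - m i) \<in> Mor D (obj d l) (obj d m)"
  by (simp add: MorD NV_diff obj_diff)

text \<open>Exponents are natural numbers, so a sum of two of them vanishes only if both do.\<close>

lemma iso_D: assumes "u \<in> Mor D b c" shows "iso_mor D b c u \<longleftrightarrow> u = (\<lambda>i. 0)"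
proof
  assume "iso_mor D b c u"
  then obtain v where "(\<lambda>i. v i + u i) = (\<lambda>i. 0)" unfolding iso_mor_def by auto
  then show "u = (\<lambda>i. 0)" by (auto simp: fun_eq_iff)
next
  assume "u = (\<lambda>i. 0)"
  then show "iso_mor D b c u" using assms by (auto simp: iso_mor_def MorD NV_zero intro!: bexI[of _ "\<lambda>i. 0"])
qed

end

text \<open>Common frame of the bar complex and the Koszul-type complex: a list \<open>L\<close>
  takes its coefficients at the source \<open>ob L\<close> of the exponent \<open>E L\<close> over
  \<open>d\<close>. Deletion does not increase \<open>E\<close>, so the difference of the exponents
  is a morphism that carries the coefficients along, and \<open>E_Nil\<close> places the target of
  the augmentation at \<open>d\<close>.\<close>

locale vsys = action r n a for r n a +
  fixes k :: "('k, 'x) ring_scheme" and A :: "'a list set" and E :: "'a list \<Rightarrow> nat \<Rightarrow> nat" and d :: "nat \<Rightarrow> int"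
  assumes k: "cring k" and A_closed: "L \<in> A \<Longrightarrow> K \<in> dels L \<Longrightarrow> K \<in> A"
    and E_NV: "L \<in> A \<Longrightarrow> E L \<in> NV" and E_mono: "L \<in> A \<Longrightarrow> K \<in> dels L \<Longrightarrow> E K \<le> E L"
    and A_Nil: "[] \<in> A" and E_Nil: "E [] = (\<lambda>i. 0)" and d: "d \<in> Obj D"
begin

abbreviation "ob L \<equiv> obj d (E L)"
abbreviation "G M L \<equiv> At M (ob L)"
abbreviation "ac M L K \<equiv> Act M (ob L) (ob K) (\<lambda>i. E L i - E K i)"

lemma ob_Obj: "ob L \<in> Obj D" by (rule obj_Obj[OF d])

lemma ac_mor: "L \<in> A \<Longrightarrow> K \<in> dels L \<Longrightarrow> (\<lambda>i. E L i - E K i) \<in> Mor D (ob L) (ob K)"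
  by (rule diff_mor[OF E_NV E_mono])

lemma ac_mor2: "L \<in> A \<Longrightarrow> K \<in> dels L \<Longrightarrow> J \<in> dels K \<Longrightarrow> (\<lambda>i. E L i - E J i) \<in> Mor D (ob L) (ob J)"
  using E_mono[of L K] E_mono[of K J] A_closed by (intro diff_mor E_NV) (auto intro: order_trans)

lemma lsys_G: assumes M: "is_kCmod k D M" shows "lsys k A (G M) (ac M)"
proof (rule lsys.intro)
  show "cring k" by (rule k)
  show "\<And>L K. L \<in> A \<Longrightarrow> K \<in> dels L \<Longrightarrow> K \<in> A" by (rule A_closed)
  show "\<And>L. L \<in> A \<Longrightarrow> Module.module k (G M L)" by (rule kCmod_module[OF M ob_Obj])
  show "\<And>L K. L \<in> A \<Longrightarrow> K \<in> dels L \<Longrightarrow> ac M L K \<in> mod_hom k (G M L) (G M K)"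
    by (rule kCmod_act[OF M ob_Obj ob_Obj ac_mor])
  show "ac M L J \<in> mod_hom k (G M L) (G M J)" if "L \<in> A" "K \<in> dels L" "J \<in> dels K" for L K J
    by (rule kCmod_act[OF M ob_Obj ob_Obj ac_mor2]) (use that in auto)
  fix L K J x assume L: "L \<in> A" "K \<in> dels L" "J \<in> dels K" and x: "x \<in> carrier (G M L)"
  have "E J \<le> E K" "E K \<le> E L" using L A_closed E_mono by auto
  then have "(\<lambda>i. (E K i - E J i) + (E L i - E K i)) = (\<lambda>i. E L i - E J i)" by (auto simp: le_fun_def)
  then show "ac M K J (ac M L K x) = ac M L J x"
    using kCmod_comp[OF M ob_Obj ob_Obj ob_Obj ac_mor[OF L(1,2)] ac_mor[OF A_closed[OF L(1,2)] L(3)] x] by simp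
qed

lemma lsys_map_G:
  assumes M: "is_kCmod k D M" and M': "is_kCmod k D M'" and f: "f \<in> nat_trans k D M M'"
  shows "lsys_map k A (G M) (ac M) (G M') (ac M') (\<lambda>L. f (ob L))"
  unfolding lsys_map_def lsys_map_axioms_def
  using lsys_G[OF M] lsys_G[OF M'] nat_trans_hom[OF f ob_Obj] nat_trans_act[OF f ob_Obj ob_Obj ac_mor] by auto

lemma ker_incl: assumes M: "is_kCmod k D M" shows "(\<lambda>c x. x) \<in> nat_trans k D (ker_fmod M M' f) M"
  unfolding nat_trans_def ker_fmod_def
  by (auto intro!: mod_homI simp: a_kernel_def')

lemma lsys_ses_G:
  assumes M: "is_kCmod k D M" and M': "is_kCmod k D M'" and f: "f \<in> nat_trans k D M M'" and ep: "epic D M M' f"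
    and K: "is_kCmod k D (ker_fmod M M' f)"
  shows "lsys_ses k A (G (ker_fmod M M' f)) (ac (ker_fmod M M' f)) (G M) (ac M) (G M') (ac M') (\<lambda>L x. x) (\<lambda>L. f (ob L))"
  unfolding lsys_ses_def lsys_ses_axioms_def
  using lsys_map_G[OF K M ker_incl[OF M]] lsys_map_G[OF M M' f] ep ob_Obj
  by (auto simp: epic_def ker_fmod_def a_kernel_def')

text \<open>Degree 0 claims only surjectivity, which passes along an epimorphism without any
  information on its kernel. This starts the dimension shift.\<close>

lemma Tex_zero_quotient:
  assumes M: "is_kCmod k D M" and M': "is_kCmod k D M'" and f: "f \<in> nat_trans k D M M'" and ep: "epic D M M' f"
    and ex: "Tex A (G M) (ac M) 0"
  shows "Tex A (G M') (ac M') 0"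
  unfolding Tex_def
proof
  interpret f: lsys_map k A "G M" "ac M" "G M'" "ac M'" "\<lambda>L. f (ob L)" by (rule lsys_map_G[OF M M' f])
  fix z assume "z \<in> Tcyc A (G M') (ac M') 0"
  then have z: "z \<in> carrier (Tm A (G M') 0)" by (simp add: Tcyc_def)
  obtain y where y: "y \<in> carrier (Tm A (G M) 0)" "Tmap A 0 (\<lambda>L. f (ob L)) y = z"
    using f.Tmap_surj[OF _ z] ep ob_Obj unfolding epic_def by blast
  then have "y \<in> Tcyc A (G M) (ac M) 0" by (simp add: Tcyc_def)
  from TexD[OF ex this] obtain x where x: "x \<in> carrier (Tm A (G M) (Suc 0))" "bd A (G M) (ac M) 0 x = y" by (elim exE conjE)
  have "z = bd A (G M') (ac M') 0 (Tmap A (Suc 0) (\<lambda>L. f (ob L)) x)" using f.Tmap_bd[OF x(1)] x(2) y(2) by simp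
  then show "z \<in> bd A (G M') (ac M') 0 ` carrier (Tm A (G M') (Suc 0))"
    using mod_homD(1)[OF f.Tmap_hom x(1)] by simp
qed

text \<open>The strand of the element \<open>x\<^sup>\<mu>\<^sup>-\<^sup>E\<^sup>(\<^sup>L\<^sup>) b\<^sub>t\<close> in the summand of \<open>L\<close> is \<open>(t, \<mu>)\<close>; it is preserved
  by the boundary.\<close>

definition "strands N c = {(L, t, \<mu>). L \<in> A \<and> t \<in> N \<and> \<mu> \<in> Mor D (c t) d \<and> E L \<le> \<mu>}"
definition "sgen P c b = (\<lambda>(L, t, \<mu>). Tin A (G P) (length L) L (Act P (c t) (ob L) (\<lambda>i. \<mu> i - E L i) (b t)))"

lemma strand_mor: "E L \<le> \<mu> \<Longrightarrow> \<mu> \<in> Mor D c d \<Longrightarrow> (\<lambda>i. \<mu> i - E L i) \<in> Mor D c (ob L)"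
  by (auto simp: MorD NV_diff obj_diff)

lemma T_basis:
  assumes B: "fbasis k D P N c b"
  shows "lbasis k (Tm A (G P) q) {(L, s). (L, s) \<in> strands N c \<and> length L = q} (sgen P c b)"
proof -
  let ?J = "SIGMA L:{L \<in> A. length L = q}. SIGMA t:N. Mor D (c t) (ob L)"
  let ?\<beta> = "\<lambda>(L, i). dsum_in {L \<in> A. length L = q} (G P) L ((\<lambda>(t, w). Act P (c t) (ob L) w (b t)) i)"
  have 1: "lbasis k (Tm A (G P) q) ?J ?\<beta>"
    unfolding Tm_def by (rule lbasis_dsum[OF k fbasis_lbasis[OF B ob_Obj]])
  \<comment> \<open>The basis of the summand of \<open>L\<close> comes indexed by
    \<open>w = \<mu> - E L\<close>; indexing it by \<open>\<mu> = w + E L\<close> makes the second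
    index constant along the boundary.\<close>
  have 2: "bij_betw (\<lambda>(L, t, \<mu>). (L, t, (\<lambda>i. \<mu> i - E L i))) {(L, s). (L, s) \<in> strands N c \<and> length L = q} ?J"
  proof (rule bij_betwI[where g = "\<lambda>(L, t, w). (L, t, (\<lambda>i. w i + E L i))"])
    show "(\<lambda>(L, t, \<mu>). (L, t, (\<lambda>i. \<mu> i - E L i))) \<in> {(L, s). (L, s) \<in> strands N c \<and> length L = q} \<rightarrow> ?J"
      using strand_mor by (auto simp: strands_def)
    show "(\<lambda>(L, t, w). (L, t, (\<lambda>i. w i + E L i))) \<in> ?J \<rightarrow> {(L, s). (L, s) \<in> strands N c \<and> length L = q}"
      by (auto simp: strands_def MorD NV_add E_NV obj_obj add_ac le_fun_def)
  qed (auto simp: strands_def le_fun_def)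
  show ?thesis
    by (rule lbasis_cong[OF _ lbasis_reindex[OF 1 2]]) (auto simp: sgen_def)
qed

lemma bd_sgen:
  assumes B: "fbasis k D P N c b" and s: "(L, t, \<mu>) \<in> strands N c" "length L = Suc q"
  shows "bd A (G P) (ac P) q (sgen P c b (L, t, \<mu>)) = alt (Tm A (G P) q) (\<lambda>K. sgen P c b (K, t, \<mu>)) L"
proof -
  note P = fbasis_kCmod[OF B]
  interpret lsys k A "G P" "ac P" by (rule lsys_G[OF P])
  have a: "L \<in> A" "t \<in> N" "\<mu> \<in> Mor D (c t) d" "E L \<le> \<mu>" using s by (auto simp: strands_def)
  note ct = fbasis_obj[OF B a(2)] and bt = fbasis_in[OF B a(2)]
  have m: "(\<lambda>i. \<mu> i - E L i) \<in> Mor D (c t) (ob L)" by (rule strand_mor[OF a(4,3)])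
  have x: "Act P (c t) (ob L) (\<lambda>i. \<mu> i - E L i) (b t) \<in> carrier (G P L)"
    by (rule mod_homD(1)[OF kCmod_act[OF P ct ob_Obj m] bt])
  have "bd A (G P) (ac P) q (sgen P c b (L, t, \<mu>)) = alt (Tm A (G P) q) (\<lambda>K. Tin A (G P) q K (ac P L K (Act P (c t) (ob L) (\<lambda>i. \<mu> i - E L i) (b t)))) L"
    using bd_in[OF a(1) s(2) x] s(2) by (simp add: sgen_def)
  also have "\<dots> = alt (Tm A (G P) q) (\<lambda>K. sgen P c b (K, t, \<mu>)) L"
  proof (rule alt_cong)
    fix K assume K: "K \<in> dels L"
    have "E K \<le> E L" by (rule E_mono[OF a(1) K])
    \<comment> \<open>Subtraction of natural numbers is truncated; the differences add up because
      \<open>E K \<le> E L \<le> \<mu>\<close>.\<close>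
    then have "(\<lambda>i. (E L i - E K i) + (\<mu> i - E L i)) = (\<lambda>i. \<mu> i - E K i)" using a(4) by (auto simp: le_fun_def)
    then have "ac P L K (Act P (c t) (ob L) (\<lambda>i. \<mu> i - E L i) (b t)) = Act P (c t) (ob K) (\<lambda>i. \<mu> i - E K i) (b t)"
      using kCmod_comp[OF P ct ob_Obj ob_Obj m ac_mor[OF a(1) K] bt] by simp
    then show "Tin A (G P) q K (ac P L K (Act P (c t) (ob L) (\<lambda>i. \<mu> i - E L i) (b t))) = sgen P c b (K, t, \<mu>)"
      using dels_length[OF K] s(2) by (simp add: sgen_def)
  qed
  finally show ?thesis .
qed

text \<open>The vertex to be prepended is a function of \<open>\<mu>\<close>, so it does not change
  along a strand, as \<open>contract\<close> requires.\<close>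

lemma Tex_free:
  assumes B: "fbasis k D P N c b"
    and v: "\<And>L t \<mu>. (L, t, \<mu>) \<in> strands N c \<Longrightarrow> length L = p \<Longrightarrow>
       (v \<mu> # L, t, \<mu>) \<in> strands N c \<or> (\<exists>L'. L = v \<mu> # L') \<and> (\<forall>L''. (v \<mu> # v \<mu> # L'', t, \<mu>) \<notin> strands N c)"
  shows "Tex A (G P) (ac P) p"
  unfolding Tex_def
proof
  interpret lsys k A "G P" "ac P" by (rule lsys_G[OF fbasis_kCmod[OF B]])
  fix z assume z: "z \<in> Tcyc A (G P) (ac P) p"
  show "z \<in> bd A (G P) (ac P) p ` carrier (Tm A (G P) (Suc p))"
  proof (rule contract[where I = "strands N c" and \<beta> = "sgen P c b" and v = "\<lambda>(t, \<mu>). v \<mu>" and d = "bd A (G P) (ac P)" and C = "Tm A (G P)", OF k T_basis[OF B] bd_hom])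
    show "\<And>L s q. (L, s) \<in> strands N c \<Longrightarrow> length L = Suc q \<Longrightarrow>
      bd A (G P) (ac P) q (sgen P c b (L, s)) = alt (Tm A (G P) q) (\<lambda>K. sgen P c b (K, s)) L"
      using bd_sgen[OF B] by auto
    show "(K, s) \<in> strands N c" if "(L, s) \<in> strands N c" "K \<in> dels L" for L K s
      using that A_closed[of L K] E_mono[of L K] by (auto simp: strands_def intro: order_trans)
    show "((case s of (t, \<mu>) \<Rightarrow> v \<mu>) # L, s) \<in> strands N c \<or> (\<exists>L'. L = (case s of (t, \<mu>) \<Rightarrow> v \<mu>) # L') \<and>
      (\<forall>L''. ((case s of (t, \<mu>) \<Rightarrow> v \<mu>) # (case s of (t, \<mu>) \<Rightarrow> v \<mu>) # L'', s) \<notin> strands N c)"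
      if "(L, s) \<in> strands N c" "length L = p" for L s
      using v[of L "fst s" "snd s"] that by (cases s) auto
  qed (use z in \<open>auto simp: Tcyc_def\<close>)
qed

end

section \<open>The bar complex of a set of degrees\<close>

text \<open>A list \<open>\<mu>\<^sub>0 > \<dots> > \<mu>\<^sub>p\<close> stands for the chain \<open>d - A\<mu>\<^sub>0 \<rightarrow> \<dots> \<rightarrow> d - A\<mu>\<^sub>p\<close> and the morphism \<open>\<mu>\<^sub>p\<close> from
  its last object to \<open>d\<close>.\<close>

definition (in action) "bar_lists S d = {L. sorted_wrt (\<lambda>x y. y < x) L \<and> (\<forall>\<mu>\<in>set L. \<mu> \<in> NV \<and> obj d \<mu> \<in> S)}"

text \<open>The head is the largest entry, so \<open>obj d (head_exp L)\<close> is the first object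
  of the chain, at which the bar construction takes its coefficients. The value at the empty list
  gives \<open>d\<close> itself.\<close>

definition head_exp :: "(nat \<Rightarrow> nat) list \<Rightarrow> nat \<Rightarrow> nat"
  where "head_exp L = (if L = [] then (\<lambda>i. 0) else hd L)"

lemma sorted_wrt_dels: "sorted_wrt R L \<Longrightarrow> K \<in> dels L \<Longrightarrow> sorted_wrt R K"
proof (induction L arbitrary: K)
  case (Cons v L)
  then show ?case using dels_subset[of _ L] by fastforce
qed simp

locale bar_sys = action r n a for r n a +
  fixes k :: "('k, 'x) ring_scheme" and S :: "(nat \<Rightarrow> int) set" and d :: "nat \<Rightarrow> int"
  assumes k: "cring k" and d: "d \<in> Obj D"

sublocale bar_sys \<subseteq> vsys r n a k "bar_lists S d" head_exp d
proof (intro vsys.intro vsys_axioms.intro action_axioms)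
  show "cring k" by (rule k)
  show "d \<in> Obj D" by (rule d)
  fix L assume L: "L \<in> bar_lists S d"
  show "head_exp L \<in> NV" using L by (cases L) (auto simp: bar_lists_def head_exp_def NV_zero)
  fix K assume K: "K \<in> dels L"
  show "K \<in> bar_lists S d" using L K sorted_wrt_dels[of _ L K] dels_subset[OF K] by (auto simp: bar_lists_def)
  show "head_exp K \<le> head_exp L"
  proof (cases "K = []")
    case False
    then have "hd K \<in> set L" using dels_subset[OF K] by auto
    moreover obtain v L' where "L = v # L'" using K by (cases L) auto
    ultimately show ?thesis using L False by (auto simp: bar_lists_def head_exp_def intro: less_imp_le)
  qed (simp add: head_exp_def le_fun_def)
qed (auto simp: bar_lists_def head_exp_def)

text \<open>The entry prepended is \<open>\<mu>\<close> itself. It dominates the head, so it either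
  is the head or is strictly larger than all entries. Its object is the degree \<open>c t\<close> of
  the generator, and \<open>c t \<in> S\<close> makes the longer list admissible.\<close>

lemma (in bar_sys) Tex_bar_free:
  assumes B: "fbasis k D P N c b" and S: "\<And>t. t \<in> N \<Longrightarrow> c t \<in> S"
  shows "Tex (bar_lists S d) (G P) (ac P) p"
proof (rule Tex_free[OF B, where v = "\<lambda>\<mu>. \<mu>"])
  fix L t \<mu> assume s: "(L, t, \<mu>) \<in> strands N c"
  then have a: "L \<in> bar_lists S d" "t \<in> N" "\<mu> \<in> NV" "obj d \<mu> = c t" "head_exp L \<le> \<mu>" "\<mu> \<in> Mor D (c t) d"
    by (auto simp: strands_def MorD)
  show "(\<mu> # L, t, \<mu>) \<in> strands N c \<or> (\<exists>L'. L = \<mu> # L') \<and> (\<forall>L''. (\<mu> # \<mu> # L'', t, \<mu>) \<notin> strands N c)"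
  proof (cases "\<exists>L'. L = \<mu> # L'")
    case True
    moreover have "(\<mu> # \<mu> # L'', t, \<mu>) \<notin> strands N c" for L'' unfolding strands_def by (simp add: bar_lists_def)
    ultimately show ?thesis by blast
  next
    case False
    have "y < \<mu>" if y: "y \<in> set L" for y
    proof -
      obtain x L' where L: "L = x # L'" using y by (cases L) auto
      then have "x < \<mu>" using a(5) False by (auto simp: head_exp_def order_less_le)
      then show ?thesis using y L a(1) by (auto simp: bar_lists_def)
    qed
    then have "\<mu> # L \<in> bar_lists S d" using a S by (auto simp: bar_lists_def)
    then have "(\<mu> # L, t, \<mu>) \<in> strands N c"
      using a(2,6) unfolding strands_def by (simp add: head_exp_def)
    then show ?thesis by simp
  qed
qed

section \<open>The Koszul-type complex\<close>

text \<open>Exponent of the squarefree monomial on the entries of \<open>L\<close>; repeated entries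
  count once. The lists are unordered and may repeat entries, so that a vertex can be prepended to
  any of them.\<close>

definition simplex_exp :: "nat list \<Rightarrow> nat \<Rightarrow> nat"
  where "simplex_exp L = (\<lambda>i. if i \<in> set L then 1 else 0)"

locale koszul_sys = action r n a for r n a +
  fixes k :: "('k, 'x) ring_scheme" and d :: "nat \<Rightarrow> int"
  assumes k: "cring k" and d: "d \<in> Obj D"

sublocale koszul_sys \<subseteq> vsys r n a k "lists {..<n}" simplex_exp d
proof (intro vsys.intro vsys_axioms.intro action_axioms)
  show "cring k" by (rule k)
  show "d \<in> Obj D" by (rule d)
  fix L assume L: "L \<in> lists {..<n}"
  show "simplex_exp L \<in> NV" using L by (force simp: NV_def simplex_exp_def)
  fix K assume K: "K \<in> dels L"
  show "K \<in> lists {..<n}" "simplex_exp K \<le> simplex_exp L"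
    using L dels_subset[OF K] by (auto simp: simplex_exp_def le_fun_def)
qed (auto simp: simplex_exp_def)

lemma (in koszul_sys) simplex_le: "i < n \<Longrightarrow> \<mu> i \<noteq> 0 \<Longrightarrow> simplex_exp L \<le> \<mu> \<Longrightarrow> simplex_exp (i # L) \<le> \<mu>"
  by (auto simp: simplex_exp_def le_fun_def split: if_splits)

text \<open>The strand of \<open>\<mu>\<close> consists of all lists in the support of
  \<open>\<mu>\<close>, which is a cone over any element of the support. For the empty list this
  fails if \<open>\<mu> = 0\<close>, since then there is nothing to prepend; a nonempty list forces
  the support to be nonempty.\<close>

lemma (in koszul_sys) Tex_koszul_free:
  assumes B: "fbasis k D P N c b"
  shows "Tex (lists {..<n}) (G P) (ac P) (Suc p)"
proof (rule Tex_free[OF B, where v = "\<lambda>\<mu>. SOME i. \<mu> i \<noteq> 0"])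
  fix L t \<mu> assume s: "(L, t, \<mu>) \<in> strands N c" "length L = Suc p"
  then have a: "L \<in> lists {..<n}" "\<mu> \<in> NV" "simplex_exp L \<le> \<mu>" by (auto simp: strands_def MorD)
  obtain i L' where "L = i # L'" using s(2) by (cases L) auto
  then have "\<mu> i \<noteq> 0" using le_funD[OF a(3), of i] by (auto simp: simplex_exp_def)
  then have i: "\<mu> (SOME i. \<mu> i \<noteq> 0) \<noteq> 0" by (rule someI)
  then have "(SOME i. \<mu> i \<noteq> 0) < n" using a(2) by (auto simp: NV_def not_less[symmetric])
  then show "((SOME i. \<mu> i \<noteq> 0) # L, t, \<mu>) \<in> strands N c \<or> (\<exists>L'. L = (SOME i. \<mu> i \<noteq> 0) # L') \<and>
      (\<forall>L''. ((SOME i. \<mu> i \<noteq> 0) # (SOME i. \<mu> i \<noteq> 0) # L'', t, \<mu>) \<notin> strands N c)"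
    using simplex_le[OF _ i a(3)] s(1) by (auto simp: strands_def)
qed

text \<open>Dual functionals separate vectors, since the coordinate map into the direct sum of
  copies of \<open>k\<close> is bijective.\<close>

lemma lbasis_eqI:
  assumes k: "cring k" and B: "lbasis k V I \<beta>" and v: "v \<in> carrier V" "v' \<in> carrier V"
    and eq: "\<And>\<kappa> i. i \<in> I \<Longrightarrow> \<kappa> \<in> mod_hom k V (self_mod k) \<Longrightarrow>
      (\<And>j. j \<in> I \<Longrightarrow> \<kappa> (\<beta> j) = (if j = i then \<one>\<^bsub>k\<^esub> else \<zero>\<^bsub>k\<^esub>)) \<Longrightarrow> \<kappa> v = \<kappa> v'"
  shows "v = v'"
proof -
  interpret k: cring k by (rule k)
  let ?D = "dsum_mod I (\<lambda>_. self_mod k)"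
  note DB = lbasis_dsum_self[OF k, of I]
  have "\<exists>K\<in>mod_hom k V ?D. \<forall>i\<in>I. K (\<beta> i) = dsum_in I (\<lambda>_. self_mod k) i \<one>\<^bsub>k\<^esub>"
    by (rule lbasis_lift[OF k B lbasis_module[OF DB]]) (rule lbasis_closed[OF DB])
  then obtain K where K: "K \<in> mod_hom k V ?D" "\<And>i. i \<in> I \<Longrightarrow> K (\<beta> i) = dsum_in I (\<lambda>_. self_mod k) i \<one>\<^bsub>k\<^esub>" by blast
  have bij: "bij_betw K (carrier V) (carrier ?D)"
    by (rule lbasis_bij[OF k B DB K(1) bij_betw_id]) (simp add: K(2))
  have "K v i = K v' i" if i: "i \<in> I" for i
  proof (rule eq[OF i, where \<kappa> = "\<lambda>v. K v i"])
    have "(\<lambda>f. f i) \<in> mod_hom k ?D (self_mod k)" by (rule mod_homI) (use i in \<open>auto simp: dsum_sel\<close>)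
    then show "(\<lambda>v. K v i) \<in> mod_hom k V (self_mod k)" by (rule mod_hom_comp[OF K(1)])
  qed (use i in \<open>auto simp: K(2) dsum_in_def\<close>)
  moreover have "K v \<in> carrier ?D" "K v' \<in> carrier ?D" using mod_homD(1)[OF K(1)] v by auto
  ultimately have "K v = K v'" by (intro PiE_ext[of _ I "\<lambda>_. carrier k"]) (auto simp: dsum_sel)
  then show ?thesis using bij v by (auto simp: bij_betw_def inj_on_def)
qed

section \<open>Minimal resolutions\<close>

context action begin

text \<open>The coefficient of the generator \<open>b t\<close> itself at the object
  \<open>c t\<close>, that is, of its translate along the identity.\<close>

definition "coord0 k P N c b t \<kappa> \<longleftrightarrow> t \<in> N \<and> \<kappa> \<in> mod_hom k (At P (c t)) (self_mod k) \<and>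
   (\<forall>s\<in>N. \<forall>w\<in>Mor D (c s) (c t). \<kappa> (Act P (c s) (c t) w (b s)) = (if s = t \<and> w = (\<lambda>i. 0) then \<one>\<^bsub>k\<^esub> else \<zero>\<^bsub>k\<^esub>))"

lemma coord0_exists:
  assumes B: "fbasis k D P N c b" and t: "t \<in> N"
  shows "\<exists>\<kappa>. coord0 k P N c b t \<kappa>"
proof -
  have "(t, \<lambda>i. 0) \<in> (SIGMA s:N. Mor D (c s) (c t))" using t by (simp add: MorD NV_zero)
  then obtain \<kappa> where "\<kappa> \<in> mod_hom k (At P (c t)) (self_mod k)"
    "\<forall>j\<in>(SIGMA s:N. Mor D (c s) (c t)). \<kappa> ((\<lambda>(s, w). Act P (c s) (c t) w (b s)) j) = (if j = (t, \<lambda>i. 0) then \<one>\<^bsub>k\<^esub> else \<zero>\<^bsub>k\<^esub>)"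
    using fbasis_lbasis[OF B fbasis_obj[OF B t]] unfolding lbasis_def by blast
  then show ?thesis using t unfolding coord0_def by auto
qed

lemma coord0_one:
  assumes B: "fbasis k D P N c b" and \<kappa>: "coord0 k P N c b t \<kappa>"
  shows "\<kappa> (b t) = \<one>\<^bsub>k\<^esub>"
proof -
  have t: "t \<in> N" using \<kappa> by (simp add: coord0_def)
  have "Act P (c t) (c t) (\<lambda>i. 0) (b t) = b t"
    using kCmod_id[OF fbasis_kCmod[OF B] fbasis_obj[OF B t] fbasis_in[OF B t]] by simp
  moreover have "(\<lambda>i. 0) \<in> Mor D (c t) (c t)" by (simp add: MorD NV_zero)
  ultimately show ?thesis using \<kappa> t unfolding coord0_def by metis
qed

text \<open>Acting by \<open>u \<noteq> 0\<close> turns a translate along \<open>w\<close> into one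
  along \<open>u + w \<noteq> 0\<close>, which has no component on the generator.\<close>

lemma coord0_image:
  assumes k: "cring k" and B: "fbasis k D P N c b" and \<kappa>: "coord0 k P N c b t \<kappa>"
    and u: "u \<in> Mor D e (c t)" "u \<noteq> (\<lambda>i. 0)" "e \<in> Obj D" and x: "x \<in> carrier (At P e)"
  shows "\<kappa> (Act P e (c t) u x) = \<zero>\<^bsub>k\<^esub>"
proof -
  have t: "t \<in> N" and h: "\<kappa> \<in> mod_hom k (At P (c t)) (self_mod k)" using \<kappa> by (simp_all add: coord0_def)
  note P = fbasis_kCmod[OF B] and ct = fbasis_obj[OF B]
  have z: "(\<lambda>_. \<zero>\<^bsub>self_mod k\<^esub>) \<in> mod_hom k (At P e) (self_mod k)"
    by (rule mod_hom_const_zero[OF kCmod_module[OF P u(3)] self_mod_module[OF k]])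
  have "\<kappa> (Act P e (c t) u x) = \<zero>\<^bsub>self_mod k\<^esub>"
  proof (rule lbasis_ext[OF fbasis_lbasis[OF B u(3)] self_mod_module[OF k] mod_hom_comp[OF kCmod_act[OF P u(3) ct[OF t] u(1)] h] z _ x])
    fix i assume "i \<in> (SIGMA t:N. Mor D (c t) e)"
    then obtain s w where i: "i = (s, w)" "s \<in> N" "w \<in> Mor D (c s) e" by auto
    have "(\<lambda>i. u i + w i) \<noteq> (\<lambda>i. 0)" using u(2) by (auto simp: fun_eq_iff)
    moreover have "(\<lambda>i. u i + w i) \<in> Mor D (c s) (c t)"
      using cat_comp[OF category_D ct[OF i(2)] u(3) ct[OF t] i(3) u(1)] by simp
    ultimately have "\<kappa> (Act P (c s) (c t) (\<lambda>i. u i + w i) (b s)) = \<zero>\<^bsub>k\<^esub>" using \<kappa> i(2) by (auto simp: coord0_def)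
    then show "\<kappa> (Act P e (c t) u ((\<lambda>(t, w). Act P (c t) e w (b t)) i)) = \<zero>\<^bsub>self_mod k\<^esub>"
      using kCmod_comp[OF P ct[OF i(2)] u(3) ct[OF t] i(3) u(1) fbasis_in[OF B i(2)]] i(1) by simp
  qed
  then show ?thesis by simp
qed

text \<open>If the coordinate at \<open>b\<^sub>t\<close> did not vanish on the kernel, the hyperplane on which it vanishes would
  still map onto the target.\<close>

lemma kernel_coord0:
  assumes k: "field k" and B: "fbasis k D P N c b" and \<kappa>: "coord0 k P N c b t \<kappa>"
    and cov: "projective_cover k D P M f" and x: "x \<in> carrier (At P (c t))" "f (c t) x = \<zero>\<^bsub>At M (c t)\<^esub>"
  shows "\<kappa> x = \<zero>\<^bsub>k\<^esub>"
proof (rule ccontr)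
  interpret k: field k by (rule k)
  have ck: "cring k" by (rule k.is_cring)
  assume nz: "\<kappa> x \<noteq> \<zero>\<^bsub>k\<^esub>"
  have t: "t \<in> N" and h: "\<kappa> \<in> mod_hom k (At P (c t)) (self_mod k)" using \<kappa> by (simp_all add: coord0_def)
  note P = fbasis_kCmod[OF B] and ct = fbasis_obj[OF B t]
  have M: "is_kCmod k D M" and f: "f \<in> nat_trans k D P M" and ep: "epic D P M f"
    and sup: "\<And>(K :: (nat \<Rightarrow> int, nat \<Rightarrow> nat, 'a, 'c) fmod) g. g \<in> nat_trans k D K P \<Longrightarrow> is_kCmod k D K \<Longrightarrow>
       epic D K P g \<longleftrightarrow> epic D K M (\<lambda>c. f c \<circ> g c)"
    using cov unfolding projective_cover_def superfluous_epi_def by blast+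
  let ?H = "{y \<in> carrier (At P (c t)). \<kappa> y = \<zero>\<^bsub>k\<^esub>}"
  \<comment> \<open>\<open>K\<close> is the hyperplane at \<open>c t\<close> and all of
    \<open>P\<close> elsewhere. It is a subfunctor because non-identity morphisms into
    \<open>c t\<close> land in the hyperplane by \<open>coord0_image\<close>.\<close>
  define K where "K = \<lparr>At = (\<lambda>e. if e = c t then (At P e)\<lparr>carrier := ?H\<rparr> else At P e), Act = Act P\<rparr>"
  have Kc: "carrier (At K e) = (if e = c t then ?H else carrier (At P e))" for e by (simp add: K_def)
  have sub: "carrier (At K e) \<subseteq> carrier (At P e)" for e by (auto simp: Kc)
  have Ko: "add (At K e) = add (At P e)" "smult (At K e) = smult (At P e)" "zero (At K e) = zero (At P e)" for e
    by (simp_all add: K_def)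
  have sH: "submodule ?H k (At P (c t))"
    using submodule_vimage[OF kCmod_module[OF P ct] self_mod_module[OF ck] h zero_submodule[OF self_mod_module[OF ck]]] by simp
  have Kact: "Act P e e' u y \<in> carrier (At K e')" if a: "e \<in> Obj D" "e' \<in> Obj D" "u \<in> Mor D e e'" "y \<in> carrier (At K e)" for e e' u y
  proof (cases "e' = c t")
    case True
    have "\<kappa> (Act P e e' u y) = \<zero>\<^bsub>k\<^esub>"
    proof (cases "u = (\<lambda>i. 0)")
      case False
      then show ?thesis using coord0_image[OF ck B \<kappa>, of u e y] a sub True by auto
    next
      case u: True
      then have "e = e'" using a(3) by (simp add: MorD)
      then show ?thesis using u a(4) True kCmod_id[OF P ct, of y] by (simp add: Kc)
    qed
    then show ?thesis using True mod_homD(1)[OF kCmod_act[OF P a(1-3)]] a(4) sub by (auto simp: Kc)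
  next
    case False
    then show ?thesis using mod_homD(1)[OF kCmod_act[OF P a(1-3)]] a(4) sub by (auto simp: Kc)
  qed
  have KM: "is_kCmod k D K"
  proof (rule is_kCmodI)
    show "Module.module k (At K e)" if e: "e \<in> Obj D" for e
    proof (cases "e = c t")
      case True
      interpret Module.module k "At P (c t)" by (rule kCmod_module[OF P ct])
      show ?thesis using submodule.submodule_is_module[OF sH module_axioms] True by (simp add: K_def)
    next
      case False
      then show ?thesis using kCmod_module[OF P e] by (simp add: K_def)
    qed
    show "Act K e e' u \<in> mod_hom k (At K e) (At K e')" if a: "e \<in> Obj D" "e' \<in> Obj D" "u \<in> Mor D e e'" for e e' u
    proof (rule mod_homI)
      have A: "Act K e e' u = Act P e e' u" by (simp add: K_def)
      note h = kCmod_act[OF P a]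
      fix y assume y: "y \<in> carrier (At K e)"
      show "Act K e e' u y \<in> carrier (At K e')" unfolding A by (rule Kact[OF a y])
      show "Act K e e' u (q \<odot>\<^bsub>At K e\<^esub> y) = q \<odot>\<^bsub>At K e'\<^esub> Act K e e' u y" if "q \<in> carrier k" for q
        unfolding A Ko by (rule mod_homD(3)[OF h that subsetD[OF sub y]])
      fix z assume z: "z \<in> carrier (At K e)"
      show "Act K e e' u (y \<oplus>\<^bsub>At K e\<^esub> z) = Act K e e' u y \<oplus>\<^bsub>At K e'\<^esub> Act K e e' u z"
        unfolding A Ko by (rule mod_homD(2)[OF h subsetD[OF sub y] subsetD[OF sub z]])
    qed
    show "Act K e e (Id D e) y = y" if "e \<in> Obj D" "y \<in> carrier (At K e)" for e y
      using kCmod_id[OF P that(1) subsetD[OF sub that(2)]] by (simp add: K_def)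
    show "Act K a d (Comp D v u) x = Act K b d v (Act K a b u x)"
      if "a \<in> Obj D" "b \<in> Obj D" "d \<in> Obj D" "u \<in> Mor D a b" "v \<in> Mor D b d" "x \<in> carrier (At K a)" for a b d u v x
      using kCmod_comp[OF P that(1-5) subsetD[OF sub that(6)]] by (simp add: K_def)
  qed
  have "(\<lambda>y. y) \<in> mod_hom k (At K e) (At P e)" for e
    by (rule mod_homI) (simp_all add: Ko subsetD[OF sub])
  then have g: "(\<lambda>e y. y) \<in> nat_trans k D K P"
    unfolding nat_trans_def by (simp add: K_def)
  have "epic D K M (\<lambda>e. f e \<circ> (\<lambda>y. y))"
    unfolding epic_def
  proof
    fix e assume e: "e \<in> Obj D"
    have Pe: "f e ` carrier (At P e) = carrier (At M e)" using ep e by (simp add: epic_def)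
    show "(f e \<circ> (\<lambda>y. y)) ` carrier (At K e) = carrier (At M e)"
    proof (cases "e = c t")
      case False
      then show ?thesis using Pe by (auto simp: Kc)
    next
      case True
      interpret Pt: Module.module k "At P (c t)" by (rule kCmod_module[OF P ct])
      interpret Mt: Module.module k "At M (c t)" by (rule kCmod_module[OF M ct])
      note fh = nat_trans_hom[OF f ct]
      have "f e y \<in> f e ` ?H" if y: "y \<in> carrier (At P (c t))" for y
      proof -
        \<comment> \<open>Subtracting this multiple of \<open>x\<close> cancels the coordinate of
          \<open>y\<close> and leaves the image under \<open>f\<close> unchanged, as
          \<open>f\<close> kills \<open>x\<close>.\<close>
        let ?q = "\<kappa> y \<otimes>\<^bsub>k\<^esub> inv\<^bsub>k\<^esub> (\<kappa> x)"
        let ?y = "y \<ominus>\<^bsub>At P (c t)\<^esub> ?q \<odot>\<^bsub>At P (c t)\<^esub> x"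
        have kx: "\<kappa> x \<in> carrier k" "\<kappa> y \<in> carrier k" using mod_homD(1)[OF h] x y by auto
        have ix: "inv\<^bsub>k\<^esub> (\<kappa> x) \<in> carrier k" "inv\<^bsub>k\<^esub> (\<kappa> x) \<otimes>\<^bsub>k\<^esub> \<kappa> x = \<one>\<^bsub>k\<^esub>"
          using k.field_Units kx nz by auto
        have q: "?q \<in> carrier k" using kx ix by simp
        have qx: "?q \<odot>\<^bsub>At P (c t)\<^esub> x \<in> carrier (At P (c t))" using q x by simp
        have "\<kappa> ?y = \<kappa> y \<ominus>\<^bsub>self_mod k\<^esub> \<kappa> (?q \<odot>\<^bsub>At P (c t)\<^esub> x)"
          by (rule mod_hom_minus'[OF Pt.module_axioms self_mod_module[OF ck] h y qx])
        also have "\<kappa> (?q \<odot>\<^bsub>At P (c t)\<^esub> x) = \<kappa> y"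
          using mod_homD(3)[OF h q x(1)] kx ix by (simp add: k.m_assoc)
        also have "\<kappa> y \<ominus>\<^bsub>self_mod k\<^esub> \<kappa> y = \<zero>\<^bsub>k\<^esub>"
          using abelian_group.r_neg[OF module.axioms(2)[OF self_mod_module[OF ck]], of "\<kappa> y"] kx by (simp add: a_minus_def)
        finally have "\<kappa> ?y = \<zero>\<^bsub>k\<^esub>" .
        moreover have "f e ?y = f e y \<ominus>\<^bsub>At M (c t)\<^esub> f e (?q \<odot>\<^bsub>At P (c t)\<^esub> x)"
          unfolding True by (rule mod_hom_minus'[OF Pt.module_axioms Mt.module_axioms fh y qx])
        moreover have "f e (?q \<odot>\<^bsub>At P (c t)\<^esub> x) = \<zero>\<^bsub>At M (c t)\<^esub>"
          unfolding True using mod_homD(3)[OF fh q x(1)] x(2) Mt.smult_r_null[OF q] by simp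
        moreover have "f e y \<in> carrier (At M (c t))" unfolding True by (rule mod_homD(1)[OF fh y])
        ultimately have "f e ?y = f e y" by (simp add: a_minus_def Mt.M.a_inv_zero)
        moreover have "?y \<in> ?H" using \<open>\<kappa> ?y = \<zero>\<^bsub>k\<^esub>\<close> y qx by simp
        ultimately show ?thesis by (metis (no_types, lifting) imageI)
      qed
      then have "f e ` ?H = f e ` carrier (At P (c t))" by auto
      then show ?thesis using Pe True by (simp add: Kc o_def)
    qed
  qed
  \<comment> \<open>Superfluity turns this into surjectivity of the inclusion of \<open>K\<close>,
    which contradicts \<open>\<kappa> x \<noteq> 0\<close>.\<close>
  then have "epic D K P (\<lambda>e y. y)" using sup[OF g KM] by simp
  then have "carrier (At K (c t)) = carrier (At P (c t))" using ct by (simp add: epic_def)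
  then have "?H = carrier (At P (c t))" unfolding Kc by (simp only: if_True simp_thms)
  then show False using x nz by blast
qed

text \<open>Without a generator at \<open>e\<close>, every basis vector is a translate along a
  non-isomorphism and dies in the quotient. With one, the functional of \<open>coord0\<close>
  vanishes on all such translates but not on \<open>b t\<close>.\<close>

lemma S_quot_nonzero:
  assumes k: "field k" and B: "fbasis k D P N c b" and e: "e \<in> Obj D"
  shows "carrier (S_quot k D P e) \<noteq> {\<zero>\<^bsub>S_quot k D P e\<^esub>} \<longleftrightarrow> (\<exists>t\<in>N. c t = e)"
proof -
  interpret k: field k by (rule k)
  have ck: "cring k" by (rule k.is_cring)
  note P = fbasis_kCmod[OF B] and ct = fbasis_obj[OF B]
  let ?X = "\<Union>b\<in>Obj D. \<Union>u\<in>{u \<in> Mor D b e. \<not> iso_mor D b e u}. Act P b e u ` carrier (At P b)"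
  let ?H = "mod_span k (At P e) ?X"
  have X: "?X \<subseteq> carrier (At P e)" using mod_homD(1)[OF kCmod_act[OF P _ e]] by blast
  note Pe = kCmod_module[OF P e]
  interpret Q: quotient_module k "At P e" ?H
    using Pe mod_span_submodule(1)[OF Pe X] by (simp add: quotient_module_def quotient_module_axioms_def)
  have Sq: "S_quot k D P e = quot_mod (At P e) ?H" by (simp add: S_quot_def)
  have Xin: "x \<in> ?H" if "x \<in> ?X" for x using mod_span_submodule(2)[OF Pe X] that by blast
  show ?thesis
  proof
    assume ne: "carrier (S_quot k D P e) \<noteq> {\<zero>\<^bsub>S_quot k D P e\<^esub>}"
    show "\<exists>t\<in>N. c t = e"
    proof (rule ccontr)
      assume no: "\<not> (\<exists>t\<in>N. c t = e)"
      have all: "x \<in> ?H" if x: "x \<in> carrier (At P e)" for x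
      proof (rule lbasis_induct_submodule[OF fbasis_lbasis[OF B e] Q.sub _ x])
        fix i assume "i \<in> (SIGMA t:N. Mor D (c t) e)"
        then obtain t w where i: "i = (t, w)" "t \<in> N" "w \<in> Mor D (c t) e" by auto
        have "w \<noteq> (\<lambda>i. 0)" using i no by (auto simp: MorD)
        then have "\<not> iso_mor D (c t) e w" using iso_D[OF i(3)] by simp
        then have "Act P (c t) e w (b t) \<in> ?X" using i ct fbasis_in[OF B] by blast
        then show "(\<lambda>(t, w). Act P (c t) e w (b t)) i \<in> ?H" using Xin i(1) by simp
      qed
      have "Y = \<zero>\<^bsub>quot_mod (At P e) ?H\<^esub>" if "Y \<in> carrier (quot_mod (At P e) ?H)" for Y
        using that all Q.proj_eq_zero unfolding Q.coset_carrier by blast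
      moreover have "\<zero>\<^bsub>quot_mod (At P e) ?H\<^esub> \<in> carrier (quot_mod (At P e) ?H)" by (rule mod_zero[OF Q.quot_module])
      ultimately show False using ne unfolding Sq by blast
    qed
  next
    assume "\<exists>t\<in>N. c t = e"
    then obtain t where t: "t \<in> N" "c t = e" by blast
    obtain \<kappa> where \<kappa>: "coord0 k P N c b t \<kappa>" using coord0_exists[OF B t(1)] by blast
    have h: "\<kappa> \<in> mod_hom k (At P e) (self_mod k)" using \<kappa> t by (simp add: coord0_def)
    have k0: "\<kappa> x \<in> {\<zero>\<^bsub>self_mod k\<^esub>}" if "x \<in> ?H" for x
    proof (rule mod_span_image[OF Pe self_mod_module[OF ck] h zero_submodule[OF self_mod_module[OF ck]] X _ that])
      fix s assume "s \<in> ?X"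
      then obtain e' u y where s: "e' \<in> Obj D" "u \<in> Mor D e' e" "\<not> iso_mor D e' e u" "y \<in> carrier (At P e')" "s = Act P e' e u y" by blast
      then have "u \<noteq> (\<lambda>i. 0)" using iso_D by blast
      then show "\<kappa> s \<in> {\<zero>\<^bsub>self_mod k\<^esub>}" using coord0_image[OF ck B \<kappa>] s t(2) by auto
    qed
    have "b t \<notin> ?H"
    proof
      assume "b t \<in> ?H"
      from k0[OF this] show False using coord0_one[OF B \<kappa>] k.one_not_zero by simp
    qed
    moreover have bt: "b t \<in> carrier (At P e)" using fbasis_in[OF B t(1)] t(2) by simp
    ultimately have "?H +>\<^bsub>At P e\<^esub> b t \<noteq> \<zero>\<^bsub>quot_mod (At P e) ?H\<^esub>" using Q.proj_eq_zero by blast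
    moreover have "?H +>\<^bsub>At P e\<^esub> b t \<in> carrier (quot_mod (At P e) ?H)" using Q.coset_carrier bt by blast
    ultimately show "carrier (S_quot k D P e) \<noteq> {\<zero>\<^bsub>S_quot k D P e\<^esub>}" unfolding Sq by blast
  qed
qed

end

section \<open>Dimension shifting along covers and the radical of a free functor\<close>

context vsys begin

lemma Tex_step_quotient:
  assumes cov: "projective_cover k D P M f" and K: "is_kCmod k D (ker_fmod P M f)"
    and exP: "Tex A (G P) (ac P) (Suc p)" and exK: "Tex A (G (ker_fmod P M f)) (ac (ker_fmod P M f)) p"
  shows "Tex A (G M) (ac M) (Suc p)"
proof -
  have "is_kCmod k D P" "is_kCmod k D M" "f \<in> nat_trans k D P M" "epic D P M f"
    using cov by (simp_all add: projective_cover_def superfluous_epi_def is_projective_def)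
  then show ?thesis by (rule lsys_ses.exact_quotient[OF lsys_ses_G[OF _ _ _ _ K] exP exK])
qed

lemma ob_Nil: "ob [] = d"
  by (simp add: E_Nil)

lemma T0_in: assumes "z \<in> carrier (Tm A (G P) 0)" shows "z [] \<in> carrier (At P d)" "z = Tin A (G P) 0 [] (z [])"
  using assms ob_Nil A_Nil by (auto simp: Tm_carrier PiE_iff extensional_def dsum_in_def fun_eq_iff)

end

context koszul_sys begin

text \<open>The boundaries in degree 0 are the radical of \<open>P(d)\<close>: the translate of a
  generator along \<open>w \<noteq> 0\<close> is the boundary of a one-entry list \<open>[i]\<close>
  with \<open>i\<close> in the support of \<open>w\<close>. If the coordinates of \<open>x\<close>
  at the generators in degree \<open>d\<close> vanish, then \<open>x\<close> lies in the span of
  these translates.\<close>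

lemma rad_boundary:
  assumes B: "fbasis k D P N c b" and x: "x \<in> carrier (At P d)"
    and cx: "\<And>t \<kappa>. c t = d \<Longrightarrow> coord0 k P N c b t \<kappa> \<Longrightarrow> \<kappa> x = \<zero>\<^bsub>k\<^esub>"
  shows "Tin (lists {..<n}) (G P) 0 [] x \<in> bd (lists {..<n}) (G P) (ac P) 0 ` carrier (Tm (lists {..<n}) (G P) (Suc 0))"
proof -
  interpret k: cring k by (rule k)
  let ?A = "lists {..<n}"
  note P = fbasis_kCmod[OF B] and ct = fbasis_obj[OF B]
  interpret lsys k ?A "G P" "ac P" by (rule lsys_G[OF P])
  let ?I = "SIGMA t:N. Mor D (c t) d"
  let ?\<beta> = "\<lambda>(t, w). Act P (c t) d w (b t)"
  note LB = fbasis_lbasis[OF B d] and Pd = kCmod_module[OF P d]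
  let ?im = "bd ?A (G P) (ac P) 0 ` carrier (Tm ?A (G P) (Suc 0))"
  let ?H = "{x \<in> carrier (At P d). Tin ?A (G P) 0 [] x \<in> ?im}"
  have inh: "Tin ?A (G P) 0 [] \<in> mod_hom k (At P d) (Tm ?A (G P) 0)"
    using Tin_hom[of "[]" 0] by (simp add: E_Nil)
  have sH: "submodule ?H k (At P d)"
    by (rule submodule_vimage[OF Pd modT inh submodule_image[OF modT modT bd_hom]])
  have gen: "Act P (c t) d w (b t) \<in> ?H" if t: "t \<in> N" "w \<in> Mor D (c t) d" "w \<noteq> (\<lambda>i. 0)" for t w
  proof -
    obtain i where i: "w i \<noteq> 0" using t(3) by auto
    then have "i < n" using t(2) by (auto simp: MorD NV_def not_less[symmetric])
    moreover have "simplex_exp [i] \<le> w" using i by (auto simp: simplex_exp_def le_fun_def)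
    ultimately have s: "([i], t, w) \<in> strands N c" using t by (auto simp: strands_def)
    have s0: "([], t, w) \<in> strands N c" using t by (auto simp: strands_def simplex_exp_def le_fun_def)
    have "bd ?A (G P) (ac P) 0 (sgen P c b ([i], t, w)) = sgen P c b ([], t, w) \<ominus>\<^bsub>Tm ?A (G P) 0\<^esub> \<zero>\<^bsub>Tm ?A (G P) 0\<^esub>"
      using bd_sgen[OF B s] by simp
    also have "\<dots> = sgen P c b ([], t, w)"
    proof -
      interpret T0: Module.module k "Tm ?A (G P) 0" by (rule modT)
      have "sgen P c b ([], t, w) \<in> carrier (Tm ?A (G P) 0)" by (rule lbasis_closed[OF T_basis[OF B]]) (use s0 in auto)
      then show ?thesis by (simp add: a_minus_def T0.M.a_inv_zero)
    qed
    also have "\<dots> = Tin ?A (G P) 0 [] (Act P (c t) d w (b t))" by (simp add: sgen_def E_Nil)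
    finally have "Tin ?A (G P) 0 [] (Act P (c t) d w (b t)) = bd ?A (G P) (ac P) 0 (sgen P c b ([i], t, w))" by simp
    moreover have "sgen P c b ([i], t, w) \<in> carrier (Tm ?A (G P) (Suc 0))"
      by (rule lbasis_closed[OF T_basis[OF B]]) (use s in auto)
    ultimately show ?thesis using mod_homD(1)[OF kCmod_act[OF P ct[OF t(1)] d t(2)] fbasis_in[OF B t(1)]] by auto
  qed
  \<comment> \<open>The projection that forgets the generators in degree \<open>d\<close>; by
    hypothesis it fixes \<open>x\<close>.\<close>
  let ?e = "\<lambda>i. if snd i = (\<lambda>i. 0) then \<zero>\<^bsub>At P d\<^esub> else ?\<beta> i"
  have "\<exists>e\<in>mod_hom k (At P d) (At P d). \<forall>i\<in>?I. e (?\<beta> i) = ?e i"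
    by (rule lbasis_lift[OF k LB Pd]) (use lbasis_closed[OF LB] mod_zero[OF Pd] in \<open>auto split: if_splits\<close>)
  then obtain e where e: "e \<in> mod_hom k (At P d) (At P d)" "\<And>i. i \<in> ?I \<Longrightarrow> e (?\<beta> i) = ?e i" by blast
  have "e x = x"
  proof (rule lbasis_eqI[OF k LB mod_homD(1)[OF e(1) x] x])
    fix \<kappa> i assume i: "i \<in> ?I" and h: "\<kappa> \<in> mod_hom k (At P d) (self_mod k)"
      and \<kappa>: "\<And>j. j \<in> ?I \<Longrightarrow> \<kappa> (?\<beta> j) = (if j = i then \<one>\<^bsub>k\<^esub> else \<zero>\<^bsub>k\<^esub>)"
    note S = self_mod_module[OF k]
    have kz: "\<kappa> \<zero>\<^bsub>At P d\<^esub> = \<zero>\<^bsub>k\<^esub>" using mod_hom_zero[OF Pd S h] by simp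
    show "\<kappa> (e x) = \<kappa> x"
    proof (cases "snd i = (\<lambda>i. 0)")
      case False
      show ?thesis
        by (rule lbasis_ext[OF LB S mod_hom_comp[OF e(1) h] h _ x], subst e(2), assumption)
          (use False \<kappa> kz in \<open>auto split: if_splits\<close>)
    next
      case True
      have "\<kappa> (e x) = \<zero>\<^bsub>self_mod k\<^esub>"
        by (rule lbasis_ext[OF LB S mod_hom_comp[OF e(1) h] mod_hom_const_zero[OF Pd S] _ x], subst e(2), assumption)
          (use True \<kappa> kz in \<open>auto split: if_splits\<close>)
      moreover have "\<kappa> x = \<zero>\<^bsub>k\<^esub>"
      proof (rule cx)
        show ci: "c (fst i) = d" using True i by (auto simp: MorD)
        show "coord0 k P N c b (fst i) \<kappa>"
          unfolding coord0_def ci using i h \<kappa> True by (auto simp: prod_eq_iff)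
      qed
      ultimately show ?thesis by simp
    qed
  qed
  moreover have "x \<in> {x \<in> carrier (At P d). e x \<in> ?H}"
  proof (rule lbasis_induct_submodule[OF LB submodule_vimage[OF Pd Pd e(1) sH] _ x])
    fix i assume i: "i \<in> ?I"
    show "?\<beta> i \<in> {x \<in> carrier (At P d). e x \<in> ?H}"
      using e(2)[OF i] gen[of "fst i" "snd i"] i lbasis_closed[OF LB i] submodule_zero[OF sH] by (auto split: if_splits)
  qed
  ultimately show ?thesis by simp
qed

text \<open>Conversely, a boundary involves only translates along exponents that contain some
  variable, hence nonzero ones.\<close>

lemma boundary_coord0:
  assumes B: "fbasis k D P N c b" and y: "y \<in> carrier (Tm (lists {..<n}) (G P) (Suc 0))"
    and t: "c t = d" "coord0 k P N c b t \<kappa>"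
  shows "\<kappa> (bd (lists {..<n}) (G P) (ac P) 0 y []) = \<zero>\<^bsub>k\<^esub>"
proof -
  let ?A = "lists {..<n}"
  note P = fbasis_kCmod[OF B]
  interpret lsys k ?A "G P" "ac P" by (rule lsys_G[OF P])
  have ev: "(\<lambda>z. z []) \<in> mod_hom k (Tm ?A (G P) 0) (At P d)"
    by (rule mod_homI) (auto simp: Tm_def dsum_sel E_Nil PiE_iff)
  have h: "\<kappa> \<in> mod_hom k (At P d) (self_mod k)" using t by (simp add: coord0_def)
  note S = self_mod_module[OF k]
  have "\<kappa> (bd ?A (G P) (ac P) 0 y []) = \<zero>\<^bsub>self_mod k\<^esub>"
  proof (rule lbasis_ext[OF T_basis[OF B] S mod_hom_comp[OF bd_hom mod_hom_comp[OF ev h]] mod_hom_const_zero[OF modT S] _ y])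
    fix i assume "i \<in> {(L, s). (L, s) \<in> strands N c \<and> length L = Suc 0}"
    then obtain v s \<mu> where i: "i = ([v], s, \<mu>)" "([v], s, \<mu>) \<in> strands N c" by (auto simp: length_Suc_conv)
    interpret T0: Module.module k "Tm ?A (G P) 0" by (rule modT)
    have s: "s \<in> N" "\<mu> \<in> Mor D (c s) d" "simplex_exp [v] \<le> \<mu>" using i(2) by (auto simp: strands_def)
    have "\<mu> v \<noteq> 0" using le_funD[OF s(3), of v] by (auto simp: simplex_exp_def)
    then have m: "\<mu> \<noteq> (\<lambda>i. 0)" by auto
    have s0: "([], s, \<mu>) \<in> strands N c" using s by (auto simp: strands_def simplex_exp_def le_fun_def)
    have "sgen P c b ([], s, \<mu>) \<in> carrier (Tm ?A (G P) 0)" by (rule lbasis_closed[OF T_basis[OF B]]) (use s0 in auto)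
    then have "bd ?A (G P) (ac P) 0 (sgen P c b i) = sgen P c b ([], s, \<mu>)"
      using bd_sgen[OF B i(2)] i(1) by (simp add: a_minus_def T0.M.a_inv_zero)
    moreover have "sgen P c b ([], s, \<mu>) [] = Act P (c s) d \<mu> (b s)" by (simp add: sgen_def dsum_in_def E_Nil)
    ultimately have "bd ?A (G P) (ac P) 0 (sgen P c b i) [] = Act P (c s) d \<mu> (b s)" by simp
    moreover have "\<kappa> (Act P (c s) d \<mu> (b s)) = \<zero>\<^bsub>k\<^esub>" using t m s by (auto simp: coord0_def)
    ultimately show "\<kappa> (bd ?A (G P) (ac P) 0 (sgen P c b i) []) = \<zero>\<^bsub>self_mod k\<^esub>" by simp
  qed
  then show ?thesis by simp
qed

text \<open>By minimality the kernel of the cover has no components on generators, so in degree 0 it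
  consists of boundaries of \<open>P\<close>; this is the input that \<open>exact_sub\<close> asks
  for. If \<open>P\<close> had a generator in degree \<open>d\<close>, its image would be a boundary
  in \<open>M\<close>, so the generator would differ from a boundary of \<open>P\<close> by an
  element of the kernel. Both have coordinate 0 at the generator, which itself has coordinate
  1.\<close>

lemma koszul_step:
  assumes fk: "field k" and B: "fbasis k D P N c b" and cov: "projective_cover k D P M f" and K: "is_kCmod k D (ker_fmod P M f)"
    and ex: "\<And>p. Tex (lists {..<n}) (G M) (ac M) p"
  shows "\<And>p. Tex (lists {..<n}) (G (ker_fmod P M f)) (ac (ker_fmod P M f)) p" and "\<And>t. t \<in> N \<Longrightarrow> c t \<noteq> d"
proof -
  let ?A = "lists {..<n}"
  let ?K = "ker_fmod P M f"
  have P: "is_kCmod k D P" and M: "is_kCmod k D M" and f: "f \<in> nat_trans k D P M" and ep: "epic D P M f"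
    using cov by (simp_all add: projective_cover_def superfluous_epi_def is_projective_def)
  interpret E: lsys_ses k ?A "G ?K" "ac ?K" "G P" "ac P" "G M" "ac M" "\<lambda>L x. x" "\<lambda>L. f (ob L)"
    by (rule lsys_ses_G[OF P M f ep K])
  have ker: "\<kappa> x = \<zero>\<^bsub>k\<^esub>" if "x \<in> carrier (At P d)" "f d x = \<zero>\<^bsub>At M d\<^esub>" "c t = d" "coord0 k P N c b t \<kappa>" for x t \<kappa>
    using kernel_coord0[OF fk B that(4) cov] that by simp
  show "Tex ?A (G ?K) (ac ?K) p" for p
  proof (rule E.exact_sub[OF _ ex])
    show "Tmap ?A p (\<lambda>L x. x) ` Tcyc ?A (G ?K) (ac ?K) p \<subseteq> bd ?A (G P) (ac P) p ` carrier (Tm ?A (G P) (Suc p))"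
    proof
      fix y assume "y \<in> Tmap ?A p (\<lambda>L x. x) ` Tcyc ?A (G ?K) (ac ?K) p"
      then obtain z where z: "z \<in> Tcyc ?A (G ?K) (ac ?K) p" "y = Tmap ?A p (\<lambda>L x. x) z" by blast
      have zc: "z \<in> carrier (Tm ?A (G ?K) p)" using z(1) by (simp add: Tcyc_def)
      have y: "y \<in> carrier (Tm ?A (G P) p)" unfolding z(2) by (rule mod_homD(1)[OF E.i.Tmap_hom zc])
      show "y \<in> bd ?A (G P) (ac P) p ` carrier (Tm ?A (G P) (Suc p))"
      proof (cases p)
        case (Suc q)
        have zc': "z \<in> carrier (Tm ?A (G ?K) (Suc q))" using zc Suc by simp
        have "bd ?A (G P) (ac P) q y = Tmap ?A q (\<lambda>L x. x) (bd ?A (G ?K) (ac ?K) q z)"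
          unfolding z(2) Suc by (rule E.i.Tmap_bd[OF zc', symmetric])
        also have "\<dots> = \<zero>\<^bsub>Tm ?A (G P) q\<^esub>"
          using z(1) Suc mod_hom_zero[OF E.i.G.modT E.i.G'.modT E.i.Tmap_hom] by (simp add: Tcyc_def)
        finally have "y \<in> Tcyc ?A (G P) (ac P) p" using y Suc by (simp add: Tcyc_def)
        then show ?thesis using Tex_koszul_free[OF B, of q] Suc unfolding Tex_def by blast
      next
        case 0
        have y0: "y [] \<in> carrier (At P d)" "y = Tin ?A (G P) 0 [] (y [])" using T0_in[of y P] y 0 by auto
        have "y [] = z []" using z(2) 0 by (simp add: Tmap_def)
        moreover have "z [] \<in> carrier (At ?K d)" using T0_in(1)[of z ?K] zc 0 by simp
        ultimately have "f d (y []) = \<zero>\<^bsub>At M d\<^esub>" by (simp add: ker_fmod_def a_kernel_def')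
        then have "Tin ?A (G P) 0 [] (y []) \<in> bd ?A (G P) (ac P) 0 ` carrier (Tm ?A (G P) (Suc 0))"
          by (intro rad_boundary[OF B y0(1)]) (rule ker[OF y0(1)])
        then show ?thesis using y0(2) 0 by simp
      qed
    qed
  qed
  fix t assume t: "t \<in> N"
  show "c t \<noteq> d"
  proof
    assume td: "c t = d"
    obtain \<kappa> where \<kappa>: "coord0 k P N c b t \<kappa>" using coord0_exists[OF B t] by blast
    have bt: "b t \<in> carrier (At P d)" using fbasis_in[OF B t] td by simp
    have fb: "f d (b t) \<in> carrier (At M d)" by (rule mod_homD(1)[OF nat_trans_hom[OF f d] bt])
    have "Tin ?A (G M) 0 [] (f d (b t)) \<in> carrier (Tm ?A (G M) 0)"
      by (rule E.f.G'.Tin_closed) (use fb in \<open>auto simp: E_Nil\<close>)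
    then have "Tin ?A (G M) 0 [] (f d (b t)) \<in> Tcyc ?A (G M) (ac M) 0" by (simp add: Tcyc_def)
    from TexD[OF ex this] obtain y where y: "y \<in> carrier (Tm ?A (G M) (Suc 0))"
      "bd ?A (G M) (ac M) 0 y = Tin ?A (G M) 0 [] (f d (b t))" by (elim exE conjE)
    obtain x where x: "x \<in> carrier (Tm ?A (G P) (Suc 0))" "Tmap ?A (Suc 0) (\<lambda>L. f (ob L)) x = y"
      using E.f.Tmap_surj[OF E.surj y(1)] by blast
    let ?z = "bd ?A (G P) (ac P) 0 x"
    have zc: "?z \<in> carrier (Tm ?A (G P) 0)" by (rule mod_homD(1)[OF E.i.G'.bd_hom x(1)])
    have z0: "?z [] \<in> carrier (At P d)" by (rule T0_in(1)[OF zc])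
    have "Tmap ?A 0 (\<lambda>L. f (ob L)) ?z = Tin ?A (G M) 0 [] (f d (b t))"
      using E.f.Tmap_bd[OF x(1)] x(2) y(2) by simp
    then have "Tmap ?A 0 (\<lambda>L. f (ob L)) ?z [] = Tin ?A (G M) 0 [] (f d (b t)) []" by simp
    then have fz: "f d (?z []) = f d (b t)" by (simp add: Tmap_def dsum_in_def E_Nil)
    interpret Pd: Module.module k "At P d" by (rule kCmod_module[OF P d])
    interpret Md: Module.module k "At M d" by (rule kCmod_module[OF M d])
    let ?w = "b t \<ominus>\<^bsub>At P d\<^esub> ?z []"
    have w: "?w \<in> carrier (At P d)" using bt z0 by simp
    have "f d ?w = \<zero>\<^bsub>At M d\<^esub>"
      using mod_hom_minus'[OF Pd.module_axioms Md.module_axioms nat_trans_hom[OF f d] bt z0] fz fb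
      by (simp add: a_minus_def Md.M.r_neg)
    then have kw: "\<kappa> ?w = \<zero>\<^bsub>k\<^esub>" by (rule ker[OF w _ td \<kappa>])
    have h: "\<kappa> \<in> mod_hom k (At P d) (self_mod k)" using \<kappa> td by (simp add: coord0_def)
    interpret k: field k by (rule fk)
    interpret S: Module.module k "self_mod k" by (rule self_mod_module[OF k])
    have "\<kappa> ?w = \<kappa> (b t) \<ominus>\<^bsub>self_mod k\<^esub> \<kappa> (?z [])"
      by (rule mod_hom_minus'[OF Pd.module_axioms S.module_axioms h bt z0])
    also have "\<dots> = \<one>\<^bsub>k\<^esub> \<ominus>\<^bsub>self_mod k\<^esub> \<zero>\<^bsub>self_mod k\<^esub>"
      using coord0_one[OF B \<kappa>] boundary_coord0[OF B x(1) td \<kappa>] by simp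
    also have "\<dots> = \<one>\<^bsub>k\<^esub>" using S.M.r_zero[of "\<one>\<^bsub>k\<^esub>"] S.M.a_inv_zero by (simp add: a_minus_def)
    finally show False using kw k.one_not_zero by simp
  qed
qed

end

text \<open>\<open>Zf j\<close> is the \<open>(j + 1)\<close>-st syzygy.\<close>

locale min_res = action r n a for r n a +
  fixes k :: "('k, 'x) ring_scheme" and P :: "nat \<Rightarrow> (nat \<Rightarrow> int, nat \<Rightarrow> nat, 'k, 'v) fmod" and dP eP
    and M :: "(nat \<Rightarrow> int, nat \<Rightarrow> nat, 'k, 'w) fmod"
  assumes fk: "field k" and res: "minimal_free_resolution k D P dP eP M"
begin

lemma ck: "cring k"
  using fk by (simp add: field_def domain_def)

definition "Zf j = (case j of 0 \<Rightarrow> ker_fmod (P 0) M eP | Suc i \<Rightarrow> ker_fmod (P (Suc i)) (P i) (dP i))"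

lemma cover0: "projective_cover k D (P 0) M eP"
  using res by (simp add: minimal_free_resolution_def)

lemma cover_Suc: "projective_cover k D (P (Suc j)) (Zf j) (dP j)"
  using res by (cases j) (simp_all add: minimal_free_resolution_def Zf_def)

lemma M_kCmod: "is_kCmod k D M"
  using cover0 by (simp add: projective_cover_def)

lemma Zf_kCmod: "is_kCmod k D (Zf j)"
  using cover_Suc by (simp add: projective_cover_def)

text \<open>The kernel of \<open>dP j\<close> is the same whether the target is \<open>P j\<close>
  or the syzygy inside it, as both have the same zero. Thus each syzygy is the kernel of a cover of
  the preceding one.\<close>

lemma Zf_Suc: "Zf (Suc j) = ker_fmod (P (Suc j)) (Zf j) (dP j)"
  by (cases j) (simp_all add: Zf_def ker_fmod_def a_kernel_def')

lemma Zf_0: "Zf 0 = ker_fmod (P 0) M eP"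
  by (simp add: Zf_def)

lemma P_free: "is_free k D (P i)"
  using res by (simp add: minimal_free_resolution_def)

definition "S = Obj (betti_category k D P)"

lemma S_obj: "c \<in> S \<Longrightarrow> c \<in> Obj D"
  by (simp add: S_def betti_category_def full_subcat_def)

lemma S_basis: assumes B: "fbasis k D (P i) N c b" and t: "t \<in> N" shows "c t \<in> S"
proof -
  have "carrier (S_quot k D (P i) (c t)) \<noteq> {\<zero>\<^bsub>S_quot k D (P i) (c t)\<^esub>}"
    using S_quot_nonzero[OF fk B fbasis_obj[OF B t]] t by blast
  then show ?thesis using fbasis_obj[OF B t] by (auto simp: S_def betti_category_def full_subcat_def)
qed

text \<open>By \<open>S_basis\<close> all generators of all \<open>P i\<close> have degrees in
  \<open>S\<close>, so each \<open>P i\<close> has an exact bar complex.\<close>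

lemma bar_exact:
  assumes d: "d \<in> Obj D"
  shows "Tex (bar_lists S d) (\<lambda>L. At M (obj d (head_exp L)))
    (\<lambda>L K. Act M (obj d (head_exp L)) (obj d (head_exp K)) (\<lambda>i. head_exp L i - head_exp K i)) p"
proof -
  interpret bar_sys r n a k S d by (intro bar_sys.intro bar_sys_axioms.intro action_axioms ck d)
  have exP: "Tex (bar_lists S d) (G (P i)) (ac (P i)) p" for i p
  proof -
    obtain N :: "((nat \<Rightarrow> int) \<times> 'v) set" and c b where B: "fbasis k D (P i) N c b"
      using is_free_imp_fbasis[OF ck category_D P_free] by blast
    show ?thesis by (rule Tex_bar_free[OF B S_basis[OF B]])
  qed
  note cov = projective_cover_def superfluous_epi_def is_projective_def
  \<comment> \<open>Induction on the degree for all syzygies together: degree \<open>p + 1\<close>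
    of \<open>Zf j\<close> rests on degree \<open>p\<close> of \<open>Zf (j + 1)\<close>.\<close>
  have exZ: "Tex (bar_lists S d) (G (Zf j)) (ac (Zf j)) p" for j p
  proof (induction p arbitrary: j)
    case 0
    show ?case by (rule Tex_zero_quotient[where f = "dP j", OF _ _ _ _ exP[of "Suc j"]])
        (use cover_Suc[of j] in \<open>simp_all add: cov\<close>)
  next
    case (Suc p)
    show ?case
      by (rule Tex_step_quotient[OF cover_Suc _ exP]) (use Zf_kCmod[of "Suc j"] Suc[of "Suc j"] in \<open>simp_all add: Zf_Suc\<close>)
  qed
  show ?thesis
  proof (cases p)
    case 0
    then show ?thesis using Tex_zero_quotient[where f = eP, OF _ _ _ _ exP[of 0 0]] cover0 by (simp add: cov)
  next
    case (Suc q)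
    have "Tex (bar_lists S d) (G M) (ac M) (Suc q)"
      by (rule Tex_step_quotient[OF cover0 _ exP]) (use Zf_kCmod[of 0] exZ[of 0] in \<open>simp_all add: Zf_0\<close>)
    then show ?thesis using Suc by simp
  qed
qed

text \<open>Here the induction climbs through the syzygies, with exactness in all degrees at each
  stage, and \<open>koszul_step\<close> excludes generators in degree \<open>d\<close> along the
  way.\<close>

lemma koszul_exact_not_betti:
  assumes d: "d \<in> Obj D" and ex: "\<And>p. Tex (lists {..<n}) (\<lambda>L. At M (obj d (simplex_exp L)))
    (\<lambda>L K. Act M (obj d (simplex_exp L)) (obj d (simplex_exp K)) (\<lambda>i. simplex_exp L i - simplex_exp K i)) p"
  shows "d \<notin> S"
proof -
  interpret koszul_sys r n a k d by (intro koszul_sys.intro koszul_sys_axioms.intro action_axioms ck d)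
  have basis: "\<exists>(N :: ((nat \<Rightarrow> int) \<times> 'v) set) c b. fbasis k D (P i) N c b" for i
    by (rule is_free_imp_fbasis[OF ck category_D P_free])
  have exZ: "Tex (lists {..<n}) (G (Zf j)) (ac (Zf j)) p" for j p
  proof (induction j arbitrary: p)
    case 0
    obtain N :: "((nat \<Rightarrow> int) \<times> 'v) set" and c b where B: "fbasis k D (P 0) N c b" using basis by blast
    show ?case unfolding Zf_0 by (rule koszul_step(1)[OF fk B cover0 _ ex]) (use Zf_kCmod[of 0] Zf_0 in simp)
  next
    case (Suc j)
    obtain N :: "((nat \<Rightarrow> int) \<times> 'v) set" and c b where B: "fbasis k D (P (Suc j)) N c b" using basis by blast
    show ?case unfolding Zf_Suc by (rule koszul_step(1)[OF fk B cover_Suc _ Suc]) (use Zf_kCmod[of "Suc j"] Zf_Suc in simp)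
  qed
  have "carrier (S_quot k D (P i) d) = {\<zero>\<^bsub>S_quot k D (P i) d\<^esub>}" for i
  proof -
    obtain N :: "((nat \<Rightarrow> int) \<times> 'v) set" and c b where B: "fbasis k D (P i) N c b" using basis by blast
    have "c t \<noteq> d" if "t \<in> N" for t
    proof (cases i)
      case 0
      show ?thesis by (rule koszul_step(2)[OF fk B[unfolded 0] cover0 _ ex that]) (use Zf_kCmod[of 0] Zf_0 in simp)
    next
      case (Suc j)
      show ?thesis by (rule koszul_step(2)[OF fk B[unfolded Suc] cover_Suc _ exZ that]) (use Zf_kCmod[of "Suc j"] Zf_Suc in simp)
    qed
    then show ?thesis using S_quot_nonzero[OF fk B d] by blast
  qed
  then show ?thesis by (simp add: S_def betti_category_def full_subcat_def)
qed

end

section \<open>Semigroup algebras\<close>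

text \<open>The two records can differ only in the ring multiplication and its unit, which the
  module axioms ignore.\<close>

lemma module_cong:
  assumes M: "Module.module k M" and "carrier M' = carrier M" "add M' = add M" "zero M' = zero M" "smult M' = smult M"
  shows "Module.module k M'"
proof -
  interpret M: Module.module k M by fact
  have "abelian_group M'"
    by (rule abelian_groupI) (auto simp: assms M.M.a_ac intro: M.M.l_neg)
  then show ?thesis
    by (intro moduleI M.R.cring_axioms) (simp_all add: assms M.smult_l_distr M.smult_r_distr M.smult_assoc1)
qed

locale salg = k: cring k + S: comm_monoid S for k :: "('k, 'x) ring_scheme" and S :: "('s, 'y) monoid_scheme"
begin

abbreviation "B \<equiv> semigroup_algebra k S"
abbreviation "mn \<equiv> monomial k S"

lemma B_sel:
  "carrier B = {f \<in> carrier S \<rightarrow>\<^sub>E carrier k. finite {s \<in> carrier S. f s \<noteq> \<zero>\<^bsub>k\<^esub>}}"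
  "\<zero>\<^bsub>B\<^esub> = (\<lambda>s\<in>carrier S. \<zero>\<^bsub>k\<^esub>)"
  "f \<oplus>\<^bsub>B\<^esub> g = (\<lambda>s\<in>carrier S. f s \<oplus>\<^bsub>k\<^esub> g s)"
  "b \<odot>\<^bsub>B\<^esub> f = (\<lambda>s\<in>carrier S. b \<otimes>\<^bsub>k\<^esub> f s)"
  "\<one>\<^bsub>B\<^esub> = mn \<one>\<^bsub>S\<^esub>"
  by (simp_all add: semigroup_algebra_def monomial_def)

lemma B_dsum:
  "carrier B = carrier (dsum_mod (carrier S) (\<lambda>_. self_mod k))" "add B = add (dsum_mod (carrier S) (\<lambda>_. self_mod k))"
  "zero B = zero (dsum_mod (carrier S) (\<lambda>_. self_mod k))" "smult B = smult (dsum_mod (carrier S) (\<lambda>_. self_mod k))"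
  by (simp_all add: semigroup_algebra_def dsum_mod_def self_mod_def)

lemma B_eval:
  assumes "s \<in> carrier S"
  shows "mn t s = (if s = t then \<one>\<^bsub>k\<^esub> else \<zero>\<^bsub>k\<^esub>)" "(f \<oplus>\<^bsub>B\<^esub> g) s = f s \<oplus>\<^bsub>k\<^esub> g s" "(b \<odot>\<^bsub>B\<^esub> f) s = b \<otimes>\<^bsub>k\<^esub> f s"
  using assms by (simp_all add: monomial_def B_sel)

lemma B_val: "f \<in> carrier B \<Longrightarrow> s \<in> carrier S \<Longrightarrow> f s \<in> carrier k"
  by (auto simp: B_sel PiE_iff)

lemma B_fin: "f \<in> carrier B \<Longrightarrow> finite {s \<in> carrier S. f s \<noteq> \<zero>\<^bsub>k\<^esub>}"
  by (simp add: B_sel)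

lemma B_eqI: "f \<in> carrier B \<Longrightarrow> g \<in> carrier B \<Longrightarrow> (\<And>s. s \<in> carrier S \<Longrightarrow> f s = g s) \<Longrightarrow> f = g"
  by (rule PiE_ext[of _ "carrier S" "\<lambda>_. carrier k"]) (auto simp: B_sel)

lemma kmod: "Module.module k B"
  by (rule module_cong[OF dsum_module[OF k.cring_axioms self_mod_module[OF k.cring_axioms]] B_dsum])

text \<open>As multiplication is bilinear, associativity and the unit law, and later the module
  laws, need to be checked on monomials only.\<close>

lemma B_lbasis: "lbasis k B (carrier S) mn"
proof -
  let ?D = "dsum_mod (carrier S) (\<lambda>_. self_mod k)"
  have "(\<lambda>x. x) \<in> mod_hom k ?D B" by (rule mod_homI) (simp_all add: B_dsum)
  then have "lbasis k B (carrier S) (\<lambda>i. dsum_in (carrier S) (\<lambda>_. self_mod k) i \<one>\<^bsub>k\<^esub>)"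
    by (rule lbasis_transfer[OF lbasis_dsum_self[OF k.cring_axioms] kmod]) (simp add: B_dsum bij_betw_def)
  then show ?thesis by (rule lbasis_cong[rotated]) (auto simp: dsum_in_def monomial_def intro!: restrict_ext)
qed

lemma mn_closed: "s \<in> carrier S \<Longrightarrow> mn s \<in> carrier B"
  by (rule lbasis_closed[OF B_lbasis])

text \<open>The defining sum runs over the supports of the factors, which change under addition.
  Here any finite sets around the supports may serve, so that the sums for different factors can be
  taken over one index set.\<close>

lemma mult_eval:
  assumes f: "f \<in> carrier B" and g: "g \<in> carrier B" and s: "s \<in> carrier S"
    and X: "finite X" "X \<subseteq> carrier S" "{x \<in> carrier S. f x \<noteq> \<zero>\<^bsub>k\<^esub>} \<subseteq> X"
    and Y: "finite Y" "Y \<subseteq> carrier S" "{x \<in> carrier S. g x \<noteq> \<zero>\<^bsub>k\<^esub>} \<subseteq> Y"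
  shows "(f \<otimes>\<^bsub>B\<^esub> g) s = (\<Oplus>\<^bsub>k\<^esub> p\<in>{p \<in> X \<times> Y. fst p \<otimes>\<^bsub>S\<^esub> snd p = s}. f (fst p) \<otimes>\<^bsub>k\<^esub> g (snd p))"
proof -
  let ?I = "{p \<in> carrier S \<times> carrier S. fst p \<otimes>\<^bsub>S\<^esub> snd p = s \<and> f (fst p) \<noteq> \<zero>\<^bsub>k\<^esub> \<and> g (snd p) \<noteq> \<zero>\<^bsub>k\<^esub>}"
  have "(f \<otimes>\<^bsub>B\<^esub> g) s = (\<Oplus>\<^bsub>k\<^esub> p\<in>?I. f (fst p) \<otimes>\<^bsub>k\<^esub> g (snd p))"
    using s by (simp add: semigroup_algebra_def)
  also have "\<dots> = (\<Oplus>\<^bsub>k\<^esub> p\<in>{p \<in> X \<times> Y. fst p \<otimes>\<^bsub>S\<^esub> snd p = s}. f (fst p) \<otimes>\<^bsub>k\<^esub> g (snd p))"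
  proof (rule k.add.finprod_mono_neutral_cong_left)
    show "finite {p \<in> X \<times> Y. fst p \<otimes>\<^bsub>S\<^esub> snd p = s}" by (rule finite_subset[of _ "X \<times> Y"]) (use X Y in auto)
    show "?I \<subseteq> {p \<in> X \<times> Y. fst p \<otimes>\<^bsub>S\<^esub> snd p = s}" using X Y by auto
    have v: "f x \<in> carrier k" "g y \<in> carrier k" if "x \<in> X" "y \<in> Y" for x y
      using that X(2) Y(2) B_val f g by auto
    show "(\<lambda>p. f (fst p) \<otimes>\<^bsub>k\<^esub> g (snd p)) \<in> {p \<in> X \<times> Y. fst p \<otimes>\<^bsub>S\<^esub> snd p = s} \<rightarrow> carrier k"
      using v by auto
    show "f (fst p) \<otimes>\<^bsub>k\<^esub> g (snd p) = \<zero>\<^bsub>k\<^esub>" if "p \<in> {p \<in> X \<times> Y. fst p \<otimes>\<^bsub>S\<^esub> snd p = s} - ?I" for p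
    proof -
      have "f (fst p) = \<zero>\<^bsub>k\<^esub> \<or> g (snd p) = \<zero>\<^bsub>k\<^esub>" using that X(2) Y(2) by auto
      then show ?thesis using that v[of "fst p" "snd p"] by auto
    qed
  qed auto
  finally show ?thesis .
qed

lemma mult_comm:
  assumes f: "f \<in> carrier B" and g: "g \<in> carrier B"
  shows "f \<otimes>\<^bsub>B\<^esub> g = g \<otimes>\<^bsub>B\<^esub> f"
proof -
  have "(f \<otimes>\<^bsub>B\<^esub> g) s = (g \<otimes>\<^bsub>B\<^esub> f) s" if s: "s \<in> carrier S" for s
  proof -
    let ?X = "{x \<in> carrier S. f x \<noteq> \<zero>\<^bsub>k\<^esub>}" and ?Y = "{x \<in> carrier S. g x \<noteq> \<zero>\<^bsub>k\<^esub>}"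
    let ?J = "{p \<in> ?Y \<times> ?X. fst p \<otimes>\<^bsub>S\<^esub> snd p = s}"
    let ?I = "{p \<in> ?X \<times> ?Y. fst p \<otimes>\<^bsub>S\<^esub> snd p = s}"
    have "(f \<otimes>\<^bsub>B\<^esub> g) s = (\<Oplus>\<^bsub>k\<^esub> p\<in>?I. f (fst p) \<otimes>\<^bsub>k\<^esub> g (snd p))"
      by (rule mult_eval[OF f g s]) (use B_fin[OF f] B_fin[OF g] in auto)
    also have "?I = prod.swap ` ?J" by (auto simp: S.m_comm image_iff)
    also have "(\<Oplus>\<^bsub>k\<^esub> p\<in>prod.swap ` ?J. f (fst p) \<otimes>\<^bsub>k\<^esub> g (snd p)) = (\<Oplus>\<^bsub>k\<^esub> p\<in>?J. f (fst (prod.swap p)) \<otimes>\<^bsub>k\<^esub> g (snd (prod.swap p)))"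
      by (rule k.add.finprod_reindex) (use B_val[OF f] B_val[OF g] in auto)
    also have "\<dots> = (\<Oplus>\<^bsub>k\<^esub> p\<in>?J. g (fst p) \<otimes>\<^bsub>k\<^esub> f (snd p))"
      by (rule k.finsum_cong') (use B_val[OF f] B_val[OF g] in \<open>auto simp: k.m_comm\<close>)
    also have "\<dots> = (g \<otimes>\<^bsub>B\<^esub> f) s"
      by (rule mult_eval[OF g f s, symmetric]) (use B_fin[OF f] B_fin[OF g] in auto)
    finally show ?thesis .
  qed
  then show ?thesis by (auto simp: semigroup_algebra_def fun_eq_iff)
qed

lemma mult_closed:
  assumes f: "f \<in> carrier B" and g: "g \<in> carrier B"
  shows "f \<otimes>\<^bsub>B\<^esub> g \<in> carrier B"
proof -
  let ?X = "{x \<in> carrier S. f x \<noteq> \<zero>\<^bsub>k\<^esub>}" and ?Y = "{x \<in> carrier S. g x \<noteq> \<zero>\<^bsub>k\<^esub>}"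
  have e: "(f \<otimes>\<^bsub>B\<^esub> g) s = (\<Oplus>\<^bsub>k\<^esub> p\<in>{p \<in> ?X \<times> ?Y. fst p \<otimes>\<^bsub>S\<^esub> snd p = s}. f (fst p) \<otimes>\<^bsub>k\<^esub> g (snd p))" if "s \<in> carrier S" for s
    by (rule mult_eval[OF f g that]) (use B_fin[OF f] B_fin[OF g] in auto)
  have "(f \<otimes>\<^bsub>B\<^esub> g) s \<in> carrier k" if "s \<in> carrier S" for s
    unfolding e[OF that] by (rule k.finsum_closed) (use B_val[OF f] B_val[OF g] in auto)
  moreover have "s \<in> (\<lambda>p. fst p \<otimes>\<^bsub>S\<^esub> snd p) ` (?X \<times> ?Y)" if s: "s \<in> carrier S" "(f \<otimes>\<^bsub>B\<^esub> g) s \<noteq> \<zero>\<^bsub>k\<^esub>" for s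
  proof (rule ccontr)
    assume "s \<notin> (\<lambda>p. fst p \<otimes>\<^bsub>S\<^esub> snd p) ` (?X \<times> ?Y)"
    then have "{p \<in> ?X \<times> ?Y. fst p \<otimes>\<^bsub>S\<^esub> snd p = s} = {}" by blast
    then show False using e[OF s(1)] s(2) by (simp only: k.finsum_empty)
  qed
  then have "finite {s \<in> carrier S. (f \<otimes>\<^bsub>B\<^esub> g) s \<noteq> \<zero>\<^bsub>k\<^esub>}"
    by (intro finite_subset[OF _ finite_imageI[OF finite_cartesian_product[OF B_fin[OF f] B_fin[OF g]]]]) blast
  moreover have "f \<otimes>\<^bsub>B\<^esub> g \<in> extensional (carrier S)" by (simp add: semigroup_algebra_def)
  ultimately show ?thesis by (simp add: B_sel PiE_iff)
qed

lemma mult_hom_left: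
  assumes g: "g \<in> carrier B" shows "(\<lambda>f. f \<otimes>\<^bsub>B\<^esub> g) \<in> mod_hom k B B"
proof (rule mod_homI)
  interpret B: Module.module k B by (rule kmod)
  show "\<And>f. f \<in> carrier B \<Longrightarrow> f \<otimes>\<^bsub>B\<^esub> g \<in> carrier B" by (rule mult_closed[OF _ g])
  let ?Y = "{x \<in> carrier S. g x \<noteq> \<zero>\<^bsub>k\<^esub>}"
  fix f assume f: "f \<in> carrier B"
  show "(f \<oplus>\<^bsub>B\<^esub> f') \<otimes>\<^bsub>B\<^esub> g = f \<otimes>\<^bsub>B\<^esub> g \<oplus>\<^bsub>B\<^esub> f' \<otimes>\<^bsub>B\<^esub> g" if f': "f' \<in> carrier B" for f'
  proof (rule B_eqI)
    have ff: "f \<oplus>\<^bsub>B\<^esub> f' \<in> carrier B" using f f' by simp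
    show "(f \<oplus>\<^bsub>B\<^esub> f') \<otimes>\<^bsub>B\<^esub> g \<in> carrier B" by (rule mult_closed[OF ff g])
    show "f \<otimes>\<^bsub>B\<^esub> g \<oplus>\<^bsub>B\<^esub> f' \<otimes>\<^bsub>B\<^esub> g \<in> carrier B" using mult_closed f f' g by simp
    fix s assume s: "s \<in> carrier S"
    let ?X = "{x \<in> carrier S. f x \<noteq> \<zero>\<^bsub>k\<^esub>} \<union> {x \<in> carrier S. f' x \<noteq> \<zero>\<^bsub>k\<^esub>}"
    have X: "finite ?X" "?X \<subseteq> carrier S" using B_fin f f' by auto
    have Y: "finite ?Y" "?Y \<subseteq> carrier S" "?Y \<subseteq> ?Y" using B_fin g by auto
    let ?I = "{p \<in> ?X \<times> ?Y. fst p \<otimes>\<^bsub>S\<^esub> snd p = s}"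
    have "((f \<oplus>\<^bsub>B\<^esub> f') \<otimes>\<^bsub>B\<^esub> g) s = (\<Oplus>\<^bsub>k\<^esub> p\<in>?I. (f \<oplus>\<^bsub>B\<^esub> f') (fst p) \<otimes>\<^bsub>k\<^esub> g (snd p))"
      by (rule mult_eval[OF ff g s X _ Y]) (auto simp: B_sel)
    also have "\<dots> = (\<Oplus>\<^bsub>k\<^esub> p\<in>?I. f (fst p) \<otimes>\<^bsub>k\<^esub> g (snd p) \<oplus>\<^bsub>k\<^esub> f' (fst p) \<otimes>\<^bsub>k\<^esub> g (snd p))"
      by (rule k.finsum_cong') (use B_val[OF f] B_val[OF f'] B_val[OF g] in \<open>auto simp: B_sel(3) k.l_distr\<close>)
    also have "\<dots> = (\<Oplus>\<^bsub>k\<^esub> p\<in>?I. f (fst p) \<otimes>\<^bsub>k\<^esub> g (snd p)) \<oplus>\<^bsub>k\<^esub> (\<Oplus>\<^bsub>k\<^esub> p\<in>?I. f' (fst p) \<otimes>\<^bsub>k\<^esub> g (snd p))"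
      by (rule k.finsum_addf) (use B_val[OF f] B_val[OF f'] B_val[OF g] in auto)
    also have "(\<Oplus>\<^bsub>k\<^esub> p\<in>?I. f (fst p) \<otimes>\<^bsub>k\<^esub> g (snd p)) = (f \<otimes>\<^bsub>B\<^esub> g) s"
      by (rule mult_eval[OF f g s X _ Y, symmetric]) auto
    also have "(\<Oplus>\<^bsub>k\<^esub> p\<in>?I. f' (fst p) \<otimes>\<^bsub>k\<^esub> g (snd p)) = (f' \<otimes>\<^bsub>B\<^esub> g) s"
      by (rule mult_eval[OF f' g s X _ Y, symmetric]) auto
    finally show "((f \<oplus>\<^bsub>B\<^esub> f') \<otimes>\<^bsub>B\<^esub> g) s = (f \<otimes>\<^bsub>B\<^esub> g \<oplus>\<^bsub>B\<^esub> f' \<otimes>\<^bsub>B\<^esub> g) s"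
      using s by (simp add: B_eval)
  qed
  fix b assume b: "b \<in> carrier k"
  show "(b \<odot>\<^bsub>B\<^esub> f) \<otimes>\<^bsub>B\<^esub> g = b \<odot>\<^bsub>B\<^esub> (f \<otimes>\<^bsub>B\<^esub> g)"
  proof (rule B_eqI)
    have bf: "b \<odot>\<^bsub>B\<^esub> f \<in> carrier B" using f b by simp
    show "(b \<odot>\<^bsub>B\<^esub> f) \<otimes>\<^bsub>B\<^esub> g \<in> carrier B" by (rule mult_closed[OF bf g])
    show "b \<odot>\<^bsub>B\<^esub> (f \<otimes>\<^bsub>B\<^esub> g) \<in> carrier B" using mult_closed f b g by simp
    fix s assume s: "s \<in> carrier S"
    let ?X = "{x \<in> carrier S. f x \<noteq> \<zero>\<^bsub>k\<^esub>}"
    have X: "finite ?X" "?X \<subseteq> carrier S" using B_fin f by auto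
    have Y: "finite ?Y" "?Y \<subseteq> carrier S" "?Y \<subseteq> ?Y" using B_fin g by auto
    let ?I = "{p \<in> ?X \<times> ?Y. fst p \<otimes>\<^bsub>S\<^esub> snd p = s}"
    have "((b \<odot>\<^bsub>B\<^esub> f) \<otimes>\<^bsub>B\<^esub> g) s = (\<Oplus>\<^bsub>k\<^esub> p\<in>?I. (b \<odot>\<^bsub>B\<^esub> f) (fst p) \<otimes>\<^bsub>k\<^esub> g (snd p))"
      by (rule mult_eval[OF bf g s X _ Y]) (use b in \<open>auto simp: B_sel\<close>)
    also have "\<dots> = (\<Oplus>\<^bsub>k\<^esub> p\<in>?I. b \<otimes>\<^bsub>k\<^esub> (f (fst p) \<otimes>\<^bsub>k\<^esub> g (snd p)))"
      by (rule k.finsum_cong') (use b B_val[OF f] B_val[OF g] in \<open>auto simp: B_sel(4) k.m_assoc\<close>)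
    also have "\<dots> = b \<otimes>\<^bsub>k\<^esub> (\<Oplus>\<^bsub>k\<^esub> p\<in>?I. f (fst p) \<otimes>\<^bsub>k\<^esub> g (snd p))"
      by (rule k.finsum_rdistr[symmetric]) (use b X Y B_val[OF f] B_val[OF g] in auto)
    also have "(\<Oplus>\<^bsub>k\<^esub> p\<in>?I. f (fst p) \<otimes>\<^bsub>k\<^esub> g (snd p)) = (f \<otimes>\<^bsub>B\<^esub> g) s"
      by (rule mult_eval[OF f g s X _ Y, symmetric]) auto
    finally show "((b \<odot>\<^bsub>B\<^esub> f) \<otimes>\<^bsub>B\<^esub> g) s = (b \<odot>\<^bsub>B\<^esub> (f \<otimes>\<^bsub>B\<^esub> g)) s"
      using s by (simp add: B_eval)
  qed
qed

lemma mult_hom_right: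
  assumes f: "f \<in> carrier B" shows "(\<lambda>g. f \<otimes>\<^bsub>B\<^esub> g) \<in> mod_hom k B B"
proof (rule mod_homI)
  interpret B: Module.module k B by (rule kmod)
  show "f \<otimes>\<^bsub>B\<^esub> g \<in> carrier B" if "g \<in> carrier B" for g by (rule mult_closed[OF f that])
  show "f \<otimes>\<^bsub>B\<^esub> (g \<oplus>\<^bsub>B\<^esub> g') = f \<otimes>\<^bsub>B\<^esub> g \<oplus>\<^bsub>B\<^esub> f \<otimes>\<^bsub>B\<^esub> g'" if g: "g \<in> carrier B" "g' \<in> carrier B" for g g'
    using mod_homD(2)[OF mult_hom_left[OF f] g] g B.M.a_closed[OF g] by (simp add: mult_comm[OF f])
  show "f \<otimes>\<^bsub>B\<^esub> (b \<odot>\<^bsub>B\<^esub> g) = b \<odot>\<^bsub>B\<^esub> (f \<otimes>\<^bsub>B\<^esub> g)" if g: "b \<in> carrier k" "g \<in> carrier B" for b g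
    using mod_homD(3)[OF mult_hom_left[OF f] g] g B.smult_closed[OF g] by (simp add: mult_comm[OF f])
qed

lemma mn_mult:
  assumes "x \<in> carrier S" "y \<in> carrier S" shows "mn x \<otimes>\<^bsub>B\<^esub> mn y = mn (x \<otimes>\<^bsub>S\<^esub> y)"
proof (rule B_eqI)
  fix s assume s: "s \<in> carrier S"
  have "(mn x \<otimes>\<^bsub>B\<^esub> mn y) s = (\<Oplus>\<^bsub>k\<^esub> p\<in>{p \<in> {x} \<times> {y}. fst p \<otimes>\<^bsub>S\<^esub> snd p = s}. mn x (fst p) \<otimes>\<^bsub>k\<^esub> mn y (snd p))"
    by (rule mult_eval[OF mn_closed mn_closed s]) (use assms in \<open>auto simp: B_eval split: if_splits\<close>)
  also have "{p \<in> {x} \<times> {y}. fst p \<otimes>\<^bsub>S\<^esub> snd p = s} = (if x \<otimes>\<^bsub>S\<^esub> y = s then {(x, y)} else {})" by auto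
  finally show "(mn x \<otimes>\<^bsub>B\<^esub> mn y) s = mn (x \<otimes>\<^bsub>S\<^esub> y) s"
    using s assms by (auto simp: B_eval)
qed (use assms mn_closed mult_closed in auto)

lemma one_mult: assumes f: "f \<in> carrier B" shows "mn \<one>\<^bsub>S\<^esub> \<otimes>\<^bsub>B\<^esub> f = f"
  by (rule lbasis_ext[OF B_lbasis kmod mult_hom_right[OF mn_closed[OF S.one_closed]] mod_hom_ident _ f]) (simp add: mn_mult)

lemma mult_assoc:
  assumes f: "f \<in> carrier B" and g: "g \<in> carrier B" and h: "h \<in> carrier B"
  shows "(f \<otimes>\<^bsub>B\<^esub> g) \<otimes>\<^bsub>B\<^esub> h = f \<otimes>\<^bsub>B\<^esub> (g \<otimes>\<^bsub>B\<^esub> h)"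
proof (rule lbasis_ext[OF B_lbasis kmod mod_hom_comp[OF mult_hom_left[OF g] mult_hom_left[OF h]] mult_hom_left[OF mult_closed[OF g h]] _ f])
  fix x assume x: "x \<in> carrier S"
  note X = mn_closed[OF x]
  show "(mn x \<otimes>\<^bsub>B\<^esub> g) \<otimes>\<^bsub>B\<^esub> h = mn x \<otimes>\<^bsub>B\<^esub> (g \<otimes>\<^bsub>B\<^esub> h)"
  proof (rule lbasis_ext[OF B_lbasis kmod mod_hom_comp[OF mult_hom_right[OF X] mult_hom_left[OF h]] mod_hom_comp[OF mult_hom_left[OF h] mult_hom_right[OF X]] _ g])
    fix y assume y: "y \<in> carrier S"
    note Y = mn_closed[OF y]
    show "(mn x \<otimes>\<^bsub>B\<^esub> mn y) \<otimes>\<^bsub>B\<^esub> h = mn x \<otimes>\<^bsub>B\<^esub> (mn y \<otimes>\<^bsub>B\<^esub> h)"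
      by (rule lbasis_ext[OF B_lbasis kmod mult_hom_right[OF mult_closed[OF X Y]] mod_hom_comp[OF mult_hom_right[OF Y] mult_hom_right[OF X]] _ h])
        (simp add: mn_mult x y S.m_assoc)
  qed
qed

lemma B_cring: "cring B"
proof (rule cringI)
  interpret B: Module.module k B by (rule kmod)
  show "abelian_group B" by (rule B.M.abelian_group_axioms)
  show "comm_monoid B"
    by (rule comm_monoidI) (simp_all add: mult_closed mult_assoc mn_closed one_mult B_sel(5), rule mult_comm)
  show "(x \<oplus>\<^bsub>B\<^esub> y) \<otimes>\<^bsub>B\<^esub> z = x \<otimes>\<^bsub>B\<^esub> z \<oplus>\<^bsub>B\<^esub> y \<otimes>\<^bsub>B\<^esub> z" if "x \<in> carrier B" "y \<in> carrier B" "z \<in> carrier B" for x y z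
    by (rule mod_homD(2)[OF mult_hom_left]) (use that in auto)
qed

end

locale salg_hom = S: salg k S + T: salg k T for k :: "('k, 'x) ring_scheme" and S :: "('s, 'y) monoid_scheme" and T :: "('t, 'z) monoid_scheme" +
  fixes h assumes h: "h \<in> hom S T"
begin

abbreviation "am \<equiv> algebra_map k S T h"

lemma h_closed: "s \<in> carrier S \<Longrightarrow> h s \<in> carrier T"
  using h by (auto simp: hom_def)

text \<open>As in \<open>mult_eval\<close>, the index set is freed from the support of
  \<open>f\<close> in order to prove additivity.\<close>

lemma am_eval:
  assumes f: "f \<in> carrier S.B" and t: "t \<in> carrier T" and X: "finite X" "X \<subseteq> carrier S" "{x \<in> carrier S. f x \<noteq> \<zero>\<^bsub>k\<^esub>} \<subseteq> X"
  shows "am f t = (\<Oplus>\<^bsub>k\<^esub> s\<in>{s \<in> X. h s = t}. f s)"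
proof -
  have "am f t = (\<Oplus>\<^bsub>k\<^esub> s\<in>{s \<in> carrier S. f s \<noteq> \<zero>\<^bsub>k\<^esub> \<and> h s = t}. f s)" using t by (simp add: algebra_map_def)
  also have "\<dots> = (\<Oplus>\<^bsub>k\<^esub> s\<in>{s \<in> X. h s = t}. f s)"
    by (rule S.k.add.finprod_mono_neutral_cong_left) (use X S.B_val[OF f] in auto)
  finally show ?thesis .
qed

lemma am_hom: "am \<in> mod_hom k S.B T.B"
proof (rule mod_homI)
  interpret B: Module.module k S.B by (rule S.kmod)
  fix f assume f: "f \<in> carrier S.B"
  let ?F = "{x \<in> carrier S. f x \<noteq> \<zero>\<^bsub>k\<^esub>}"
  have e: "am f t = (\<Oplus>\<^bsub>k\<^esub> s\<in>{s \<in> ?F. h s = t}. f s)" if "t \<in> carrier T" for t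
    by (rule am_eval[OF f that]) (use S.B_fin[OF f] in auto)
  have c: "am f t \<in> carrier k" if "t \<in> carrier T" for t
    unfolding e[OF that] by (rule S.k.finsum_closed) (use S.B_val[OF f] in auto)
  have "t \<in> h ` ?F" if "t \<in> carrier T" "am f t \<noteq> \<zero>\<^bsub>k\<^esub>" for t
  proof (rule ccontr)
    assume "t \<notin> h ` ?F"
    then have "{s \<in> ?F. h s = t} = {}" by blast
    then show False using e[OF that(1)] that(2) by (simp only: S.k.finsum_empty)
  qed
  then have "finite {t \<in> carrier T. am f t \<noteq> \<zero>\<^bsub>k\<^esub>}"
    by (intro finite_subset[OF _ finite_imageI[OF S.B_fin[OF f], of h]]) blast
  then show fc: "am f \<in> carrier T.B" using c by (simp add: T.B_sel PiE_iff algebra_map_def)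
  show "am (f \<oplus>\<^bsub>S.B\<^esub> g) = am f \<oplus>\<^bsub>T.B\<^esub> am g" if g: "g \<in> carrier S.B" for g
  proof
    fix t
    show "am (f \<oplus>\<^bsub>S.B\<^esub> g) t = (am f \<oplus>\<^bsub>T.B\<^esub> am g) t"
    proof (cases "t \<in> carrier T")
      case True
      let ?X = "?F \<union> {x \<in> carrier S. g x \<noteq> \<zero>\<^bsub>k\<^esub>}"
      have X: "finite ?X" "?X \<subseteq> carrier S" using S.B_fin f g by auto
      have fg: "f \<oplus>\<^bsub>S.B\<^esub> g \<in> carrier S.B" using f g by simp
      have "am (f \<oplus>\<^bsub>S.B\<^esub> g) t = (\<Oplus>\<^bsub>k\<^esub> s\<in>{s \<in> ?X. h s = t}. (f \<oplus>\<^bsub>S.B\<^esub> g) s)"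
        by (rule am_eval[OF fg True X]) (auto simp: S.B_sel)
      also have "\<dots> = (\<Oplus>\<^bsub>k\<^esub> s\<in>{s \<in> ?X. h s = t}. f s \<oplus>\<^bsub>k\<^esub> g s)"
        by (rule S.k.finsum_cong') (use S.B_val[OF f] S.B_val[OF g] in \<open>auto simp: S.B_sel(3)\<close>)
      also have "\<dots> = (\<Oplus>\<^bsub>k\<^esub> s\<in>{s \<in> ?X. h s = t}. f s) \<oplus>\<^bsub>k\<^esub> (\<Oplus>\<^bsub>k\<^esub> s\<in>{s \<in> ?X. h s = t}. g s)"
        by (rule S.k.finsum_addf) (use S.B_val[OF f] S.B_val[OF g] in auto)
      also have "(\<Oplus>\<^bsub>k\<^esub> s\<in>{s \<in> ?X. h s = t}. f s) = am f t" by (rule am_eval[OF f True X, symmetric]) auto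
      also have "(\<Oplus>\<^bsub>k\<^esub> s\<in>{s \<in> ?X. h s = t}. g s) = am g t" by (rule am_eval[OF g True X, symmetric]) auto
      finally show ?thesis using True by (simp add: T.B_eval)
    qed (simp add: algebra_map_def T.B_sel(3))
  qed
  fix b assume b: "b \<in> carrier k"
  show "am (b \<odot>\<^bsub>S.B\<^esub> f) = b \<odot>\<^bsub>T.B\<^esub> am f"
  proof
    fix t
    show "am (b \<odot>\<^bsub>S.B\<^esub> f) t = (b \<odot>\<^bsub>T.B\<^esub> am f) t"
    proof (cases "t \<in> carrier T")
      case True
      have X: "finite ?F" "?F \<subseteq> carrier S" using S.B_fin f by auto
      have bf: "b \<odot>\<^bsub>S.B\<^esub> f \<in> carrier S.B" using f b by simp
      have "am (b \<odot>\<^bsub>S.B\<^esub> f) t = (\<Oplus>\<^bsub>k\<^esub> s\<in>{s \<in> ?F. h s = t}. (b \<odot>\<^bsub>S.B\<^esub> f) s)"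
        by (rule am_eval[OF bf True X]) (use b in \<open>auto simp: S.B_sel\<close>)
      also have "\<dots> = (\<Oplus>\<^bsub>k\<^esub> s\<in>{s \<in> ?F. h s = t}. b \<otimes>\<^bsub>k\<^esub> f s)"
        by (rule S.k.finsum_cong') (use b S.B_val[OF f] in \<open>auto simp: S.B_sel(4)\<close>)
      also have "\<dots> = b \<otimes>\<^bsub>k\<^esub> (\<Oplus>\<^bsub>k\<^esub> s\<in>{s \<in> ?F. h s = t}. f s)"
        by (rule S.k.finsum_rdistr[symmetric]) (use b finite_subset[OF _ X(1), of "{s \<in> ?F. h s = t}"] S.B_val[OF f] in auto)
      finally show ?thesis using True e by (simp add: T.B_eval)
    qed (simp add: algebra_map_def T.B_sel(4))
  qed
qed

lemma am_mn: assumes x: "x \<in> carrier S" shows "am (S.mn x) = T.mn (h x)"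
proof (rule T.B_eqI)
  show "am (S.mn x) \<in> carrier T.B" by (rule mod_homD(1)[OF am_hom S.mn_closed[OF x]])
  show "T.mn (h x) \<in> carrier T.B" by (rule T.mn_closed[OF h_closed[OF x]])
  fix t assume t: "t \<in> carrier T"
  have "am (S.mn x) t = (\<Oplus>\<^bsub>k\<^esub> s\<in>{s \<in> {x}. h s = t}. S.mn x s)"
    by (rule am_eval[OF S.mn_closed[OF x] t]) (use x in \<open>auto simp: S.B_eval split: if_splits\<close>)
  also have "{s \<in> {x}. h s = t} = (if h x = t then {x} else {})" by auto
  finally show "am (S.mn x) t = T.mn (h x) t" using x t h_closed[OF x] by (auto simp: S.B_eval T.B_eval)
qed

lemma am_mult:
  assumes f: "f \<in> carrier S.B" and g: "g \<in> carrier S.B"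
  shows "am (f \<otimes>\<^bsub>S.B\<^esub> g) = am f \<otimes>\<^bsub>T.B\<^esub> am g"
proof (rule lbasis_ext[OF S.B_lbasis T.kmod mod_hom_comp[OF S.mult_hom_left[OF g] am_hom] mod_hom_comp[OF am_hom T.mult_hom_left[OF mod_homD(1)[OF am_hom g]]] _ f])
  fix x assume x: "x \<in> carrier S"
  note X = S.mn_closed[OF x]
  show "am (S.mn x \<otimes>\<^bsub>S.B\<^esub> g) = am (S.mn x) \<otimes>\<^bsub>T.B\<^esub> am g"
  proof (rule lbasis_ext[OF S.B_lbasis T.kmod mod_hom_comp[OF S.mult_hom_right[OF X] am_hom] mod_hom_comp[OF am_hom T.mult_hom_right[OF mod_homD(1)[OF am_hom X]]] _ g])
    fix y assume y: "y \<in> carrier S"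
    have "h (x \<otimes>\<^bsub>S\<^esub> y) = h x \<otimes>\<^bsub>T\<^esub> h y" using h x y by (auto simp: hom_def)
    then show "am (S.mn x \<otimes>\<^bsub>S.B\<^esub> S.mn y) = am (S.mn x) \<otimes>\<^bsub>T.B\<^esub> am (S.mn y)"
      using x y by (simp add: S.mn_mult am_mn T.mn_mult h_closed)
  qed
qed

end

section \<open>Dickson's lemma\<close>

text \<open>Call an index good if no later value is smaller. Every tail contains a good index,
  namely one at which the minimum of the tail is attained, and the values at good indices
  increase.\<close>

lemma nat_seq_mono_subseq:
  fixes s :: "nat \<Rightarrow> nat"
  shows "\<exists>h :: nat \<Rightarrow> nat. strict_mono h \<and> mono (\<lambda>m. s (h m))"
proof -
  let ?P = "\<lambda>x. \<forall>m\<ge>x. s x \<le> s m"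
  have ex: "\<exists>y>x. ?P y" for x
  proof -
    define v where "v = (LEAST v. \<exists>y>x. s y = v)"
    have "\<exists>y>x. s y = v" unfolding v_def by (rule LeastI_ex) blast
    then obtain y where y: "y > x" "s y = v" by blast
    have "s y \<le> s m" if "m \<ge> y" for m
    proof -
      have "v \<le> s m" unfolding v_def by (rule Least_le) (use that y(1) in \<open>auto intro: exI[of _ m]\<close>)
      then show ?thesis using y(2) by simp
    qed
    then show ?thesis using y(1) by blast
  qed
  have "\<exists>h. \<forall>m. ?P (h m) \<and> h m < h (Suc m)"
    by (rule dependent_nat_choice) (use ex in blast)+
  then obtain h where h: "\<And>m. ?P (h m)" "\<And>m. h m < h (Suc m)" by blast
  then have sm: "strict_mono h" by (simp add: strict_mono_Suc_iff)
  have "mono (\<lambda>m. s (h m))"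
    by (rule monoI) (use h(1) strict_mono_less_eq[OF sm] in blast)
  then show ?thesis using sm by blast
qed

text \<open>One coordinate is treated at a time; passing to a further subsequence keeps the earlier
  coordinates monotone.\<close>

lemma dickson:
  fixes s :: "nat \<Rightarrow> nat \<Rightarrow> nat"
  shows "\<exists>h :: nat \<Rightarrow> nat. strict_mono h \<and> (\<forall>i<n. mono (\<lambda>m. s (h m) i))"
proof (induction n)
  case 0
  show ?case by (rule exI[of _ id]) (simp add: strict_mono_def)
next
  case (Suc n)
  then obtain h :: "nat \<Rightarrow> nat" where "strict_mono h \<and> (\<forall>i<n. mono (\<lambda>m. s (h m) i))" by (rule exE)
  then have h: "strict_mono h" "\<And>i. i < n \<Longrightarrow> mono (\<lambda>m. s (h m) i)" by auto
  obtain f :: "nat \<Rightarrow> nat" where f: "strict_mono f" "mono (\<lambda>m. s (h (f m)) n)"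
    using nat_seq_mono_subseq[of "\<lambda>m. s (h m) n"] by blast
  have "mono (\<lambda>m. s (h (f m)) i)" if "i < n" for i
    using h(2)[OF that] strict_mono_mono[OF f(1)] by (simp add: mono_def)
  moreover have "strict_mono (\<lambda>m. h (f m))" using h(1) f(1) by (simp add: strict_mono_def)
  ultimately show ?case
    using f(2) by (intro exI[of _ "\<lambda>m. h (f m)"]) (auto simp: less_Suc_eq)
qed

section \<open>The semigroup ring as a functor\<close>

lemma vec_sel [simp]:
  "carrier (vec_monoid m) = {v. \<forall>i\<ge>m. v i = 0}" "u \<otimes>\<^bsub>vec_monoid m\<^esub> v = (\<lambda>i. u i + v i)" "\<one>\<^bsub>vec_monoid m\<^esub> = (\<lambda>i. 0)"
  by (simp_all add: vec_monoid_def)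

lemma vec_comm_monoid: "comm_monoid (vec_monoid m :: (nat \<Rightarrow> 'a::comm_monoid_add) monoid)"
  by (rule comm_monoidI) (auto simp: add_ac)

locale affine = Q: comm_monoid Q for Q :: "('q, 'y) monoid_scheme" +
  fixes k :: "('k, 'x) ring_scheme" and r n :: nat and \<iota> :: "'q \<Rightarrow> nat \<Rightarrow> nat" and g :: "nat \<Rightarrow> 'q"
  assumes fk: "field k" and iota: "\<iota> \<in> hom Q (Nat_vec r)" and iota_inj: "inj_on \<iota> (carrier Q)"
    and g_gen: "minimal_generating_set Q (g ` {..<n})"
begin

abbreviation "deg \<equiv> (\<lambda>q j. int (\<iota> q j))"
abbreviation "a \<equiv> (\<lambda>i. deg (g i))"
definition "gexp l = (\<Otimes>\<^bsub>Q\<^esub> i\<in>{..<n}. g i [^]\<^bsub>Q\<^esub> (l i :: nat))"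
definition "DQ = deg ` carrier Q"

lemma g_closed: "i < n \<Longrightarrow> g i \<in> carrier Q"
  using g_gen by (auto simp: minimal_generating_set_def)

lemma iota_mult: "x \<in> carrier Q \<Longrightarrow> y \<in> carrier Q \<Longrightarrow> \<iota> (x \<otimes>\<^bsub>Q\<^esub> y) j = \<iota> x j + \<iota> y j"
  using iota by (auto simp: hom_def)

lemma iota_one: "\<iota> \<one>\<^bsub>Q\<^esub> j = 0"
  using iota_mult[of "\<one>\<^bsub>Q\<^esub>" "\<one>\<^bsub>Q\<^esub>" j] by simp

lemma iota_pow: "x \<in> carrier Q \<Longrightarrow> \<iota> (x [^]\<^bsub>Q\<^esub> (m :: nat)) j = m * \<iota> x j"
  by (induction m) (auto simp: iota_one iota_mult)

lemma gexp_pi: "(\<lambda>i. g i [^]\<^bsub>Q\<^esub> (l i :: nat)) \<in> {..<n} \<rightarrow> carrier Q"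
  using g_closed by auto

lemma gexp_closed: "gexp l \<in> carrier Q"
  unfolding gexp_def by (rule Q.finprod_closed[OF gexp_pi])

lemma iota_finprod:
  assumes "finite F" "F \<subseteq> {..<n}"
  shows "\<iota> (\<Otimes>\<^bsub>Q\<^esub> i\<in>F. g i [^]\<^bsub>Q\<^esub> (l i :: nat)) j = (\<Sum>i\<in>F. l i * \<iota> (g i) j)"
  using assms
proof (induction F rule: finite_induct)
  case empty
  then show ?case by (simp add: iota_one)
next
  case (insert i F)
  have "(\<lambda>i. g i [^]\<^bsub>Q\<^esub> l i) \<in> F \<rightarrow> carrier Q" "g i [^]\<^bsub>Q\<^esub> l i \<in> carrier Q" using insert.prems g_closed by auto
  then show ?case using insert g_closed[of i] by (simp add: iota_mult iota_pow)
qed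

lemma deg_gexp: "deg (gexp l) = lin_comb n a l"
  by (simp add: gexp_def iota_finprod lin_comb_def fun_eq_iff)

lemma gexp_add: "gexp (\<lambda>i. l i + m i) = gexp l \<otimes>\<^bsub>Q\<^esub> gexp m"
proof -
  have "gexp (\<lambda>i. l i + m i) = (\<Otimes>\<^bsub>Q\<^esub> i\<in>{..<n}. g i [^]\<^bsub>Q\<^esub> l i \<otimes>\<^bsub>Q\<^esub> g i [^]\<^bsub>Q\<^esub> m i)"
    unfolding gexp_def by (rule Q.finprod_cong') (use g_closed in \<open>auto simp: Q.nat_pow_mult\<close>)
  then show ?thesis unfolding gexp_def using Q.finprod_multf[OF gexp_pi gexp_pi] by simp
qed

lemma gexp_zero: "gexp (\<lambda>i. 0) = \<one>\<^bsub>Q\<^esub>"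
  by (simp add: gexp_def)

text \<open>The values of \<open>gexp\<close> form a submonoid that contains the generators.\<close>

lemma gexp_surj: assumes "q \<in> carrier Q" shows "\<exists>l. (\<forall>i\<ge>n. l i = 0) \<and> gexp l = q"
proof -
  let ?H = "gexp ` {l. \<forall>i\<ge>n. l i = 0}"
  have "submonoid ?H Q"
  proof
    show "?H \<subseteq> carrier Q" using gexp_closed by auto
    show "\<one>\<^bsub>Q\<^esub> \<in> ?H" using gexp_zero by (intro image_eqI[of _ _ "\<lambda>i. 0"]) auto
    fix x y assume "x \<in> ?H" "y \<in> ?H"
    then obtain l m where "x = gexp l" "y = gexp m" "\<forall>i\<ge>n. l i = 0" "\<forall>i\<ge>n. m i = 0" by auto
    then show "x \<otimes>\<^bsub>Q\<^esub> y \<in> ?H" by (intro image_eqI[of _ _ "\<lambda>i. l i + m i"]) (auto simp: gexp_add)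
  qed
  moreover have "g ` {..<n} \<subseteq> ?H"
  proof
    fix x assume "x \<in> g ` {..<n}"
    then obtain i where i: "i < n" "x = g i" by auto
    let ?e = "\<lambda>j. if j = i then 1 else 0 :: nat"
    have "gexp ?e = (\<Otimes>\<^bsub>Q\<^esub> j\<in>{..<n}. if i = j then g j else \<one>\<^bsub>Q\<^esub>)"
      unfolding gexp_def by (rule Q.finprod_cong') (use g_closed in auto)
    also have "\<dots> = g i" by (rule Q.finprod_singleton) (use i g_closed in auto)
    finally show "x \<in> ?H" using i by (intro image_eqI[of _ _ ?e]) auto
  qed
  ultimately have "monoid_span Q (g ` {..<n}) \<subseteq> ?H" by (auto simp: monoid_span_def)
  then show ?thesis using assms g_gen by (auto simp: minimal_generating_set_def)
qed

text \<open>Every submonoid contains the identity, so a generator equal to it could be dropped,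
  against minimality.\<close>

lemma g_not_one: assumes i: "i < n" shows "g i \<noteq> \<one>\<^bsub>Q\<^esub>"
proof
  assume one: "g i = \<one>\<^bsub>Q\<^esub>"
  let ?X = "g ` {..<n}"
  have "submonoid H Q \<and> ?X - {g i} \<subseteq> H \<longleftrightarrow> submonoid H Q \<and> ?X \<subseteq> H" for H
  proof (cases "submonoid H Q")
    case True
    then have "g i \<in> H" using submonoid.one_closed one by metis
    then show ?thesis by auto
  qed simp
  then have "monoid_span Q (?X - {g i}) = monoid_span Q ?X" by (simp add: monoid_span_def)
  moreover have "?X - {g i} \<subset> ?X" using i by auto
  ultimately show False using g_gen by (simp add: minimal_generating_set_def)
qed

lemma deg_inj: "x \<in> carrier Q \<Longrightarrow> y \<in> carrier Q \<Longrightarrow> deg x = deg y \<Longrightarrow> x = y"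
  by (rule inj_onD[OF iota_inj]) (auto simp: fun_eq_iff)

lemma deg_Obj: "q \<in> carrier Q \<Longrightarrow> j \<ge> r \<Longrightarrow> deg q j = 0"
  using iota by (auto simp: hom_def)

lemma a_nonzero: assumes "i < n" shows "\<exists>j. a i j \<noteq> 0"
proof (rule ccontr)
  assume "\<not> ?thesis"
  then have "g i = \<one>\<^bsub>Q\<^esub>" by (intro deg_inj g_closed assms Q.one_closed) (auto simp: iota_one)
  then show False using g_not_one[OF assms] by simp
qed

sublocale action r n a
  by unfold_locales (use deg_Obj g_closed a_nonzero in auto)

sublocale k: field k by (rule fk)

lemma gexp_eq: "gexp = (\<lambda>l. \<Otimes>\<^bsub>Q\<^esub> i\<in>{..<n}. g i [^]\<^bsub>Q\<^esub> (l i :: nat))"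
  by (simp add: gexp_def fun_eq_iff)

sublocale N: salg k "Nat_vec n"
  by (intro salg.intro k.is_cring vec_comm_monoid)

sublocale A: salg k Q
  by (intro salg.intro k.is_cring Q.comm_monoid_axioms)

sublocale NA: salg_hom k "Nat_vec n" Q gexp
  by (intro salg_hom.intro N.salg_axioms A.salg_axioms salg_hom_axioms.intro)
    (auto simp: hom_def gexp_closed gexp_add gexp_zero)

abbreviation "R \<equiv> semigroup_algebra k (Nat_vec n)"
abbreviation "kQ \<equiv> semigroup_ring_module k Q n g"
abbreviation "kQgr \<equiv> algebra_grading k Q deg"
abbreviation "kF \<equiv> functor_of_graded k n kQ kQgr"

lemma kQ_sel [simp]:
  "carrier kQ = carrier A.B" "add kQ = add A.B" "zero kQ = zero A.B" "smult kQ = (\<lambda>f x. NA.am f \<otimes>\<^bsub>A.B\<^esub> x)"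
  by (simp_all add: semigroup_ring_module_def Let_def gexp_eq)

lemma scalar: "b \<in> carrier k \<Longrightarrow> m \<in> carrier A.B \<Longrightarrow> (b \<odot>\<^bsub>R\<^esub> \<one>\<^bsub>R\<^esub>) \<odot>\<^bsub>kQ\<^esub> m = b \<odot>\<^bsub>A.B\<^esub> m"
proof -
  assume b: "b \<in> carrier k" and m: "m \<in> carrier A.B"
  have z: "(\<lambda>i. 0) \<in> carrier (Nat_vec n)" by simp
  have o: "\<one>\<^bsub>R\<^esub> = N.mn (\<lambda>i. 0)" using N.B_sel(5) by simp
  have "NA.am (b \<odot>\<^bsub>R\<^esub> \<one>\<^bsub>R\<^esub>) = b \<odot>\<^bsub>A.B\<^esub> A.mn \<one>\<^bsub>Q\<^esub>"
    unfolding o using mod_homD(3)[OF NA.am_hom b N.mn_closed[OF z]] NA.am_mn[OF z] by (simp add: gexp_zero)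
  then show ?thesis
    using mod_homD(3)[OF A.mult_hom_left[OF m] b A.mn_closed[OF Q.one_closed]] A.one_mult[OF m] by simp
qed

lemma kF_sel:
  "carrier (At kF \<gamma>) = {f \<in> carrier A.B. \<forall>s\<in>carrier Q. f s \<noteq> \<zero>\<^bsub>k\<^esub> \<longrightarrow> deg s = \<gamma>}"
  "add (At kF \<gamma>) = add A.B" "zero (At kF \<gamma>) = zero A.B"
  "b \<in> carrier k \<Longrightarrow> m \<in> carrier A.B \<Longrightarrow> b \<odot>\<^bsub>At kF \<gamma>\<^esub> m = b \<odot>\<^bsub>A.B\<^esub> m"
  using scalar by (simp_all add: functor_of_graded_def Let_def algebra_grading_def)

lemma kF_act: "l \<in> NV \<Longrightarrow> Act kF c d l m = A.mn (gexp l) \<otimes>\<^bsub>A.B\<^esub> m"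
  using NA.am_mn[of l] by (simp add: functor_of_graded_def Let_def NV_def)

text \<open>The monomial of the element of \<open>Q\<close> of degree \<open>\<gamma>\<close>, which
  is unique because \<open>deg\<close> is injective, or 0 if there is none. Naming it by its degree
  makes the constancy of \<open>k[Q]\<close> on \<open>DQ\<close> visible.\<close>

definition "un \<gamma> = (\<lambda>q\<in>carrier Q. if deg q = \<gamma> then \<one>\<^bsub>k\<^esub> else \<zero>\<^bsub>k\<^esub>)"

lemma un_deg: "q \<in> carrier Q \<Longrightarrow> un (deg q) = A.mn q"
  by (auto simp: un_def monomial_def intro!: restrict_ext dest: deg_inj)

lemma un_closed: assumes "\<gamma> \<in> DQ" shows "un \<gamma> \<in> carrier (At kF \<gamma>)"
proof -
  obtain q where q: "q \<in> carrier Q" "\<gamma> = deg q" using assms by (auto simp: DQ_def)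
  have "un \<gamma> \<in> carrier A.B" using un_deg[OF q(1)] A.mn_closed[OF q(1)] q(2) by simp
  then show ?thesis by (simp add: kF_sel un_def)
qed

lemma deg_act: "q \<in> carrier Q \<Longrightarrow> deg (gexp l \<otimes>\<^bsub>Q\<^esub> q) = (\<lambda>j. deg q j + lin_comb n a l j)"
  using fun_cong[OF deg_gexp[of l]] gexp_closed by (auto simp: iota_mult)

text \<open>\<open>DQ\<close> is closed under targets of morphisms, and a morphism sends the
  monomial of its source to the monomial of its target. So on \<open>DQ\<close> the functor
  \<open>k[Q]\<close> is constant with value \<open>k\<close>.\<close>

lemma act_un:
  assumes "c \<in> DQ" "l \<in> Mor D c d"
  shows "d \<in> DQ" "Act kF c d l (un c) = un d"
proof -
  obtain q where q: "q \<in> carrier Q" "c = deg q" using assms by (auto simp: DQ_def)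
  have l: "l \<in> NV" "c = obj d l" using assms(2) by (auto simp: MorD)
  have d: "d = deg (gexp l \<otimes>\<^bsub>Q\<^esub> q)" using l(2) q(2) deg_act[OF q(1)] by (auto simp: obj_def fun_eq_iff)
  then show "d \<in> DQ" using gexp_closed q(1) by (auto simp: DQ_def)
  have "Act kF c d l (un c) = A.mn (gexp l \<otimes>\<^bsub>Q\<^esub> q)"
    using kF_act[OF l(1)] un_deg[OF q(1)] q A.mn_mult[OF gexp_closed q(1)] by simp
  also have "\<dots> = un d" using un_deg[of "gexp l \<otimes>\<^bsub>Q\<^esub> q"] gexp_closed q(1) d by simp
  finally show "Act kF c d l (un c) = un d" .
qed

text \<open>Each homogeneous component of \<open>k[Q]\<close> has dimension 1 or 0, according to
  whether \<open>\<gamma>\<close> is in \<open>DQ\<close>.\<close>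

lemma un_lbasis:
  assumes M: "Module.module k (At kF \<gamma>)"
  shows "lbasis k (At kF \<gamma>) (if \<gamma> \<in> DQ then {()} else {}) (\<lambda>_. un \<gamma>)"
proof (rule lbasisI[OF M])
  show "un \<gamma> \<in> carrier (At kF \<gamma>)" if "i \<in> (if \<gamma> \<in> DQ then {()} else {})" for i
    using un_closed that by (auto split: if_splits)
  let ?X = "(\<lambda>_. un \<gamma>) ` (if \<gamma> \<in> DQ then {()} else {})"
  have X: "?X \<subseteq> carrier (At kF \<gamma>)" using un_closed by (auto split: if_splits)
  note sub = mod_span_submodule[OF M X]
  fix v assume v: "v \<in> carrier (At kF \<gamma>)"
  then have vB: "v \<in> carrier A.B" by (simp add: kF_sel)
  show "v \<in> mod_span k (At kF \<gamma>) ?X"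
  proof (cases "\<gamma> \<in> DQ")
    case True
    then obtain q where q: "q \<in> carrier Q" "\<gamma> = deg q" by (auto simp: DQ_def)
    have uB: "un \<gamma> \<in> carrier A.B" using un_closed[OF True] by (simp add: kF_sel)
    have vq: "v q \<in> carrier k" by (rule A.B_val[OF vB q(1)])
    have ug: "un \<gamma> \<in> mod_span k (At kF \<gamma>) ?X" using sub(2) True by auto
    have "v = v q \<odot>\<^bsub>A.B\<^esub> un \<gamma>"
    proof (rule A.B_eqI[OF vB])
      show "v q \<odot>\<^bsub>A.B\<^esub> un \<gamma> \<in> carrier A.B" using module.smult_closed[OF A.kmod vq uB] .
      fix s assume s: "s \<in> carrier Q"
      show "v s = (v q \<odot>\<^bsub>A.B\<^esub> un \<gamma>) s"
      proof (cases "deg s = \<gamma>")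
        case True
        then have "s = q" by (intro deg_inj[OF s q(1)]) (simp add: q(2))
        then show ?thesis using s vq q(2) by (simp add: A.B_eval un_def)
      next
        case False
        then have "v s = \<zero>\<^bsub>k\<^esub>" using v s by (auto simp: kF_sel)
        then show ?thesis using s vq False by (simp add: A.B_eval un_def)
      qed
    qed
    also have "\<dots> = v q \<odot>\<^bsub>At kF \<gamma>\<^esub> un \<gamma>" using kF_sel(4)[OF vq uB] by simp
    finally have e: "v = v q \<odot>\<^bsub>At kF \<gamma>\<^esub> un \<gamma>" .
    show ?thesis by (subst e) (rule Module.module.submoduleE(4)[OF M sub(1) vq ug])
  next
    case False
    have "v = \<zero>\<^bsub>A.B\<^esub>"
    proof (rule A.B_eqI[OF vB])
      show "\<zero>\<^bsub>A.B\<^esub> \<in> carrier A.B" by (rule mod_zero[OF A.kmod])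
      fix s assume s: "s \<in> carrier Q"
      then have "v s = \<zero>\<^bsub>k\<^esub>" using v False by (auto simp: kF_sel DQ_def)
      then show "v s = \<zero>\<^bsub>A.B\<^esub> s" using s by (simp add: A.B_sel)
    qed
    then have "v = \<zero>\<^bsub>At kF \<gamma>\<^esub>" by (simp add: kF_sel)
    then show ?thesis using submodule_zero[OF sub(1)] by simp
  qed
next
  fix i assume "i \<in> (if \<gamma> \<in> DQ then {()} else {})"
  then obtain q where q: "q \<in> carrier Q" "\<gamma> = deg q" by (auto simp: DQ_def split: if_splits)
  have "(\<lambda>v. v q) \<in> mod_hom k (At kF \<gamma>) (self_mod k)"
    by (rule mod_homI) (auto simp: kF_sel A.B_eval q(1) A.B_val)
  then show "\<exists>\<kappa>\<in>mod_hom k (At kF \<gamma>) (self_mod k). \<forall>j\<in>if \<gamma> \<in> DQ then {()} else {}. \<kappa> (un \<gamma>) = (if j = i then \<one>\<^bsub>k\<^esub> else \<zero>\<^bsub>k\<^esub>)"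
    by (rule bexI[rotated]) (use q in \<open>auto simp: un_def\<close>)
qed

end

locale betti_setup = affine Q k r n \<iota> g for Q :: "('q, 'y) monoid_scheme" and k :: "('k, 'x) ring_scheme" and r n \<iota> g +
  fixes P :: "nat \<Rightarrow> (nat \<Rightarrow> int, nat \<Rightarrow> nat, 'k, 'v) fmod" and dP eP
  assumes res: "minimal_free_resolution k D P dP eP kF"

sublocale betti_setup \<subseteq> min_res r n a k P dP eP kF
  by (intro min_res.intro action_axioms min_res_axioms.intro fk res)

locale vsys_Q = betti_setup Q k r n \<iota> g P dP eP + V: vsys r n a k A E d
  for Q :: "('q, 'y) monoid_scheme" and k :: "('k, 'x) ring_scheme" and r n \<iota> g
    and P :: "nat \<Rightarrow> (nat \<Rightarrow> int, nat \<Rightarrow> nat, 'k, 'v) fmod" and dP eP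
    and A :: "'b list set" and E d
begin

text \<open>The unit component is a dummy strand index in the form that \<open>contract\<close> asks
  for: with coefficients in \<open>k[Q]\<close> there is only one strand.\<close>

definition "degs = {(L, ()) | L. L \<in> A \<and> V.ob L \<in> DQ}"
definition "ugen = (\<lambda>(L, u :: unit). Tin A (V.G kF) (length L) L (un (V.ob L)))"

lemma ugen_lbasis: "lbasis k (Tm A (V.G kF) p) {(L, s). (L, s) \<in> degs \<and> length L = p} ugen"
proof -
  have 1: "lbasis k (Tm A (V.G kF) p) (SIGMA L:{L \<in> A. length L = p}. if V.ob L \<in> DQ then {()} else {})
     (\<lambda>(L, i). dsum_in {L \<in> A. length L = p} (V.G kF) L (un (V.ob L)))"
    unfolding Tm_def
    by (rule lbasis_dsum[OF ck un_lbasis[OF kCmod_module[OF M_kCmod V.ob_Obj]]])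
  have 2: "(SIGMA L:{L \<in> A. length L = p}. if V.ob L \<in> DQ then {()} else {}) = {(L, s). (L, s) \<in> degs \<and> length L = p}"
    by (auto simp: degs_def split: if_splits)
  show ?thesis
    by (rule lbasis_cong[OF _ 1[unfolded 2]]) (auto simp: ugen_def)
qed

lemma degs_dels: assumes "(L, s) \<in> degs" "K \<in> dels L" shows "(K, s) \<in> degs"
proof -
  have L: "L \<in> A" "V.ob L \<in> DQ" using assms(1) by (auto simp: degs_def)
  show ?thesis using act_un(1)[OF L(2) V.ac_mor[OF L(1) assms(2)]] V.A_closed[OF L(1) assms(2)] by (simp add: degs_def)
qed

lemma bd_ugen:
  assumes "(L, s) \<in> degs" "length L = Suc q"
  shows "bd A (V.G kF) (V.ac kF) q (ugen (L, s)) = alt (Tm A (V.G kF) q) (\<lambda>K. ugen (K, s)) L"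
proof -
  interpret G: lsys k A "V.G kF" "V.ac kF" by (rule V.lsys_G[OF M_kCmod])
  have L: "L \<in> A" "V.ob L \<in> DQ" using assms by (auto simp: degs_def)
  have "bd A (V.G kF) (V.ac kF) q (ugen (L, s)) = alt (Tm A (V.G kF) q) (\<lambda>K. Tin A (V.G kF) q K (V.ac kF L K (un (V.ob L)))) L"
    using G.bd_in[OF L(1) assms(2) un_closed[OF L(2)]] assms(2) by (simp add: ugen_def)
  also have "\<dots> = alt (Tm A (V.G kF) q) (\<lambda>K. ugen (K, s)) L"
  proof (rule alt_cong)
    fix K assume K: "K \<in> dels L"
    show "Tin A (V.G kF) q K (V.ac kF L K (un (V.ob L))) = ugen (K, s)"
      using act_un(2)[OF L(2) V.ac_mor[OF L(1) K]] dels_length[OF K] assms(2) by (simp add: ugen_def)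
  qed
  finally show ?thesis .
qed

end

section \<open>The Betti degrees of the semigroup ring\<close>

context betti_setup begin

text \<open>Prepending \<open>v\<close> contracts the complex with coefficients in
  \<open>k[Q]\<close>: by hypothesis it never leads from a list with nonzero coefficients to one
  with zero coefficients.\<close>

lemma not_betti_cone:
  assumes c: "c \<in> Obj D"
    and v: "\<And>L. L \<in> lists {..<n} \<Longrightarrow> obj c (simplex_exp L) \<in> DQ \<Longrightarrow> v < n \<and> obj c (simplex_exp (v # L)) \<in> DQ"
  shows "c \<notin> S"
proof (rule koszul_exact_not_betti[OF c])
  fix p
  interpret K: koszul_sys r n a k c by (intro koszul_sys.intro koszul_sys_axioms.intro action_axioms ck c)
  interpret vsys_Q Q k r n \<iota> g P dP eP "lists {..<n}" simplex_exp c ..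
  interpret G: lsys k "lists {..<n}" "K.G kF" "K.ac kF" by (rule K.lsys_G[OF M_kCmod])
  show "Tex (lists {..<n}) (\<lambda>L. At kF (obj c (simplex_exp L)))
     (\<lambda>L K. Act kF (obj c (simplex_exp L)) (obj c (simplex_exp K)) (\<lambda>i. simplex_exp L i - simplex_exp K i)) p"
    unfolding Tex_def
  proof
    fix z assume z: "z \<in> Tcyc (lists {..<n}) (K.G kF) (K.ac kF) p"
    show "z \<in> bd (lists {..<n}) (K.G kF) (K.ac kF) p ` carrier (Tm (lists {..<n}) (K.G kF) (Suc p))"
      by (rule contract[where I = degs and \<beta> = ugen and v = "\<lambda>_. v" and d = "bd (lists {..<n}) (K.G kF) (K.ac kF)"
            and C = "Tm (lists {..<n}) (K.G kF)", OF ck ugen_lbasis G.bd_hom bd_ugen degs_dels])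
        (use v z in \<open>auto simp: degs_def Tcyc_def\<close>)
  qed
qed

text \<open>For \<open>c\<close> outside \<open>DQ\<close> the complex is zero, since a list with
  degree in \<open>DQ\<close> would force \<open>c \<in> DQ\<close>. The cone condition is then
  vacuous, with 0 as a placeholder for the apex.\<close>

lemma S_DQ: "S \<subseteq> DQ"
proof
  fix c assume c: "c \<in> S"
  show "c \<in> DQ"
  proof (rule ccontr)
    assume nc: "c \<notin> DQ"
    have "c \<notin> S"
    proof (rule not_betti_cone[OF S_obj[OF c]])
      fix L assume L: "L \<in> lists {..<n}" "obj c (simplex_exp L) \<in> DQ"
      have "simplex_exp L \<in> NV" using L(1) by (force simp: NV_def simplex_exp_def)
      then have "c \<in> DQ" using act_un(1)[OF L(2)] by (simp add: MorD)
      then show "0 < n \<and> obj c (simplex_exp (0 # L)) \<in> DQ" using nc by simp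
    qed
    then show False using c by simp
  qed
qed

text \<open>Of infinitely many Betti degrees, infinitely many have the same complex of \<open>F\<close> with
  \<open>c - a\<^sub>F \<in> A(\<nat>\<^sup>n)\<close>, and among these there are two with exponents \<open>l x \<le> l y\<close> that differ at some
  \<open>j\<close>. Then \<open>j\<close> is the apex of a cone for \<open>s y\<close>.\<close>

lemma finite_S: "finite S"
proof (rule ccontr)
  assume inf: "infinite S"
  \<comment> \<open>The complex of faces at \<open>c\<close>. It is a set of subsets of
    \<open>{..<n}\<close>, so only finitely many values occur.\<close>
  define ty where "ty c = {F. F \<subseteq> {..<n} \<and> (\<exists>L. set L = F \<and> obj c (simplex_exp L) \<in> DQ)}" for c
  have "ty ` S \<subseteq> Pow (Pow {..<n})" by (auto simp: ty_def)
  then have "finite (ty ` S)" by (rule finite_subset) simp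
  from pigeonhole_infinite[OF inf this] obtain c0 where "infinite {c \<in> S. ty c = ty c0}" by blast
  then obtain s :: "nat \<Rightarrow> nat \<Rightarrow> int" where s: "inj s" "range s \<subseteq> {c \<in> S. ty c = ty c0}"
    using infinite_iff_countable_subset[of "{c \<in> S. ty c = ty c0}"] by blast
  have "\<exists>l\<in>NV. s m = deg (gexp l)" for m
  proof -
    have "s m \<in> DQ" using s(2) S_DQ by auto
    then obtain q where q: "q \<in> carrier Q" "s m = deg q" by (auto simp: DQ_def)
    then show ?thesis using gexp_surj[OF q(1)] by (auto simp: NV_def)
  qed
  then have "\<forall>m. \<exists>l. l \<in> NV \<and> s m = deg (gexp l)" by blast
  from choice[OF this] obtain l where l: "\<And>m. l m \<in> NV" "\<And>m. s m = deg (gexp (l m))" by blast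
  obtain h :: "nat \<Rightarrow> nat" where "strict_mono h \<and> (\<forall>i<n. mono (\<lambda>m. l (h m) i))" using dickson[where s = l and n = n] by (rule exE)
  then have h: "strict_mono h" "\<And>i. i < n \<Longrightarrow> mono (\<lambda>m. l (h m) i)" by auto
  define x y where "x = h 0" and "y = h 1"
  have xy: "x \<noteq> y" using strict_monoD[OF h(1), of 0 1] by (simp add: x_def y_def)
  have le: "l x \<le> l y"
  proof (rule le_funI)
    fix i show "l x i \<le> l y i"
      using monoD[OF h(2), of i 0 1] l(1)[of x] by (cases "i < n") (auto simp: x_def y_def NV_def)
  qed
  have "s x \<noteq> s y" using s(1) xy by (auto simp: inj_def)
  then have "l x \<noteq> l y" using l(2) by metis
  then obtain j where j: "l x j < l y j" using le by (metis le_funD le_neq_implies_less ext)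
  then have jn: "j < n" using l(1)[of y] by (auto simp: NV_def not_less[symmetric])
  have "s y \<in> S" using s(2) by auto
  moreover have "s y \<notin> S"
  proof (rule not_betti_cone[OF S_obj[OF \<open>s y \<in> S\<close>], where v = j], intro conjI jn)
    fix L assume L: "L \<in> lists {..<n}" "obj (s y) (simplex_exp L) \<in> DQ"
    show "obj (s y) (simplex_exp (j # L)) \<in> DQ"
    proof (cases "j \<in> set L")
      case True
      then have "simplex_exp (j # L) = simplex_exp L" by (auto simp: simplex_exp_def)
      then show ?thesis using L by simp
    next
      case False
      have "ty (s m) = ty c0" for m using s(2) by auto
      then have "ty (s x) = ty (s y)" by simp
      moreover have "set L \<in> ty (s y)" using L by (auto simp: ty_def)
      ultimately have "set L \<in> ty (s x)" by simp
      then obtain L' where "set L' = set L" "obj (s x) (simplex_exp L') \<in> DQ" by (auto simp: ty_def)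
      then have sx: "obj (s x) (simplex_exp L) \<in> DQ" by (simp add: simplex_exp_def)
      \<comment> \<open>This is \<open>l y - l x\<close> with one factor of the variable
        \<open>j\<close> removed, which exists because \<open>l x j < l y j\<close>. It is a
        morphism from the degree of \<open>L\<close> over \<open>s x\<close> to the degree of
        \<open>j # L\<close> over \<open>s y\<close>, and \<open>DQ\<close> is closed under
        targets.\<close>
      define \<nu> where "\<nu> = (\<lambda>i. if i = j then l y i - l x i - 1 else l y i - l x i)"
      have nu: "\<nu> \<in> NV" using l(1)[of y] by (auto simp: NV_def \<nu>_def)
      have lx: "s m i = lin_comb n a (l m) i" for m i using l(2)[of m] fun_cong[OF deg_gexp, of "l m" i] by simp
      have e1: "lin_comb n a (l y) i = lin_comb n a (l x) i + lin_comb n a \<nu> i + lin_comb n a (simplex_exp [j]) i" for i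
      proof -
        have "l y = (\<lambda>i. (l x i + \<nu> i) + simplex_exp [j] i)"
          using le j by (auto simp: \<nu>_def simplex_exp_def le_fun_def fun_eq_iff)
        then show ?thesis by (metis lin_comb_add)
      qed
      have e2: "lin_comb n a (simplex_exp (j # L)) i = lin_comb n a (simplex_exp [j]) i + lin_comb n a (simplex_exp L) i" for i
      proof -
        have "simplex_exp (j # L) = (\<lambda>i. simplex_exp [j] i + simplex_exp L i)" using False by (auto simp: simplex_exp_def)
        then show ?thesis by (metis lin_comb_add)
      qed
      have "\<nu> \<in> Mor D (obj (s x) (simplex_exp L)) (obj (s y) (simplex_exp (j # L)))"
        unfolding MorD using nu by (auto simp: obj_def lx e1 e2 fun_eq_iff)
      then show ?thesis by (rule act_un(1)[OF sx])
    qed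
  qed
  ultimately show False by simp
qed

end

section \<open>Left Kan extensions of free functors\<close>

text \<open>The projection onto the basis vectors in \<open>I0\<close> fixes \<open>v\<close>, as a
  comparison of coordinates shows, and its image lies in \<open>H\<close>.\<close>

lemma lbasis_span_sub:
  assumes k: "cring k" and B: "lbasis k V I \<beta>" and v: "v \<in> carrier V"
    and 0: "\<And>i \<kappa>. i \<in> I \<Longrightarrow> i \<notin> I0 \<Longrightarrow> \<kappa> \<in> mod_hom k V (self_mod k) \<Longrightarrow>
      (\<And>j. j \<in> I \<Longrightarrow> \<kappa> (\<beta> j) = (if j = i then \<one>\<^bsub>k\<^esub> else \<zero>\<^bsub>k\<^esub>)) \<Longrightarrow> \<kappa> v = \<zero>\<^bsub>k\<^esub>"
    and H: "submodule H k V" "\<And>i. i \<in> I \<Longrightarrow> i \<in> I0 \<Longrightarrow> \<beta> i \<in> H"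
  shows "v \<in> H"
proof -
  note V = lbasis_module[OF B] and S = self_mod_module[OF k]
  let ?e = "\<lambda>i. if i \<in> I0 then \<beta> i else \<zero>\<^bsub>V\<^esub>"
  have "\<exists>e\<in>mod_hom k V V. \<forall>i\<in>I. e (\<beta> i) = ?e i"
    by (rule lbasis_lift[OF k B V]) (use lbasis_closed[OF B] mod_zero[OF V] in \<open>auto split: if_splits\<close>)
  then obtain e where e: "e \<in> mod_hom k V V" "\<And>i. i \<in> I \<Longrightarrow> e (\<beta> i) = ?e i" by blast
  have "e v = v"
  proof (rule lbasis_eqI[OF k B mod_homD(1)[OF e(1) v] v])
    fix \<kappa> i assume i: "i \<in> I" and h: "\<kappa> \<in> mod_hom k V (self_mod k)"
      and \<kappa>: "\<And>j. j \<in> I \<Longrightarrow> \<kappa> (\<beta> j) = (if j = i then \<one>\<^bsub>k\<^esub> else \<zero>\<^bsub>k\<^esub>)"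
    have kz: "\<kappa> \<zero>\<^bsub>V\<^esub> = \<zero>\<^bsub>k\<^esub>" using mod_hom_zero[OF V S h] by simp
    show "\<kappa> (e v) = \<kappa> v"
    proof (cases "i \<in> I0")
      case True
      show ?thesis
        by (rule lbasis_ext[OF B S mod_hom_comp[OF e(1) h] h _ v], subst e(2), assumption)
          (use True \<kappa> kz in \<open>auto split: if_splits\<close>)
    next
      case False
      have "\<kappa> (e v) = \<zero>\<^bsub>self_mod k\<^esub>"
        by (rule lbasis_ext[OF B S mod_hom_comp[OF e(1) h] mod_hom_const_zero[OF V S] _ v], subst e(2), assumption)
          (use False \<kappa> kz in \<open>auto split: if_splits\<close>)
      then show ?thesis using 0[OF i False h \<kappa>] by simp
    qed
  qed
  moreover have "v \<in> {x \<in> carrier V. e x \<in> H}"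
  proof (rule lbasis_induct_submodule[OF B submodule_vimage[OF V V e(1) H(1)] _ v])
    fix i assume i: "i \<in> I"
    show "\<beta> i \<in> {x \<in> carrier V. e x \<in> H}"
      using e(2)[OF i] H(2)[OF i] lbasis_closed[OF B i] submodule_zero[OF H(1)] by (auto split: if_splits)
  qed
  ultimately show ?thesis by simp
qed

lemma res_kCmod:
  assumes F: "is_functor C D \<alpha>o \<alpha>m" and M: "is_kCmod k D M"
  shows "is_kCmod k C (res_fmod \<alpha>o \<alpha>m M)"
proof -
  have o: "c \<in> Obj C \<Longrightarrow> \<alpha>o c \<in> Obj D" "c \<in> Obj C \<Longrightarrow> \<alpha>m c c (Id C c) = Id D (\<alpha>o c)" for c
    using F by (auto simp: is_functor_def)
  have m: "b \<in> Obj C \<Longrightarrow> c \<in> Obj C \<Longrightarrow> u \<in> Mor C b c \<Longrightarrow> \<alpha>m b c u \<in> Mor D (\<alpha>o b) (\<alpha>o c)" for b c u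
    using F unfolding is_functor_def by blast
  have c: "b \<in> Obj C \<Longrightarrow> c \<in> Obj C \<Longrightarrow> d \<in> Obj C \<Longrightarrow> u \<in> Mor C b c \<Longrightarrow> v \<in> Mor C c d \<Longrightarrow>
       \<alpha>m b d (Comp C v u) = Comp D (\<alpha>m c d v) (\<alpha>m b c u)" for b c d u v
    using F unfolding is_functor_def by blast
  show ?thesis
    by (rule is_kCmodI)
      (auto simp: res_fmod_def o c kCmod_module[OF M] kCmod_act[OF M o(1) o(1) m] kCmod_id[OF M] kCmod_comp[OF M o(1) o(1) o(1) m m] intro!: m)
qed

context kan_ext begin

lemma unit_in: "c \<in> Obj C \<Longrightarrow> x \<in> carrier (At L c) \<Longrightarrow> \<eta> c x \<in> carrier (At J (\<alpha>o c))"
  using cosetin_hom[OF ob _ idD, THEN mod_homD(1)] by (simp add: ind_unit_def)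

text \<open>Induction sends representable functors to representable ones. Spanning is read off from
  the colimit formula. Independence comes from the universal property, which supplies a map from
  \<open>J\<close> to the free functor on the objects \<open>\<alpha>o (c t)\<close> that takes
  generators to generators.\<close>

theorem ind_fbasis:
  assumes B: "fbasis k C L N c b"
  shows "fbasis k D J N (\<lambda>t. \<alpha>o (c t)) (\<lambda>t. \<eta> (c t) (b t))"
proof -
  note ct = fbasis_obj[OF B] and bt = fbasis_in[OF B]
  have co: "(\<lambda>t. \<alpha>o (c t)) \<in> N \<rightarrow> Obj D" using ct ob by auto
  let ?W = "free_fmod k D N (\<lambda>t. \<alpha>o (c t))"
  note WB = free_fmod_fbasis[OF k catD co]
  let ?g = "\<lambda>t. free_gen k D N (\<lambda>t. \<alpha>o (c t)) (\<alpha>o (c t)) t (Id D (\<alpha>o (c t)))"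
  note W = fbasis_kCmod[OF WB]
  have gin: "?g t \<in> carrier (At (res_fmod \<alpha>o \<alpha>m ?W) (c t))" if "t \<in> N" for t
    using fbasis_in[OF WB that] by (simp add: res_fmod_def)
  obtain \<phi> where \<phi>: "\<phi> \<in> nat_trans k C L (res_fmod \<alpha>o \<alpha>m ?W)"
    and \<phi>b: "\<forall>d\<in>Obj C. \<forall>t\<in>N. \<forall>w\<in>Mor C (c t) d. \<phi> d (Act L (c t) d w (b t)) = Act (res_fmod \<alpha>o \<alpha>m ?W) (c t) d w (?g t)"
    using fbasis_lift[OF k catC B res_kCmod[OF func W], of ?g, OF gin] by blast
  have \<phi>b': "\<phi> (c t) (b t) = ?g t" if t: "t \<in> N" for t
  proof -
    have "\<phi> (c t) (Act L (c t) (c t) (Id C (c t)) (b t)) = Act (res_fmod \<alpha>o \<alpha>m ?W) (c t) (c t) (Id C (c t)) (?g t)"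
      using \<phi>b ct[OF t] t cat_id[OF catC ct[OF t]] by blast
    then show ?thesis using kCmod_id[OF L ct[OF t] bt[OF t]] kCmod_id[OF res_kCmod[OF func W] ct[OF t] gin[OF t]] by simp
  qed
  obtain \<psi> where \<psi>: "\<psi> \<in> nat_trans k D J ?W" and \<psi>e: "\<forall>c\<in>Obj C. \<forall>x\<in>carrier (At L c). \<psi> (\<alpha>o c) (\<eta> c x) = \<phi> c x"
    using ind_universal[OF W \<phi>] by blast
  have psi: "\<psi> d (Act J (\<alpha>o (c t)) d w (\<eta> (c t) (b t))) = Act ?W (\<alpha>o (c t)) d w (?g t)"
    if d: "d \<in> Obj D" and t: "t \<in> N" "w \<in> Mor D (\<alpha>o (c t)) d" for d t w
    using nat_trans_act[OF \<psi> ob[OF ct[OF t(1)]] d t(2) unit_in[OF ct[OF t(1)] bt[OF t(1)]]] \<psi>e ct[OF t(1)] bt[OF t(1)] \<phi>b'[OF t(1)] by simp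
  have "lbasis k (At J d) (SIGMA t:N. Mor D (\<alpha>o (c t)) d) (\<lambda>(t, w). Act J (\<alpha>o (c t)) d w (\<eta> (c t) (b t)))" if d: "d \<in> Obj D" for d
  proof (rule lbasisI[OF modJ[OF d]])
    let ?\<beta> = "\<lambda>(t, w). Act J (\<alpha>o (c t)) d w (\<eta> (c t) (b t))"
    let ?I = "SIGMA t:N. Mor D (\<alpha>o (c t)) d"
    show cl: "?\<beta> i \<in> carrier (At J d)" if "i \<in> ?I" for i
      using that mod_homD(1)[OF ActJ_hom[OF ob[OF ct] d] unit_in[OF ct bt]] by auto
    let ?X = "?\<beta> ` ?I"
    have X: "?X \<subseteq> carrier (At J d)" using cl by blast
    note sub = mod_span_submodule[OF modJ[OF d] X]
    interpret Q: quotient_module k "X d" "H d" by (rule quotX[OF d])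
    have proj: "(\<lambda>f. H d +>\<^bsub>X d\<^esub> f) \<in> mod_hom k (X d) (At J d)" unfolding AtJ by (rule Q.proj_hom)
    have LX: "lbasis k (X d) (SIGMA z:I d. SIGMA t:N. Mor C (c t) (fst z))
       (\<lambda>(z, i). dsum_in (I d) (\<lambda>(c, w). At L c) z ((\<lambda>(t, v). Act L (c t) (fst z) v (b t)) i))"
      unfolding ind_sum_def
      by (rule lbasis_dsum[OF k]) (use fbasis_lbasis[OF B] in \<open>auto simp: comma_def split: prod.split\<close>)
    fix Y assume "Y \<in> carrier (At J d)"
    then obtain f where f: "f \<in> carrier (X d)" "Y = H d +>\<^bsub>X d\<^esub> f" using carrierJ[OF d] by blast
    have "f \<in> {f \<in> carrier (X d). H d +>\<^bsub>X d\<^esub> f \<in> mod_span k (At J d) ?X}"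
    proof (rule lbasis_induct_submodule[OF LX submodule_vimage[OF modX modJ[OF d] proj sub(1)] _ f(1)])
      fix i assume i: "i \<in> (SIGMA z:I d. SIGMA t:N. Mor C (c t) (fst z))"
      then obtain e w t v where ie: "i = ((e, w), (t, v))" "e \<in> Obj C" "w \<in> Mor D (\<alpha>o e) d" "t \<in> N" "v \<in> Mor C (c t) e"
        by (auto simp: comma_def)
      \<comment> \<open>The defining relation moves \<open>v\<close> from the element into the
        morphism, so the class is a translate of the generator
        \<open>\<eta> (c t) (b t)\<close>.\<close>
      have "H d +>\<^bsub>X d\<^esub> \<iota> d e w (Act L (c t) e v (b t)) = Act J (\<alpha>o (c t)) d (Comp D w (\<alpha>m (c t) e v)) (\<eta> (c t) (b t))"
        using glue[OF d ct[OF ie(4)] ie(2,5,3) bt[OF ie(4)]]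
          act_unit[OF d ct[OF ie(4)] comp_mor[OF ct[OF ie(4)] ie(2) d ie(5,3)] bt[OF ie(4)]] by simp
      also have "\<dots> \<in> ?X" using comp_mor[OF ct[OF ie(4)] ie(2) d ie(5,3)] ie(4) by force
      finally have "H d +>\<^bsub>X d\<^esub> \<iota> d e w (Act L (c t) e v (b t)) \<in> mod_span k (At J d) ?X" using sub(2) by (rule rev_subsetD)
      then show "(\<lambda>(z, i). dsum_in (I d) (\<lambda>(c, w). At L c) z ((\<lambda>(t, v). Act L (c t) (fst z) v (b t)) i)) i
          \<in> {f \<in> carrier (X d). H d +>\<^bsub>X d\<^esub> f \<in> mod_span k (At J d) ?X}"
        using lbasis_closed[OF LX i] ie(1) by simp
    qed
    then show "Y \<in> mod_span k (At J d) ?X" using f(2) by simp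
  next
    let ?I = "SIGMA t:N. Mor D (\<alpha>o (c t)) d"
    fix i assume "i \<in> ?I"
    then obtain \<kappa> where \<kappa>: "\<kappa> \<in> mod_hom k (At ?W d) (self_mod k)"
      "\<forall>j\<in>?I. \<kappa> ((\<lambda>(t, w). Act ?W (\<alpha>o (c t)) d w (?g t)) j) = (if j = i then \<one>\<^bsub>k\<^esub> else \<zero>\<^bsub>k\<^esub>)"
      using fbasis_lbasis[OF WB d] unfolding lbasis_def by blast
    have "\<forall>j\<in>?I. \<kappa> (\<psi> d ((\<lambda>(t, w). Act J (\<alpha>o (c t)) d w (\<eta> (c t) (b t))) j)) = (if j = i then \<one>\<^bsub>k\<^esub> else \<zero>\<^bsub>k\<^esub>)"
      using \<kappa>(2) psi[OF d] by auto
    then show "\<exists>\<kappa>\<in>mod_hom k (At J d) (self_mod k). \<forall>j\<in>?I. \<kappa> ((\<lambda>(t, w). Act J (\<alpha>o (c t)) d w (\<eta> (c t) (b t))) j) = (if j = i then \<one>\<^bsub>k\<^esub> else \<zero>\<^bsub>k\<^esub>)"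
      by (rule bexI[OF _ mod_hom_comp[OF nat_trans_hom[OF \<psi> d] \<kappa>(1)]])
  qed
  then show ?thesis unfolding fbasis_def using ind_is_kCmod co unit_in[OF ct bt] by blast
qed

end

locale kan_map = A: kan_ext k C D \<alpha>o \<alpha>m L + B: kan_ext k C D \<alpha>o \<alpha>m L' for k C D \<alpha>o \<alpha>m L L' +
  fixes f assumes f: "f \<in> nat_trans k C L L'"
begin

definition "fX d = dsum_lift (A.I d) (\<lambda>(c, w). At L c) (B.X d) (\<lambda>(c, w) x. B.\<iota> d c w (f c x))"

lemma fX_ph: "c \<in> Obj C \<Longrightarrow> w \<in> Mor D (\<alpha>o c) d \<Longrightarrow> (\<lambda>x. B.\<iota> d c w (f c x)) \<in> mod_hom k (At L c) (B.X d)"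
  by (rule mod_hom_comp[OF nat_trans_hom[OF f] B.in_hom])

lemma fX_hom: "fX d \<in> mod_hom k (A.X d) (B.X d)"
  unfolding fX_def by (rule A.lift_hom[OF B.modX fX_ph])

lemma fX_in: "c \<in> Obj C \<Longrightarrow> w \<in> Mor D (\<alpha>o c) d \<Longrightarrow> x \<in> carrier (At L c) \<Longrightarrow> fX d (A.\<iota> d c w x) = B.\<iota> d c w (f c x)"
  unfolding fX_def by (rule A.lift_in[OF B.modX fX_ph])

lemma fX_rel:
  assumes d: "d \<in> Obj D" and h: "h \<in> A.H d" shows "fX d h \<in> B.H d"
proof -
  interpret Q: quotient_module k "B.X d" "B.H d" by (rule B.quotX[OF d])
  show ?thesis
  proof (rule mod_span_image[OF A.modX B.modX fX_hom Q.sub A.gens_closed[OF d] _ h[unfolded ind_rel_def]])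
    fix s assume "s \<in> A.gens d"
    then obtain b c u w x where s: "s = A.\<iota> d b (Comp D w (\<alpha>m b c u)) x \<ominus>\<^bsub>A.X d\<^esub> A.\<iota> d c w (Act L b c u x)"
      and a: "b \<in> Obj C" "c \<in> Obj C" "u \<in> Mor C b c" "w \<in> Mor D (\<alpha>o c) d" "x \<in> carrier (At L b)" by blast
    note m = A.comp_mor[OF a(1,2) d a(3,4)] mod_homD(1)[OF A.actL[OF a(1-3)] a(5)]
    have "fX d s = fX d (A.\<iota> d b (Comp D w (\<alpha>m b c u)) x) \<ominus>\<^bsub>B.X d\<^esub> fX d (A.\<iota> d c w (Act L b c u x))"
      unfolding s by (rule mod_hom_minus'[OF A.modX B.modX fX_hom])
        (use a m mod_homD(1)[OF A.in_hom] in auto)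
    also have "\<dots> = B.\<iota> d b (Comp D w (\<alpha>m b c u)) (f b x) \<ominus>\<^bsub>B.X d\<^esub> B.\<iota> d c w (Act L' b c u (f b x))"
      using fX_in[OF a(1) m(1) a(5)] fX_in[OF a(2,4) m(2)] nat_trans_act[OF f a(1-3,5)] by simp
    finally have "fX d s \<in> B.gens d" using a mod_homD(1)[OF nat_trans_hom[OF f a(1)] a(5)] by blast
    then show "fX d s \<in> B.H d"
      unfolding ind_rel_def using mod_span_submodule(2)[OF B.modX B.gens_closed[OF d]] by blast
  qed
qed

abbreviation "g \<equiv> ind_map k C D \<alpha>o \<alpha>m L L' f"

lemma g_eq: "g d = quot_map (B.X d) (B.H d) (fX d)"
  by (simp add: ind_map_def fX_def)

lemma g_coset: "d \<in> Obj D \<Longrightarrow> y \<in> carrier (A.X d) \<Longrightarrow> g d (A.H d +>\<^bsub>A.X d\<^esub> y) = B.H d +>\<^bsub>B.X d\<^esub> fX d y"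
  unfolding g_eq by (rule quot_map_coset[OF A.quotX B.quotX fX_hom fX_rel])

lemma ind_map_unit:
  assumes "c \<in> Obj C" "x \<in> carrier (At L c)"
  shows "g (\<alpha>o c) (A.\<eta> c x) = B.\<eta> c (f c x)"
  unfolding ind_unit_def
  using g_coset[OF A.ob[OF assms(1)] mod_homD(1)[OF A.in_hom[OF assms(1) A.idD[OF assms(1)]] assms(2)]]
    fX_in[OF assms(1) A.idD[OF assms(1)] assms(2)] by simp

theorem ind_map_nat_trans: "g \<in> nat_trans k D A.J B.J"
proof -
  have "g d \<in> mod_hom k (At A.J d) (At B.J d)" if d: "d \<in> Obj D" for d
    unfolding g_eq A.AtJ B.AtJ by (rule quot_map_hom[OF A.quotX[OF d] B.quotX[OF d] fX_hom fX_rel[OF d]])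
  moreover have "g e (Act A.J d e v Y) = Act B.J d e v (g d Y)"
    if de: "d \<in> Obj D" "e \<in> Obj D" "v \<in> Mor D d e" and Y: "Y \<in> carrier (At A.J d)" for d e v Y
  proof -
    obtain y where y: "y \<in> carrier (A.X d)" "Y = A.H d +>\<^bsub>A.X d\<^esub> y" using Y A.carrierJ[OF de(1)] by blast
    have "fX e (A.T d e v y) = B.T d e v (fX d y)"
    proof (rule A.hom_ext[OF B.modX mod_hom_comp[OF A.T_hom[OF de] fX_hom] mod_hom_comp[OF fX_hom B.T_hom[OF de]] _ y(1)])
      fix c w x assume a: "c \<in> Obj C" "w \<in> Mor D (\<alpha>o c) d" "x \<in> carrier (At L c)"
      show "fX e (A.T d e v (A.\<iota> d c w x)) = B.T d e v (fX d (A.\<iota> d c w x))"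
        using A.T_in[OF de a] fX_in[OF a(1) A.comp_mor'[OF a(1) de(1,2) a(2) de(3)] a(3)] fX_in[OF a]
          B.T_in[OF de a(1,2) mod_homD(1)[OF nat_trans_hom[OF f a(1)] a(3)]] by simp
    qed
    then show ?thesis
      using y A.ActJ_coset[OF de y(1)] g_coset[OF de(1) y(1)] g_coset[OF de(2) mod_homD(1)[OF A.T_hom[OF de] y(1)]]
        B.ActJ_coset[OF de mod_homD(1)[OF fX_hom y(1)]] by simp
  qed
  ultimately show ?thesis by (simp add: nat_trans_def)
qed

end

section \<open>Quotients of functors\<close>

locale fquot =
  fixes k :: "('k, 'x) ring_scheme" and C :: "('o, 'm) cat" and M :: "('o, 'm, 'k, 'v) fmod" and H
  assumes M: "is_kCmod k C M" and sub: "c \<in> Obj C \<Longrightarrow> submodule (H c) k (At M c)"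
    and stable: "c \<in> Obj C \<Longrightarrow> d \<in> Obj C \<Longrightarrow> u \<in> Mor C c d \<Longrightarrow> x \<in> H c \<Longrightarrow> Act M c d u x \<in> H d"
    and C: "category C"
begin

lemma quot: "c \<in> Obj C \<Longrightarrow> quotient_module k (At M c) (H c)"
  using sub kCmod_module[OF M] by (simp add: quotient_module_def quotient_module_axioms_def)

lemma act_coset:
  assumes "c \<in> Obj C" "d \<in> Obj C" "u \<in> Mor C c d" "x \<in> carrier (At M c)"
  shows "Act (quot_fmod M H) c d u (H c +>\<^bsub>At M c\<^esub> x) = H d +>\<^bsub>At M d\<^esub> Act M c d u x"
  unfolding quot_fmod_def
  by simp (rule quot_map_coset[OF quot[OF assms(1)] quot[OF assms(2)] kCmod_act[OF M assms(1-3)] stable[OF assms(1-3)] assms(4)])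

lemma quot_kCmod: "is_kCmod k C (quot_fmod M H)"
proof (rule is_kCmodI)
  have At: "At (quot_fmod M H) c = quot_mod (At M c) (H c)" for c by (simp add: quot_fmod_def)
  have cos: "\<exists>x\<in>carrier (At M c). Y = H c +>\<^bsub>At M c\<^esub> x" if "c \<in> Obj C" "Y \<in> carrier (At (quot_fmod M H) c)" for c Y
    using that quotient_module.coset_carrier[OF quot[OF that(1)]] by (simp add: At)
  show "Module.module k (At (quot_fmod M H) c)" if "c \<in> Obj C" for c
    unfolding At by (rule quotient_module.quot_module[OF quot[OF that]])
  show "Act (quot_fmod M H) c d u \<in> mod_hom k (At (quot_fmod M H) c) (At (quot_fmod M H) d)"
    if a: "c \<in> Obj C" "d \<in> Obj C" "u \<in> Mor C c d" for c d u
    unfolding quot_fmod_def by simp (rule quot_map_hom[OF quot[OF a(1)] quot[OF a(2)] kCmod_act[OF M a] stable[OF a]])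
  show "Act (quot_fmod M H) c c (Id C c) Y = Y" if c: "c \<in> Obj C" "Y \<in> carrier (At (quot_fmod M H) c)" for c Y
  proof -
    obtain x where x: "x \<in> carrier (At M c)" "Y = H c +>\<^bsub>At M c\<^esub> x" using cos[OF c] by blast
    then show ?thesis using act_coset[OF c(1) c(1) cat_id[OF C c(1)] x(1)] kCmod_id[OF M c(1) x(1)] by simp
  qed
  show "Act (quot_fmod M H) b d (Comp C v u) Y = Act (quot_fmod M H) c d v (Act (quot_fmod M H) b c u Y)"
    if a: "b \<in> Obj C" "c \<in> Obj C" "d \<in> Obj C" "u \<in> Mor C b c" "v \<in> Mor C c d" and Y: "Y \<in> carrier (At (quot_fmod M H) b)" for b c d u v Y
  proof -
    obtain x where x: "x \<in> carrier (At M b)" "Y = H b +>\<^bsub>At M b\<^esub> x" using cos[OF a(1) Y] by blast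
    then show ?thesis
      using act_coset[OF a(1,3) cat_comp[OF C a(1-5)] x(1)] act_coset[OF a(1,2,4) x(1)]
        act_coset[OF a(2,3,5) mod_homD(1)[OF kCmod_act[OF M a(1,2,4)] x(1)]] kCmod_comp[OF M a x(1)] by simp
  qed
qed

end

lemma mod_hom_finsum_family:
  assumes M: "Module.module k M" and N: "Module.module k N" and "finite S" "\<And>i. i \<in> S \<Longrightarrow> f i \<in> mod_hom k M N"
  shows "(\<lambda>x. \<Oplus>\<^bsub>N\<^esub> i\<in>S. f i x) \<in> mod_hom k M N"
  using assms(3,4)
proof (induction S rule: finite_induct)
  case empty
  interpret N: Module.module k N by (rule N)
  show ?case using mod_hom_const_zero[OF M N] by simp
next
  case (insert i S)
  interpret N: Module.module k N by (rule N)
  have h: "(\<lambda>x. f i x \<oplus>\<^bsub>N\<^esub> (\<Oplus>\<^bsub>N\<^esub> i\<in>S. f i x)) \<in> mod_hom k M N"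
    by (rule mod_hom_add[OF M N]) (use insert in auto)
  have e: "(\<Oplus>\<^bsub>N\<^esub> i\<in>insert i S. f i x) = f i x \<oplus>\<^bsub>N\<^esub> (\<Oplus>\<^bsub>N\<^esub> i\<in>S. f i x)" if "x \<in> carrier M" for x
    by (rule N.M.finsum_insert) (use insert that mod_homD(1) in fastforce)+
  interpret M: Module.module k M by (rule M)
  show ?case
    by (rule mod_homI) (simp_all add: e mod_homD[OF h])
qed

text \<open>Splitting off the index 0 shifts all other indices by one and flips their signs, which
  is the recursion of \<open>alt\<close>.\<close>

lemma alternating_sum_alt:
  assumes N: "Module.module k N" and "length L = Suc p"
    and "\<And>K. K \<in> dels L \<Longrightarrow> \<psi> K \<in> carrier N"
  shows "(\<Oplus>\<^bsub>N\<^esub> i\<in>{..p}. if even i then \<psi> (take i L @ drop (Suc i) L) else \<ominus>\<^bsub>N\<^esub> \<psi> (take i L @ drop (Suc i) L)) = alt N \<psi> L"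
  using assms(2,3)
proof (induction L arbitrary: p \<psi>)
  case (Cons v L)
  interpret N: Module.module k N by (rule N)
  have dl: "take i L @ drop (Suc i) L \<in> dels L" if "i < length L" for i L
    using that
  proof (induction L arbitrary: i)
    case (Cons x L)
    then show ?case by (cases i) auto
  qed simp
  have pl: "\<psi> L \<in> carrier N" using Cons.prems by simp
  show ?case
  proof (cases p)
    case 0
    then show ?thesis using Cons.prems pl by (simp add: a_minus_def N.M.a_inv_zero)
  next
    case (Suc q)
    let ?f = "\<lambda>i. if even i then \<psi> (take i (v # L) @ drop (Suc i) (v # L)) else \<ominus>\<^bsub>N\<^esub> \<psi> (take i (v # L) @ drop (Suc i) (v # L))"
    let ?h = "\<lambda>i. if even i then \<psi> (v # take i L @ drop (Suc i) L) else \<ominus>\<^bsub>N\<^esub> \<psi> (v # take i L @ drop (Suc i) L)"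
    have c: "\<psi> (v # take i L @ drop (Suc i) L) \<in> carrier N" if "i \<le> q" for i
      using Cons.prems dl[of i L] that Suc by auto
    have fc: "?f \<in> {..Suc q} \<rightarrow> carrier N"
    proof
      fix i assume "i \<in> {..Suc q}"
      then show "?f i \<in> carrier N" using c[of "i - 1"] pl by (cases i) auto
    qed
    have "(\<Oplus>\<^bsub>N\<^esub> i\<in>{..p}. ?f i) = (\<Oplus>\<^bsub>N\<^esub> i\<in>{..q}. ?f (Suc i)) \<oplus>\<^bsub>N\<^esub> ?f 0"
      unfolding Suc by (rule N.M.finsum_Suc2[OF fc])
    also have "(\<Oplus>\<^bsub>N\<^esub> i\<in>{..q}. ?f (Suc i)) = (\<Oplus>\<^bsub>N\<^esub> i\<in>{..q}. \<ominus>\<^bsub>N\<^esub> ?h i)"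
      by (rule N.M.finsum_cong') (use c in auto)
    also have "\<dots> = \<ominus>\<^bsub>N\<^esub> (\<Oplus>\<^bsub>N\<^esub> i\<in>{..q}. ?h i)"
      by (rule mod_hom_finsum[OF N N mod_hom_uminus[OF N N mod_hom_ident], symmetric]) (use c in auto)
    also have "(\<Oplus>\<^bsub>N\<^esub> i\<in>{..q}. ?h i) = alt N (\<lambda>K. \<psi> (v # K)) L"
      by (rule Cons.IH) (use Cons.prems Suc in auto)
    finally show ?thesis
      using pl N.M.alt_closed[of L "\<lambda>K. \<psi> (v # K)"] Cons.prems by (simp add: a_minus_def N.M.a_comm)
  qed
qed simp

section \<open>Chains and lists of exponents\<close>

text \<open>The differences of consecutive exponents are the morphisms of the chain. Its companion
  \<open>lst\<close> recovers the exponents by summing from the right, starting with the morphism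
  \<open>w\<close> from the last object to \<open>d\<close>.\<close>

fun dif :: "(nat \<Rightarrow> nat) list \<Rightarrow> (nat \<Rightarrow> nat) list" where
  "dif (x # y # L) = (\<lambda>j. x j - y j) # dif (y # L)"
| "dif L = []"

fun lst :: "(nat \<Rightarrow> nat) list \<Rightarrow> (nat \<Rightarrow> nat) \<Rightarrow> (nat \<Rightarrow> nat) list" where
  "lst [] w = [w]"
| "lst (u # us) w = (\<lambda>j. hd (lst us w) j + u j) # lst us w"

fun adj :: "'a list \<Rightarrow> bool" where
  "adj (x # y # L) \<longleftrightarrow> x = y \<or> adj (y # L)"
| "adj L \<longleftrightarrow> False"

definition del :: "nat \<Rightarrow> 'a list \<Rightarrow> 'a list" where "del i L = take i L @ drop (Suc i) L"

lemma dif_length: "length (dif L) = length L - 1"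
  by (induction L rule: dif.induct) auto

lemma dif_nth: "Suc i < length L \<Longrightarrow> dif L ! i = (\<lambda>j. (L ! i) j - (L ! Suc i) j)"
proof (induction L arbitrary: i rule: dif.induct)
  case (1 x y L)
  then show ?case by (cases i) auto
qed auto

lemma lst_ne [simp]: "lst us w \<noteq> []"
  by (cases us) auto

lemma lst_length: "length (lst us w) = Suc (length us)"
  by (induction us) auto

lemma lst_dif: "sorted_wrt (\<lambda>x y. y \<le> x) L \<Longrightarrow> L \<noteq> [] \<Longrightarrow> lst (dif L) (last L) = L"
proof (induction L rule: dif.induct)
  case (1 x y L)
  then have "lst (dif (y # L)) (last (y # L)) = y # L" "y \<le> x" by auto
  then show ?case by (auto simp: le_fun_def)
qed auto

lemma dif_lst: "dif (lst us w) = us"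
proof (induction us)
  case (Cons u us)
  obtain y L where "lst us w = y # L" by (cases "lst us w") auto
  then show ?case using Cons by simp
qed simp

lemma last_lst: "last (lst us w) = w"
  by (induction us) auto

lemma adj_nth: "adj L \<longleftrightarrow> (\<exists>i. Suc i < length L \<and> L ! i = L ! Suc i)"
proof (induction L rule: adj.induct)
  case (1 x y L)
  show ?case
  proof
    assume "adj (x # y # L)"
    then show "\<exists>i. Suc i < length (x # y # L) \<and> (x # y # L) ! i = (x # y # L) ! Suc i"
      using 1 by (auto intro: exI[of _ 0] exI[of _ "Suc _"])
  next
    assume "\<exists>i. Suc i < length (x # y # L) \<and> (x # y # L) ! i = (x # y # L) ! Suc i"
    then obtain i where "Suc i < length (x # y # L)" "(x # y # L) ! i = (x # y # L) ! Suc i" by blast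
    then show "adj (x # y # L)" using 1 by (cases i) auto
  qed
qed auto

lemma adj_Cons: "adj L \<Longrightarrow> adj (x # L)"
  by (cases L) auto

lemma strict_iff_not_adj:
  fixes L :: "'a::order list"
  shows "sorted_wrt (\<lambda>x y. y < x) L \<longleftrightarrow> sorted_wrt (\<lambda>x y. y \<le> x) L \<and> \<not> adj L"
proof (induction L rule: adj.induct)
  case (1 x y L)
  show ?case using 1 by (auto intro: less_imp_le order_less_le_trans order_le_less_trans)
qed auto

lemma dif_map_add: "dif (map (\<lambda>\<mu> j. u j + \<mu> j) L) = dif L"
  by (induction L rule: dif.induct) auto

text \<open>Deleting an inner entry merges two differences into their sum, which is the composite
  that an inner face takes.\<close>

lemma dif_del:
  "sorted_wrt (\<lambda>x y. y \<le> x) L \<Longrightarrow> 0 < i \<Longrightarrow> Suc i < length L \<Longrightarrow>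
    dif (del i L) = take (i - 1) (dif L) @ [\<lambda>j. (dif L ! i) j + (dif L ! (i - 1)) j] @ drop (Suc i) (dif L)"
proof (induction L arbitrary: i rule: dif.induct)
  case (1 x y L)
  show ?case
  proof (cases "i = 1")
    case True
    then obtain z L' where L: "L = z # L'" using 1(4) by (cases L) auto
    have "y \<le> x" "z \<le> y" using 1(2) L by auto
    then have "(\<lambda>j. x j - z j) = (\<lambda>j. (y j - z j) + (x j - y j))" by (auto simp: le_fun_def fun_eq_iff)
    then show ?thesis using True L by (simp add: del_def)
  next
    case False
    then obtain i' where i: "i = Suc (Suc i')" using 1(3) by (cases i; cases "i - 1") auto
    have IH: "dif (del (Suc i') (y # L)) = take i' (dif (y # L)) @ [\<lambda>j. (dif (y # L) ! Suc i') j + (dif (y # L) ! i') j] @ drop (Suc (Suc i')) (dif (y # L))"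
      using 1(1)[of "Suc i'"] 1(2,4) i by simp
    have "del i (x # y # L) = x # y # del i' L" "del (Suc i') (y # L) = y # del i' L" by (simp_all add: del_def i)
    then show ?thesis using IH i by simp
  qed
qed auto

lemma dif_butlast: "dif (butlast L) = butlast (dif L)"
proof (induction L rule: dif.induct)
  case (1 x y L)
  then show ?case by (cases L) auto
qed auto

text \<open>This is the last face: the last morphism of the chain is absorbed into the morphism to
  \<open>d\<close>.\<close>

lemma last_butlast_dif:
  "sorted_wrt (\<lambda>x y. y \<le> x) L \<Longrightarrow> Suc 0 < length L \<Longrightarrow> (\<lambda>j. last L j + last (dif L) j) = last (butlast L)"
proof (induction L rule: dif.induct)
  case (1 x y L)
  show ?case
  proof (cases L)
    case Nil
    then show ?thesis using 1(2) by (auto simp: le_fun_def)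
  next
    case (Cons z L')
    have "(\<lambda>j. last (y # L) j + last (dif (y # L)) j) = last (butlast (y # L))" using 1 Cons by auto
    then show ?thesis using Cons by (auto simp: dif_length)
  qed
qed auto

lemma del_dels: "i < length L \<Longrightarrow> del i L \<in> dels L"
proof (induction L arbitrary: i)
  case (Cons x L)
  then show ?case by (cases i) (auto simp: del_def)
qed simp

lemma alt_submodule:
  assumes N: "Module.module k N" and H: "submodule H k N"
  shows "(\<And>J. J \<in> dels K \<Longrightarrow> \<psi> J \<in> H) \<Longrightarrow> alt N \<psi> K \<in> H"
proof (induction K arbitrary: \<psi>)
  case Nil
  show ?case using submodule_zero[OF H] by simp
next
  case (Cons v K)
  interpret N: Module.module k N by (rule N)
  have "alt N (\<lambda>J. \<psi> (v # J)) K \<in> H" by (rule Cons.IH) (use Cons.prems in auto)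
  then show ?case using Cons.prems N.submoduleE[OF H] by (simp add: a_minus_def)
qed

text \<open>The two faces that delete one of two equal neighbours coincide and have opposite signs;
  every other face keeps the pair and is sent into \<open>H\<close>. With \<open>H\<close> the
  degenerate elements, this makes the differential descend to the normalized complex.\<close>

lemma alt_adj:
  assumes N: "Module.module k N" and H: "submodule H k N"
  shows "adj L \<Longrightarrow> (\<And>K. K \<in> dels L \<Longrightarrow> \<psi> K \<in> carrier N) \<Longrightarrow> (\<And>K. K \<in> dels L \<Longrightarrow> adj K \<Longrightarrow> \<psi> K \<in> H) \<Longrightarrow> alt N \<psi> L \<in> H"
proof (induction L arbitrary: \<psi> rule: adj.induct)
  case (1 x y L)
  interpret N: Module.module k N by (rule N)
  note HE = N.submoduleE[OF H]
  have diff: "u \<ominus>\<^bsub>N\<^esub> v \<in> H" if "u \<in> H" "v \<in> H" for u v using that HE by (simp add: a_minus_def)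
  show ?case
  proof (cases "x = y")
    case True
    let ?t = "alt N (\<lambda>K. \<psi> (x # x # K)) L"
    have tH: "?t \<in> H" by (rule alt_submodule[OF N H]) (use 1(4) True in auto)
    then have t: "?t \<in> carrier N" using HE(1) by blast
    have p: "\<psi> (x # L) \<in> carrier N" using 1(3)[of "x # L"] True by auto
    have "alt N \<psi> (x # y # L) = \<psi> (x # L) \<ominus>\<^bsub>N\<^esub> (\<psi> (x # L) \<ominus>\<^bsub>N\<^esub> ?t)" using True by simp
    also have "\<dots> = ?t"
    proof -
      have "\<ominus>\<^bsub>N\<^esub> (\<psi> (x # L) \<oplus>\<^bsub>N\<^esub> \<ominus>\<^bsub>N\<^esub> ?t) = \<ominus>\<^bsub>N\<^esub> \<psi> (x # L) \<oplus>\<^bsub>N\<^esub> ?t" using p t by (simp add: N.M.minus_add)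
      then show ?thesis using p t N.M.a_assoc[of "\<psi> (x # L)" "\<ominus>\<^bsub>N\<^esub> \<psi> (x # L)" ?t] by (simp add: a_minus_def N.M.r_neg)
    qed
    finally show ?thesis using tH by simp
  next
    case False
    then have a: "adj (y # L)" using 1(2) by simp
    have "alt N (\<lambda>K. \<psi> (x # K)) (y # L) \<in> H"
      by (rule 1(1)[OF a]) (use 1(3,4) in \<open>auto intro: adj_Cons\<close>)
    moreover have "\<psi> (y # L) \<in> H" using 1(4) a by auto
    ultimately show ?thesis using diff by simp
  qed
qed auto

section \<open>The normalized bar resolution of a full subcategory\<close>

locale subcat = action r n a for r n a +
  fixes k :: "('k, 'x) ring_scheme" and S :: "(nat \<Rightarrow> int) set"
  assumes ck: "cring k" and S_sub: "S \<subseteq> Obj D"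
begin

abbreviation "C \<equiv> full_subcat D S"

lemma C_sel [simp]: "Obj C = S" "Mor C = Mor D" "Id C = Id D" "Comp C = Comp D"
  using S_sub by (auto simp: full_subcat_def)

lemma category_C: "category C"
  unfolding category_def C_sel
  using cat_id[OF category_D] cat_comp[OF category_D] cat_idl[OF category_D] cat_idr[OF category_D] cat_assoc[OF category_D] S_sub
  by (meson subsetD)

lemma functor_C: "is_functor C D (\<lambda>c. c) (\<lambda>c d u. u)"
  using S_sub by (auto simp: is_functor_def)

text \<open>Repeated entries correspond to identity morphisms in the chain.\<close>

definition "WL d = {L. sorted_wrt (\<lambda>x y. y \<le> x) L \<and> (\<forall>\<mu>\<in>set L. \<mu> \<in> NV \<and> obj d \<mu> \<in> S)}"
definition "ch d L = (map (obj d) L, dif L)"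

lemma bar_lists_WL: "L \<in> bar_lists S d \<longleftrightarrow> L \<in> WL d \<and> \<not> adj L"
  by (auto simp: bar_lists_def WL_def strict_iff_not_adj)

lemma ch_chains:
  assumes L: "L \<in> WL d" "length L = Suc p"
  shows "ch d L \<in> chains C p" "last L \<in> Mor D (last (fst (ch d L))) d"
proof -
  have m: "\<And>i. i < length L \<Longrightarrow> L ! i \<in> NV" "\<And>i. i < length L \<Longrightarrow> obj d (L ! i) \<in> S"
    using L(1) by (auto simp: WL_def)
  have "dif L ! i \<in> Mor D (obj d (L ! i)) (obj d (L ! Suc i))" if "i < p" for i
  proof -
    have "L ! Suc i \<le> L ! i" using L that by (auto simp: WL_def sorted_wrt_iff_nth_less)
    then show ?thesis using diff_mor[of "L ! i" "L ! Suc i" d] m[of i] that L(2) by (simp add: dif_nth)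
  qed
  then show "ch d L \<in> chains C p"
    using L m by (auto simp: chains_def ch_def dif_length WL_def)
  have "last L \<in> NV" using L by (cases L) (auto simp: WL_def)
  moreover have "last (map (obj d) L) = obj d (last L)" using L(2) by (cases L) (simp_all add: last_map)
  ultimately show "last L \<in> Mor D (last (fst (ch d L))) d" by (simp add: MorD ch_def)
qed

lemma lst_WL:
  assumes "(cs, us) \<in> chains C p" "w \<in> Mor D (last cs) d"
  shows "lst us w \<in> WL d \<and> map (obj d) (lst us w) = cs"
  using assms
proof (induction us arbitrary: cs p)
  case Nil
  then obtain c where "cs = [c]" by (cases cs) (auto simp: chains_def)
  then show ?case using Nil by (auto simp: WL_def MorD chains_def)
next
  case (Cons u us)
  have nth: "\<And>i. i < p \<Longrightarrow> (u # us) ! i \<in> Mor D (cs ! i) (cs ! Suc i)" "set cs \<subseteq> S"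
    and len: "length cs = Suc p" "p = Suc (length us)" using Cons.prems(1) by (simp_all add: chains_def)
  obtain c cs' where cs: "cs = c # cs'" using len(1) by (cases cs) simp_all
  have "us ! i \<in> Mor D (cs' ! i) (cs' ! Suc i)" if "i < length us" for i
    using nth(1)[of "Suc i"] that cs len(2) by simp
  then have "(cs', us) \<in> chains C (length us)"
    using nth(2) cs len by (simp add: chains_def)
  moreover have "last cs = last cs'" using cs len by auto
  ultimately have IH: "lst us w \<in> WL d" "map (obj d) (lst us w) = cs'" using Cons.IH Cons.prems(2) by auto
  let ?L = "lst us w"
  have u: "u \<in> Mor D c (cs' ! 0)" using nth(1)[of 0] cs len by simp
  obtain y L where yL: "?L = y # L" by (cases ?L) auto
  have c0: "cs' ! 0 = obj d y" using IH(2) yL by auto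
  have "c = obj d (\<lambda>j. y j + u j)" "u \<in> NV" using u c0 by (simp_all add: MorD obj_obj)
  moreover have "y \<in> NV" using IH(1) yL by (simp add: WL_def)
  moreover have "c \<in> S" using nth(2) cs by simp
  moreover have "x \<le> (\<lambda>j. y j + u j)" if "x \<in> set ?L" for x
  proof -
    have "x \<le> y" using IH(1) yL that by (auto simp: WL_def)
    then show ?thesis by (auto simp: le_fun_def intro: trans_le_add1)
  qed
  ultimately show ?case using IH yL cs by (auto simp: WL_def NV_add)
qed

text \<open>A chain together with a morphism from its last object to \<open>d\<close> amounts to a
  weakly decreasing list: the exponents from the objects to \<open>d\<close> grow towards the start
  of the chain.\<close>

lemma ch_bij:
  "bij_betw (\<lambda>L. (ch d L, last L)) {L \<in> WL d. length L = Suc p} (SIGMA t:chains C p. Mor D (last (fst t)) d)"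
proof (rule bij_betwI[where g = "\<lambda>(t, w). lst (snd t) w"])
  show "(\<lambda>L. (ch d L, last L)) \<in> {L \<in> WL d. length L = Suc p} \<rightarrow> (SIGMA t:chains C p. Mor D (last (fst t)) d)"
    using ch_chains by auto
  have len: "length us = p" if "(cs, us) \<in> chains C p" for cs us using that by (auto simp: chains_def)
  show "(\<lambda>(t, w). lst (snd t) w) \<in> (SIGMA t:chains C p. Mor D (last (fst t)) d) \<rightarrow> {L \<in> WL d. length L = Suc p}"
    using lst_WL len by (auto simp: lst_length)
  show "(case (ch d L, last L) of (t, w) \<Rightarrow> lst (snd t) w) = L" if "L \<in> {L \<in> WL d. length L = Suc p}" for L
    using that lst_dif[of L] by (cases "L = []") (auto simp: ch_def WL_def)
  show "(ch d (case z of (t, w) \<Rightarrow> lst (snd t) w), last (case z of (t, w) \<Rightarrow> lst (snd t) w)) = z"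
    if z: "z \<in> (SIGMA t:chains C p. Mor D (last (fst t)) d)" for z
    using z lst_WL by (cases z; cases "fst z") (auto simp: ch_def dif_lst last_lst)
qed

text \<open>In a weakly decreasing list the truncated difference of neighbours is 0 only if they are
  equal.\<close>

lemma ch_identity:
  assumes "L \<in> WL d" shows "has_identity C (ch d L) \<longleftrightarrow> adj L"
proof
  assume "has_identity C (ch d L)"
  then obtain i where i: "i < length L - 1" "dif L ! i = (\<lambda>j. 0)" by (auto simp: has_identity_def ch_def dif_length)
  then have s: "Suc i < length L" by simp
  have "L ! Suc i \<le> L ! i" using assms s by (auto simp: WL_def sorted_wrt_iff_nth_less)
  then have "L ! i = L ! Suc i" using i(2) dif_nth[OF s] by (auto simp: le_fun_def fun_eq_iff intro: antisym)
  then show "adj L" using s adj_nth by blast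
next
  assume "adj L"
  then obtain i where "Suc i < length L" "L ! i = L ! Suc i" using adj_nth by blast
  then show "has_identity C (ch d L)"
    by (auto simp: has_identity_def ch_def dif_length dif_nth intro!: exI[of _ i])
qed

definition "nchains p = {t \<in> chains C p. \<not> has_identity C t}"

lemma ch_bij_strict:
  "bij_betw (\<lambda>L. (ch d L, last L)) {L \<in> bar_lists S d. length L = Suc p} (SIGMA t:nchains p. Mor D (last (fst t)) d)"
proof -
  let ?f = "\<lambda>L. (ch d L, last L)" and ?A = "{L \<in> WL d. length L = Suc p}"
  have "?f ` {L \<in> ?A. \<not> has_identity C (fst (?f L))} = {z \<in> ?f ` ?A. \<not> has_identity C (fst z)}" by auto
  also have "?f ` ?A = (SIGMA t:chains C p. Mor D (last (fst t)) d)" using ch_bij[of d p] by (simp add: bij_betw_def)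
  finally have "bij_betw ?f {L \<in> ?A. \<not> has_identity C (fst (?f L))} {z \<in> (SIGMA t:chains C p. Mor D (last (fst t)) d). \<not> has_identity C (fst z)}"
    by (intro bij_betw_subset[OF ch_bij]) auto
  moreover have "{L \<in> {L \<in> WL d. length L = Suc p}. \<not> has_identity C (fst (ch d L, last L))} = {L \<in> bar_lists S d. length L = Suc p}"
    using ch_identity by (auto simp: bar_lists_WL)
  moreover have "{z \<in> (SIGMA t:chains C p. Mor D (last (fst t)) d). \<not> has_identity C (fst z)} = (SIGMA t:nchains p. Mor D (last (fst t)) d)"
    by (auto simp: nchains_def)
  ultimately show ?thesis by simp
qed

lemma WL_dels: "L \<in> WL d \<Longrightarrow> K \<in> dels L \<Longrightarrow> K \<in> WL d"
  using dels_subset[of K L] sorted_wrt_dels[of _ L K] by (auto simp: WL_def)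

section \<open>The unnormalized bar complex in terms of lists\<close>

abbreviation "cn \<equiv> (\<lambda>t :: (nat \<Rightarrow> int) list \<times> (nat \<Rightarrow> nat) list. last (fst t))"
abbreviation "K1 \<equiv> (const_fmod k :: (nat \<Rightarrow> int, nat \<Rightarrow> nat, 'k, 'k) fmod)"
abbreviation "U p \<equiv> ubar C K1 p"

lemma At_const [simp]: "At K1 c = self_mod k" "Act K1 c d u x = x"
  by (simp_all add: const_fmod_def)

lemma U_free: "U p = free_fmod k C (chains C p) cn"
  by (simp add: ubar_def bar_summand_def[abs_def])

lemma chains_obj: "cn \<in> chains C p \<rightarrow> Obj C"
proof
  fix t assume t: "t \<in> chains C p"
  then have "fst t \<noteq> []" "set (fst t) \<subseteq> S" by (auto simp: chains_def)
  then show "cn t \<in> Obj C" using last_in_set[of "fst t"] by auto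
qed

lemma U_kCmod: "is_kCmod k C (U p)"
  unfolding U_free by (rule free_fmod_kCmod[OF ck category_C chains_obj])

text \<open>The element of the unnormalized bar complex over \<open>d\<close> that a list encodes,
  with coefficient 1: the differences give the chain and the last entry is the morphism from its
  last object to \<open>d\<close>.\<close>

definition "gen p d L = free_gen k C (chains C p) cn d (ch d L) (last L)"

lemma gen_lbasis: "lbasis k (At (U p) d) {L \<in> WL d. length L = Suc p} (gen p d)"
  using lbasis_reindex[OF free_gen_lbasis[OF ck category_C chains_obj, of p d, unfolded C_sel(2)] ch_bij[of d p]]
  unfolding U_free gen_def[abs_def] by simp

lemma gen_closed: "L \<in> WL d \<Longrightarrow> length L = Suc p \<Longrightarrow> gen p d L \<in> carrier (At (U p) d)"
  by (rule lbasis_closed[OF gen_lbasis]) simp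

lemma ubar_in_hom:
  assumes "t \<in> chains C p" "w \<in> Mor D (cn t) d"
  shows "ubar_in C K1 p d t w \<in> mod_hom k (self_mod k) (At (U p) d)"
proof -
  note S1 = self_mod_module[OF ck]
  have "(\<lambda>x. dsum_in (chains C p) (\<lambda>t. At (bar_summand C K1 t) d) t (dsum_in (Mor C (cn t) d) (\<lambda>_. self_mod k) w x))
      \<in> mod_hom k (self_mod k) (dsum_mod (chains C p) (\<lambda>t. At (bar_summand C K1 t) d))"
  proof (rule mod_hom_comp[where g = "dsum_in (chains C p) (\<lambda>t. At (bar_summand C K1 t) d) t"])
    show "dsum_in (Mor C (cn t) d) (\<lambda>_. self_mod k) w \<in> mod_hom k (self_mod k) (At (bar_summand C K1 t) d)"
      unfolding bar_summand_def rep_tensor_def using dsum_in_hom[where I = "Mor C (cn t) d" and j = w, OF ck S1] assms(2) by simp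
    show "dsum_in (chains C p) (\<lambda>t. At (bar_summand C K1 t) d) t \<in> mod_hom k (At (bar_summand C K1 t) d) (dsum_mod (chains C p) (\<lambda>t. At (bar_summand C K1 t) d))"
      by (rule dsum_in_hom[OF ck _ assms(1)]) (simp add: bar_summand_def rep_tensor_def dsum_module[OF ck S1])
  qed
  then show ?thesis by (simp add: ubar_in_def[abs_def] ubar_def dsum_fmod_def)
qed

lemma gen_ubar_in: "gen p d L = ubar_in C K1 p d (ch d L) (last L) \<one>\<^bsub>k\<^esub>"
  by (simp add: gen_def free_gen_def ubar_in_def bar_summand_def)

text \<open>The function inside \<open>bar_face\<close>, repeated literally so that unfolding
  \<open>bar_face\<close> produces it.\<close>

abbreviation "face_fun p i d \<equiv> (\<lambda>(cs, us) w x.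
        if i = 0 then
          ubar_in C K1 (Suc p - 1) d (tl cs, tl us) w (Act K1 (cs ! 0) (cs ! 1) (us ! 0) x)
        else if i < Suc p then
          ubar_in C K1 (Suc p - 1) d
            (take i cs @ drop (Suc i) cs,
             take (i - 1) us @ [Comp C (us ! i) (us ! (i - 1))] @ drop (Suc i) us) w x
        else
          ubar_in C K1 (Suc p - 1) d (butlast cs, butlast us) (Comp C w (last us)) x)"

text \<open>All three kinds of face become the deletion of entry \<open>i\<close>. The first drops
  an object, and the coefficients do not change because they are constant; an inner one adds two
  differences; the last adds the last difference to the exponent that leads to
  \<open>d\<close>.\<close>

lemma face_fun_ch:
  assumes L: "L \<in> WL d" "length L = Suc (Suc p)" and i: "i \<le> Suc p"
  shows "face_fun p i d (ch d L) (last L) x = ubar_in C K1 p d (ch d (del i L)) (last (del i L)) x"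
proof -
  have s: "sorted_wrt (\<lambda>x y. y \<le> x) L" using L by (simp add: WL_def)
  consider "i = 0" | "0 < i" "i < Suc p" | "i = Suc p" using i by linarith
  then show ?thesis
  proof cases
    case 1
    obtain x y L' where "L = x # y # L'" using L(2) by (cases L; cases "tl L") auto
    then show ?thesis using 1 by (simp add: ch_def del_def)
  next
    case 2
    have "last (del i L) = last L" using 2 L(2) by (simp add: del_def)
    moreover have "ch d (del i L) = (take i (map (obj d) L) @ drop (Suc i) (map (obj d) L),
       take (i - 1) (dif L) @ [\<lambda>j. (dif L ! i) j + (dif L ! (i - 1)) j] @ drop (Suc i) (dif L))"
      using dif_del[OF s, of i] 2 L(2) by (simp add: ch_def del_def take_map drop_map)
    ultimately show ?thesis using 2 by (simp add: ch_def)
  next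
    case 3
    have d: "del (Suc p) L = butlast L" using L(2) by (simp add: del_def butlast_conv_take)
    have "(\<lambda>j. last L j + last (dif L) j) = last (butlast L)" by (rule last_butlast_dif[OF s]) (simp add: L(2))
    then show ?thesis using 3 by (simp add: d ch_def dif_butlast map_butlast)
  qed
qed

lemma WL_del: "L \<in> WL d \<Longrightarrow> length L = Suc (Suc p) \<Longrightarrow> i \<le> Suc p \<Longrightarrow> del i L \<in> WL d \<and> length (del i L) = Suc p"
  using del_dels[of i L] WL_dels[of L d "del i L"] dels_length[of "del i L" L] by simp

text \<open>Every chain with a morphism to \<open>d\<close> comes from a list, and for it the face
  is a summand inclusion \<open>ubar_in\<close>.\<close>

lemma face_fun_hom:
  assumes "t \<in> chains C (Suc p)" "w \<in> Mor D (cn t) d" "i \<le> Suc p"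
  shows "face_fun p i d t w \<in> mod_hom k (self_mod k) (At (U p) d)"
proof -
  have "(t, w) \<in> (\<lambda>L. (ch d L, last L)) ` {L \<in> WL d. length L = Suc (Suc p)}"
    using ch_bij[of d "Suc p"] assms(1,2) by (auto simp: bij_betw_def)
  then obtain L where L: "L \<in> WL d" "length L = Suc (Suc p)" and tw: "t = ch d L" "w = last L" by auto
  note dl = WL_del[OF L assms(3)]
  have "face_fun p i d t w = ubar_in C K1 p d (ch d (del i L)) (last (del i L))"
    using face_fun_ch[OF L assms(3)] unfolding tw by (rule ext)
  then show ?thesis using ubar_in_hom[OF ch_chains[of "del i L" d p]] dl by simp
qed

lemma face_lift_hom:
  assumes "t \<in> chains C (Suc p)" "i \<le> Suc p"
  shows "dsum_lift (Mor C (cn t) d) (\<lambda>_. self_mod k) (At (U p) d) (face_fun p i d t) \<in> mod_hom k (At (bar_summand C K1 t) d) (At (U p) d)"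
proof (cases "d \<in> S")
  case True
  note S1 = self_mod_module[OF ck] and Ud = kCmod_module[OF U_kCmod, unfolded C_sel, OF True]
  show ?thesis unfolding bar_summand_def rep_tensor_def
    by simp (rule dsum_lift_hom[OF ck S1 Ud face_fun_hom[OF assms(1) _ assms(2)]])
next
  case False
  note S1 = self_mod_module[OF ck]
  have Ud: "Module.module k (At (U p) d)" by (rule lbasis_module[OF gen_lbasis])
  show ?thesis unfolding bar_summand_def rep_tensor_def
    by simp (rule dsum_lift_hom[OF ck S1 Ud face_fun_hom[OF assms(1) _ assms(2)]])
qed

lemma summand_module: "Module.module k (At (bar_summand C K1 t) d)"
  unfolding bar_summand_def rep_tensor_def by (simp add: dsum_module[OF ck self_mod_module[OF ck]])

lemma U_module: "Module.module k (At (U p) d)"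
  by (rule lbasis_module[OF gen_lbasis])

lemma At_U: "At (U p) d = dsum_mod (chains C p) (\<lambda>t. At (bar_summand C K1 t) d)"
  by (simp add: ubar_def dsum_fmod_def)

lemma bar_face_eq: "bar_face C K1 (Suc p) i d = dsum_lift (chains C (Suc p)) (\<lambda>t. At (bar_summand C K1 t) d) (At (U p) d)
    (\<lambda>t. dsum_lift (Mor C (cn t) d) (\<lambda>_. self_mod k) (At (U p) d) (face_fun p i d t))"
  unfolding bar_face_def bar_lift_def by simp

lemma bar_face_hom: assumes "i \<le> Suc p" shows "bar_face C K1 (Suc p) i d \<in> mod_hom k (At (U (Suc p)) d) (At (U p) d)"
  unfolding bar_face_eq At_U[of "Suc p"]
  by (rule dsum_lift_hom[OF ck summand_module U_module face_lift_hom[OF _ assms]])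

lemma bar_face_gen:
  assumes L: "L \<in> WL d" "length L = Suc (Suc p)" and i: "i \<le> Suc p"
  shows "bar_face C K1 (Suc p) i d (gen (Suc p) d L) = gen p d (del i L)"
proof -
  interpret k: cring k by (rule ck)
  note S1 = self_mod_module[OF ck]
  have t: "ch d L \<in> chains C (Suc p)" "last L \<in> Mor C (cn (ch d L)) d" using ch_chains[OF L] by auto
  have x: "dsum_in (Mor C (cn (ch d L)) d) (\<lambda>_. self_mod k) (last L) \<one>\<^bsub>k\<^esub> \<in> carrier (At (bar_summand C K1 (ch d L)) d)"
    unfolding bar_summand_def rep_tensor_def
    using mod_homD(1)[OF dsum_in_hom[OF ck S1 t(2)], of "\<one>\<^bsub>k\<^esub>"] by simp
  have ge: "gen (Suc p) d L = dsum_in (chains C (Suc p)) (\<lambda>t. At (bar_summand C K1 t) d) (ch d L)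
      (dsum_in (Mor C (cn (ch d L)) d) (\<lambda>_. self_mod k) (last L) \<one>\<^bsub>k\<^esub>)"
    by (simp add: gen_ubar_in ubar_in_def)
  have "bar_face C K1 (Suc p) i d (gen (Suc p) d L) =
     dsum_lift (Mor C (cn (ch d L)) d) (\<lambda>_. self_mod k) (At (U p) d) (face_fun p i d (ch d L)) (dsum_in (Mor C (cn (ch d L)) d) (\<lambda>_. self_mod k) (last L) \<one>\<^bsub>k\<^esub>)"
    unfolding bar_face_eq ge
    by (rule dsum_lift_in[where F = "\<lambda>t. At (bar_summand C K1 t) d" and I = "chains C (Suc p)"])
      (rule ck summand_module U_module face_lift_hom i t(1) x | assumption)+
  also have "\<dots> = face_fun p i d (ch d L) (last L) \<one>\<^bsub>k\<^esub>"
    by (rule dsum_lift_in[OF ck S1 U_module face_fun_hom[OF t(1) _ i] t(2)]) (auto simp: t)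
  also have "\<dots> = gen p d (del i L)" unfolding face_fun_ch[OF L i] gen_ubar_in ..
  finally show ?thesis .
qed

lemma ubar_diff_hom: "ubar_diff C K1 p d \<in> mod_hom k (At (U (Suc p)) d) (At (U p) d)"
  unfolding ubar_diff_def[abs_def]
proof (rule mod_hom_finsum_family[OF U_module U_module])
  fix i assume "i \<in> {..Suc p}"
  then show "(\<lambda>f. if even i then bar_face C K1 (Suc p) i d f else \<ominus>\<^bsub>At (U p) d\<^esub> bar_face C K1 (Suc p) i d f) \<in> mod_hom k (At (U (Suc p)) d) (At (U p) d)"
    using bar_face_hom[of i p d] mod_hom_uminus[OF U_module U_module, of "bar_face C K1 (Suc p) i d"] by (cases "even i") auto
qed simp

lemma ubar_diff_gen:
  assumes L: "L \<in> WL d" "length L = Suc (Suc p)"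
  shows "ubar_diff C K1 p d (gen (Suc p) d L) = alt (At (U p) d) (gen p d) L"
proof -
  interpret N: Module.module k "At (U p) d" by (rule U_module)
  have c: "gen p d (del i L) \<in> carrier (At (U p) d)" if "i \<le> Suc p" for i using WL_del[OF L that] gen_closed by blast
  have "ubar_diff C K1 p d (gen (Suc p) d L) =
    (\<Oplus>\<^bsub>At (U p) d\<^esub> i\<in>{..Suc p}. if even i then gen p d (take i L @ drop (Suc i) L) else \<ominus>\<^bsub>At (U p) d\<^esub> gen p d (take i L @ drop (Suc i) L))"
    unfolding ubar_diff_def
    by (rule N.M.finsum_cong') (use c bar_face_gen[OF L] in \<open>auto simp: del_def\<close>)
  also have "\<dots> = alt (At (U p) d) (gen p d) L"
    by (rule alternating_sum_alt[OF U_module L(2)])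
      (use WL_dels[OF L(1)] dels_length L(2) in \<open>auto intro!: gen_closed dest: dels_length\<close>)
  finally show ?thesis .
qed

text \<open>A morphism \<open>u\<close> from \<open>d\<close> to \<open>e\<close> is absorbed by
  adding \<open>u\<close> to every entry; objects and differences, hence the chain, stay the
  same.\<close>

lemma WL_map_add:
  assumes "L \<in> WL d" "u \<in> Mor D d e" shows "map (\<lambda>\<mu> j. u j + \<mu> j) L \<in> WL e" "ch e (map (\<lambda>\<mu> j. u j + \<mu> j) L) = ch d L"
proof -
  have u: "u \<in> NV" "d = obj e u" using assms(2) by (auto simp: MorD)
  then have o: "obj e (\<lambda>j. u j + \<mu> j) = obj d \<mu>" for \<mu> by (simp add: obj_obj)
  show "map (\<lambda>\<mu> j. u j + \<mu> j) L \<in> WL e"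
    using assms(1) u(1) by (auto simp: WL_def sorted_wrt_map o NV_add le_fun_def elim!: sorted_wrt_mono_rel[rotated])
  show "ch e (map (\<lambda>\<mu> j. u j + \<mu> j) L) = ch d L" by (simp add: ch_def dif_map_add o)
qed

lemma act_gen:
  assumes "d \<in> S" "e \<in> S" "u \<in> Mor D d e" "L \<in> WL d" "length L = Suc p"
  shows "Act (U p) d e u (gen p d L) = gen p e (map (\<lambda>\<mu> j. u j + \<mu> j) L)"
proof -
  have "Act (U p) d e u (gen p d L) = free_gen k C (chains C p) cn e (ch d L) (Comp C u (last L))"
    unfolding gen_def U_free
    by (rule free_gen_act[OF ck category_C chains_obj]) (use assms ch_chains[OF assms(4,5)] in auto)
  moreover have "L \<noteq> []" using assms(5) by auto
  ultimately show ?thesis using WL_map_add[OF assms(4,3)] by (simp add: gen_def last_map)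
qed

lemma ubar_diff_nat: "ubar_diff C K1 p \<in> nat_trans k C (U (Suc p)) (U p)"
proof -
  have "ubar_diff C K1 p e (Act (U (Suc p)) d e u x) = Act (U p) d e u (ubar_diff C K1 p d x)"
    if a: "d \<in> S" "e \<in> S" "u \<in> Mor D d e" and x: "x \<in> carrier (At (U (Suc p)) d)" for d e u x
  proof (rule lbasis_ext[OF gen_lbasis U_module mod_hom_comp[OF kCmod_act[OF U_kCmod, unfolded C_sel, OF a] ubar_diff_hom]
        mod_hom_comp[OF ubar_diff_hom kCmod_act[OF U_kCmod, unfolded C_sel, OF a]] _ x])
    fix L assume "L \<in> {L \<in> WL d. length L = Suc (Suc p)}"
    then have L: "L \<in> WL d" "length L = Suc (Suc p)" by auto
    have "ubar_diff C K1 p e (Act (U (Suc p)) d e u (gen (Suc p) d L)) = alt (At (U p) e) (\<lambda>K. gen p e (map (\<lambda>\<mu> j. u j + \<mu> j) K)) L"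
      using act_gen[OF a L] ubar_diff_gen[OF WL_map_add(1)[OF L(1) a(3)], of p] L(2) by (simp add: alt_map)
    also have "\<dots> = alt (At (U p) e) (\<lambda>K. Act (U p) d e u (gen p d K)) L"
    proof (rule alt_cong)
      fix K assume K: "K \<in> dels L"
      show "gen p e (map (\<lambda>\<mu> j. u j + \<mu> j) K) = Act (U p) d e u (gen p d K)"
        by (rule act_gen[OF a WL_dels[OF L(1) K], symmetric]) (use dels_length[OF K] L(2) in simp)
    qed
    also have "\<dots> = Act (U p) d e u (alt (At (U p) d) (gen p d) L)"
      by (rule mod_hom_alt[OF U_module U_module kCmod_act[OF U_kCmod, unfolded C_sel, OF a], symmetric])
        (use WL_dels[OF L(1)] L(2) in \<open>auto intro!: gen_closed dest: dels_length\<close>)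
    finally show "ubar_diff C K1 p e (Act (U (Suc p)) d e u (gen (Suc p) d L)) = Act (U p) d e u (ubar_diff C K1 p d (gen (Suc p) d L))"
      unfolding ubar_diff_gen[OF L] .
  qed
  then show ?thesis using ubar_diff_hom by (simp add: nat_trans_def)
qed

section \<open>Degenerate elements and the normalized bar complex\<close>

abbreviation "Hd p d \<equiv> degenerate C K1 p d"

lemma eval_hom: "t \<in> chains C p \<Longrightarrow> (\<lambda>f. f t) \<in> mod_hom k (At (U p) d) (At (bar_summand C K1 t) d)"
  unfolding At_U by (rule mod_homI) (auto simp: dsum_sel)

lemma Hd_submodule: "submodule (Hd p d) k (At (U p) d)"
proof -
  interpret Module.module k "At (U p) d" by (rule U_module)
  have h: "f t = \<zero>\<^bsub>At (bar_summand C K1 t) d\<^esub>" if "f \<in> Hd p d" "t \<in> chains C p" "\<not> has_identity C t" for f t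
    using that by (simp add: degenerate_def)
  have c: "f \<in> carrier (At (U p) d)" if "f \<in> Hd p d" for f using that by (simp add: degenerate_def)
  have z: "\<zero>\<^bsub>At (bar_summand C K1 t) d\<^esub> \<in> carrier (At (bar_summand C K1 t) d)" for t by (rule mod_zero[OF summand_module])
  note E = eval_hom
  show ?thesis
  proof (rule submoduleI)
    show "\<zero>\<^bsub>At (U p) d\<^esub> \<in> Hd p d"
      using mod_hom_zero[OF U_module summand_module E] by (auto simp: degenerate_def)
    show "\<ominus>\<^bsub>At (U p) d\<^esub> f \<in> Hd p d" if "f \<in> Hd p d" for f
    proof -
      have "(\<ominus>\<^bsub>At (U p) d\<^esub> f) t = \<zero>\<^bsub>At (bar_summand C K1 t) d\<^esub>" if "t \<in> chains C p" "\<not> has_identity C t" for t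
      proof -
        interpret T: Module.module k "At (bar_summand C K1 t) d" by (rule summand_module)
        show ?thesis using mod_hom_minus[OF U_module summand_module E[OF that(1)] c[OF \<open>f \<in> Hd p d\<close>]] h[OF \<open>f \<in> Hd p d\<close> that] T.M.a_inv_zero by simp
      qed
      then show ?thesis using c[OF that] by (simp add: degenerate_def)
    qed
    show "f \<oplus>\<^bsub>At (U p) d\<^esub> g \<in> Hd p d" if fg: "f \<in> Hd p d" "g \<in> Hd p d" for f g
    proof -
      have "(f \<oplus>\<^bsub>At (U p) d\<^esub> g) t = \<zero>\<^bsub>At (bar_summand C K1 t) d\<^esub>" if "t \<in> chains C p" "\<not> has_identity C t" for t
      proof -
        interpret T: Module.module k "At (bar_summand C K1 t) d" by (rule summand_module)
        show ?thesis using mod_homD(2)[OF E[OF that(1)] c[OF fg(1)] c[OF fg(2)]] h[OF fg(1) that] h[OF fg(2) that] by simp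
      qed
      then show ?thesis using c fg by (simp add: degenerate_def)
    qed
    show "b \<odot>\<^bsub>At (U p) d\<^esub> f \<in> Hd p d" if b: "b \<in> carrier k" "f \<in> Hd p d" for b f
    proof -
      have "(b \<odot>\<^bsub>At (U p) d\<^esub> f) t = \<zero>\<^bsub>At (bar_summand C K1 t) d\<^esub>" if "t \<in> chains C p" "\<not> has_identity C t" for t
      proof -
        interpret T: Module.module k "At (bar_summand C K1 t) d" by (rule summand_module)
        show ?thesis using mod_homD(3)[OF E[OF that(1)] b(1) c[OF b(2)]] h[OF b(2) that] b(1) by simp
      qed
      then show ?thesis using c b by (simp add: degenerate_def)
    qed
  qed (use c in auto)
qed

lemma gen_adj: assumes "L \<in> WL d" "length L = Suc p" "adj L" shows "gen p d L \<in> Hd p d"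
proof -
  have "gen p d L t = \<zero>\<^bsub>At (bar_summand C K1 t) d\<^esub>" if "t \<in> chains C p" "\<not> has_identity C t" for t
    using that ch_identity[OF assms(1)] assms(3) by (auto simp: gen_ubar_in ubar_in_def dsum_in_def)
  then show ?thesis using gen_closed[OF assms(1,2)] by (simp add: degenerate_def)
qed

text \<open>The functional is the evaluation at the chain and the morphism encoded by
  \<open>L\<close>. This chain contains no identity, so degenerate elements vanish there.\<close>

lemma gen_dual:
  assumes L: "L \<in> WL d" "length L = Suc p" "\<not> adj L"
    and \<kappa>: "\<kappa> \<in> mod_hom k (At (U p) d) (self_mod k)"
    and dual: "\<And>K. K \<in> {L \<in> WL d. length L = Suc p} \<Longrightarrow> \<kappa> (gen p d K) = (if K = L then \<one>\<^bsub>k\<^esub> else \<zero>\<^bsub>k\<^esub>)"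
    and h: "h \<in> Hd p d"
  shows "\<kappa> h = \<zero>\<^bsub>k\<^esub>"
proof -
  note t = ch_chains[OF L(1,2)]
  have ev: "(\<lambda>f. f (ch d L) (last L)) \<in> mod_hom k (At (U p) d) (self_mod k)"
  proof (rule mod_hom_comp[OF eval_hom[OF t(1)]])
    show "(\<lambda>f. f (last L)) \<in> mod_hom k (At (bar_summand C K1 (ch d L)) d) (self_mod k)"
      unfolding bar_summand_def rep_tensor_def by (rule mod_homI) (use t(2) in \<open>auto simp: dsum_sel\<close>)
  qed
  have hc: "h \<in> carrier (At (U p) d)" using h by (simp add: degenerate_def)
  have "\<kappa> h = h (ch d L) (last L)"
  proof (rule lbasis_ext[OF gen_lbasis self_mod_module[OF ck] \<kappa> ev _ hc])
    fix K assume K: "K \<in> {L \<in> WL d. length L = Suc p}"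
    have "(ch d K, last K) = (ch d L, last L) \<longleftrightarrow> K = L"
      using ch_bij[of d p] K L(1,2) by (auto simp: bij_betw_def inj_on_def)
    then show "\<kappa> (gen p d K) = gen p d K (ch d L) (last L)"
      using dual[OF K] t by (auto simp: gen_ubar_in ubar_in_def dsum_in_def bar_summand_def rep_tensor_def dsum_sel)
  qed
  also have "h (ch d L) = \<zero>\<^bsub>At (bar_summand C K1 (ch d L)) d\<^esub>"
    using h t(1) ch_identity[OF L(1)] L(3) by (simp add: degenerate_def)
  finally show ?thesis using t(2) by (simp add: bar_summand_def rep_tensor_def dsum_sel)
qed

text \<open>By \<open>gen_dual\<close> a degenerate element has no coordinates at lists without
  repetition. Claims about degenerate elements are thereby reduced to the generators of lists with a
  repetition.\<close>

lemma Hd_span: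
  assumes "submodule H k (At (U p) d)" "\<And>L. L \<in> WL d \<Longrightarrow> length L = Suc p \<Longrightarrow> adj L \<Longrightarrow> gen p d L \<in> H" "h \<in> Hd p d"
  shows "h \<in> H"
  by (rule lbasis_span_sub[OF ck gen_lbasis[of p d], where ?I0.0 = "{L. adj L}"])
    (use assms gen_dual in \<open>auto simp: degenerate_def\<close>)

lemma Hd_act: assumes "d \<in> S" "e \<in> S" "u \<in> Mor D d e" "h \<in> Hd p d" shows "Act (U p) d e u h \<in> Hd p e"
proof -
  note A = kCmod_act[OF U_kCmod, unfolded C_sel, OF assms(1-3)]
  have "h \<in> {x \<in> carrier (At (U p) d). Act (U p) d e u x \<in> Hd p e}"
  proof (rule Hd_span[OF submodule_vimage[OF U_module U_module A Hd_submodule] _ assms(4)])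
    fix L assume L: "L \<in> WL d" "length L = Suc p" "adj L"
    have "adj (map (\<lambda>\<mu> j. u j + \<mu> j) L)" using L(3) by (auto simp: adj_nth)
    then have "gen p e (map (\<lambda>\<mu> j. u j + \<mu> j) L) \<in> Hd p e" using WL_map_add[OF L(1) assms(3)] L(2) by (intro gen_adj) auto
    then show "gen p d L \<in> {x \<in> carrier (At (U p) d). Act (U p) d e u x \<in> Hd p e}"
      using act_gen[OF assms(1-3) L(1,2)] gen_closed[OF L(1,2)] by simp
  qed
  then show ?thesis by simp
qed

text \<open>On the generator of a list with a repetition the differential is an alternating sum to
  which \<open>alt_adj\<close> applies.\<close>

lemma Hd_diff: assumes "h \<in> Hd (Suc p) d" shows "ubar_diff C K1 p d h \<in> Hd p d"
proof -
  have "h \<in> {x \<in> carrier (At (U (Suc p)) d). ubar_diff C K1 p d x \<in> Hd p d}"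
  proof (rule Hd_span[OF submodule_vimage[OF U_module U_module ubar_diff_hom Hd_submodule] _ assms])
    fix L assume L: "L \<in> WL d" "length L = Suc (Suc p)" "adj L"
    have dl: "K \<in> WL d" "length K = Suc p" if "K \<in> dels L" for K
      using WL_dels[OF L(1) that] dels_length[OF that] L(2) by auto
    have "alt (At (U p) d) (gen p d) L \<in> Hd p d"
      by (rule alt_adj[OF U_module Hd_submodule L(3)]) (use dl in \<open>auto intro!: gen_closed gen_adj\<close>)
    then show "gen (Suc p) d L \<in> {x \<in> carrier (At (U (Suc p)) d). ubar_diff C K1 p d x \<in> Hd p d}"
      using ubar_diff_gen[OF L(1,2)] gen_closed[OF L(1,2)] by simp
  qed
  then show ?thesis by simp
qed

abbreviation "NB p \<equiv> nbar C K1 p"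

sublocale nb: fquot k C "U p" "Hd p" for p
  by (rule fquot.intro) (use U_kCmod Hd_submodule Hd_act category_C in auto)

lemma NB_eq: "NB p = quot_fmod (U p) (Hd p)"
  by (simp add: nbar_def)

lemma NB_kCmod: "is_kCmod k C (NB p)"
  unfolding NB_eq by (rule nb.quot_kCmod)

definition "cls p d x = Hd p d +>\<^bsub>At (U p) d\<^esub> x"

lemma nq: "quotient_module k (At (U p) d) (Hd p d)"
  using Hd_submodule U_module by (simp add: quotient_module_def quotient_module_axioms_def)

lemma cls_hom: "cls p d \<in> mod_hom k (At (U p) d) (At (NB p) d)"
  using quotient_module.proj_hom[OF nq] by (simp add: NB_eq quot_fmod_def cls_def[abs_def])

lemma nbar_diff_cls: "x \<in> carrier (At (U (Suc p)) d) \<Longrightarrow> nbar_diff C K1 p d (cls (Suc p) d x) = cls p d (ubar_diff C K1 p d x)"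
  unfolding nbar_diff_def cls_def by (rule quot_map_coset[OF nq nq ubar_diff_hom Hd_diff])

lemma cls_surj: "Y \<in> carrier (At (NB p) d) \<Longrightarrow> \<exists>x\<in>carrier (At (U p) d). Y = cls p d x"
  using quotient_module.coset_carrier[OF nq] by (simp add: NB_eq quot_fmod_def cls_def)

lemma act_cls:
  assumes "d \<in> S" "e \<in> S" "u \<in> Mor D d e" "x \<in> carrier (At (U p) d)"
  shows "Act (NB p) d e u (cls p d x) = cls p e (Act (U p) d e u x)"
  using nb.act_coset[of d e u x p] assms by (simp add: NB_eq cls_def)

lemma nbar_diff_nat: "nbar_diff C K1 p \<in> nat_trans k C (NB (Suc p)) (NB p)"
proof -
  have "nbar_diff C K1 p d \<in> mod_hom k (At (NB (Suc p)) d) (At (NB p) d)" for d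
    using quot_map_hom[OF nq nq ubar_diff_hom Hd_diff] by (simp add: nbar_diff_def NB_eq quot_fmod_def)
  moreover have "nbar_diff C K1 p e (Act (NB (Suc p)) d e u Y) = Act (NB p) d e u (nbar_diff C K1 p d Y)"
    if a: "d \<in> S" "e \<in> S" "u \<in> Mor D d e" and Y: "Y \<in> carrier (At (NB (Suc p)) d)" for d e u Y
  proof -
    obtain x where x: "x \<in> carrier (At (U (Suc p)) d)" "Y = cls (Suc p) d x" using cls_surj[OF Y] by blast
    show ?thesis
      using x act_cls[OF a x(1)] nbar_diff_cls[OF x(1)] nbar_diff_cls[OF mod_homD(1)[OF kCmod_act[OF U_kCmod, unfolded C_sel, OF a] x(1)]]
        act_cls[OF a mod_homD(1)[OF ubar_diff_hom x(1)]] nat_trans_act[OF ubar_diff_nat, unfolded C_sel, OF a x(1)] by simp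
  qed
  ultimately show ?thesis by (simp add: nat_trans_def)
qed

text \<open>The generator of the normalized complex that belongs to the chain \<open>t\<close>: the
  class of the identity at its last object.\<close>

definition "bt p t = cls p (cn t) (free_gen k C (chains C p) cn (cn t) t (\<lambda>j. 0))"

lemma cls_gen:
  assumes "d \<in> S" "L \<in> WL d" "length L = Suc p"
  shows "cls p d (gen p d L) = Act (NB p) (obj d (last L)) d (last L) (bt p (ch d L))"
proof -
  have c: "cn (ch d L) = obj d (last L)" using assms(3) by (cases L) (simp_all add: ch_def last_map)
  note t = ch_chains[OF assms(2,3)]
  have cS: "obj d (last L) \<in> S" using assms(2,3) by (cases L) (auto simp: WL_def)
  have z: "(\<lambda>j. 0) \<in> Mor D (obj d (last L)) (obj d (last L))" by (simp add: MorD NV_zero)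
  have w: "last L \<in> Mor D (obj d (last L)) d" using t(2) c by simp
  let ?fg = "free_gen k C (chains C p) cn"
  have fc: "?fg (obj d (last L)) (ch d L) (\<lambda>j. 0) \<in> carrier (At (U p) (obj d (last L)))"
    unfolding U_free by (rule lbasis_closed[OF free_gen_lbasis[OF ck category_C chains_obj], of "(ch d L, \<lambda>j. 0)", simplified])
      (use t z c in auto)
  have "gen p d L = Act (U p) (obj d (last L)) d (last L) (?fg (obj d (last L)) (ch d L) (\<lambda>j. 0))"
    using free_gen_act[OF ck category_C chains_obj, of "obj d (last L)" d "last L" "ch d L" p "\<lambda>j. 0"] assms(1) cS w t z c
    by (simp add: U_free gen_def)
  then show ?thesis using act_cls[OF cS assms(1) w fc] by (simp add: bt_def c)
qed

text \<open>By \<open>lbasis_quot\<close> the lists without repetition index a basis of the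
  quotient. Rewriting such a list as a chain and a morphism \<open>w\<close> identifies the basis
  vector as the translate of \<open>bt p t\<close> along \<open>w\<close>.\<close>

lemma NB_fbasis: "fbasis k C (NB p) (nchains p) cn (bt p)"
proof -
  have o: "cn t \<in> S" if "t \<in> nchains p" for t using that chains_obj by (auto simp: nchains_def)
  have basis: "lbasis k (At (NB p) d) {L \<in> bar_lists S d. length L = Suc p} (\<lambda>L. cls p d (gen p d L))" for d
  proof -
    have "lbasis k (quot_mod (At (U p) d) (Hd p d)) {L \<in> bar_lists S d. length L = Suc p} (\<lambda>L. Hd p d +>\<^bsub>At (U p) d\<^esub> gen p d L)"
    proof (rule lbasis_quot[OF gen_lbasis nq ck])
      show "{L \<in> bar_lists S d. length L = Suc p} \<subseteq> {L \<in> WL d. length L = Suc p}" by (auto simp: bar_lists_WL)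
      show "\<And>L. L \<in> {L \<in> WL d. length L = Suc p} \<Longrightarrow> L \<notin> {L \<in> bar_lists S d. length L = Suc p} \<Longrightarrow> gen p d L \<in> Hd p d"
        using gen_adj by (auto simp: bar_lists_WL)
      fix L assume "L \<in> {L \<in> bar_lists S d. length L = Suc p}"
      then have L: "L \<in> WL d" "length L = Suc p" "\<not> adj L" by (auto simp: bar_lists_WL)
      obtain \<kappa> where \<kappa>: "\<kappa> \<in> mod_hom k (At (U p) d) (self_mod k)"
        "\<And>K. K \<in> {L \<in> WL d. length L = Suc p} \<Longrightarrow> \<kappa> (gen p d K) = (if K = L then \<one>\<^bsub>k\<^esub> else \<zero>\<^bsub>k\<^esub>)"
        using gen_lbasis[of p d] L(1,2) unfolding lbasis_def by blast
      show "\<exists>\<kappa>\<in>mod_hom k (At (U p) d) (self_mod k). (\<forall>h\<in>Hd p d. \<kappa> h = \<zero>\<^bsub>k\<^esub>) \<and>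
          (\<forall>j\<in>{L \<in> bar_lists S d. length L = Suc p}. \<kappa> (gen p d j) = (if j = L then \<one>\<^bsub>k\<^esub> else \<zero>\<^bsub>k\<^esub>))"
        by (rule bexI[OF _ \<kappa>(1)]) (use gen_dual[OF L \<kappa>] \<kappa>(2) in \<open>auto simp: bar_lists_WL\<close>)
    qed
    then show ?thesis by (simp add: NB_eq quot_fmod_def cls_def)
  qed
  have "lbasis k (At (NB p) d) (SIGMA t:nchains p. Mor D (cn t) d) (\<lambda>(t, w). Act (NB p) (cn t) d w (bt p t))" if d: "d \<in> S" for d
  proof -
    let ?h = "inv_into {L \<in> bar_lists S d. length L = Suc p} (\<lambda>L. (ch d L, last L))"
    have h: "bij_betw ?h (SIGMA t:nchains p. Mor D (cn t) d) {L \<in> bar_lists S d. length L = Suc p}"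
      by (rule bij_betw_inv_into[OF ch_bij_strict])
    show ?thesis
    proof (rule lbasis_cong[OF _ lbasis_reindex[OF basis h]])
      fix i assume i: "i \<in> (SIGMA t:nchains p. Mor D (cn t) d)"
      have "i \<in> (\<lambda>L. (ch d L, last L)) ` {L \<in> bar_lists S d. length L = Suc p}"
        using i ch_bij_strict[of d p] by (simp only: bij_betw_def)
      then obtain L where L: "L \<in> bar_lists S d" "length L = Suc p" "i = (ch d L, last L)" by blast
      have "?h i = L" unfolding L(3) by (rule inv_into_f_f) (use ch_bij_strict[of d p] L in \<open>auto simp: bij_betw_def\<close>)
      moreover have "cn (ch d L) = obj d (last L)" using L(2) by (cases L) (simp_all add: ch_def last_map)
      ultimately show "cls p d (gen p d (?h i)) = (\<lambda>(t, w). Act (NB p) (cn t) d w (bt p t)) i"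
        using cls_gen[OF d, of L p] L by (simp add: bar_lists_WL)
    qed
  qed
  moreover have "bt p t \<in> carrier (At (NB p) (cn t))" if "t \<in> nchains p" for t
  proof -
    have "free_gen k C (chains C p) cn (cn t) t (\<lambda>j. 0) \<in> carrier (At (U p) (cn t))"
      unfolding U_free by (rule lbasis_closed[OF free_gen_lbasis[OF ck category_C chains_obj], of "(t, \<lambda>j. 0)", simplified])
        (use that in \<open>auto simp: nchains_def MorD NV_zero\<close>)
    then show ?thesis unfolding bt_def by (rule mod_homD(1)[OF cls_hom])
  qed
  ultimately show ?thesis unfolding fbasis_def using NB_kCmod o by (simp add: Pi_iff)
qed

end

section \<open>Induction of the bar resolution\<close>

text \<open>The complex on lists is shifted by one: \<open>T (Suc i)\<close> corresponds to
  \<open>F i\<close>, and \<open>T 0\<close>, the term of the empty list, to \<open>M\<close>. The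
  isomorphisms \<open>\<Psi>\<close> and \<open>\<theta>\<close> carry exactness over.\<close>

lemma exact_augmented_transfer:
  fixes T :: "nat \<Rightarrow> ('k, 'u) module"
  assumes F: "\<And>i. Module.module k (F i)" and M: "Module.module k M" and T: "\<And>i. Module.module k (T i)"
    and \<Psi>: "\<And>i. \<Psi> i \<in> mod_hom k (F i) (T (Suc i))" "\<And>i. bij_betw (\<Psi> i) (carrier (F i)) (carrier (T (Suc i)))"
    and \<theta>: "\<theta> \<in> mod_hom k M (T 0)" "bij_betw \<theta> (carrier M) (carrier (T 0))"
    and d: "\<And>i. d i \<in> mod_hom k (F (Suc i)) (F i)" and e: "e \<in> mod_hom k (F 0) M"
    and cd: "\<And>i x. x \<in> carrier (F (Suc i)) \<Longrightarrow> \<delta> (Suc i) (\<Psi> (Suc i) x) = \<Psi> i (d i x)"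
    and ce: "\<And>x. x \<in> carrier (F 0) \<Longrightarrow> \<delta> 0 (\<Psi> 0 x) = \<theta> (e x)"
    and dd: "\<And>i z. z \<in> carrier (T (Suc (Suc i))) \<Longrightarrow> \<delta> i (\<delta> (Suc i) z) = \<zero>\<^bsub>T i\<^esub>"
    and ex0: "\<And>z. z \<in> carrier (T 0) \<Longrightarrow> z \<in> \<delta> 0 ` carrier (T (Suc 0))"
    and ex: "\<And>i z. z \<in> carrier (T (Suc i)) \<Longrightarrow> \<delta> i z = \<zero>\<^bsub>T i\<^esub> \<Longrightarrow> z \<in> \<delta> (Suc i) ` carrier (T (Suc (Suc i)))"
  shows "exact_augmented F d e M"
proof -
  have Tim: "\<exists>x\<in>carrier (F i). \<Psi> i x = y" if "y \<in> carrier (T (Suc i))" for i y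
  proof -
    have "y \<in> \<Psi> i ` carrier (F i)" using that \<Psi>(2)[of i] by (simp add: bij_betw_def)
    then show ?thesis by auto
  qed
  have inj: "x = y" if "x \<in> carrier (F i)" "y \<in> carrier (F i)" "\<Psi> i x = \<Psi> i y" for i x y
    using that \<Psi>(2)[of i] by (auto simp: bij_betw_def inj_on_def)
  have injM: "x = y" if "x \<in> carrier M" "y \<in> carrier M" "\<theta> x = \<theta> y" for x y
    using that \<theta>(2) by (auto simp: bij_betw_def inj_on_def)
  have z: "\<Psi> i \<zero>\<^bsub>F i\<^esub> = \<zero>\<^bsub>T (Suc i)\<^esub>" for i by (rule mod_hom_zero[OF F T \<Psi>(1)])
  have z\<theta>: "\<theta> \<zero>\<^bsub>M\<^esub> = \<zero>\<^bsub>T 0\<^esub>" by (rule mod_hom_zero[OF M T \<theta>(1)])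
  note Pc = mod_homD(1)[OF \<Psi>(1)] and dc = mod_homD(1)[OF d] and ec = mod_homD(1)[OF e] and tc = mod_homD(1)[OF \<theta>(1)]
  have A: "e ` carrier (F 0) = carrier M"
  proof (intro equalityI subsetI)
    fix m assume m: "m \<in> carrier M"
    obtain y where y: "y \<in> carrier (T (Suc 0))" "\<theta> m = \<delta> 0 y" using ex0[OF tc[OF m]] by blast
    obtain x where x: "x \<in> carrier (F 0)" "\<Psi> 0 x = y" using Tim[OF y(1)] by blast
    have "e x = m" by (rule injM[OF ec[OF x(1)] m]) (use ce[OF x(1)] x(2) y(2) in simp)
    then show "m \<in> e ` carrier (F 0)" using x(1) by blast
  qed (use ec in auto)
  have B: "d 0 ` carrier (F 1) = a_kernel (F 0) M e"
  proof (intro equalityI subsetI)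
    fix y assume "y \<in> d 0 ` carrier (F 1)"
    then obtain x where x: "x \<in> carrier (F (Suc 0))" "y = d 0 x" by auto
    have "e y = \<zero>\<^bsub>M\<^esub>"
      by (rule injM[OF ec mod_zero[OF M]]) (use x dc[OF x(1)] cd[OF x(1)] ce[OF dc[OF x(1)]] dd[OF Pc[OF x(1)]] z\<theta> in auto)
    then show "y \<in> a_kernel (F 0) M e" using x dc[OF x(1)] by (simp add: a_kernel_def')
  next
    fix y assume "y \<in> a_kernel (F 0) M e"
    then have y: "y \<in> carrier (F 0)" "e y = \<zero>\<^bsub>M\<^esub>" by (auto simp: a_kernel_def')
    obtain u where u: "u \<in> carrier (T (Suc (Suc 0)))" "\<Psi> 0 y = \<delta> (Suc 0) u"
      using ex[OF Pc[OF y(1)]] ce[OF y(1)] y(2) z\<theta> by auto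
    obtain x where x: "x \<in> carrier (F (Suc 0))" "\<Psi> (Suc 0) x = u" using Tim[OF u(1)] by blast
    have "d 0 x = y" by (rule inj[OF dc[OF x(1)] y(1)]) (use cd[OF x(1)] x(2) u(2) in simp)
    then show "y \<in> d 0 ` carrier (F 1)" using x(1) by auto
  qed
  have "d (Suc i) ` carrier (F (Suc (Suc i))) = a_kernel (F (Suc i)) (F i) (d i)" for i
  proof (intro equalityI subsetI)
    fix y assume "y \<in> d (Suc i) ` carrier (F (Suc (Suc i)))"
    then obtain x where x: "x \<in> carrier (F (Suc (Suc i)))" "y = d (Suc i) x" by auto
    have "d i y = \<zero>\<^bsub>F i\<^esub>"
      by (rule inj[OF dc mod_zero[OF F]]) (use x dc[OF x(1)] cd[OF x(1)] cd[OF dc[OF x(1)]] dd[OF Pc[OF x(1)]] z in auto)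
    then show "y \<in> a_kernel (F (Suc i)) (F i) (d i)" using x dc[OF x(1)] by (simp add: a_kernel_def')
  next
    fix y assume "y \<in> a_kernel (F (Suc i)) (F i) (d i)"
    then have y: "y \<in> carrier (F (Suc i))" "d i y = \<zero>\<^bsub>F i\<^esub>" by (auto simp: a_kernel_def')
    obtain u where u: "u \<in> carrier (T (Suc (Suc (Suc i))))" "\<Psi> (Suc i) y = \<delta> (Suc (Suc i)) u"
      using ex[OF Pc[OF y(1)]] cd[OF y(1)] y(2) z by auto
    obtain x where x: "x \<in> carrier (F (Suc (Suc i)))" "\<Psi> (Suc (Suc i)) x = u" using Tim[OF u(1)] by blast
    have "d (Suc i) x = y" by (rule inj[OF dc[OF x(1)] y(1)]) (use cd[OF x(1)] x(2) u(2) in simp)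
    then show "y \<in> d (Suc i) ` carrier (F (Suc (Suc i)))" using x(1) by auto
  qed
  then show ?thesis using A B by (simp add: exact_augmented_def)
qed

sublocale betti_setup \<subseteq> subcat r n a k S
  by (intro subcat.intro action_axioms subcat_axioms.intro ck) (use S_obj in auto)

context betti_setup begin

lemma betti_C: "betti_category k D P = C"
  using S_obj by (auto simp: S_def betti_category_def full_subcat_def)

abbreviation "\<rho>o \<equiv> (\<lambda>c :: nat \<Rightarrow> int. c)"
abbreviation "\<rho>m \<equiv> (\<lambda>(c :: nat \<Rightarrow> int) (d :: nat \<Rightarrow> int) (u :: nat \<Rightarrow> nat). u)"
abbreviation "F p \<equiv> ind_fmod k C D \<rho>o \<rho>m (NB p)"
abbreviation "dF p \<equiv> ind_map k C D \<rho>o \<rho>m (NB (Suc p)) (NB p) (nbar_diff C K1 p)"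
abbreviation "et p \<equiv> ind_unit k C D \<rho>o \<rho>m (NB p)"

sublocale ind: kan_ext k C D \<rho>o \<rho>m "NB p" for p
  by (intro kan_ext.intro ck category_C category_D functor_C NB_kCmod)

sublocale indm: kan_map k C D \<rho>o \<rho>m "NB (Suc p)" "NB p" "nbar_diff C K1 p" for p
  by (intro kan_map.intro kan_map_axioms.intro ind.kan_ext_axioms nbar_diff_nat)

lemma F_kCmod: "is_kCmod k D (F p)"
  by (rule ind.ind_is_kCmod)

lemma F_fbasis: "fbasis k D (F p) (nchains p) cn (\<lambda>t. et p (cn t) (bt p t))"
  by (rule ind.ind_fbasis[OF NB_fbasis])

lemma dF_nat: "dF p \<in> nat_trans k D (F (Suc p)) (F p)"
  by (rule indm.ind_map_nat_trans)

text \<open>The basis element at \<open>d\<close> encoded by a list. The object \<open>d\<close>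
  need not lie in \<open>S\<close>; the bar generator lives at the last object of the chain and is
  moved to \<open>d\<close> by the last exponent.\<close>

definition "bF p d L = Act (F p) (obj d (last L)) d (last L) (et p (obj d (last L)) (bt p (ch d L)))"

lemma cn_ch: "L \<noteq> [] \<Longrightarrow> cn (ch d L) = obj d (last L)"
  by (simp add: ch_def last_map)

lemma bF_lbasis: assumes "d \<in> Obj D" shows "lbasis k (At (F p) d) {L \<in> bar_lists S d. length L = Suc p} (bF p d)"
proof (rule lbasis_cong[OF _ lbasis_reindex[OF fbasis_lbasis[OF F_fbasis assms] ch_bij_strict]])
  fix L assume "L \<in> {L \<in> bar_lists S d. length L = Suc p}"
  then have "L \<noteq> []" by auto
  then show "(\<lambda>(t, w). Act (F p) (cn t) d w (et p (cn t) (bt p t))) (ch d L, last L) = bF p d L"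
    by (simp add: bF_def cn_ch)
qed

lemma F_module: "d \<in> Obj D \<Longrightarrow> Module.module k (At (F p) d)"
  by (rule kCmod_module[OF F_kCmod])

lemma bF_closed: "d \<in> Obj D \<Longrightarrow> L \<in> bar_lists S d \<Longrightarrow> length L = Suc p \<Longrightarrow> bF p d L \<in> carrier (At (F p) d)"
  by (rule lbasis_closed[OF bF_lbasis]) auto

lemma dF_bF:
  assumes d: "d \<in> Obj D" and L: "L \<in> bar_lists S d" "length L = Suc (Suc p)"
  shows "dF p d (bF (Suc p) d L) = alt (At (F p) d) (bF p d) L"
proof -
  define w where "w = last L"
  define c where "c = obj d w"
  \<comment> \<open>The same list seen from \<open>c\<close>: subtracting \<open>w\<close> from
    every entry makes the last entry 0 and leaves the chain unchanged.\<close>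
  define L0 where "L0 = map (\<lambda>\<mu> j. \<mu> j - w j) L"
  have LW: "L \<in> WL d" using L(1) by (simp add: bar_lists_WL)
  have ne: "L \<noteq> []" using L(2) by auto
  have "w \<in> set L" using ne by (simp add: w_def)
  then have w: "w \<in> NV" "c \<in> S" using LW by (auto simp: WL_def c_def)
  have cD: "c \<in> Obj D" using S_obj w(2) .
  have wm: "w \<in> Mor D c d" by (simp add: MorD w c_def)
  have le: "w \<le> \<mu>" if "\<mu> \<in> set L" for \<mu>
  proof -
    have "sorted_wrt (\<lambda>x y. y \<le> x) (butlast L @ [last L])" using LW ne by (simp add: WL_def)
    then have "\<forall>x\<in>set (butlast L). last L \<le> x" by (simp add: sorted_wrt_append)
    moreover have "\<mu> \<in> set (butlast L @ [last L])" using ne that by simp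
    then have "\<mu> = last L \<or> \<mu> \<in> set (butlast L)" unfolding set_append by auto
    ultimately show ?thesis unfolding w_def by blast
  qed
  have L0W: "L0 \<in> WL c"
  proof -
    have "obj c (\<lambda>j. \<mu> j - w j) = obj d \<mu>" if "\<mu> \<in> set L" for \<mu> using obj_diff[OF le[OF that]] by (simp add: c_def)
    moreover have "sorted_wrt (\<lambda>x y. y \<le> x) L0"
      unfolding L0_def sorted_wrt_map
      by (rule sorted_wrt_mono_rel[of _ "\<lambda>x y. y \<le> x"]) (use LW in \<open>auto simp: WL_def le_fun_def intro: diff_le_mono\<close>)
    ultimately show ?thesis using LW by (auto simp: WL_def L0_def NV_diff)
  qed
  have L0L: "map (\<lambda>\<mu> j. w j + \<mu> j) L0 = L"
    unfolding L0_def map_map by (rule map_idI) (use le in \<open>auto simp: le_fun_def\<close>)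
  have L0len: "length L0 = Suc (Suc p)" by (simp add: L0_def L)
  have chL: "ch d L = ch c L0" using WL_map_add(2)[OF L0W wm] L0L by simp
  have last0: "last L0 = (\<lambda>j. 0)" using ne by (simp add: L0_def last_map w_def)
  have L0ne: "L0 \<noteq> []" using ne by (simp add: L0_def)
  have bt0: "bt (Suc p) (ch d L) = cls (Suc p) c (gen (Suc p) c L0)"
    using cn_ch[OF L0ne, of c] last0 by (simp add: chL bt_def gen_def)
  have dl: "K \<in> WL c" "length K = Suc p" "K \<noteq> []" if "K \<in> dels L0" for K
    using WL_dels[OF L0W that] dels_length[OF that] L0len by auto
  have ec: "et p c \<in> mod_hom k (At (NB p) c) (At (F p) c)"
    using nat_trans_hom[OF ind.ind_unit_nat_trans, of c p] w(2) by (simp add: res_fmod_def)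
  have "nbar_diff C K1 p c (bt (Suc p) (ch d L)) = cls p c (alt (At (U p) c) (gen p c) L0)"
    unfolding bt0 using nbar_diff_cls[OF gen_closed[OF L0W L0len]] ubar_diff_gen[OF L0W L0len] by simp
  also have "\<dots> = alt (At (NB p) c) (\<lambda>K. cls p c (gen p c K)) L0"
    by (rule mod_hom_alt[OF U_module kCmod_module[OF NB_kCmod] cls_hom]) (use dl gen_closed w(2) in auto)
  finally have nd: "nbar_diff C K1 p c (bt (Suc p) (ch d L)) = alt (At (NB p) c) (\<lambda>K. cls p c (gen p c K)) L0" .
  have clc: "cls p c (gen p c K) \<in> carrier (At (NB p) c)" if "K \<in> dels L0" for K
    by (rule mod_homD(1)[OF cls_hom gen_closed]) (use dl[OF that] in auto)
  have btc: "bt (Suc p) (ch d L) \<in> carrier (At (NB (Suc p)) c)"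
    unfolding bt0 by (rule mod_homD(1)[OF cls_hom gen_closed[OF L0W L0len]])
  have step: "et p c (cls p c (gen p c K)) = bF p c K" if K: "K \<in> dels L0" for K
  proof -
    have cK: "obj c (last K) \<in> S" "last K \<in> NV" using dl[OF K] by (auto simp: WL_def)
    have lm: "last K \<in> Mor D (obj c (last K)) c" by (simp add: MorD cK)
    have tc: "ch c K \<in> chains C p" by (rule ch_chains(1)[OF dl(1,2)[OF K]])
    have bc: "bt p (ch c K) \<in> carrier (At (NB p) (obj c (last K)))"
    proof -
      have "free_gen k C (chains C p) cn (cn (ch c K)) (ch c K) (\<lambda>j. 0) \<in> carrier (At (U p) (cn (ch c K)))"
        unfolding U_free by (rule lbasis_closed[OF free_gen_lbasis[OF ck category_C chains_obj], of "(ch c K, \<lambda>j. 0)", simplified])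
          (use tc in \<open>auto simp: MorD NV_zero\<close>)
      then show ?thesis unfolding bt_def cn_ch[OF dl(3)[OF K]] by (rule mod_homD(1)[OF cls_hom])
    qed
    show ?thesis unfolding cls_gen[OF w(2) dl(1,2)[OF K]] bF_def
      using nat_trans_act[OF ind.ind_unit_nat_trans, of "obj c (last K)" c "last K" "bt p (ch c K)" p] cK(1) w(2) lm bc
      by (simp add: res_fmod_def)
  qed
  have bFc: "bF p c K \<in> carrier (At (F p) c)" if K: "K \<in> dels L0" for K
    unfolding step[OF K, symmetric] by (rule mod_homD(1)[OF ec clc[OF K]])
  have etc: "et (Suc p) c (bt (Suc p) (ch d L)) \<in> carrier (At (F (Suc p)) c)"
    using ind.unit_in[of c "bt (Suc p) (ch d L)" "Suc p"] btc w(2) by simp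
  have "dF p d (bF (Suc p) d L) = Act (F p) c d w (dF p c (et (Suc p) c (bt (Suc p) (ch d L))))"
    unfolding bF_def w_def[symmetric] c_def[symmetric] by (rule nat_trans_act[OF dF_nat cD d wm etc])
  also have "dF p c (et (Suc p) c (bt (Suc p) (ch d L))) = et p c (nbar_diff C K1 p c (bt (Suc p) (ch d L)))"
    using indm.ind_map_unit[of c "bt (Suc p) (ch d L)" p] btc w(2) by simp
  also have "\<dots> = alt (At (F p) c) (\<lambda>K. bF p c K) L0"
  proof -
    have "et p c (nbar_diff C K1 p c (bt (Suc p) (ch d L))) = alt (At (F p) c) (\<lambda>K. et p c (cls p c (gen p c K))) L0"
      unfolding nd by (rule mod_hom_alt[OF kCmod_module[OF NB_kCmod] F_module[OF cD] ec clc]) (use w(2) in simp)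
    also have "\<dots> = alt (At (F p) c) (\<lambda>K. bF p c K) L0" by (rule alt_cong) (rule step)
    finally show ?thesis .
  qed
  also have "Act (F p) c d w (alt (At (F p) c) (\<lambda>K. bF p c K) L0) = alt (At (F p) d) (\<lambda>K. Act (F p) c d w (bF p c K)) L0"
    by (rule mod_hom_alt[OF F_module[OF cD] F_module[OF d] kCmod_act[OF F_kCmod cD d wm] bFc])
  also have "\<dots> = alt (At (F p) d) (\<lambda>K. bF p d (map (\<lambda>\<mu> j. w j + \<mu> j) K)) L0"
  proof (rule alt_cong)
    fix K assume K: "K \<in> dels L0"
    have cK: "obj c (last K) \<in> S" "last K \<in> NV" using dl[OF K] by (auto simp: WL_def)
    have lm: "last K \<in> Mor D (obj c (last K)) c" by (simp add: MorD cK)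
    have lk: "last (map (\<lambda>\<mu> j. w j + \<mu> j) K) = (\<lambda>j. w j + last K j)" using dl(3)[OF K] by (simp add: last_map)
    have o: "obj d (\<lambda>j. w j + last K j) = obj c (last K)" by (simp add: c_def obj_obj)
    have "et p (obj c (last K)) (bt p (ch c K)) \<in> carrier (At (F p) (obj c (last K)))"
    proof -
      have "free_gen k C (chains C p) cn (cn (ch c K)) (ch c K) (\<lambda>j. 0) \<in> carrier (At (U p) (cn (ch c K)))"
        unfolding U_free by (rule lbasis_closed[OF free_gen_lbasis[OF ck category_C chains_obj], of "(ch c K, \<lambda>j. 0)", simplified])
          (use ch_chains(1)[OF dl(1,2)[OF K]] in \<open>auto simp: MorD NV_zero\<close>)
      then have "bt p (ch c K) \<in> carrier (At (NB p) (obj c (last K)))"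
        unfolding bt_def cn_ch[OF dl(3)[OF K]] by (rule mod_homD(1)[OF cls_hom])
      then show ?thesis using ind.unit_in[of "obj c (last K)" "bt p (ch c K)" p] cK(1) by simp
    qed
    then show "Act (F p) c d w (bF p c K) = bF p d (map (\<lambda>\<mu> j. w j + \<mu> j) K)"
      using kCmod_comp[OF F_kCmod S_obj[OF cK(1)] cD d lm wm] WL_map_add(2)[OF dl(1)[OF K] wm]
      by (simp add: bF_def lk o)
  qed
  also have "\<dots> = alt (At (F p) d) (bF p d) (map (\<lambda>\<mu> j. w j + \<mu> j) L0)" by (simp add: alt_map)
  finally show ?thesis unfolding L0L .
qed

text \<open>\<open>F 0\<close> is free on the objects in \<open>S\<close>; each generator is sent to
  the monomial of its degree, which exists because \<open>S \<subseteq> DQ\<close>.\<close>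

lemma augmentation_exists:
  "\<exists>e\<in>nat_trans k D (F 0) kF. \<forall>d\<in>Obj D. \<forall>L\<in>bar_lists S d. length L = Suc 0 \<longrightarrow> e d (bF 0 d L) = un d"
proof -
  have o: "cn t \<in> S" if "t \<in> nchains 0" for t using that chains_obj by (auto simp: nchains_def)
  have "\<exists>e\<in>nat_trans k D (F 0) kF. \<forall>d\<in>Obj D. \<forall>t\<in>nchains 0. \<forall>w\<in>Mor D (cn t) d.
     e d (Act (F 0) (cn t) d w (et 0 (cn t) (bt 0 t))) = Act kF (cn t) d w (un (cn t))"
    by (rule fbasis_lift[OF ck category_D F_fbasis M_kCmod]) (use un_closed S_DQ o in blast)
  then obtain e where e: "e \<in> nat_trans k D (F 0) kF" "\<forall>d\<in>Obj D. \<forall>t\<in>nchains 0. \<forall>w\<in>Mor D (cn t) d.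
     e d (Act (F 0) (cn t) d w (et 0 (cn t) (bt 0 t))) = Act kF (cn t) d w (un (cn t))" by blast
  have "e d (bF 0 d L) = un d" if d: "d \<in> Obj D" and L: "L \<in> bar_lists S d" "length L = Suc 0" for d L
  proof -
    have LW: "L \<in> WL d" using L(1) by (simp add: bar_lists_WL)
    have ne: "L \<noteq> []" using L(2) by auto
    have "(ch d L, last L) \<in> (SIGMA t:nchains 0. Mor D (cn t) d)"
      using ch_bij_strict[of d 0] L by (auto simp: bij_betw_def)
    then have t: "ch d L \<in> nchains 0" "last L \<in> Mor D (cn (ch d L)) d" by auto
    have "e d (bF 0 d L) = Act kF (cn (ch d L)) d (last L) (un (cn (ch d L)))"
      using e(2)[rule_format, OF d t] by (simp add: bF_def cn_ch[OF ne])
    also have "\<dots> = un d" using act_un(2)[OF _ t(2)] o[OF t(1)] S_DQ by auto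
    finally show ?thesis .
  qed
  then show ?thesis using e(1) by blast
qed

text \<open>In list coordinates the induced complex is the one with coefficients in
  \<open>k[Q]\<close>: the head of a nonempty admissible list has its object in \<open>S\<close>,
  hence in \<open>DQ\<close>, where the coefficients are one-dimensional. Exactness is then
  \<open>bar_exact\<close>.\<close>

lemma F_exact:
  assumes e: "e \<in> nat_trans k D (F 0) kF" and eb: "\<forall>d\<in>Obj D. \<forall>L\<in>bar_lists S d. length L = Suc 0 \<longrightarrow> e d (bF 0 d L) = un d"
    and d: "d \<in> Obj D"
  shows "exact_augmented (\<lambda>i. At (F i) d) (\<lambda>i. dF i d) (e d) (At kF d)"
proof -
  interpret V: bar_sys r n a k S d by (intro bar_sys.intro bar_sys_axioms.intro action_axioms ck d)
  interpret VQ: vsys_Q Q k r n \<iota> g P dP eP "bar_lists S d" head_exp d ..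
  interpret G: lsys k "bar_lists S d" "V.G kF" "V.ac kF" by (rule V.lsys_G[OF M_kCmod])
  let ?A = "bar_lists S d"
  let ?T = "\<lambda>p. Tm ?A (V.G kF) p"
  let ?\<delta> = "\<lambda>p. bd ?A (V.G kF) (V.ac kF) p"
  have TB: "lbasis k (?T p) {(L, s). (L, s) \<in> VQ.degs \<and> length L = p} VQ.ugen" for p by (rule VQ.ugen_lbasis)
  have dg: "(L, ()) \<in> VQ.degs" if "L \<in> ?A" "L \<noteq> []" for L
  proof -
    have "obj d (hd L) \<in> S" using that by (cases L) (auto simp: bar_lists_def)
    then show ?thesis using that S_DQ by (auto simp: VQ.degs_def head_exp_def)
  qed
  have bij: "bij_betw (\<lambda>L. (L, ())) {L \<in> ?A. length L = Suc p} {(L, s). (L, s) \<in> VQ.degs \<and> length L = Suc p}" for p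
    by (rule bij_betwI[where g = fst]) (auto simp: VQ.degs_def dest: dg[unfolded VQ.degs_def])
  have uc: "VQ.ugen (L, ()) \<in> carrier (?T (Suc p))" if "L \<in> ?A" "length L = Suc p" for L p
    by (rule lbasis_closed[OF TB]) (use that dg[of L] in \<open>cases "L = []"; simp\<close>)
  have "\<exists>f\<in>mod_hom k (At (F p) d) (?T (Suc p)). \<forall>L\<in>{L \<in> ?A. length L = Suc p}. f (bF p d L) = VQ.ugen (L, ())" for p
    by (rule lbasis_lift[OF ck bF_lbasis[OF d] G.modT]) (use uc in auto)
  then have "\<forall>p. \<exists>f. f \<in> mod_hom k (At (F p) d) (?T (Suc p)) \<and> (\<forall>L\<in>{L \<in> ?A. length L = Suc p}. f (bF p d L) = VQ.ugen (L, ()))" by blast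
  from choice[OF this] obtain \<Psi> where \<Psi>: "\<And>p. \<Psi> p \<in> mod_hom k (At (F p) d) (?T (Suc p))"
    "\<And>p L. L \<in> ?A \<Longrightarrow> length L = Suc p \<Longrightarrow> \<Psi> p (bF p d L) = VQ.ugen (L, ())" by auto
  show ?thesis
  proof (rule exact_augmented_transfer[where T = ?T and \<Psi> = \<Psi> and \<theta> = "Tin ?A (V.G kF) 0 []" and \<delta> = ?\<delta>, OF F_module[OF d] kCmod_module[OF M_kCmod d] G.modT \<Psi>(1)])
    show "bij_betw (\<Psi> p) (carrier (At (F p) d)) (carrier (?T (Suc p)))" for p
      by (rule lbasis_bij[OF ck bF_lbasis[OF d] TB \<Psi>(1) bij]) (simp add: \<Psi>(2))
    show th: "Tin ?A (V.G kF) 0 [] \<in> mod_hom k (At kF d) (?T 0)"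
      using G.Tin_hom[of "[]" 0] V.A_Nil V.ob_Nil by simp
    show "bij_betw (Tin ?A (V.G kF) 0 []) (carrier (At kF d)) (carrier (?T 0))"
    proof (rule bij_betwI[where g = "\<lambda>z. z []"])
      show "Tin ?A (V.G kF) 0 [] \<in> carrier (At kF d) \<rightarrow> carrier (?T 0)" using mod_homD(1)[OF th] by auto
      show "(\<lambda>z. z []) \<in> carrier (?T 0) \<rightarrow> carrier (At kF d)" using V.T0_in(1)[of _ kF] by auto
      show "Tin ?A (V.G kF) 0 [] x [] = x" for x using V.A_Nil by (simp add: dsum_in_def)
      show "Tin ?A (V.G kF) 0 [] (z []) = z" if "z \<in> carrier (?T 0)" for z using V.T0_in(2)[OF that] by simp
    qed
    show "dF i d \<in> mod_hom k (At (F (Suc i)) d) (At (F i) d)" for i by (rule nat_trans_hom[OF dF_nat d])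
    show "e d \<in> mod_hom k (At (F 0) d) (At kF d)" by (rule nat_trans_hom[OF e d])
    show "?\<delta> (Suc i) (\<Psi> (Suc i) x) = \<Psi> i (dF i d x)" if x: "x \<in> carrier (At (F (Suc i)) d)" for i x
    proof (rule lbasis_ext[OF bF_lbasis[OF d] G.modT mod_hom_comp[OF \<Psi>(1) G.bd_hom] mod_hom_comp[OF nat_trans_hom[OF dF_nat d] \<Psi>(1)] _ x])
      fix L assume "L \<in> {L \<in> ?A. length L = Suc (Suc i)}"
      then have L: "L \<in> ?A" "length L = Suc (Suc i)" by auto
      have dl: "K \<in> ?A" "length K = Suc i" if "K \<in> dels L" for K using V.A_closed[OF L(1) that] dels_length[OF that] L(2) by auto
      have Lne: "L \<noteq> []" using L(2) by auto
      have "?\<delta> (Suc i) (\<Psi> (Suc i) (bF (Suc i) d L)) = alt (?T (Suc i)) (\<lambda>K. VQ.ugen (K, ())) L"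
        using \<Psi>(2)[OF L] VQ.bd_ugen[OF dg[OF L(1) Lne] L(2)] by simp
      also have "\<dots> = alt (?T (Suc i)) (\<lambda>K. \<Psi> i (bF i d K)) L" by (rule alt_cong) (simp add: \<Psi>(2) dl)
      also have "\<dots> = \<Psi> i (alt (At (F i) d) (bF i d) L)"
        by (rule mod_hom_alt[OF F_module[OF d] G.modT \<Psi>(1), symmetric]) (rule bF_closed[OF d dl])
      finally show "?\<delta> (Suc i) (\<Psi> (Suc i) (bF (Suc i) d L)) = \<Psi> i (dF i d (bF (Suc i) d L))" unfolding dF_bF[OF d L] .
    qed
    show "?\<delta> 0 (\<Psi> 0 x) = Tin ?A (V.G kF) 0 [] (e d x)" if x: "x \<in> carrier (At (F 0) d)" for x
    proof (rule lbasis_ext[OF bF_lbasis[OF d] G.modT mod_hom_comp[OF \<Psi>(1) G.bd_hom] mod_hom_comp[OF nat_trans_hom[OF e d] th] _ x])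
      fix L assume "L \<in> {L \<in> ?A. length L = Suc 0}"
      then have L: "L \<in> ?A" "length L = Suc 0" by auto
      then obtain v where v: "L = [v]" by (cases L) auto
      have Lne: "L \<noteq> []" using L(2) by auto
      interpret T0: Module.module k "?T 0" by (rule G.modT)
      have "([], ()) \<in> VQ.degs" by (rule VQ.degs_dels[OF dg[OF L(1) Lne]]) (simp add: v)
      then have u0: "VQ.ugen ([], ()) \<in> carrier (?T 0)" by (intro lbasis_closed[OF TB]) auto
      have "?\<delta> 0 (\<Psi> 0 (bF 0 d L)) = VQ.ugen ([], ()) \<ominus>\<^bsub>?T 0\<^esub> \<zero>\<^bsub>?T 0\<^esub>"
        using \<Psi>(2)[OF L] VQ.bd_ugen[OF dg[OF L(1) Lne] L(2)] v by simp
      also have "\<dots> = VQ.ugen ([], ())" using u0 by (simp add: a_minus_def T0.M.a_inv_zero)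
      also have "\<dots> = Tin ?A (V.G kF) 0 [] (e d (bF 0 d L))"
        using eb d L V.ob_Nil by (simp add: VQ.ugen_def)
      finally show "?\<delta> 0 (\<Psi> 0 (bF 0 d L)) = Tin ?A (V.G kF) 0 [] (e d (bF 0 d L))" .
    qed
    show "?\<delta> i (?\<delta> (Suc i) z) = \<zero>\<^bsub>?T i\<^esub>" if "z \<in> carrier (?T (Suc (Suc i)))" for i z by (rule G.bd_bd[OF that])
    have ex: "Tex ?A (V.G kF) (V.ac kF) p" for p by (rule bar_exact[OF d])
    show "z \<in> ?\<delta> 0 ` carrier (?T (Suc 0))" if "z \<in> carrier (?T 0)" for z
      using ex[of 0] that by (auto simp: Tex_def Tcyc_def)
    show "z \<in> ?\<delta> (Suc i) ` carrier (?T (Suc (Suc i)))" if "z \<in> carrier (?T (Suc i))" "?\<delta> i z = \<zero>\<^bsub>?T i\<^esub>" for i z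
      using ex[of "Suc i"] that by (auto simp: Tex_def Tcyc_def)
  qed
qed

theorem F_free_resolution: "free_resolution k D F dF kF"
proof -
  have "is_free k D (F i)" for i by (rule fbasis_imp_is_free[OF ck k.one_not_zero category_D F_fbasis])
  then show ?thesis unfolding free_resolution_def
    using M_kCmod dF_nat augmentation_exists F_exact by blast
qed

text \<open>\<open>S\<close> is finite, and so is every hom set: each variable has positive degree
  in some coordinate, and there the difference of the degrees bounds its exponent.\<close>

lemma finite_nchains: "finite (nchains p)"
proof -
  let ?V = "{l. \<exists>c\<in>S. \<exists>d\<in>S. l \<in> Mor D c d}"
  have fin: "finite {l. l \<in> Mor D c d}" for c d
  proof -
    \<comment> \<open>A common bound for the exponents of a morphism from \<open>c\<close> to
      \<open>d\<close>; the inserted 0 keeps the maximum meaningful if \<open>r = 0\<close>.\<close>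
    define m where "m = Max (insert 0 ((\<lambda>j. nat (d j - c j)) ` {..<r}))"
    have "l i \<le> m" if l: "l \<in> Mor D c d" and i: "i < n" for l i
    proof -
      obtain j where j: "a i j \<noteq> 0" using a_nz[OF i] by blast
      then have jr: "j < r" using a_supp[OF i, of j] by (auto simp: not_less[symmetric])
      have "int (l i) * 1 \<le> int (l i) * a i j" using j a_nonneg[OF i, of j] by (intro mult_left_mono) auto
      also have "\<dots> \<le> lin_comb n a l j"
        unfolding lin_comb_def by (rule member_le_sum) (use i a_nonneg in auto)
      also have "\<dots> = d j - c j" using l by (auto simp: MorD obj_def)
      finally have "l i \<le> nat (d j - c j)" by simp
      also have "\<dots> \<le> m" unfolding m_def using jr by (intro Max_ge) auto
      finally show ?thesis .
    qed
    then have "{l. l \<in> Mor D c d} \<subseteq> {l. \<forall>i. (i \<in> {..<n} \<longrightarrow> l i \<in> {..m}) \<and> (i \<notin> {..<n} \<longrightarrow> l i = 0)}"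
      by (auto simp: MorD NV_def)
    then show ?thesis by (rule finite_subset) (rule finite_set_of_finite_funs; simp)
  qed
  have "?V = (\<Union>c\<in>S. \<Union>d\<in>S. {l. l \<in> Mor D c d})" by auto
  then have "finite ?V" using finite_S fin by auto
  have "nchains p \<subseteq> {cs. set cs \<subseteq> S \<and> length cs = Suc p} \<times> {us. set us \<subseteq> ?V \<and> length us = p}"
  proof
    fix t assume "t \<in> nchains p"
    then have t: "t \<in> chains C p" by (simp add: nchains_def)
    obtain cs us where tt: "t = (cs, us)" by (cases t)
    have h: "length cs = Suc p" "length us = p" "set cs \<subseteq> S" "\<forall>i<p. us ! i \<in> Mor D (cs ! i) (cs ! Suc i)"
      using t by (auto simp: tt chains_def)
    have "u \<in> ?V" if u: "u \<in> set us" for u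
    proof -
      obtain i where i: "i < p" "u = us ! i" using u h(2) by (metis in_set_conv_nth)
      have "cs ! i \<in> S" "cs ! Suc i \<in> S" using h(1,3) i(1) nth_mem[of i cs] nth_mem[of "Suc i" cs] by auto
      then show ?thesis using h(4) i by auto
    qed
    then show "t \<in> {cs. set cs \<subseteq> S \<and> length cs = Suc p} \<times> {us. set us \<subseteq> ?V \<and> length us = p}"
      using h by (auto simp: tt)
  qed
  then show ?thesis
    by (rule finite_subset) (intro finite_cartesian_product finite_lists_length_eq finite_S \<open>finite ?V\<close>)
qed

text \<open>The sum of the coordinates strictly increases along non-identity morphisms, so the
  objects of such a chain are \<open>p + 1\<close> distinct elements of \<open>S\<close>.\<close>

lemma nchains_empty: assumes "card S \<le> p" shows "nchains p = {}"
proof (rule ccontr)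
  assume "nchains p \<noteq> {}"
  then obtain t where t: "t \<in> nchains p" by blast
  obtain cs us where tt: "t = (cs, us)" by (cases t)
  have h: "length cs = Suc p" "length us = p" "set cs \<subseteq> S" "\<And>i. i < p \<Longrightarrow> us ! i \<in> Mor D (cs ! i) (cs ! Suc i)"
    "\<And>i. i < p \<Longrightarrow> us ! i \<noteq> (\<lambda>j. 0) \<or> cs ! i \<noteq> cs ! Suc i"
    using t by (auto simp: tt nchains_def chains_def has_identity_def)
  define sz where "sz c = (\<Sum>j<r. c j)" for c :: "nat \<Rightarrow> int"
  have lt: "sz (cs ! i) < sz (cs ! Suc i)" if i: "i < p" for i
  proof -
    let ?u = "us ! i"
    have u: "?u \<in> NV" "cs ! i = obj (cs ! Suc i) ?u" using h(4)[OF i] by (auto simp: MorD)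
    then have "?u \<noteq> (\<lambda>j. 0)" using h(5)[OF i] by (metis obj_zero)
    then obtain i0 where i0: "?u i0 \<noteq> 0" by auto
    then have i0n: "i0 < n" using u(1) by (auto simp: NV_def not_less[symmetric])
    obtain j where j: "a i0 j \<noteq> 0" using a_nz[OF i0n] by blast
    then have jr: "j < r" using a_supp[OF i0n, of j] by (auto simp: not_less[symmetric])
    have nn: "0 \<le> lin_comb n a ?u j" for j unfolding lin_comb_def by (rule sum_nonneg) (use a_nonneg in auto)
    have "0 < int (?u i0) * a i0 j" using i0 j a_nonneg[OF i0n, of j] by (intro mult_pos_pos) auto
    also have "\<dots> \<le> lin_comb n a ?u j" unfolding lin_comb_def by (rule member_le_sum) (use i0n a_nonneg in auto)
    finally have "0 < (\<Sum>j<r. lin_comb n a ?u j)" using jr nn by (intro sum_pos2[of _ j]) auto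
    moreover have "sz (cs ! i) = sz (cs ! Suc i) - (\<Sum>j<r. lin_comb n a ?u j)"
      by (subst u(2)) (simp add: sz_def obj_def sum_subtractf)
    ultimately show ?thesis by simp
  qed
  have mono: "sz (cs ! i) < sz (cs ! (i + Suc m))" if "i + Suc m \<le> p" for i m
    using that
  proof (induction m)
    case (Suc m)
    then show ?case using lt[of "i + Suc m"] by simp
  qed (use lt in simp)
  have "distinct cs"
    unfolding distinct_conv_nth
  proof (intro allI impI)
    fix i j assume ij: "i < length cs" "j < length cs" "i \<noteq> j"
    show "cs ! i \<noteq> cs ! j"
    proof (cases "i < j")
      case True
      then show ?thesis using mono[of i "j - i - 1"] ij h(1) by auto
    next
      case False
      then show ?thesis using mono[of j "i - j - 1"] ij h(1) by auto
    qed
  qed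
  then have "card (set cs) = Suc p" using distinct_card h(1) by metis
  then show False using card_mono[OF finite_S h(3)] assms by simp
qed

end

section \<open>Graded modules\<close>

declare vec_sel [simp del]

lemma abelian_group_cong:
  fixes M :: "('a, 'x) ring_scheme" and M' :: "('a, 'y) ring_scheme"
  assumes "abelian_group M" and e: "carrier M' = carrier M" "add M' = add M" "zero M' = zero M"
  shows "abelian_group M'"
proof -
  interpret M: abelian_group M by fact
  show ?thesis by (rule abelian_groupI) (auto simp: e M.a_ac intro: M.l_neg)
qed

lemma finsum_cong_struct:
  assumes "carrier M' = carrier M" "add M' = add M" "zero M' = zero M"
  shows "finsum M' f A = finsum M f A"
  by (simp add: finsum_def finprod_def assms)

lemma additive_finsum:
  assumes N: "abelian_group N" and p: "\<And>x. x \<in> carrier N \<Longrightarrow> p x \<in> carrier N"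
    "\<And>x y. x \<in> carrier N \<Longrightarrow> y \<in> carrier N \<Longrightarrow> p (x \<oplus>\<^bsub>N\<^esub> y) = p x \<oplus>\<^bsub>N\<^esub> p y"
    and S: "finite S" "\<And>i. i \<in> S \<Longrightarrow> x i \<in> carrier N"
  shows "p (\<Oplus>\<^bsub>N\<^esub> i\<in>S. x i) = (\<Oplus>\<^bsub>N\<^esub> i\<in>S. p (x i))"
proof -
  interpret N: abelian_group N by fact
  have "p \<zero>\<^bsub>N\<^esub> \<oplus>\<^bsub>N\<^esub> p \<zero>\<^bsub>N\<^esub> = p \<zero>\<^bsub>N\<^esub>" using p(2)[of "\<zero>\<^bsub>N\<^esub>" "\<zero>\<^bsub>N\<^esub>"] by simp
  then have p0: "p \<zero>\<^bsub>N\<^esub> = \<zero>\<^bsub>N\<^esub>" using p(1)[of "\<zero>\<^bsub>N\<^esub>"] by (simp add: N.add.r_cancel_one)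
  show ?thesis using S
  proof (induction S rule: finite_induct)
    case empty
    then show ?case using p0 by simp
  next
    case (insert i S)
    have "(\<Oplus>\<^bsub>N\<^esub> i\<in>insert i S. x i) = x i \<oplus>\<^bsub>N\<^esub> (\<Oplus>\<^bsub>N\<^esub> i\<in>S. x i)" by (rule N.finsum_insert) (use insert in auto)
    moreover have "(\<Oplus>\<^bsub>N\<^esub> i\<in>insert i S. p (x i)) = p (x i) \<oplus>\<^bsub>N\<^esub> (\<Oplus>\<^bsub>N\<^esub> i\<in>S. p (x i))"
      by (rule N.finsum_insert) (use insert p in auto)
    moreover have "(\<Oplus>\<^bsub>N\<^esub> i\<in>S. x i) \<in> carrier N" by (rule N.finsum_closed) (use insert in auto)
    ultimately show ?case using insert p(2) by simp
  qed
qed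

text \<open>Applying the projection \<open>p \<delta>\<close> to any decomposition returns its
  component of degree \<open>\<delta>\<close>, which gives uniqueness. For existence, the sum of the
  finitely many nonzero projections of \<open>m\<close> has the same projections as
  \<open>m\<close>, and \<open>inj\<close> identifies the two.\<close>

lemma graded_decomposition:
  assumes N: "abelian_group N" and gr: "\<And>\<gamma>. \<gamma> \<in> G \<Longrightarrow> gr \<gamma> \<subseteq> carrier N"
    and p: "\<And>\<gamma> x. \<gamma> \<in> G \<Longrightarrow> x \<in> carrier N \<Longrightarrow> p \<gamma> x \<in> gr \<gamma>"
    and add: "\<And>\<gamma> x y. \<gamma> \<in> G \<Longrightarrow> x \<in> carrier N \<Longrightarrow> y \<in> carrier N \<Longrightarrow> p \<gamma> (x \<oplus>\<^bsub>N\<^esub> y) = p \<gamma> x \<oplus>\<^bsub>N\<^esub> p \<gamma> y"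
    and self: "\<And>\<gamma> x. \<gamma> \<in> G \<Longrightarrow> x \<in> gr \<gamma> \<Longrightarrow> p \<gamma> x = x"
    and other: "\<And>\<gamma> \<delta> x. \<gamma> \<in> G \<Longrightarrow> \<delta> \<in> G \<Longrightarrow> \<gamma> \<noteq> \<delta> \<Longrightarrow> x \<in> gr \<delta> \<Longrightarrow> p \<gamma> x = \<zero>\<^bsub>N\<^esub>"
    and fin: "\<And>x. x \<in> carrier N \<Longrightarrow> finite {\<gamma> \<in> G. p \<gamma> x \<noteq> \<zero>\<^bsub>N\<^esub>}"
    and inj: "\<And>x y. x \<in> carrier N \<Longrightarrow> y \<in> carrier N \<Longrightarrow> (\<And>\<gamma>. \<gamma> \<in> G \<Longrightarrow> p \<gamma> x = p \<gamma> y) \<Longrightarrow> x = y"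
    and m: "m \<in> carrier N"
  shows "\<exists>!h. h \<in> (\<Pi>\<^sub>E \<gamma>\<in>G. gr \<gamma>) \<and> finite {\<gamma> \<in> G. h \<gamma> \<noteq> \<zero>\<^bsub>N\<^esub>} \<and>
       m = (\<Oplus>\<^bsub>N\<^esub> \<gamma>\<in>{\<gamma> \<in> G. h \<gamma> \<noteq> \<zero>\<^bsub>N\<^esub>}. h \<gamma>)"
proof -
  interpret N: abelian_group N by fact
  have comp: "p \<delta> (\<Oplus>\<^bsub>N\<^esub> \<gamma>\<in>{\<gamma> \<in> G. h \<gamma> \<noteq> \<zero>\<^bsub>N\<^esub>}. h \<gamma>) = h \<delta>"
    if h: "\<And>\<gamma>. \<gamma> \<in> G \<Longrightarrow> h \<gamma> \<in> gr \<gamma>" "finite {\<gamma> \<in> G. h \<gamma> \<noteq> \<zero>\<^bsub>N\<^esub>}" and d: "\<delta> \<in> G" for h \<delta>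
  proof -
    let ?S = "{\<gamma> \<in> G. h \<gamma> \<noteq> \<zero>\<^bsub>N\<^esub>}"
    have hc: "h \<gamma> \<in> carrier N" if "\<gamma> \<in> G" for \<gamma> using h(1)[OF that] gr[OF that] by blast
    have "p \<delta> (\<Oplus>\<^bsub>N\<^esub> \<gamma>\<in>?S. h \<gamma>) = (\<Oplus>\<^bsub>N\<^esub> \<gamma>\<in>?S. p \<delta> (h \<gamma>))"
      by (rule additive_finsum[OF N]) (use p[OF d] gr[OF d] add[OF d] h(2) hc in auto)
    also have "\<dots> = (\<Oplus>\<^bsub>N\<^esub> \<gamma>\<in>?S. if \<delta> = \<gamma> then h \<gamma> else \<zero>\<^bsub>N\<^esub>)"
      by (rule N.finsum_cong') (use hc self[OF d] other[OF d] h(1) in auto)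
    also have "\<dots> = h \<delta>"
    proof (cases "h \<delta> = \<zero>\<^bsub>N\<^esub>")
      case True
      have "(\<Oplus>\<^bsub>N\<^esub> \<gamma>\<in>?S. if \<delta> = \<gamma> then h \<gamma> else \<zero>\<^bsub>N\<^esub>) = (\<Oplus>\<^bsub>N\<^esub> \<gamma>\<in>?S. \<zero>\<^bsub>N\<^esub>)"
        by (rule N.finsum_cong') (use True in auto)
      then show ?thesis using True by simp
    next
      case False
      show ?thesis by (rule N.add.finprod_singleton) (use False d h(2) hc in auto)
    qed
    finally show ?thesis .
  qed
  let ?h = "\<lambda>\<gamma>\<in>G. p \<gamma> m"
  have S: "{\<gamma> \<in> G. ?h \<gamma> \<noteq> \<zero>\<^bsub>N\<^esub>} = {\<gamma> \<in> G. p \<gamma> m \<noteq> \<zero>\<^bsub>N\<^esub>}" by auto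
  show ?thesis
  proof (rule ex1I[of _ ?h])
    have f: "finite {\<gamma> \<in> G. ?h \<gamma> \<noteq> \<zero>\<^bsub>N\<^esub>}" unfolding S by (rule fin[OF m])
    have hp: "?h \<in> (\<Pi>\<^sub>E \<gamma>\<in>G. gr \<gamma>)" using p m by auto
    have cl: "(\<Oplus>\<^bsub>N\<^esub> \<gamma>\<in>{\<gamma> \<in> G. ?h \<gamma> \<noteq> \<zero>\<^bsub>N\<^esub>}. ?h \<gamma>) \<in> carrier N"
      by (rule N.finsum_closed) (use p m gr in fastforce)
    have "m = (\<Oplus>\<^bsub>N\<^esub> \<gamma>\<in>{\<gamma> \<in> G. ?h \<gamma> \<noteq> \<zero>\<^bsub>N\<^esub>}. ?h \<gamma>)"
      by (rule inj[OF m cl], subst comp) (use f p m in auto)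
    then show "?h \<in> (\<Pi>\<^sub>E \<gamma>\<in>G. gr \<gamma>) \<and> finite {\<gamma> \<in> G. ?h \<gamma> \<noteq> \<zero>\<^bsub>N\<^esub>} \<and>
       m = (\<Oplus>\<^bsub>N\<^esub> \<gamma>\<in>{\<gamma> \<in> G. ?h \<gamma> \<noteq> \<zero>\<^bsub>N\<^esub>}. ?h \<gamma>)" using f hp by blast
  next
    fix h assume h: "h \<in> (\<Pi>\<^sub>E \<gamma>\<in>G. gr \<gamma>) \<and> finite {\<gamma> \<in> G. h \<gamma> \<noteq> \<zero>\<^bsub>N\<^esub>} \<and>
       m = (\<Oplus>\<^bsub>N\<^esub> \<gamma>\<in>{\<gamma> \<in> G. h \<gamma> \<noteq> \<zero>\<^bsub>N\<^esub>}. h \<gamma>)"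
    show "h = ?h"
    proof
      fix \<gamma>
      show "h \<gamma> = ?h \<gamma>"
      proof (cases "\<gamma> \<in> G")
        case True
        have "p \<gamma> (\<Oplus>\<^bsub>N\<^esub> \<gamma>\<in>{\<gamma> \<in> G. h \<gamma> \<noteq> \<zero>\<^bsub>N\<^esub>}. h \<gamma>) = h \<gamma>" by (rule comp[OF _ _ True]) (use h in auto)
        then show ?thesis using h True by simp
      next
        case False
        then show ?thesis using h by auto
      qed
    qed
  qed
qed

lemma lbasis_empty: "lbasis k V {} \<beta> \<Longrightarrow> carrier V = {\<zero>\<^bsub>V\<^esub>}"
  using lbasis_induct_submodule[OF _ zero_submodule[OF lbasis_module]] mod_zero[OF lbasis_module] by fastforce

section \<open>The graded module of a functor\<close>

context affine begin

lemma Z_Obj: "carrier (Int_vec r) = Obj D"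
  by (auto simp: vec_sel ObjD)

lemma Z_add: "\<gamma> \<otimes>\<^bsub>Int_vec r\<^esub> \<delta> = (\<lambda>j. \<gamma> j + \<delta> j)"
  by (simp add: vec_sel)

lemma Z_inv: assumes "\<gamma> \<in> Obj D" shows "inv\<^bsub>Int_vec r\<^esub> \<gamma> = (\<lambda>j. - \<gamma> j)"
  unfolding m_inv_def
proof (rule the_equality)
  show "(\<lambda>j. - \<gamma> j) \<in> carrier (Int_vec r) \<and> \<gamma> \<otimes>\<^bsub>Int_vec r\<^esub> (\<lambda>j. - \<gamma> j) = \<one>\<^bsub>Int_vec r\<^esub> \<and>
    (\<lambda>j. - \<gamma> j) \<otimes>\<^bsub>Int_vec r\<^esub> \<gamma> = \<one>\<^bsub>Int_vec r\<^esub>" using assms by (simp add: vec_sel ObjD)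
  fix y assume "y \<in> carrier (Int_vec r) \<and> \<gamma> \<otimes>\<^bsub>Int_vec r\<^esub> y = \<one>\<^bsub>Int_vec r\<^esub> \<and> y \<otimes>\<^bsub>Int_vec r\<^esub> \<gamma> = \<one>\<^bsub>Int_vec r\<^esub>"
  then have "(\<lambda>j. \<gamma> j + y j) = (\<lambda>j. 0)" by (simp add: vec_sel)
  then have "\<gamma> j + y j = 0" for j by (metis (full_types))
  then show "y = (\<lambda>j. - \<gamma> j)" by (metis (no_types, opaque_lifting) add_eq_0_iff ext)
qed

lemma N_carrier: "carrier (Nat_vec n) = NV"
  by (rule NV_carrier)

lemma N_mult: "l \<otimes>\<^bsub>Nat_vec n\<^esub> m = (\<lambda>i. l i + m i)" and N_one: "\<one>\<^bsub>Nat_vec n\<^esub> = (\<lambda>i. 0)"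
  by (simp_all add: vec_sel)

text \<open>One additive group carries two structures: \<open>KM M\<close> over \<open>k\<close>,
  where bases and direct sums are at hand, and \<open>tot M\<close> over \<open>R\<close>.\<close>

abbreviation "KM M \<equiv> dsum_mod (Obj D) (At M)"
abbreviation "tot M \<equiv> total_module k r n a M"
abbreviation "gr M \<equiv> total_grading r M"
abbreviation "Rgr \<equiv> algebra_grading k (Nat_vec n) (lin_comb n a)"

text \<open>Multiplication by the monomial with exponent \<open>l\<close>.\<close>

definition "sh M l m = (\<lambda>\<delta>\<in>Obj D. Act M (obj \<delta> l) \<delta> l (m (obj \<delta> l)))"

lemma tot_sel: "carrier (tot M) = carrier (KM M)" "add (tot M) = add (KM M)" "zero (tot M) = zero (KM M)"
  by (simp_all add: total_module_def Let_def Z_Obj)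

lemma tot_smult: "f \<odot>\<^bsub>tot M\<^esub> m = (\<lambda>\<delta>\<in>Obj D. \<Oplus>\<^bsub>At M \<delta>\<^esub> l\<in>{l \<in> NV. f l \<noteq> \<zero>\<^bsub>k\<^esub>}. f l \<odot>\<^bsub>At M \<delta>\<^esub> Act M (obj \<delta> l) \<delta> l (m (obj \<delta> l)))"
  by (simp add: total_module_def Let_def Z_Obj N_carrier obj_def)

lemma gr_eq: "gr M \<gamma> = {m \<in> carrier (KM M). \<forall>\<delta>\<in>Obj D. \<delta> \<noteq> \<gamma> \<longrightarrow> m \<delta> = \<zero>\<^bsub>At M \<delta>\<^esub>}"
  by (simp add: total_grading_def Z_Obj)

lemma obj_inj: "obj \<delta> l = obj \<delta>' l \<Longrightarrow> \<delta> = \<delta>'"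
  by (auto simp: obj_def fun_eq_iff)

lemma obj_mor: "l \<in> NV \<Longrightarrow> l \<in> Mor D (obj \<delta> l) \<delta>"
  by (simp add: MorD)

context
  fixes M :: "(nat \<Rightarrow> int, nat \<Rightarrow> nat, 'k, 'u) fmod" assumes M: "is_kCmod k D M"
begin

lemma KM_module: "Module.module k (KM M)"
  by (rule dsum_module[OF k.is_cring kCmod_module[OF M]])

lemma KM_at: "m \<in> carrier (KM M) \<Longrightarrow> \<delta> \<in> Obj D \<Longrightarrow> m \<delta> \<in> carrier (At M \<delta>)"
  by (auto simp: dsum_sel)

lemma KM_eqI: "m \<in> carrier (KM M) \<Longrightarrow> m' \<in> carrier (KM M) \<Longrightarrow> (\<And>\<delta>. \<delta> \<in> Obj D \<Longrightarrow> m \<delta> = m' \<delta>) \<Longrightarrow> m = m'"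
  by (rule PiE_ext[of _ "Obj D" "\<lambda>\<delta>. carrier (At M \<delta>)"]) (auto simp: dsum_sel)

lemma KM_ev: "\<delta> \<in> Obj D \<Longrightarrow> (\<lambda>m. m \<delta>) \<in> mod_hom k (KM M) (At M \<delta>)"
  by (rule mod_homI) (auto simp: dsum_sel)

lemma sh_hom: assumes l: "l \<in> NV" shows "sh M l \<in> mod_hom k (KM M) (KM M)"
proof (rule mod_homI)
  note h = kCmod_act[OF M obj_Obj _ obj_mor[OF l]]
  fix m assume m: "m \<in> carrier (KM M)"
  have fin: "finite {\<delta> \<in> Obj D. m \<delta> \<noteq> \<zero>\<^bsub>At M \<delta>\<^esub>}" using m by (simp add: dsum_sel)
  have "{\<delta> \<in> Obj D. Act M (obj \<delta> l) \<delta> l (m (obj \<delta> l)) \<noteq> \<zero>\<^bsub>At M \<delta>\<^esub>} \<subseteq> (\<lambda>\<delta>. obj \<delta> l) -` {\<delta> \<in> Obj D. m \<delta> \<noteq> \<zero>\<^bsub>At M \<delta>\<^esub>}"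
    using mod_hom_zero[OF kCmod_module[OF M obj_Obj] kCmod_module[OF M] h] obj_Obj by auto
  moreover have "finite ((\<lambda>\<delta>. obj \<delta> l) -` {\<delta> \<in> Obj D. m \<delta> \<noteq> \<zero>\<^bsub>At M \<delta>\<^esub>})"
    by (rule finite_vimageI[OF fin]) (auto intro: injI obj_inj)
  ultimately have "finite {\<delta> \<in> Obj D. Act M (obj \<delta> l) \<delta> l (m (obj \<delta> l)) \<noteq> \<zero>\<^bsub>At M \<delta>\<^esub>}" by (rule finite_subset)
  then show "sh M l m \<in> carrier (KM M)"
    using mod_homD(1)[OF h] KM_at[OF m] obj_Obj by (auto simp: dsum_sel sh_def cong: conj_cong)
next
  note h = kCmod_act[OF M obj_Obj _ obj_mor[OF l]]
  fix m m' assume m: "m \<in> carrier (KM M)" "m' \<in> carrier (KM M)"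
  show "sh M l (m \<oplus>\<^bsub>KM M\<^esub> m') = sh M l m \<oplus>\<^bsub>KM M\<^esub> sh M l m'"
    using mod_homD(2)[OF h] KM_at[OF m(1)] KM_at[OF m(2)] obj_Obj by (auto simp: dsum_sel(3) sh_def intro!: restrict_ext)
next
  note h = kCmod_act[OF M obj_Obj _ obj_mor[OF l]]
  fix b m assume m: "b \<in> carrier k" "m \<in> carrier (KM M)"
  show "sh M l (b \<odot>\<^bsub>KM M\<^esub> m) = b \<odot>\<^bsub>KM M\<^esub> sh M l m"
    using mod_homD(3)[OF h] KM_at[OF m(2)] m(1) obj_Obj by (auto simp: dsum_sel(4) sh_def intro!: restrict_ext)
qed

lemma sh_closed: "l \<in> NV \<Longrightarrow> m \<in> carrier (KM M) \<Longrightarrow> sh M l m \<in> carrier (KM M)"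
  by (rule mod_homD(1)[OF sh_hom])

lemma sh_sh: assumes "l \<in> NV" "l' \<in> NV" "m \<in> carrier (KM M)" shows "sh M l (sh M l' m) = sh M (\<lambda>i. l i + l' i) m"
proof -
  have "Act M (obj \<delta> l) \<delta> l (Act M (obj (obj \<delta> l) l') (obj \<delta> l) l' (m (obj (obj \<delta> l) l'))) =
      Act M (obj \<delta> (\<lambda>i. l i + l' i)) \<delta> (\<lambda>i. l i + l' i) (m (obj \<delta> (\<lambda>i. l i + l' i)))" if d: "\<delta> \<in> Obj D" for \<delta>
    using kCmod_comp[OF M obj_Obj[OF obj_Obj[OF d]] obj_Obj[OF d] d obj_mor[OF assms(2)] obj_mor[OF assms(1)]
        KM_at[OF assms(3) obj_Obj[OF obj_Obj[OF d]]]] by (simp add: obj_obj)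
  then show ?thesis using obj_Obj by (auto simp: sh_def intro!: restrict_ext)
qed

lemma sh_zero: assumes "m \<in> carrier (KM M)" shows "sh M (\<lambda>i. 0) m = m"
proof (rule KM_eqI[OF sh_closed[OF NV_zero assms] assms])
  fix \<delta> assume d: "\<delta> \<in> Obj D"
  show "sh M (\<lambda>i. 0) m \<delta> = m \<delta>" using kCmod_id[OF M d KM_at[OF assms d]] d by (simp add: sh_def)
qed

lemma smult_term_hom: "l \<in> NV \<Longrightarrow> m \<in> carrier (KM M) \<Longrightarrow> (\<lambda>x. x \<odot>\<^bsub>KM M\<^esub> sh M l m) \<in> mod_hom k (self_mod k) (KM M)"
  by (rule mod_hom_smult_left[OF KM_module sh_closed])

text \<open>The definition works degree by degree. As a finite sum in \<open>KM M\<close> the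
  product is visibly linear in each factor, so that identities can be checked on monomials.\<close>

lemma tot_smult_sum:
  assumes f: "f \<in> carrier R" and m: "m \<in> carrier (KM M)"
  shows "f \<odot>\<^bsub>tot M\<^esub> m = (\<Oplus>\<^bsub>KM M\<^esub> l\<in>{l \<in> NV. f l \<noteq> \<zero>\<^bsub>k\<^esub>}. f l \<odot>\<^bsub>KM M\<^esub> sh M l m)"
proof -
  interpret K: Module.module k "KM M" by (rule KM_module)
  have fl: "f l \<in> carrier k" if "l \<in> NV" for l using N.B_val[OF f] that by (simp add: N_carrier)
  have fin: "finite {l \<in> NV. f l \<noteq> \<zero>\<^bsub>k\<^esub>}" using N.B_fin[OF f] by (simp add: N_carrier)
  have tc: "f l \<odot>\<^bsub>KM M\<^esub> sh M l m \<in> carrier (KM M)" if "l \<in> NV" for l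
    using fl[OF that] sh_closed[OF that m] by simp
  have sc: "(\<Oplus>\<^bsub>KM M\<^esub> l\<in>{l \<in> NV. f l \<noteq> \<zero>\<^bsub>k\<^esub>}. f l \<odot>\<^bsub>KM M\<^esub> sh M l m) \<in> carrier (KM M)"
    by (rule K.M.finsum_closed) (use tc in auto)
  have ev: "(\<Oplus>\<^bsub>KM M\<^esub> l\<in>{l \<in> NV. f l \<noteq> \<zero>\<^bsub>k\<^esub>}. f l \<odot>\<^bsub>KM M\<^esub> sh M l m) \<delta> =
      (\<Oplus>\<^bsub>At M \<delta>\<^esub> l\<in>{l \<in> NV. f l \<noteq> \<zero>\<^bsub>k\<^esub>}. f l \<odot>\<^bsub>At M \<delta>\<^esub> Act M (obj \<delta> l) \<delta> l (m (obj \<delta> l)))" if d: "\<delta> \<in> Obj D" for \<delta>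
  proof -
    interpret Md: Module.module k "At M \<delta>" by (rule kCmod_module[OF M d])
    have "(\<Oplus>\<^bsub>KM M\<^esub> l\<in>{l \<in> NV. f l \<noteq> \<zero>\<^bsub>k\<^esub>}. f l \<odot>\<^bsub>KM M\<^esub> sh M l m) \<delta> =
      (\<Oplus>\<^bsub>At M \<delta>\<^esub> l\<in>{l \<in> NV. f l \<noteq> \<zero>\<^bsub>k\<^esub>}. (f l \<odot>\<^bsub>KM M\<^esub> sh M l m) \<delta>)"
      by (rule mod_hom_finsum[OF KM_module Md.module_axioms KM_ev[OF d] fin]) (use tc in auto)
    also have "\<dots> = (\<Oplus>\<^bsub>At M \<delta>\<^esub> l\<in>{l \<in> NV. f l \<noteq> \<zero>\<^bsub>k\<^esub>}. f l \<odot>\<^bsub>At M \<delta>\<^esub> Act M (obj \<delta> l) \<delta> l (m (obj \<delta> l)))"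
    proof (rule Md.M.finsum_cong')
      show "(\<lambda>l. f l \<odot>\<^bsub>At M \<delta>\<^esub> Act M (obj \<delta> l) \<delta> l (m (obj \<delta> l))) \<in> {l \<in> NV. f l \<noteq> \<zero>\<^bsub>k\<^esub>} \<rightarrow> carrier (At M \<delta>)"
        using fl mod_homD(1)[OF kCmod_act[OF M obj_Obj[OF d] d obj_mor] KM_at[OF m obj_Obj[OF d]]] by auto
    qed (use d in \<open>auto simp: dsum_sel(4) sh_def\<close>)
    finally show ?thesis .
  qed
  show ?thesis
  proof
    fix \<delta>
    show "(f \<odot>\<^bsub>tot M\<^esub> m) \<delta> = (\<Oplus>\<^bsub>KM M\<^esub> l\<in>{l \<in> NV. f l \<noteq> \<zero>\<^bsub>k\<^esub>}. f l \<odot>\<^bsub>KM M\<^esub> sh M l m) \<delta>"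
    proof (cases "\<delta> \<in> Obj D")
      case True
      then show ?thesis using ev[OF True] by (simp add: tot_smult)
    next
      case False
      then show ?thesis using sc by (auto simp: tot_smult dsum_sel(1) PiE_iff extensional_def)
    qed
  qed
qed

lemma tot_smult_lift:
  assumes "f \<in> carrier R" "m \<in> carrier (KM M)"
  shows "f \<odot>\<^bsub>tot M\<^esub> m = dsum_lift (carrier (Nat_vec n)) (\<lambda>_. self_mod k) (KM M) (\<lambda>l x. x \<odot>\<^bsub>KM M\<^esub> sh M l m) f"
  using tot_smult_sum[OF assms] by (simp add: dsum_lift_def N_carrier)

lemma tot_smult_hom_left:
  assumes m: "m \<in> carrier (KM M)" shows "(\<lambda>f. f \<odot>\<^bsub>tot M\<^esub> m) \<in> mod_hom k R (KM M)"
proof -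
  let ?L = "dsum_lift (carrier (Nat_vec n)) (\<lambda>_. self_mod k) (KM M) (\<lambda>l x. x \<odot>\<^bsub>KM M\<^esub> sh M l m)"
  have L: "?L \<in> mod_hom k (dsum_mod (carrier (Nat_vec n)) (\<lambda>_. self_mod k)) (KM M)"
    by (rule dsum_lift_hom[OF k.is_cring self_mod_module[OF k.is_cring] KM_module]) (use smult_term_hom m in \<open>auto simp: N_carrier\<close>)
  interpret RK: Module.module k R by (rule N.kmod)
  show ?thesis
    by (rule mod_homI)
      (use mod_homD[OF L] m in \<open>simp_all add: tot_smult_lift N.B_dsum[symmetric]\<close>)
qed

lemma tot_smult_mono: assumes "l \<in> NV" "m \<in> carrier (KM M)" shows "N.mn l \<odot>\<^bsub>tot M\<^esub> m = sh M l m"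
proof -
  interpret K: Module.module k "KM M" by (rule KM_module)
  have mc: "N.mn l \<in> carrier R" by (rule N.mn_closed) (simp add: N_carrier assms)
  have s: "{l' \<in> NV. N.mn l l' \<noteq> \<zero>\<^bsub>k\<^esub>} = {l}" using assms(1) by (auto simp: N.B_eval N_carrier split: if_splits)
  have "N.mn l \<odot>\<^bsub>tot M\<^esub> m = (\<Oplus>\<^bsub>KM M\<^esub> l'\<in>{l}. N.mn l l' \<odot>\<^bsub>KM M\<^esub> sh M l' m)"
    unfolding tot_smult_sum[OF mc assms(2)] s ..
  also have "\<dots> = N.mn l l \<odot>\<^bsub>KM M\<^esub> sh M l m"
    using sh_closed[OF assms] N.B_val[OF mc, of l] assms(1) by (simp add: N_carrier)
  also have "\<dots> = sh M l m" using sh_closed[OF assms] assms(1) by (simp add: N.B_eval N_carrier)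
  finally show ?thesis .
qed

lemma tot_smult_hom_right:
  assumes f: "f \<in> carrier R" shows "(\<lambda>m. f \<odot>\<^bsub>tot M\<^esub> m) \<in> mod_hom k (KM M) (KM M)"
proof -
  interpret K: Module.module k "KM M" by (rule KM_module)
  have fl: "f l \<in> carrier k" if "l \<in> NV" for l using N.B_val[OF f] that by (simp add: N_carrier)
  have fin: "finite {l \<in> NV. f l \<noteq> \<zero>\<^bsub>k\<^esub>}" using N.B_fin[OF f] by (simp add: N_carrier)
  have sm: "(\<lambda>x. b \<odot>\<^bsub>KM M\<^esub> x) \<in> mod_hom k (KM M) (KM M)" if "b \<in> carrier k" for b
    by (rule mod_homI) (use that in \<open>auto simp: K.smult_r_distr K.smult_assoc1[symmetric] k.m_comm\<close>)
  have h: "(\<lambda>m. \<Oplus>\<^bsub>KM M\<^esub> l\<in>{l \<in> NV. f l \<noteq> \<zero>\<^bsub>k\<^esub>}. f l \<odot>\<^bsub>KM M\<^esub> sh M l m) \<in> mod_hom k (KM M) (KM M)"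
    by (rule mod_hom_finsum_family[OF KM_module KM_module fin]) (use mod_hom_comp[OF sh_hom sm] fl in auto)
  show ?thesis
    by (rule mod_homI) (simp_all add: tot_smult_sum[OF f] mod_homD[OF h])
qed

lemma tot_smult_closed: "f \<in> carrier R \<Longrightarrow> m \<in> carrier (KM M) \<Longrightarrow> f \<odot>\<^bsub>tot M\<^esub> m \<in> carrier (KM M)"
  by (rule mod_homD(1)[OF tot_smult_hom_right])

text \<open>Both sides are linear in \<open>f\<close> and in \<open>h\<close>; on monomials the
  claim is \<open>sh_sh\<close>, that is, functoriality.\<close>

lemma tot_smult_assoc:
  assumes f: "f \<in> carrier R" and h: "h \<in> carrier R" and m: "m \<in> carrier (KM M)"
  shows "(f \<otimes>\<^bsub>R\<^esub> h) \<odot>\<^bsub>tot M\<^esub> m = f \<odot>\<^bsub>tot M\<^esub> (h \<odot>\<^bsub>tot M\<^esub> m)"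
proof (rule lbasis_ext[OF N.B_lbasis KM_module mod_hom_comp[OF N.mult_hom_left[OF h] tot_smult_hom_left[OF m]]
      tot_smult_hom_left[OF tot_smult_closed[OF h m]] _ f])
  fix l assume "l \<in> carrier (Nat_vec n)"
  then have l: "l \<in> NV" "l \<in> carrier (Nat_vec n)" by (simp_all add: N_carrier)
  note L = N.mn_closed[OF l(2)]
  show "(N.mn l \<otimes>\<^bsub>R\<^esub> h) \<odot>\<^bsub>tot M\<^esub> m = N.mn l \<odot>\<^bsub>tot M\<^esub> (h \<odot>\<^bsub>tot M\<^esub> m)"
  proof (rule lbasis_ext[OF N.B_lbasis KM_module mod_hom_comp[OF N.mult_hom_right[OF L] tot_smult_hom_left[OF m]]
        mod_hom_comp[OF tot_smult_hom_left[OF m] tot_smult_hom_right[OF L]] _ h])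
    fix l' assume "l' \<in> carrier (Nat_vec n)"
    then have l': "l' \<in> NV" "l' \<in> carrier (Nat_vec n)" by (simp_all add: N_carrier)
    show "(N.mn l \<otimes>\<^bsub>R\<^esub> N.mn l') \<odot>\<^bsub>tot M\<^esub> m = N.mn l \<odot>\<^bsub>tot M\<^esub> (N.mn l' \<odot>\<^bsub>tot M\<^esub> m)"
      using N.mn_mult[OF l(2) l'(2)] tot_smult_mono[OF NV_add[OF l(1) l'(1)] m] tot_smult_mono[OF l'(1) m]
        tot_smult_mono[OF l(1) sh_closed[OF l'(1) m]] sh_sh[OF l(1) l'(1) m] by (simp add: N_mult)
  qed
qed

lemma tot_module: "Module.module R (tot M)"
proof (rule moduleI)
  show "cring R" by (rule N.B_cring)
  show "abelian_group (tot M)"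
    by (rule abelian_group_cong[OF module.axioms(2)[OF KM_module] tot_sel])
  fix f h m m' assume f: "f \<in> carrier R" "h \<in> carrier R" and m: "m \<in> carrier (tot M)" "m' \<in> carrier (tot M)"
  note m' = m[unfolded tot_sel]
  show "f \<odot>\<^bsub>tot M\<^esub> m \<in> carrier (tot M)" using tot_smult_closed[OF f(1) m'(1)] by (simp add: tot_sel)
  show "(f \<oplus>\<^bsub>R\<^esub> h) \<odot>\<^bsub>tot M\<^esub> m = f \<odot>\<^bsub>tot M\<^esub> m \<oplus>\<^bsub>tot M\<^esub> h \<odot>\<^bsub>tot M\<^esub> m"
    using mod_homD(2)[OF tot_smult_hom_left[OF m'(1)] f] by (simp add: tot_sel)
  show "f \<odot>\<^bsub>tot M\<^esub> (m \<oplus>\<^bsub>tot M\<^esub> m') = f \<odot>\<^bsub>tot M\<^esub> m \<oplus>\<^bsub>tot M\<^esub> f \<odot>\<^bsub>tot M\<^esub> m'"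
    using mod_homD(2)[OF tot_smult_hom_right[OF f(1)] m'] by (simp add: tot_sel)
  show "(f \<otimes>\<^bsub>R\<^esub> h) \<odot>\<^bsub>tot M\<^esub> m = f \<odot>\<^bsub>tot M\<^esub> (h \<odot>\<^bsub>tot M\<^esub> m)" by (rule tot_smult_assoc[OF f m'(1)])
next
  fix m assume "m \<in> carrier (tot M)"
  then have m: "m \<in> carrier (KM M)" by (simp add: tot_sel)
  show "\<one>\<^bsub>R\<^esub> \<odot>\<^bsub>tot M\<^esub> m = m"
    using tot_smult_mono[OF NV_zero m] sh_zero[OF m] N.B_sel(5) by (simp add: N_one)
qed

lemma gr_smult:
  assumes f: "f \<in> Rgr \<gamma>" and m: "m \<in> gr M \<delta>"
  shows "f \<odot>\<^bsub>tot M\<^esub> m \<in> gr M (\<lambda>j. \<gamma> j + \<delta> j)"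
proof -
  have fR: "f \<in> carrier R" and fs: "\<And>l. l \<in> NV \<Longrightarrow> f l \<noteq> \<zero>\<^bsub>k\<^esub> \<Longrightarrow> lin_comb n a l = \<gamma>"
    using f by (auto simp: algebra_grading_def N_carrier)
  have mK: "m \<in> carrier (KM M)" and ms: "\<And>\<epsilon>. \<epsilon> \<in> Obj D \<Longrightarrow> \<epsilon> \<noteq> \<delta> \<Longrightarrow> m \<epsilon> = \<zero>\<^bsub>At M \<epsilon>\<^esub>"
    using m by (auto simp: gr_eq)
  have "(f \<odot>\<^bsub>tot M\<^esub> m) \<epsilon> = \<zero>\<^bsub>At M \<epsilon>\<^esub>" if e: "\<epsilon> \<in> Obj D" "\<epsilon> \<noteq> (\<lambda>j. \<gamma> j + \<delta> j)" for \<epsilon>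
  proof -
    interpret Me: Module.module k "At M \<epsilon>" by (rule kCmod_module[OF M e(1)])
    have "f l \<odot>\<^bsub>At M \<epsilon>\<^esub> Act M (obj \<epsilon> l) \<epsilon> l (m (obj \<epsilon> l)) = \<zero>\<^bsub>At M \<epsilon>\<^esub>" if l: "l \<in> NV" "f l \<noteq> \<zero>\<^bsub>k\<^esub>" for l
    proof -
      have "obj \<epsilon> l \<noteq> \<delta>"
      proof
        assume "obj \<epsilon> l = \<delta>"
        then have "\<epsilon> = (\<lambda>j. \<gamma> j + \<delta> j)" unfolding fs[OF l, symmetric] by (auto simp: obj_def)
        then show False using e(2) by simp
      qed
      then have "m (obj \<epsilon> l) = \<zero>\<^bsub>At M (obj \<epsilon> l)\<^esub>" by (rule ms[OF obj_Obj[OF e(1)]])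
      then show ?thesis
        using mod_hom_zero[OF kCmod_module[OF M obj_Obj[OF e(1)]] Me.module_axioms kCmod_act[OF M obj_Obj[OF e(1)] e(1) obj_mor[OF l(1)]]]
          N.B_val[OF fR, of l] l(1) Me.smult_r_null by (simp add: N_carrier)
    qed
    then have "(\<Oplus>\<^bsub>At M \<epsilon>\<^esub> l\<in>{l \<in> NV. f l \<noteq> \<zero>\<^bsub>k\<^esub>}. f l \<odot>\<^bsub>At M \<epsilon>\<^esub> Act M (obj \<epsilon> l) \<epsilon> l (m (obj \<epsilon> l)))
       = (\<Oplus>\<^bsub>At M \<epsilon>\<^esub> l\<in>{l \<in> NV. f l \<noteq> \<zero>\<^bsub>k\<^esub>}. \<zero>\<^bsub>At M \<epsilon>\<^esub>)"
      by (intro Me.M.finsum_cong') auto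
    then show ?thesis using e(1) by (simp add: tot_smult)
  qed
  then show ?thesis using tot_smult_closed[OF fR mK] by (simp add: gr_eq)
qed

lemma tot_graded: "is_graded_module (Int_vec r) R Rgr (tot M) (gr M)"
  unfolding is_graded_module_def
proof (intro conjI ballI)
  show "Module.module R (tot M)" by (rule tot_module)
  interpret K: Module.module k "KM M" by (rule KM_module)
  interpret T: Module.module R "tot M" by (rule tot_module)
  show "additive_subgroup (gr M \<gamma>) (tot M)" if "\<gamma> \<in> carrier (Int_vec r)" for \<gamma>
  proof
    show "gr M \<gamma> \<subseteq> carrier (add_monoid (tot M))" by (auto simp: gr_eq tot_sel)
    have ev: "(m \<oplus>\<^bsub>KM M\<^esub> m') \<delta> = m \<delta> \<oplus>\<^bsub>At M \<delta>\<^esub> m' \<delta>" if "\<delta> \<in> Obj D" for m m' \<delta> using that by (simp add: dsum_sel(3))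
    show "x \<otimes>\<^bsub>add_monoid (tot M)\<^esub> y \<in> gr M \<gamma>" if xy: "x \<in> gr M \<gamma>" "y \<in> gr M \<gamma>" for x y
    proof -
      have "(x \<oplus>\<^bsub>KM M\<^esub> y) \<delta> = \<zero>\<^bsub>At M \<delta>\<^esub>" if d: "\<delta> \<in> Obj D" "\<delta> \<noteq> \<gamma>" for \<delta>
      proof -
        interpret Md: Module.module k "At M \<delta>" by (rule kCmod_module[OF M d(1)])
        show ?thesis using xy d by (simp add: ev gr_eq)
      qed
      then show ?thesis using xy by (simp add: gr_eq tot_sel)
    qed
    show "\<one>\<^bsub>add_monoid (tot M)\<^esub> \<in> gr M \<gamma>" using K.M.zero_closed by (simp add: gr_eq tot_sel) (simp add: dsum_sel)
    fix x assume x: "x \<in> gr M \<gamma>"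
    then have xc: "x \<in> carrier (KM M)" by (simp add: gr_eq)
    have "(\<ominus>\<^bsub>KM M\<^esub> x) \<delta> = \<zero>\<^bsub>At M \<delta>\<^esub>" if d: "\<delta> \<in> Obj D" "\<delta> \<noteq> \<gamma>" for \<delta>
    proof -
      interpret Md: Module.module k "At M \<delta>" by (rule kCmod_module[OF M d(1)])
      show ?thesis using mod_hom_minus[OF KM_module Md.module_axioms KM_ev[OF d(1)] xc] x d Md.M.a_inv_zero by (simp add: gr_eq)
    qed
    then have g: "\<ominus>\<^bsub>KM M\<^esub> x \<in> gr M \<gamma>" using xc by (simp add: gr_eq)
    have "\<ominus>\<^bsub>tot M\<^esub> x = \<ominus>\<^bsub>KM M\<^esub> x"
      by (rule T.M.minus_equality) (use xc in \<open>simp_all add: tot_sel K.M.l_neg\<close>)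
    then show "inv\<^bsub>add_monoid (tot M)\<^esub> x \<in> gr M \<gamma>" using g by (simp add: a_inv_def)
  qed
  show "f \<odot>\<^bsub>tot M\<^esub> m \<in> gr M (\<gamma> \<otimes>\<^bsub>Int_vec r\<^esub> \<delta>)" if "f \<in> Rgr \<gamma>" "m \<in> gr M \<delta>" for \<gamma> \<delta> f m
    using gr_smult[OF that] by (simp add: Z_add)
  fix m assume m: "m \<in> carrier (tot M)"
  show "\<exists>!h. h \<in> (\<Pi>\<^sub>E \<gamma>\<in>carrier (Int_vec r). gr M \<gamma>) \<and> finite {\<gamma> \<in> carrier (Int_vec r). h \<gamma> \<noteq> \<zero>\<^bsub>tot M\<^esub>} \<and>
       m = (\<Oplus>\<^bsub>tot M\<^esub> \<gamma>\<in>{\<gamma> \<in> carrier (Int_vec r). h \<gamma> \<noteq> \<zero>\<^bsub>tot M\<^esub>}. h \<gamma>)"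
    unfolding Z_Obj tot_sel
  proof (rule graded_decomposition[OF T.M.abelian_group_axioms, where p = "\<lambda>\<gamma> m. dsum_in (Obj D) (At M) \<gamma> (m \<gamma>)", unfolded Z_Obj tot_sel])
    note inh = dsum_in_hom[where I = "Obj D" and F = "At M", OF k.is_cring kCmod_module[OF M]]
    show "gr M \<gamma> \<subseteq> carrier (KM M)" for \<gamma> by (auto simp: gr_eq)
    show "dsum_in (Obj D) (At M) \<gamma> (x \<gamma>) \<in> gr M \<gamma>" if "\<gamma> \<in> Obj D" "x \<in> carrier (KM M)" for \<gamma> x
      using mod_homD(1)[OF inh[OF _ that(1)] KM_at[OF that(2,1)]] by (auto simp: gr_eq dsum_in_def)
    show "dsum_in (Obj D) (At M) \<gamma> ((x \<oplus>\<^bsub>KM M\<^esub> y) \<gamma>) = dsum_in (Obj D) (At M) \<gamma> (x \<gamma>) \<oplus>\<^bsub>KM M\<^esub> dsum_in (Obj D) (At M) \<gamma> (y \<gamma>)"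
      if "\<gamma> \<in> Obj D" "x \<in> carrier (KM M)" "y \<in> carrier (KM M)" for \<gamma> x y
      using mod_homD(2)[OF inh[OF _ that(1)] KM_at[OF that(2,1)] KM_at[OF that(3,1)]] that(1) by (simp add: dsum_sel(3))
    show "dsum_in (Obj D) (At M) \<gamma> (x \<gamma>) = x" if "\<gamma> \<in> Obj D" "x \<in> gr M \<gamma>" for \<gamma> x
      by (rule ext) (use that in \<open>auto simp: gr_eq dsum_in_def dsum_sel(1) PiE_iff extensional_def\<close>)
    show "dsum_in (Obj D) (At M) \<gamma> (x \<gamma>) = \<zero>\<^bsub>KM M\<^esub>" if "\<gamma> \<in> Obj D" "\<delta> \<in> Obj D" "\<gamma> \<noteq> \<delta>" "x \<in> gr M \<delta>" for \<gamma> \<delta> x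
      using that by (auto simp: gr_eq dsum_in_def dsum_sel(2) intro!: restrict_ext)
    have nz: "dsum_in (Obj D) (At M) \<gamma> (x \<gamma>) \<noteq> \<zero>\<^bsub>KM M\<^esub> \<Longrightarrow> x \<gamma> \<noteq> \<zero>\<^bsub>At M \<gamma>\<^esub>" for \<gamma> x
      by (auto simp: dsum_in_def dsum_sel(2) intro!: restrict_ext split: if_splits)
    show "finite {\<gamma> \<in> Obj D. dsum_in (Obj D) (At M) \<gamma> (x \<gamma>) \<noteq> \<zero>\<^bsub>KM M\<^esub>}" if "x \<in> carrier (KM M)" for x
      by (rule finite_subset[of _ "{\<gamma> \<in> Obj D. x \<gamma> \<noteq> \<zero>\<^bsub>At M \<gamma>\<^esub>}"]) (use that nz in \<open>auto simp: dsum_sel(1)\<close>)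
    show "x = y" if "x \<in> carrier (KM M)" "y \<in> carrier (KM M)"
      "\<And>\<gamma>. \<gamma> \<in> Obj D \<Longrightarrow> dsum_in (Obj D) (At M) \<gamma> (x \<gamma>) = dsum_in (Obj D) (At M) \<gamma> (y \<gamma>)" for x y
    proof (rule KM_eqI[OF that(1,2)])
      fix \<delta> assume d: "\<delta> \<in> Obj D"
      show "x \<delta> = y \<delta>" using fun_cong[OF that(3)[OF d], of \<delta>] d by (simp add: dsum_in_def)
    qed
    show "m \<in> carrier (KM M)" using m by (simp add: tot_sel)
  qed
qed

end

end

section \<open>The graded module \<open>k[Q]\<close> and its functor\<close>

context affine begin

lemma am_closed: "f \<in> carrier R \<Longrightarrow> NA.am f \<in> carrier A.B"
  by (rule mod_homD(1)[OF NA.am_hom])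

lemma am_one: "NA.am \<one>\<^bsub>R\<^esub> = \<one>\<^bsub>A.B\<^esub>"
  using NA.am_mn[of "\<lambda>i. 0"] N.B_sel(5) A.B_sel(5) NV_zero by (simp add: gexp_zero N_one N_carrier)

lemma kQ_module: "Module.module R kQ"
proof (rule moduleI)
  interpret B: cring A.B by (rule A.B_cring)
  show "cring R" by (rule N.B_cring)
  show "abelian_group kQ" by (rule abelian_group_cong[OF B.abelian_group_axioms kQ_sel(1-3)])
  fix f h x y assume f: "f \<in> carrier R" "h \<in> carrier R" and x: "x \<in> carrier kQ" "y \<in> carrier kQ"
  note am = am_closed[OF f(1)] am_closed[OF f(2)]
  show "f \<odot>\<^bsub>kQ\<^esub> x \<in> carrier kQ" using am x by simp
  show "(f \<oplus>\<^bsub>R\<^esub> h) \<odot>\<^bsub>kQ\<^esub> x = f \<odot>\<^bsub>kQ\<^esub> x \<oplus>\<^bsub>kQ\<^esub> h \<odot>\<^bsub>kQ\<^esub> x"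
    using am x mod_homD(2)[OF NA.am_hom f] by (simp add: B.l_distr)
  show "f \<odot>\<^bsub>kQ\<^esub> (x \<oplus>\<^bsub>kQ\<^esub> y) = f \<odot>\<^bsub>kQ\<^esub> x \<oplus>\<^bsub>kQ\<^esub> f \<odot>\<^bsub>kQ\<^esub> y"
    using am x by (simp add: B.r_distr)
  show "(f \<otimes>\<^bsub>R\<^esub> h) \<odot>\<^bsub>kQ\<^esub> x = f \<odot>\<^bsub>kQ\<^esub> (h \<odot>\<^bsub>kQ\<^esub> x)"
    using am x NA.am_mult[OF f] by (simp add: B.m_assoc)
next
  interpret B: cring A.B by (rule A.B_cring)
  fix x assume "x \<in> carrier kQ"
  then show "\<one>\<^bsub>R\<^esub> \<odot>\<^bsub>kQ\<^esub> x = x" by (simp add: am_one)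
qed

lemma kQgr_eq: "kQgr \<gamma> = {f \<in> carrier A.B. \<forall>s\<in>carrier Q. f s \<noteq> \<zero>\<^bsub>k\<^esub> \<longrightarrow> deg s = \<gamma>}"
  by (simp add: algebra_grading_def)

definition "cmp y \<gamma> = (\<lambda>s\<in>carrier Q. if deg s = \<gamma> then y s else \<zero>\<^bsub>k\<^esub>)"

lemma cmp_closed: "y \<in> carrier A.B \<Longrightarrow> cmp y \<gamma> \<in> kQgr \<gamma>"
  by (auto simp: kQgr_eq cmp_def A.B_sel(1) PiE_iff intro: rev_finite_subset)

lemma kQ_graded: "is_graded_module (Int_vec r) R Rgr kQ kQgr"
  unfolding is_graded_module_def
proof (intro conjI ballI)
  show m: "Module.module R kQ" by (rule kQ_module)
  interpret K: Module.module R kQ by (rule m)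
  interpret B: cring A.B by (rule A.B_cring)
  have degO: "deg s \<in> Obj D" if "s \<in> carrier Q" for s using deg_Obj[OF that] by (simp add: ObjD)
  show "additive_subgroup (kQgr \<gamma>) kQ" if "\<gamma> \<in> carrier (Int_vec r)" for \<gamma>
  proof
    show "kQgr \<gamma> \<subseteq> carrier (add_monoid kQ)" by (auto simp: kQgr_eq)
    show "x \<otimes>\<^bsub>add_monoid kQ\<^esub> y \<in> kQgr \<gamma>" if xy: "x \<in> kQgr \<gamma>" "y \<in> kQgr \<gamma>" for x y
    proof -
      have "deg s = \<gamma>" if s: "s \<in> carrier Q" "(x \<oplus>\<^bsub>A.B\<^esub> y) s \<noteq> \<zero>\<^bsub>k\<^esub>" for s
      proof (rule ccontr)
        assume "deg s \<noteq> \<gamma>"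
        then have "x s = \<zero>\<^bsub>k\<^esub>" "y s = \<zero>\<^bsub>k\<^esub>" using xy s(1) by (auto simp: kQgr_eq)
        then show False using s by (simp add: A.B_eval)
      qed
      then show ?thesis using xy by (simp add: kQgr_eq)
    qed
    show "\<one>\<^bsub>add_monoid kQ\<^esub> \<in> kQgr \<gamma>" using B.zero_closed by (simp add: kQgr_eq) (simp add: A.B_sel(2))
    fix x assume x: "x \<in> kQgr \<gamma>"
    then have xB: "x \<in> carrier A.B" by (simp add: kQgr_eq)
    interpret SM: Module.module k "self_mod k" by (rule self_mod_module[OF k.is_cring])
    have neg: "(\<ominus>\<^bsub>A.B\<^esub> x) s = \<zero>\<^bsub>k\<^esub>" if s: "s \<in> carrier Q" "x s = \<zero>\<^bsub>k\<^esub>" for s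
    proof -
      have ev: "(\<lambda>v. v s) \<in> mod_hom k A.B (self_mod k)" by (rule mod_homI) (auto simp: A.B_eval s A.B_val)
      show ?thesis using mod_hom_minus[OF A.kmod SM.module_axioms ev xB] SM.M.a_inv_zero s(2) by simp
    qed
    have "\<ominus>\<^bsub>A.B\<^esub> x \<in> kQgr \<gamma>" using x xB neg by (auto simp: kQgr_eq)
    moreover have "\<ominus>\<^bsub>kQ\<^esub> x = \<ominus>\<^bsub>A.B\<^esub> x"
      by (rule K.M.minus_equality) (use xB in \<open>simp_all add: B.l_neg\<close>)
    ultimately show "inv\<^bsub>add_monoid kQ\<^esub> x \<in> kQgr \<gamma>" by (simp add: a_inv_def)
  qed
  show "f \<odot>\<^bsub>kQ\<^esub> x \<in> kQgr (\<gamma> \<otimes>\<^bsub>Int_vec r\<^esub> \<delta>)" if f: "f \<in> Rgr \<gamma>" and x: "x \<in> kQgr \<delta>" for \<gamma> \<delta> f x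
  proof -
    have fR: "f \<in> carrier R" and xB: "x \<in> carrier A.B" using f x by (auto simp: algebra_grading_def)
    let ?X = "{s \<in> carrier Q. NA.am f s \<noteq> \<zero>\<^bsub>k\<^esub>}" and ?Y = "{s \<in> carrier Q. x s \<noteq> \<zero>\<^bsub>k\<^esub>}"
    have X: "deg s = \<gamma>" if s: "s \<in> ?X" for s
    proof (rule ccontr)
      assume ne: "deg s \<noteq> \<gamma>"
      have "{l \<in> {l \<in> NV. f l \<noteq> \<zero>\<^bsub>k\<^esub>}. gexp l = s} = {}"
        using f ne by (auto simp: algebra_grading_def N_carrier deg_gexp)
      moreover have "NA.am f s = (\<Oplus>\<^bsub>k\<^esub> l\<in>{l \<in> {l \<in> NV. f l \<noteq> \<zero>\<^bsub>k\<^esub>}. gexp l = s}. f l)"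
        by (rule NA.am_eval[OF fR]) (use s N.B_fin[OF fR] in \<open>auto simp: N_carrier\<close>)
      ultimately show False using s by (simp only: k.finsum_empty mem_Collect_eq) simp
    qed
    have "deg s = (\<lambda>j. \<gamma> j + \<delta> j)" if s: "s \<in> carrier Q" "(NA.am f \<otimes>\<^bsub>A.B\<^esub> x) s \<noteq> \<zero>\<^bsub>k\<^esub>" for s
    proof (rule ccontr)
      assume ne: "deg s \<noteq> (\<lambda>j. \<gamma> j + \<delta> j)"
      have "{p \<in> ?X \<times> ?Y. fst p \<otimes>\<^bsub>Q\<^esub> snd p = s} = {}"
      proof (rule equals0I)
        fix p assume p: "p \<in> {p \<in> ?X \<times> ?Y. fst p \<otimes>\<^bsub>Q\<^esub> snd p = s}"
        then have e: "deg (fst p) = \<gamma>" "deg (snd p) = \<delta>" using X x by (auto simp: kQgr_eq)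
        have "deg s = (\<lambda>j. deg (fst p) j + deg (snd p) j)" using p by (auto simp: iota_mult)
        also have "\<dots> = (\<lambda>j. \<gamma> j + \<delta> j)" unfolding fun_cong[OF e(1)] fun_cong[OF e(2)] ..
        finally show False using ne by simp
      qed
      moreover have "(NA.am f \<otimes>\<^bsub>A.B\<^esub> x) s = (\<Oplus>\<^bsub>k\<^esub> p\<in>{p \<in> ?X \<times> ?Y. fst p \<otimes>\<^bsub>Q\<^esub> snd p = s}. NA.am f (fst p) \<otimes>\<^bsub>k\<^esub> x (snd p))"
        by (rule A.mult_eval[OF am_closed[OF fR] xB s(1)]) (use A.B_fin[OF am_closed[OF fR]] A.B_fin[OF xB] in auto)
      ultimately show False using s(2) by (simp only: k.finsum_empty)
    qed
    then show ?thesis using A.mult_closed[OF am_closed[OF fR] xB] by (simp add: kQgr_eq Z_add)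
  qed
  fix y assume y: "y \<in> carrier kQ"
  show "\<exists>!h. h \<in> (\<Pi>\<^sub>E \<gamma>\<in>carrier (Int_vec r). kQgr \<gamma>) \<and> finite {\<gamma> \<in> carrier (Int_vec r). h \<gamma> \<noteq> \<zero>\<^bsub>kQ\<^esub>} \<and>
       y = (\<Oplus>\<^bsub>kQ\<^esub> \<gamma>\<in>{\<gamma> \<in> carrier (Int_vec r). h \<gamma> \<noteq> \<zero>\<^bsub>kQ\<^esub>}. h \<gamma>)"
    unfolding Z_Obj
  proof (rule graded_decomposition[where p = "\<lambda>\<gamma> y. cmp y \<gamma>", OF K.M.abelian_group_axioms])
    have ev: "cmp x \<gamma> s = (if deg s = \<gamma> then x s else \<zero>\<^bsub>k\<^esub>)" if "s \<in> carrier Q" for x s \<gamma> using that by (simp add: cmp_def)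
    show "kQgr \<gamma> \<subseteq> carrier kQ" for \<gamma> by (auto simp: kQgr_eq)
    show "cmp x \<gamma> \<in> kQgr \<gamma>" if "x \<in> carrier kQ" for x \<gamma> using cmp_closed that by simp
    show "cmp (x \<oplus>\<^bsub>kQ\<^esub> z) \<gamma> = cmp x \<gamma> \<oplus>\<^bsub>kQ\<^esub> cmp z \<gamma>" for x z \<gamma>
      by (auto simp: cmp_def A.B_sel(3) intro!: restrict_ext)
    show "cmp x \<gamma> = x" if "x \<in> kQgr \<gamma>" for x \<gamma>
    proof (rule A.B_eqI)
      show xB: "x \<in> carrier A.B" using that by (simp add: kQgr_eq)
      show "cmp x \<gamma> \<in> carrier A.B" using cmp_closed[OF xB, of \<gamma>] by (simp add: kQgr_eq)
      fix s assume s: "s \<in> carrier Q"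
      show "cmp x \<gamma> s = x s"
      proof (cases "deg s = \<gamma>")
        case True
        then show ?thesis unfolding ev[OF s] by (rule if_P)
      next
        case False
        then have "x s = \<zero>\<^bsub>k\<^esub>" using that s by (auto simp only: kQgr_eq mem_Collect_eq)
        then show ?thesis unfolding ev[OF s] using False by (simp only: if_False)
      qed
    qed
    show "cmp x \<gamma> = \<zero>\<^bsub>kQ\<^esub>" if "\<gamma> \<noteq> \<delta>" "x \<in> kQgr \<delta>" for x \<gamma> \<delta>
      using that by (auto simp: cmp_def A.B_sel(2) kQgr_eq intro!: restrict_ext)
    show "finite {\<gamma> \<in> Obj D. cmp x \<gamma> \<noteq> \<zero>\<^bsub>kQ\<^esub>}" if "x \<in> carrier kQ" for x
    proof (rule finite_subset)
      show "{\<gamma> \<in> Obj D. cmp x \<gamma> \<noteq> \<zero>\<^bsub>kQ\<^esub>} \<subseteq> deg ` {s \<in> carrier Q. x s \<noteq> \<zero>\<^bsub>k\<^esub>}"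
      proof
        fix \<gamma> assume "\<gamma> \<in> {\<gamma> \<in> Obj D. cmp x \<gamma> \<noteq> \<zero>\<^bsub>kQ\<^esub>}"
        then have "cmp x \<gamma> \<noteq> (\<lambda>s\<in>carrier Q. \<zero>\<^bsub>k\<^esub>)" by (simp add: A.B_sel(2))
        then have "\<exists>s\<in>carrier Q. deg s = \<gamma> \<and> x s \<noteq> \<zero>\<^bsub>k\<^esub>"
          unfolding cmp_def by (rule contrapos_np) (auto intro!: restrict_ext)
        then show "\<gamma> \<in> deg ` {s \<in> carrier Q. x s \<noteq> \<zero>\<^bsub>k\<^esub>}" by blast
      qed
      show "finite (deg ` {s \<in> carrier Q. x s \<noteq> \<zero>\<^bsub>k\<^esub>})" using that by (intro finite_imageI A.B_fin) simp
    qed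
    show "x = z" if xz: "x \<in> carrier kQ" "z \<in> carrier kQ" "\<And>\<gamma>. \<gamma> \<in> Obj D \<Longrightarrow> cmp x \<gamma> = cmp z \<gamma>" for x z
    proof (rule A.B_eqI)
      fix s assume s: "s \<in> carrier Q"
      show "x s = z s" using fun_cong[OF xz(3)[OF degO[OF s]], of s] s by (simp add: ev)
    qed (use xz in simp_all)
    show "y \<in> carrier kQ" by (rule y)
  qed
qed

text \<open>Compares \<open>k[Q]\<close> with the total module of the functor it defines.\<close>

definition "cmpr m = (\<lambda>q\<in>carrier Q. m (deg q) q)"

lemma deg_in_Obj: "q \<in> carrier Q \<Longrightarrow> deg q \<in> Obj D"
  using deg_Obj by (simp add: ObjD)

lemma kF_eval: "x \<in> carrier (At kF \<gamma>) \<Longrightarrow> q \<in> carrier Q \<Longrightarrow> deg q \<noteq> \<gamma> \<Longrightarrow> x q = \<zero>\<^bsub>k\<^esub>"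
  by (auto simp: kF_sel)

lemma cmpr_closed: assumes m: "m \<in> carrier (KM kF)" shows "cmpr m \<in> carrier A.B"
proof -
  have fin: "finite {\<gamma> \<in> Obj D. m \<gamma> \<noteq> \<zero>\<^bsub>At kF \<gamma>\<^esub>}" and at: "\<And>\<gamma>. \<gamma> \<in> Obj D \<Longrightarrow> m \<gamma> \<in> carrier (At kF \<gamma>)"
    using m by (auto simp: dsum_sel(1))
  have "{q \<in> carrier Q. cmpr m q \<noteq> \<zero>\<^bsub>k\<^esub>} \<subseteq> {q \<in> carrier Q. deg q \<in> {\<gamma> \<in> Obj D. m \<gamma> \<noteq> \<zero>\<^bsub>At kF \<gamma>\<^esub>}}"
    using deg_in_Obj by (auto simp: cmpr_def kF_sel(3) A.B_sel(2))
  moreover have "finite {q \<in> carrier Q. deg q \<in> {\<gamma> \<in> Obj D. m \<gamma> \<noteq> \<zero>\<^bsub>At kF \<gamma>\<^esub>}}"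
  proof (rule finite_imageD)
    show "finite (deg ` {q \<in> carrier Q. deg q \<in> {\<gamma> \<in> Obj D. m \<gamma> \<noteq> \<zero>\<^bsub>At kF \<gamma>\<^esub>}})"
      by (rule finite_subset[OF _ fin]) auto
    show "inj_on deg {q \<in> carrier Q. deg q \<in> {\<gamma> \<in> Obj D. m \<gamma> \<noteq> \<zero>\<^bsub>At kF \<gamma>\<^esub>}}"
      by (rule inj_onI) (use deg_inj in blast)
  qed
  ultimately have "finite {q \<in> carrier Q. cmpr m q \<noteq> \<zero>\<^bsub>k\<^esub>}" by (rule finite_subset)
  moreover have "m (deg q) q \<in> carrier k" if "q \<in> carrier Q" for q
    using at[OF deg_in_Obj[OF that]] A.B_val that by (auto simp: kF_sel(1))
  ultimately show ?thesis by (auto simp: A.B_sel(1) cmpr_def)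
qed

lemma cmpr_hom: assumes M: "is_kCmod k D kF" shows "cmpr \<in> mod_hom k (KM kF) A.B"
proof (rule mod_homI)
  show "cmpr m \<in> carrier A.B" if "m \<in> carrier (KM kF)" for m by (rule cmpr_closed[OF that])
  show "cmpr (m \<oplus>\<^bsub>KM kF\<^esub> m') = cmpr m \<oplus>\<^bsub>A.B\<^esub> cmpr m'" for m m'
    using deg_in_Obj by (auto simp: cmpr_def A.B_sel(3) dsum_sel(3) kF_sel(2) intro!: restrict_ext)
  show "cmpr (b \<odot>\<^bsub>KM kF\<^esub> m) = b \<odot>\<^bsub>A.B\<^esub> cmpr m" if b: "b \<in> carrier k" and m: "m \<in> carrier (KM kF)" for b m
  proof -
    have "(b \<odot>\<^bsub>KM kF\<^esub> m) (deg q) = b \<odot>\<^bsub>A.B\<^esub> m (deg q)" if "q \<in> carrier Q" for q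
      using kF_sel(4)[OF b, of "m (deg q)" "deg q"] KM_at[OF M m deg_in_Obj[OF that]] deg_in_Obj[OF that]
      by (simp add: dsum_sel(4) kF_sel(1))
    then show ?thesis by (auto simp: cmpr_def A.B_sel(4) intro!: restrict_ext)
  qed
qed

text \<open>The coefficient of the product at \<open>q\<close> depends only on the coefficients of
  \<open>x\<close> at those \<open>s\<close> with \<open>p \<otimes> s = q\<close>. In
  \<open>cmpr_sh\<close> this allows one homogeneous component to be exchanged for the whole
  element.\<close>

lemma mn_mult_local:
  assumes p: "p \<in> carrier Q" and x: "x \<in> carrier A.B" and y: "y \<in> carrier A.B" and q: "q \<in> carrier Q"
    and eq: "\<And>s. s \<in> carrier Q \<Longrightarrow> p \<otimes>\<^bsub>Q\<^esub> s = q \<Longrightarrow> x s = y s"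
  shows "(A.mn p \<otimes>\<^bsub>A.B\<^esub> x) q = (A.mn p \<otimes>\<^bsub>A.B\<^esub> y) q"
proof -
  let ?Y = "{s \<in> carrier Q. x s \<noteq> \<zero>\<^bsub>k\<^esub>} \<union> {s \<in> carrier Q. y s \<noteq> \<zero>\<^bsub>k\<^esub>}"
  have Y: "finite ?Y" "?Y \<subseteq> carrier Q" using A.B_fin[OF x] A.B_fin[OF y] by auto
  have X: "finite {p}" "{p} \<subseteq> carrier Q" "{s \<in> carrier Q. A.mn p s \<noteq> \<zero>\<^bsub>k\<^esub>} \<subseteq> {p}"
    using p by (auto simp: A.B_eval(1) split: if_splits)
  have "(A.mn p \<otimes>\<^bsub>A.B\<^esub> x) q = (\<Oplus>\<^bsub>k\<^esub> t\<in>{t \<in> {p} \<times> ?Y. fst t \<otimes>\<^bsub>Q\<^esub> snd t = q}. A.mn p (fst t) \<otimes>\<^bsub>k\<^esub> x (snd t))"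
    by (rule A.mult_eval[OF A.mn_closed[OF p] x q X Y]) auto
  also have "\<dots> = (\<Oplus>\<^bsub>k\<^esub> t\<in>{t \<in> {p} \<times> ?Y. fst t \<otimes>\<^bsub>Q\<^esub> snd t = q}. A.mn p (fst t) \<otimes>\<^bsub>k\<^esub> y (snd t))"
    by (rule k.finsum_cong') (use p eq A.B_val[OF y] A.B_val[OF A.mn_closed[OF p]] in auto)
  also have "\<dots> = (A.mn p \<otimes>\<^bsub>A.B\<^esub> y) q"
    by (rule A.mult_eval[OF A.mn_closed[OF p] y q X Y, symmetric]) auto
  finally show ?thesis .
qed

lemma cmpr_sh: assumes M: "is_kCmod k D kF" and l: "l \<in> NV" and m: "m \<in> carrier (KM kF)"
  shows "cmpr (sh kF l m) = A.mn (gexp l) \<otimes>\<^bsub>A.B\<^esub> cmpr m"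
proof (rule A.B_eqI)
  show "cmpr (sh kF l m) \<in> carrier A.B" by (rule cmpr_closed[OF sh_closed[OF M l m]])
  show "A.mn (gexp l) \<otimes>\<^bsub>A.B\<^esub> cmpr m \<in> carrier A.B" by (rule A.mult_closed[OF A.mn_closed[OF gexp_closed] cmpr_closed[OF m]])
  fix q assume q: "q \<in> carrier Q"
  have mo: "m (obj (deg q) l) \<in> carrier A.B" using KM_at[OF M m obj_Obj[OF deg_in_Obj[OF q]]] by (simp add: kF_sel(1))
  have "cmpr (sh kF l m) q = (A.mn (gexp l) \<otimes>\<^bsub>A.B\<^esub> m (obj (deg q) l)) q"
    using q deg_in_Obj[OF q] by (simp add: cmpr_def sh_def kF_act[OF l])
  also have "\<dots> = (A.mn (gexp l) \<otimes>\<^bsub>A.B\<^esub> cmpr m) q"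
  proof (rule mn_mult_local[OF gexp_closed mo cmpr_closed[OF m] q])
    fix s assume s: "s \<in> carrier Q" "gexp l \<otimes>\<^bsub>Q\<^esub> s = q"
    have "obj (deg q) l = deg s" using deg_act[OF s(1), of l] unfolding s(2) by (auto simp: obj_def)
    then show "m (obj (deg q) l) s = cmpr m s" using s(1) by (simp add: cmpr_def)
  qed
  finally show "cmpr (sh kF l m) q = (A.mn (gexp l) \<otimes>\<^bsub>A.B\<^esub> cmpr m) q" .
qed

lemma cmpr_R_hom: assumes M: "is_kCmod k D kF" shows "cmpr \<in> mod_hom R (tot kF) kQ"
proof (rule mod_homI)
  note h = cmpr_hom[OF M]
  show "cmpr m \<in> carrier kQ" if "m \<in> carrier (tot kF)" for m using mod_homD(1)[OF h] that by (simp add: tot_sel)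
  show "cmpr (m \<oplus>\<^bsub>tot kF\<^esub> m') = cmpr m \<oplus>\<^bsub>kQ\<^esub> cmpr m'" if "m \<in> carrier (tot kF)" "m' \<in> carrier (tot kF)" for m m'
    using mod_homD(2)[OF h] that by (simp add: tot_sel)
  fix f m assume f: "f \<in> carrier R" and m: "m \<in> carrier (tot kF)"
  then have m: "m \<in> carrier (KM kF)" by (simp add: tot_sel)
  have "cmpr (f \<odot>\<^bsub>tot kF\<^esub> m) = NA.am f \<otimes>\<^bsub>A.B\<^esub> cmpr m"
  proof (rule lbasis_ext[OF N.B_lbasis A.kmod mod_hom_comp[OF tot_smult_hom_left[OF M m] h]
        mod_hom_comp[OF NA.am_hom A.mult_hom_left[OF cmpr_closed[OF m]]] _ f])
    fix l assume l: "l \<in> carrier (Nat_vec n)"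
    then have "l \<in> NV" by (simp add: N_carrier)
    then show "cmpr (N.mn l \<odot>\<^bsub>tot kF\<^esub> m) = NA.am (N.mn l) \<otimes>\<^bsub>A.B\<^esub> cmpr m"
      using tot_smult_mono[OF M _ m] cmpr_sh[OF M _ m] NA.am_mn[OF l] by simp
  qed
  then show "cmpr (f \<odot>\<^bsub>tot kF\<^esub> m) = f \<odot>\<^bsub>kQ\<^esub> cmpr m" by simp
qed

lemma cmpr_bij: assumes M: "is_kCmod k D kF" shows "bij_betw cmpr (carrier (KM kF)) (carrier kQ)"
proof (rule bij_betwI')
  fix m m' assume m: "m \<in> carrier (KM kF)" "m' \<in> carrier (KM kF)"
  have "m = m'" if e: "cmpr m = cmpr m'"
  proof (rule KM_eqI[OF M m])
    fix \<delta> assume d: "\<delta> \<in> Obj D"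
    note at = KM_at[OF M m(1) d] KM_at[OF M m(2) d]
    show "m \<delta> = m' \<delta>"
    proof (rule A.B_eqI)
      fix q assume q: "q \<in> carrier Q"
      show "m \<delta> q = m' \<delta> q"
      proof (cases "deg q = \<delta>")
        case True
        then show ?thesis using fun_cong[OF e, of q] q by (simp add: cmpr_def)
      next
        case False
        then show ?thesis using kF_eval[OF at(1) q] kF_eval[OF at(2) q] by simp
      qed
    qed (use at in \<open>simp_all add: kF_sel(1)\<close>)
  qed
  then show "cmpr m = cmpr m' \<longleftrightarrow> m = m'" by blast
next
  fix m assume "m \<in> carrier (KM kF)"
  then show "cmpr m \<in> carrier kQ" using cmpr_closed by simp
next
  fix y assume "y \<in> carrier kQ"
  then have y: "y \<in> carrier A.B" by simp
  let ?m = "\<lambda>\<delta>\<in>Obj D. cmp y \<delta>"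
  have "{\<delta> \<in> Obj D. ?m \<delta> \<noteq> \<zero>\<^bsub>At kF \<delta>\<^esub>} \<subseteq> deg ` {s \<in> carrier Q. y s \<noteq> \<zero>\<^bsub>k\<^esub>}"
  proof
    fix \<delta> assume "\<delta> \<in> {\<delta> \<in> Obj D. ?m \<delta> \<noteq> \<zero>\<^bsub>At kF \<delta>\<^esub>}"
    then have "cmp y \<delta> \<noteq> (\<lambda>s\<in>carrier Q. \<zero>\<^bsub>k\<^esub>)" by (auto simp: kF_sel(3) A.B_sel(2))
    then have "\<exists>s\<in>carrier Q. deg s = \<delta> \<and> y s \<noteq> \<zero>\<^bsub>k\<^esub>"
      unfolding cmp_def by (rule contrapos_np) (auto intro!: restrict_ext)
    then show "\<delta> \<in> deg ` {s \<in> carrier Q. y s \<noteq> \<zero>\<^bsub>k\<^esub>}" by blast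
  qed
  then have "finite {\<delta> \<in> Obj D. ?m \<delta> \<noteq> \<zero>\<^bsub>At kF \<delta>\<^esub>}"
    by (rule finite_subset) (use A.B_fin[OF y] in simp)
  moreover have "cmp y \<delta> \<in> carrier (At kF \<delta>)" for \<delta> using cmp_closed[OF y, of \<delta>] by (simp add: kF_sel(1) kQgr_eq)
  ultimately have m: "?m \<in> carrier (KM kF)" by (auto simp: dsum_sel(1))
  have "y = cmpr ?m"
  proof (rule A.B_eqI[OF y cmpr_closed[OF m]])
    fix q assume "q \<in> carrier Q"
    then show "y q = cmpr ?m q" using deg_in_Obj by (simp add: cmpr_def cmp_def)
  qed
  then show "\<exists>m\<in>carrier (KM kF). y = cmpr m" using m by blast
qed

lemma cmpr_gr: "m \<in> gr kF \<gamma> \<Longrightarrow> cmpr m \<in> kQgr \<gamma>"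
  using cmpr_closed deg_in_Obj by (auto simp: gr_eq kQgr_eq cmpr_def kF_sel(3) A.B_sel(2))

section \<open>Morphisms and exactness for total modules\<close>

lemma tmap_eval: "total_map r \<phi> m = (\<lambda>\<delta>\<in>Obj D. \<phi> \<delta> (m \<delta>))"
  by (simp add: total_map_def Z_Obj)

lemma tmap_closed:
  assumes M: "is_kCmod k D M" and M': "is_kCmod k D M'" and p: "\<phi> \<in> nat_trans k D M M'" and m: "m \<in> carrier (KM M)"
  shows "total_map r \<phi> m \<in> carrier (KM M')"
proof -
  note h = nat_trans_hom[OF p]
  have "finite {\<delta> \<in> Obj D. \<phi> \<delta> (m \<delta>) \<noteq> \<zero>\<^bsub>At M' \<delta>\<^esub>}"
    by (rule finite_subset[of _ "{\<delta> \<in> Obj D. m \<delta> \<noteq> \<zero>\<^bsub>At M \<delta>\<^esub>}"])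
      (use m mod_hom_zero[OF kCmod_module[OF M] kCmod_module[OF M'] h] in \<open>auto simp: dsum_sel(1)\<close>)
  then show ?thesis using mod_homD(1)[OF h KM_at[OF M m]] by (auto simp: tmap_eval dsum_sel(1) cong: conj_cong)
qed

lemma tmap_hom:
  assumes M: "is_kCmod k D M" and M': "is_kCmod k D M'" and p: "\<phi> \<in> nat_trans k D M M'"
  shows "total_map r \<phi> \<in> mod_hom k (KM M) (KM M')"
  by (rule mod_homI)
    (use tmap_closed[OF assms] mod_homD[OF nat_trans_hom[OF p]] KM_at[OF M] in \<open>auto simp: tmap_eval dsum_sel(3,4) intro!: restrict_ext\<close>)

lemma tmap_R_hom:
  assumes M: "is_kCmod k D M" and M': "is_kCmod k D M'" and p: "\<phi> \<in> nat_trans k D M M'"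
  shows "total_map r \<phi> \<in> mod_hom R (tot M) (tot M')"
proof (rule mod_homI)
  note h = tmap_hom[OF assms]
  show "total_map r \<phi> m \<in> carrier (tot M')" if "m \<in> carrier (tot M)" for m using mod_homD(1)[OF h] that by (simp add: tot_sel)
  show "total_map r \<phi> (m \<oplus>\<^bsub>tot M\<^esub> m') = total_map r \<phi> m \<oplus>\<^bsub>tot M'\<^esub> total_map r \<phi> m'"
    if "m \<in> carrier (tot M)" "m' \<in> carrier (tot M)" for m m'
    using mod_homD(2)[OF h] that by (simp add: tot_sel)
  fix f m assume f: "f \<in> carrier R" and m: "m \<in> carrier (tot M)"
  then have m: "m \<in> carrier (KM M)" by (simp add: tot_sel)
  note tm = mod_homD(1)[OF h m]
  show "total_map r \<phi> (f \<odot>\<^bsub>tot M\<^esub> m) = f \<odot>\<^bsub>tot M'\<^esub> total_map r \<phi> m"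
  proof (rule lbasis_ext[OF N.B_lbasis KM_module[OF M'] mod_hom_comp[OF tot_smult_hom_left[OF M m] h]
        tot_smult_hom_left[OF M' tm] _ f])
    fix l assume "l \<in> carrier (Nat_vec n)"
    then have l: "l \<in> NV" by (simp add: N_carrier)
    have "total_map r \<phi> (sh M l m) = sh M' l (total_map r \<phi> m)"
      using nat_trans_act[OF p obj_Obj _ obj_mor[OF l] KM_at[OF M m obj_Obj]] obj_Obj
      by (auto simp: tmap_eval sh_def intro!: restrict_ext)
    then show "total_map r \<phi> (N.mn l \<odot>\<^bsub>tot M\<^esub> m) = N.mn l \<odot>\<^bsub>tot M'\<^esub> total_map r \<phi> m"
      using tot_smult_mono[OF M l m] tot_smult_mono[OF M' l tm] by simp
  qed
qed

lemma tmap_gr: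
  assumes M: "is_kCmod k D M" and M': "is_kCmod k D M'" and p: "\<phi> \<in> nat_trans k D M M'" and m: "m \<in> gr M \<gamma>"
  shows "total_map r \<phi> m \<in> gr M' \<gamma>"
  using m tmap_closed[OF M M' p] mod_hom_zero[OF kCmod_module[OF M] kCmod_module[OF M'] nat_trans_hom[OF p]]
  by (auto simp: gr_eq) (auto simp: tmap_eval)

lemma tmap_graded:
  assumes "is_kCmod k D M" "is_kCmod k D M'" "\<phi> \<in> nat_trans k D M M'"
  shows "total_map r \<phi> \<in> graded_hom (Int_vec r) R (tot M) (gr M) (tot M') (gr M')"
  using tmap_R_hom[OF assms] tmap_gr[OF assms] by (auto simp: graded_hom_def)

lemma tmap_image:
  assumes M: "is_kCmod k D M" and M': "is_kCmod k D M'" and p: "\<phi> \<in> nat_trans k D M M'"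
  shows "total_map r \<phi> ` carrier (KM M) = {m \<in> carrier (KM M'). \<forall>\<delta>\<in>Obj D. m \<delta> \<in> \<phi> \<delta> ` carrier (At M \<delta>)}"
proof (intro equalityI subsetI)
  fix m assume "m \<in> total_map r \<phi> ` carrier (KM M)"
  then obtain x where x: "x \<in> carrier (KM M)" "m = total_map r \<phi> x" by blast
  then show "m \<in> {m \<in> carrier (KM M'). \<forall>\<delta>\<in>Obj D. m \<delta> \<in> \<phi> \<delta> ` carrier (At M \<delta>)}"
    using tmap_closed[OF M M' p x(1)] KM_at[OF M x(1)] by (auto simp: tmap_eval)
next
  fix m assume "m \<in> {m \<in> carrier (KM M'). \<forall>\<delta>\<in>Obj D. m \<delta> \<in> \<phi> \<delta> ` carrier (At M \<delta>)}"
  then have m: "m \<in> carrier (KM M')" "\<forall>\<delta>\<in>Obj D. \<exists>x. x \<in> carrier (At M \<delta>) \<and> m \<delta> = \<phi> \<delta> x" by auto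
  from bchoice[OF m(2)] obtain X where X: "\<And>\<delta>. \<delta> \<in> Obj D \<Longrightarrow> X \<delta> \<in> carrier (At M \<delta>)" "\<And>\<delta>. \<delta> \<in> Obj D \<Longrightarrow> m \<delta> = \<phi> \<delta> (X \<delta>)"
    by blast
  \<comment> \<open>Where \<open>m\<close> vanishes the chosen preimage is 0, which keeps the
    support finite.\<close>
  let ?x = "\<lambda>\<delta>\<in>Obj D. if m \<delta> = \<zero>\<^bsub>At M' \<delta>\<^esub> then \<zero>\<^bsub>At M \<delta>\<^esub> else X \<delta>"
  have z: "\<zero>\<^bsub>At M \<delta>\<^esub> \<in> carrier (At M \<delta>)" if "\<delta> \<in> Obj D" for \<delta> by (rule mod_zero[OF kCmod_module[OF M that]])
  have "finite {\<delta> \<in> Obj D. ?x \<delta> \<noteq> \<zero>\<^bsub>At M \<delta>\<^esub>}"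
    by (rule finite_subset[of _ "{\<delta> \<in> Obj D. m \<delta> \<noteq> \<zero>\<^bsub>At M' \<delta>\<^esub>}"]) (use m(1) in \<open>auto simp: dsum_sel(1) split: if_splits\<close>)
  then have x: "?x \<in> carrier (KM M)" using X(1) z by (simp add: dsum_sel(1))
  have "m = total_map r \<phi> ?x"
  proof (rule KM_eqI[OF M' m(1) tmap_closed[OF M M' p x]])
    fix \<delta> assume d: "\<delta> \<in> Obj D"
    show "m \<delta> = total_map r \<phi> ?x \<delta>"
      using d X(2)[OF d] mod_hom_zero[OF kCmod_module[OF M d] kCmod_module[OF M' d] nat_trans_hom[OF p d]] by (simp add: tmap_eval)
  qed
  then show "m \<in> total_map r \<phi> ` carrier (KM M)" using x by blast
qed

text \<open>Images and kernels are computed in each degree separately; finiteness of supports, the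
  only global condition, is settled in \<open>tmap_image\<close>.\<close>

lemma tmap_exact:
  assumes M: "is_kCmod k D M" and M': "is_kCmod k D M'" and M'': "is_kCmod k D M''"
    and p: "\<phi> \<in> nat_trans k D M M'" and q: "\<psi> \<in> nat_trans k D M' M''"
    and ex: "\<And>\<delta>. \<delta> \<in> Obj D \<Longrightarrow> \<phi> \<delta> ` carrier (At M \<delta>) = a_kernel (At M' \<delta>) (At M'' \<delta>) (\<psi> \<delta>)"
  shows "total_map r \<phi> ` carrier (tot M) = a_kernel (tot M') (tot M'') (total_map r \<psi>)"
proof -
  have "total_map r \<psi> m = \<zero>\<^bsub>KM M''\<^esub> \<longleftrightarrow> (\<forall>\<delta>\<in>Obj D. \<psi> \<delta> (m \<delta>) = \<zero>\<^bsub>At M'' \<delta>\<^esub>)" for m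
    by (auto simp: tmap_eval dsum_sel(2) restrict_def fun_eq_iff)
  then show ?thesis unfolding tot_sel tmap_image[OF M M' p] a_kernel_def'
    using KM_at[OF M'] ex by (auto simp: a_kernel_def')
qed

end

section \<open>Total modules of finitely generated free functors\<close>

context affine begin

lemma gr_finsum:
  assumes M: "is_kCmod k D M" and S: "finite S" "\<And>i. i \<in> S \<Longrightarrow> x i \<in> gr M \<gamma>"
  shows "(\<Oplus>\<^bsub>KM M\<^esub> i\<in>S. x i) \<in> gr M \<gamma>"
proof -
  interpret K: Module.module k "KM M" by (rule KM_module[OF M])
  have xc: "x i \<in> carrier (KM M)" if "i \<in> S" for i using S(2)[OF that] by (simp add: gr_eq)
  have "(\<Oplus>\<^bsub>KM M\<^esub> i\<in>S. x i) \<delta> = \<zero>\<^bsub>At M \<delta>\<^esub>" if d: "\<delta> \<in> Obj D" "\<delta> \<noteq> \<gamma>" for \<delta>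
  proof -
    interpret Md: Module.module k "At M \<delta>" by (rule kCmod_module[OF M d(1)])
    have "(\<Oplus>\<^bsub>KM M\<^esub> i\<in>S. x i) \<delta> = (\<Oplus>\<^bsub>At M \<delta>\<^esub> i\<in>S. x i \<delta>)"
      by (rule mod_hom_finsum[OF KM_module[OF M] Md.module_axioms KM_ev[OF M d(1)] S(1) xc])
    also have "\<dots> = (\<Oplus>\<^bsub>At M \<delta>\<^esub> i\<in>S. \<zero>\<^bsub>At M \<delta>\<^esub>)"
      by (rule Md.M.finsum_cong') (use S(2) d in \<open>auto simp: gr_eq\<close>)
    finally show ?thesis by simp
  qed
  moreover have "(\<Oplus>\<^bsub>KM M\<^esub> i\<in>S. x i) \<in> carrier (KM M)" by (rule K.M.finsum_closed) (use xc in auto)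
  ultimately show ?thesis by (simp add: gr_eq)
qed

lemma fbasis_reindex:
  assumes B: "fbasis k C M N c b" and t: "bij_betw \<tau> N' N"
  shows "fbasis k C M N' (\<lambda>i. c (\<tau> i)) (\<lambda>i. b (\<tau> i))"
proof -
  have tN: "\<tau> i \<in> N" if "i \<in> N'" for i using t that by (auto simp: bij_betw_def)
  have "lbasis k (At M d) (SIGMA i:N'. Mor C (c (\<tau> i)) d) (\<lambda>(i, w). Act M (c (\<tau> i)) d w (b (\<tau> i)))" if d: "d \<in> Obj C" for d
  proof -
    have "bij_betw (\<lambda>(i, w). (\<tau> i, w)) (SIGMA i:N'. Mor C (c (\<tau> i)) d) (SIGMA t:N. Mor C (c t) d)"
      using t by (auto simp: bij_betw_def inj_on_def image_iff)
    from lbasis_reindex[OF fbasis_lbasis[OF B d] this] show ?thesis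
      by (rule lbasis_cong[rotated]) auto
  qed
  then show ?thesis using fbasis_kCmod[OF B] fbasis_obj[OF B] fbasis_in[OF B] tN by (auto simp: fbasis_def)
qed

context
  fixes M :: "(nat \<Rightarrow> int, nat \<Rightarrow> nat, 'k, 'u) fmod" and m :: nat and c b
  assumes B: "fbasis k D M {..<m} c b"
begin

text \<open>Two views of one direct sum of copies of \<open>R\<close>: over \<open>R\<close> it is
  the free module asked for, over \<open>k\<close> it has the basis of all monomials in all
  summands.\<close>

abbreviation "VR \<equiv> dsum_mod {..<m} (\<lambda>_. self_mod R)"
abbreviation "VK \<equiv> dsum_mod {..<m} (\<lambda>_. N.B)"
definition "fgen i = dsum_in (Obj D) (At M) (c i) (b i)"
text \<open>The \<open>R\<close>-linear map that takes the unit vectors to the generators. It runs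
  opposite to the isomorphism that is wanted, since maps out of a free module are easy to
  define.\<close>

definition "fmap = dsum_lift {..<m} (\<lambda>_. self_mod R) (tot M) (\<lambda>i f. f \<odot>\<^bsub>tot M\<^esub> fgen i)"

lemma M_mod: "is_kCmod k D M" by (rule fbasis_kCmod[OF B])

lemma c_obj: "i < m \<Longrightarrow> c i \<in> Obj D" and b_in: "i < m \<Longrightarrow> b i \<in> carrier (At M (c i))"
  using fbasis_obj[OF B] fbasis_in[OF B] by auto

lemma in_hom_KM: "\<delta> \<in> Obj D \<Longrightarrow> dsum_in (Obj D) (At M) \<delta> \<in> mod_hom k (At M \<delta>) (KM M)"
  by (rule dsum_in_hom[where I = "Obj D" and F = "At M", OF k.is_cring kCmod_module[OF M_mod]])

lemma fgen_closed: "i < m \<Longrightarrow> fgen i \<in> carrier (KM M)"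
  unfolding fgen_def by (rule mod_homD(1)[OF in_hom_KM[OF c_obj] b_in])

lemma fgen_gr: "i < m \<Longrightarrow> fgen i \<in> gr M (c i)"
  using fgen_closed by (auto simp: gr_eq) (auto simp: fgen_def dsum_in_def)

lemma VK_sel: "carrier VK = carrier VR" "add VK = add VR" "zero VK = zero VR"
  by (simp_all add: dsum_mod_def)

lemma RR_module: "Module.module R (self_mod R)"
  by (rule self_mod_module[OF N.B_cring])

lemma VR_module: "Module.module R VR"
  by (rule dsum_module[OF N.B_cring RR_module])

lemma fmap_hom: "fmap \<in> mod_hom R VR (tot M)"
  unfolding fmap_def
  by (rule dsum_lift_hom[OF N.B_cring RR_module tot_module[OF M_mod] mod_hom_smult_left[OF tot_module[OF M_mod]]])
    (simp add: fgen_closed tot_sel)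

lemma fmap_eq: "fmap = dsum_lift {..<m} (\<lambda>_. N.B) (KM M) (\<lambda>i f. f \<odot>\<^bsub>tot M\<^esub> fgen i)"
  by (simp add: fmap_def dsum_lift_def[abs_def] finsum_cong_struct[OF tot_sel])

lemma fmap_hom_k: "fmap \<in> mod_hom k VK (KM M)"
  unfolding fmap_eq
  by (rule dsum_lift_hom[OF k.is_cring N.kmod KM_module[OF M_mod]])
    (simp add: tot_smult_hom_left[OF M_mod] fgen_closed)

lemma fmap_in: "i < m \<Longrightarrow> f \<in> carrier R \<Longrightarrow> fmap (dsum_in {..<m} (\<lambda>_. N.B) i f) = f \<odot>\<^bsub>tot M\<^esub> fgen i"
  unfolding fmap_eq
  by (rule dsum_lift_in[OF k.is_cring N.kmod KM_module[OF M_mod]])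
    (simp_all add: tot_smult_hom_left[OF M_mod] fgen_closed)

lemma VK_lbasis: "lbasis k VK (SIGMA i:{..<m}. NV) (\<lambda>(i, l). dsum_in {..<m} (\<lambda>_. N.B) i (N.mn l))"
  using lbasis_dsum[where N = "{..<m}", OF k.is_cring N.B_lbasis] by (simp add: N_carrier)

text \<open>The degree of the product of the monomial of \<open>l\<close> and the generator
  \<open>i\<close>.\<close>

definition "tgt i l = (\<lambda>j. c i j + lin_comb n a l j)"

lemma tgt: "tgt i l = \<delta> \<longleftrightarrow> c i = obj \<delta> l"
  by (auto simp: tgt_def obj_def)

lemma tgt_Obj: "i < m \<Longrightarrow> l \<in> NV \<Longrightarrow> tgt i l \<in> Obj D"
  using c_obj[of i] by (simp add: ObjD tgt_def lin_comb_def a_supp)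

lemma sh_fgen: assumes i: "i < m" and l: "l \<in> NV"
  shows "sh M l (fgen i) = dsum_in (Obj D) (At M) (tgt i l) (Act M (c i) (tgt i l) l (b i))"
proof -
  have "Act M (obj \<delta> l) \<delta> l (fgen i (obj \<delta> l)) = (if \<delta> = tgt i l then Act M (c i) (tgt i l) l (b i) else \<zero>\<^bsub>At M \<delta>\<^esub>)"
    if d: "\<delta> \<in> Obj D" for \<delta>
  proof (cases "\<delta> = tgt i l")
    case True
    then have "obj \<delta> l = c i" using tgt[of i l \<delta>] by simp
    then show ?thesis using True c_obj[OF i] by (simp add: fgen_def dsum_in_def)
  next
    case False
    then have "obj \<delta> l \<noteq> c i" using tgt[of i l \<delta>] by auto
    then have "fgen i (obj \<delta> l) = \<zero>\<^bsub>At M (obj \<delta> l)\<^esub>" using obj_Obj[OF d] by (simp add: fgen_def dsum_in_def)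
    then show ?thesis
      using False mod_hom_zero[OF kCmod_module[OF M_mod obj_Obj[OF d]] kCmod_module[OF M_mod d] kCmod_act[OF M_mod obj_Obj[OF d] d obj_mor[OF l]]]
      by simp
  qed
  then show ?thesis by (auto simp: sh_def dsum_in_def intro!: restrict_ext)
qed

lemma fmap_basis: assumes i: "i < m" and l: "l \<in> NV"
  shows "fmap (dsum_in {..<m} (\<lambda>_. N.B) i (N.mn l)) = dsum_in (Obj D) (At M) (tgt i l) (Act M (c i) (tgt i l) l (b i))"
  using fmap_in[OF i N.mn_closed[of l]] tot_smult_mono[OF M_mod l fgen_closed[OF i]] sh_fgen[OF i l] l by (simp add: N_carrier)

text \<open>It matches two bases over \<open>k\<close>: the monomial of \<open>l\<close> in summand
  \<open>i\<close> goes to the translate of generator \<open>i\<close> along \<open>l\<close>,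
  placed in degree \<open>tgt i l\<close>.\<close>

lemma fmap_bij: "bij_betw fmap (carrier VR) (carrier (tot M))"
proof -
  have "bij_betw fmap (carrier VK) (carrier (KM M))"
  proof (rule lbasis_bij[OF k.is_cring VK_lbasis lbasis_dsum[where N = "Obj D", OF k.is_cring fbasis_lbasis[OF B]] fmap_hom_k])
    show "bij_betw (\<lambda>(i, l). (tgt i l, (i, l))) (SIGMA i:{..<m}. NV) (SIGMA \<delta>:Obj D. SIGMA t:{..<m}. Mor D (c t) \<delta>)"
    proof (rule bij_betwI[where g = snd])
      show "(\<lambda>(i, l). (tgt i l, (i, l))) \<in> (SIGMA i:{..<m}. NV) \<rightarrow> (SIGMA \<delta>:Obj D. SIGMA t:{..<m}. Mor D (c t) \<delta>)"
      proof (rule funcsetI)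
        fix x assume "x \<in> (SIGMA i:{..<m}. NV)"
        then obtain i l where x: "x = (i, l)" "i < m" "l \<in> NV" by auto
        then show "(case x of (i, l) \<Rightarrow> (tgt i l, i, l)) \<in> (SIGMA \<delta>:Obj D. SIGMA t:{..<m}. Mor D (c t) \<delta>)"
          using tgt_Obj[of i l] tgt[of i l "tgt i l"] by (simp add: MorD)
      qed
      show "(case snd y of (i, l) \<Rightarrow> (tgt i l, i, l)) = y" if "y \<in> (SIGMA \<delta>:Obj D. SIGMA t:{..<m}. Mor D (c t) \<delta>)" for y
      proof -
        obtain \<delta> i l where y: "y = (\<delta>, i, l)" "l \<in> Mor D (c i) \<delta>" using \<open>y \<in> _\<close> by auto
        then show ?thesis using tgt[of i l \<delta>] by (simp add: MorD)
      qed
    qed (auto simp: MorD)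
    show "fmap (case x of (i, l) \<Rightarrow> dsum_in {..<m} (\<lambda>_. N.B) i (N.mn l)) =
       (case (case x of (i, l) \<Rightarrow> (tgt i l, i, l)) of (\<delta>, y) \<Rightarrow>
         dsum_in (Obj D) (At M) \<delta> (case y of (t, w) \<Rightarrow> Act M (c t) \<delta> w (b t)))" if "x \<in> (SIGMA i:{..<m}. NV)" for x
      using that fmap_basis by auto
  qed
  then show ?thesis by (simp only: VK_sel tot_sel)
qed

lemma sg_eq: "\<gamma> \<in> Obj D \<Longrightarrow> shift_sum_grading (Int_vec r) R Rgr m c \<gamma> =
   {p \<in> carrier VK. \<forall>i<m. \<forall>l\<in>NV. p i l \<noteq> \<zero>\<^bsub>k\<^esub> \<longrightarrow> tgt i l = \<gamma>}"
proof -
  assume g: "\<gamma> \<in> Obj D"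
  have "\<gamma> \<otimes>\<^bsub>Int_vec r\<^esub> inv\<^bsub>Int_vec r\<^esub> c i = (\<lambda>j. \<gamma> j - c i j)" if "i < m" for i
    by (simp add: Z_add Z_inv[OF c_obj[OF that]])
  moreover have "lin_comb n a l = (\<lambda>j. \<gamma> j - c i j) \<longleftrightarrow> tgt i l = \<gamma>" for i l
    by (auto simp: tgt_def fun_eq_iff algebra_simps)
  ultimately show ?thesis
    by (auto simp: shift_sum_grading_def shift_sum_def VK_sel(1) algebra_grading_def N_carrier) (auto simp: dsum_sel(1))
qed

text \<open>Reads off the coefficients of \<open>p\<close> from \<open>fmap p\<close> by the functionals dual to the basis of \<open>M(\<delta>)\<close>.\<close>

lemma fmap_coeff:
  assumes i: "i < m" and l: "l \<in> NV" and p: "p \<in> carrier VK" and z: "fmap p (tgt i l) = \<zero>\<^bsub>At M (tgt i l)\<^esub>"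
  shows "p i l = \<zero>\<^bsub>k\<^esub>"
proof -
  define \<delta> where "\<delta> = tgt i l"
  have d: "\<delta> \<in> Obj D" unfolding \<delta>_def by (rule tgt_Obj[OF i l])
  have "(i, l) \<in> (SIGMA t:{..<m}. Mor D (c t) \<delta>)" using i l tgt[of i l \<delta>] by (simp add: MorD \<delta>_def)
  then obtain \<kappa> where K: "\<kappa> \<in> mod_hom k (At M \<delta>) (self_mod k)"
    "\<And>j. j \<in> (SIGMA t:{..<m}. Mor D (c t) \<delta>) \<Longrightarrow> \<kappa> ((\<lambda>(t, w). Act M (c t) \<delta> w (b t)) j) = (if j = (i, l) then \<one>\<^bsub>k\<^esub> else \<zero>\<^bsub>k\<^esub>)"
    using lbasis_dual[OF fbasis_lbasis[OF B d]] by blast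
  note SM = self_mod_module[OF k.is_cring]
  have ev: "(\<lambda>p. p i l) \<in> mod_hom k VK (self_mod k)"
  proof (rule mod_homI)
    fix p assume "p \<in> carrier VK"
    then have "p i \<in> carrier N.B" using i by (auto simp: dsum_sel(1))
    then show "p i l \<in> carrier (self_mod k)" using N.B_val[of "p i" l] l by (simp add: N_carrier)
  qed (use i l in \<open>auto simp: dsum_sel(3,4) N.B_eval N_carrier\<close>)
  have "\<kappa> (fmap p \<delta>) = p i l"
  proof (rule lbasis_ext[OF VK_lbasis SM mod_hom_comp[OF mod_hom_comp[OF fmap_hom_k KM_ev[OF M_mod d]] K(1)] ev _ p])
    fix x assume "x \<in> (SIGMA i:{..<m}. NV)"
    then obtain j l' where x: "x = (j, l')" "j < m" "l' \<in> NV" by auto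
    have "\<kappa> (dsum_in (Obj D) (At M) (tgt j l') (Act M (c j) (tgt j l') l' (b j)) \<delta>) = (if (j, l') = (i, l) then \<one>\<^bsub>k\<^esub> else \<zero>\<^bsub>k\<^esub>)"
    proof (cases "tgt j l' = \<delta>")
      case True
      then have "(j, l') \<in> (SIGMA t:{..<m}. Mor D (c t) \<delta>)" using x tgt[of j l' \<delta>] by (simp add: MorD)
      from K(2)[OF this] show ?thesis using True d by (simp add: dsum_in_def)
    next
      case False
      then have "(j, l') \<noteq> (i, l)" by (auto simp: \<delta>_def)
      then show ?thesis using False d mod_hom_zero[OF kCmod_module[OF M_mod d] SM K(1)] by (simp add: dsum_in_def)
    qed
    moreover have "dsum_in {..<m} (\<lambda>_. N.B) j (N.mn l') i l = (if (j, l') = (i, l) then \<one>\<^bsub>k\<^esub> else \<zero>\<^bsub>k\<^esub>)"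
      using i l by (auto simp: dsum_in_def N.B_eval(1) N.B_sel(2) N_carrier)
    ultimately show "\<kappa> (fmap ((\<lambda>(i, l). dsum_in {..<m} (\<lambda>_. N.B) i (N.mn l)) x) \<delta>) =
        ((\<lambda>(i, l). dsum_in {..<m} (\<lambda>_. N.B) i (N.mn l)) x) i l"
      using fmap_basis[OF x(2,3)] x(1) by simp
  qed
  then show ?thesis using z mod_hom_zero[OF kCmod_module[OF M_mod d] SM K(1)] by (simp add: \<delta>_def)
qed

text \<open>If \<open>fmap p\<close> vanishes outside degree \<open>\<gamma>\<close>, then
  \<open>fmap_coeff\<close> kills all coefficients of \<open>p\<close> that belong to other degrees.
  Conversely, each summand of \<open>fmap p\<close> is a product of homogeneous elements whose
  degrees add up to \<open>\<gamma>\<close>.\<close>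

lemma fmap_gr: assumes g: "\<gamma> \<in> Obj D" and p: "p \<in> carrier VK"
  shows "fmap p \<in> gr M \<gamma> \<longleftrightarrow> p \<in> shift_sum_grading (Int_vec r) R Rgr m c \<gamma>"
proof
  assume "fmap p \<in> gr M \<gamma>"
  then have "fmap p \<delta> = \<zero>\<^bsub>At M \<delta>\<^esub>" if "\<delta> \<in> Obj D" "\<delta> \<noteq> \<gamma>" for \<delta> using that by (simp add: gr_eq)
  then show "p \<in> shift_sum_grading (Int_vec r) R Rgr m c \<gamma>"
    unfolding sg_eq[OF g] using p fmap_coeff[OF _ _ p] tgt_Obj by blast
next
  assume "p \<in> shift_sum_grading (Int_vec r) R Rgr m c \<gamma>"
  then have pd: "\<And>i l. i < m \<Longrightarrow> l \<in> NV \<Longrightarrow> p i l \<noteq> \<zero>\<^bsub>k\<^esub> \<Longrightarrow> tgt i l = \<gamma>" by (simp add: sg_eq[OF g])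
  have "p i \<odot>\<^bsub>tot M\<^esub> fgen i \<in> gr M \<gamma>" if i: "i < m" for i
  proof -
    have "p i \<in> carrier R" using p i by (auto simp: dsum_sel(1))
    moreover have "lin_comb n a l = (\<lambda>j. \<gamma> j - c i j)" if "l \<in> NV" "p i l \<noteq> \<zero>\<^bsub>k\<^esub>" for l
      unfolding pd[OF i that, symmetric] by (simp add: tgt_def)
    ultimately have "p i \<in> Rgr (\<lambda>j. \<gamma> j - c i j)" by (simp add: algebra_grading_def N_carrier)
    from gr_smult[OF M_mod this fgen_gr[OF i]] show ?thesis by simp
  qed
  then show "fmap p \<in> gr M \<gamma>" unfolding fmap_eq dsum_lift_def by (intro gr_finsum[OF M_mod]) auto
qed

text \<open>\<open>is_finite_free_graded\<close> asks for a map out of the module, hence for the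
  inverse of \<open>fmap\<close>.\<close>

lemma tot_finite_free_lt: "is_finite_free_graded (Int_vec r) R Rgr (tot M) (gr M)"
proof -
  let ?f = "inv_into (carrier VR) fmap" and ?sg = "shift_sum_grading (Int_vec r) R Rgr m c"
  have f: "?f \<in> mod_hom R (tot M) VR"
    by (rule mod_hom_inv_into[OF VR_module tot_module[OF M_mod] fmap_hom fmap_bij])
  have bij: "bij_betw ?f (carrier (tot M)) (carrier VR)" by (rule bij_betw_inv_into[OF fmap_bij])
  have im: "?f ` gr M \<gamma> = ?sg \<gamma>" if g: "\<gamma> \<in> Obj D" for \<gamma>
  proof -
    have sub: "?sg \<gamma> \<subseteq> carrier VR" by (auto simp: shift_sum_grading_def shift_sum_def)
    have "fmap ` ?sg \<gamma> = gr M \<gamma>"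
    proof (intro equalityI subsetI)
      fix x assume "x \<in> fmap ` ?sg \<gamma>"
      then show "x \<in> gr M \<gamma>" using fmap_gr[OF g] sub VK_sel(1) by blast
    next
      fix x assume x: "x \<in> gr M \<gamma>"
      then have "x \<in> carrier (tot M)" by (simp add: gr_eq tot_sel)
      then obtain p where "p \<in> carrier VR" "x = fmap p" using fmap_bij by (auto simp: bij_betw_def)
      then show "x \<in> fmap ` ?sg \<gamma>" using fmap_gr[OF g, of p] x VK_sel(1) by blast
    qed
    moreover have "?f ` fmap ` ?sg \<gamma> = ?sg \<gamma>"
      using inv_into_f_f[OF bij_betw_imp_inj_on[OF fmap_bij]] sub by (force simp: image_iff)
    ultimately show ?thesis by simp
  qed
  have "?f \<in> graded_hom (Int_vec r) R (tot M) (gr M) (shift_sum R m) ?sg"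
    using f im by (auto simp: graded_hom_def shift_sum_def Z_Obj)
  moreover have "c \<in> {..<m} \<rightarrow> carrier (Int_vec r)" using c_obj by (auto simp: Z_Obj)
  ultimately show ?thesis unfolding is_finite_free_graded_def shift_sum_def[symmetric] Z_Obj
    using tot_graded[OF M_mod] bij im unfolding shift_sum_def[symmetric] by blast
qed

end

lemma tot_finite_free:
  assumes B: "fbasis k D M N c b" and N: "finite N"
  shows "is_finite_free_graded (Int_vec r) R Rgr (tot M) (gr M)"
proof -
  obtain \<tau> where "bij_betw \<tau> {0..<card N} N" using ex_bij_betw_nat_finite[OF N] by blast
  then have "bij_betw \<tau> {..<card N} N" by (simp add: atLeast0LessThan)
  from tot_finite_free_lt[OF fbasis_reindex[OF B this]] show ?thesis .
qed

end

section \<open>The finite free graded resolution\<close>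

context betti_setup begin

lemma total_resolution:
  "finite_free_graded_resolution (Int_vec r) R Rgr (\<lambda>i. tot (F i)) (\<lambda>i. gr (F i)) (\<lambda>i. total_map r (dF i)) kQ kQgr"
  unfolding finite_free_graded_resolution_def
proof (intro conjI allI)
  show "is_graded_module (Int_vec r) R Rgr kQ kQgr" by (rule kQ_graded)
  show "is_finite_free_graded (Int_vec r) R Rgr (tot (F i)) (gr (F i))" for i
    by (rule tot_finite_free[OF F_fbasis finite_nchains])
  \<comment> \<open>A chain without identities has at most \<open>card S\<close> objects, so the
    later terms are free on no generators.\<close>
  have "carrier (tot (F i)) = {\<zero>\<^bsub>tot (F i)\<^esub>}" if i: "i > card S" for i
  proof -
    have N: "nchains i = {}" using i by (intro nchains_empty) simp
    have z: "carrier (At (F i) \<delta>) = {\<zero>\<^bsub>At (F i) \<delta>\<^esub>}" if "\<delta> \<in> Obj D" for \<delta>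
      by (rule lbasis_empty) (use fbasis_lbasis[OF F_fbasis that, of i] N in simp)
    have "m = \<zero>\<^bsub>KM (F i)\<^esub>" if m: "m \<in> carrier (KM (F i))" for m
    proof (rule KM_eqI[OF F_kCmod m mod_zero[OF KM_module[OF F_kCmod]]])
      fix \<delta> assume d: "\<delta> \<in> Obj D"
      show "m \<delta> = \<zero>\<^bsub>KM (F i)\<^esub> \<delta>" using KM_at[OF F_kCmod m d] z[OF d] d by (simp add: dsum_sel(2))
    qed
    then show ?thesis using mod_zero[OF KM_module[OF F_kCmod]] unfolding tot_sel by blast
  qed
  then show "\<exists>l. \<forall>i>l. carrier (tot (F i)) = {\<zero>\<^bsub>tot (F i)\<^esub>}" by blast
  show "total_map r (dF i) \<in> graded_hom (Int_vec r) R (tot (F (Suc i))) (gr (F (Suc i))) (tot (F i)) (gr (F i))" for i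
    by (rule tmap_graded[OF F_kCmod F_kCmod dF_nat])
  obtain e where e: "e \<in> nat_trans k D (F 0) kF" and eb: "\<forall>d\<in>Obj D. \<forall>L\<in>bar_lists S d. length L = Suc 0 \<longrightarrow> e d (bF 0 d L) = un d"
    using augmentation_exists by blast
  note ex = F_exact[OF e eb, unfolded exact_augmented_def]
  note ex0 = ex[THEN conjunct1] and ex1 = ex[THEN conjunct2, THEN conjunct1]
    and ex2 = ex[THEN conjunct2, THEN conjunct2, THEN spec]
  \<comment> \<open>The total map of the augmentation ends in the total module of the functor of
    \<open>k[Q]\<close>; \<open>cmpr\<close> identifies this with \<open>k[Q]\<close>.\<close>
  let ?e = "\<lambda>m. cmpr (total_map r e m)"
  have "?e \<in> graded_hom (Int_vec r) R (tot (F 0)) (gr (F 0)) kQ kQgr"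
    unfolding graded_hom_def
  proof (intro CollectI conjI ballI image_subsetI)
    show "?e \<in> mod_hom R (tot (F 0)) kQ"
      by (rule mod_hom_comp[OF tmap_R_hom[OF F_kCmod M_kCmod e] cmpr_R_hom[OF M_kCmod]])
    show "?e m \<in> kQgr \<gamma>" if "m \<in> gr (F 0) \<gamma>" for m \<gamma>
      by (rule cmpr_gr[OF tmap_gr[OF F_kCmod M_kCmod e that]])
  qed
  moreover have "exact_augmented (\<lambda>i. tot (F i)) (\<lambda>i. total_map r (dF i)) ?e kQ"
    unfolding exact_augmented_def
  proof (intro conjI allI)
    have "total_map r e ` carrier (KM (F 0)) = carrier (KM kF)"
    proof -
      have "m \<delta> \<in> e \<delta> ` carrier (At (F 0) \<delta>)" if "m \<in> carrier (KM kF)" "\<delta> \<in> Obj D" for m \<delta>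
        unfolding ex0[OF that(2)] by (rule KM_at[OF M_kCmod that])
      then show ?thesis unfolding tmap_image[OF F_kCmod M_kCmod e] by (intro equalityI subsetI) simp_all
    qed
    then show "?e ` carrier (tot (F 0)) = carrier kQ"
      using bij_betw_imp_surj_on[OF cmpr_bij[OF M_kCmod]] unfolding tot_sel image_image[symmetric] by simp
    have "total_map r (dF 0) ` carrier (tot (F (Suc 0))) = a_kernel (tot (F 0)) (tot kF) (total_map r e)"
      by (rule tmap_exact[OF F_kCmod F_kCmod M_kCmod dF_nat e]) (simp add: ex1[simplified])
    also have "\<dots> = a_kernel (tot (F 0)) kQ ?e"
    proof -
      have "?e m = \<zero>\<^bsub>kQ\<^esub> \<longleftrightarrow> total_map r e m = \<zero>\<^bsub>tot kF\<^esub>" if m: "m \<in> carrier (tot (F 0))" for m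
      proof -
        have m': "total_map r e m \<in> carrier (KM kF)" using tmap_closed[OF F_kCmod M_kCmod e] m by (simp add: tot_sel)
        have z: "cmpr \<zero>\<^bsub>KM kF\<^esub> = \<zero>\<^bsub>kQ\<^esub>"
          using mod_hom_zero[OF KM_module[OF M_kCmod] A.kmod cmpr_hom[OF M_kCmod]] by simp
        show ?thesis
          unfolding tot_sel z[symmetric]
          by (rule inj_on_eq_iff[OF bij_betw_imp_inj_on[OF cmpr_bij[OF M_kCmod]] m' mod_zero[OF KM_module[OF M_kCmod]]])
      qed
      then show ?thesis unfolding a_kernel_def' by blast
    qed
    finally show "total_map r (dF 0) ` carrier (tot (F 1)) = a_kernel (tot (F 0)) kQ ?e" by simp
    show "total_map r (dF (Suc i)) ` carrier (tot (F (Suc (Suc i)))) = a_kernel (tot (F (Suc i))) (tot (F i)) (total_map r (dF i))" for i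
      by (rule tmap_exact[OF F_kCmod F_kCmod F_kCmod dF_nat dF_nat ex2])
  qed
  ultimately show "\<exists>e\<in>graded_hom (Int_vec r) R (tot (F 0)) (gr (F 0)) kQ kQgr.
      exact_augmented (\<lambda>i. tot (F i)) (\<lambda>i. total_map r (dF i)) e kQ" by blast
qed

end

theorem theorem9p2:
  fixes k :: "('k, 'x) ring_scheme"
    and Q :: "('q, 'y) monoid_scheme"
    and r n :: nat
    and \<iota> :: "'q \<Rightarrow> nat \<Rightarrow> nat"
    and g :: "nat \<Rightarrow> 'q"
    and P :: "nat \<Rightarrow> (nat \<Rightarrow> int, nat \<Rightarrow> nat, 'k, 'v) fmod"
    and dP :: "nat \<Rightarrow> (nat \<Rightarrow> int) \<Rightarrow> 'v \<Rightarrow> 'v"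
    and eP :: "(nat \<Rightarrow> int) \<Rightarrow> 'v \<Rightarrow> 'q \<Rightarrow> 'k"
  defines "deg \<equiv> (\<lambda>q j. int (\<iota> q j))"
  defines "a \<equiv> (\<lambda>i. deg (g i))"
  defines "R \<equiv> semigroup_algebra k (Nat_vec n)"
    and "Rgr \<equiv> algebra_grading k (Nat_vec n) (lin_comb n a)"
    and "kQ \<equiv> semigroup_ring_module k Q n g"
    and "kQgr \<equiv> algebra_grading k Q deg"
  defines "kQ_fun \<equiv> functor_of_graded k n kQ kQgr"
    and "D \<equiv> action_category r n a"
  defines "\<B> \<equiv> betti_category k D P"
  defines "\<rho>o \<equiv> (\<lambda>c. c)"
    and "\<rho>m \<equiv> (\<lambda>c d u. u)"
  defines "B \<equiv> (\<lambda>i. nbar \<B> (const_fmod k) i)"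
  defines "F \<equiv> (\<lambda>i. ind_fmod k \<B> D \<rho>o \<rho>m (B i))"
    and "dF \<equiv> (\<lambda>i. ind_map k \<B> D \<rho>o \<rho>m (B (Suc i)) (B i) (nbar_diff \<B> (const_fmod k) i))"
  assumes "field k"
    and "affine_semigroup Q" and "pointed Q" and "affine_dim Q = r"
    and "\<iota> \<in> hom Q (Nat_vec r)" and "inj_on \<iota> (carrier Q)"
    and "inj_on g {..<n}" and "minimal_generating_set Q (g ` {..<n})"
    and "minimal_free_resolution k D P dP eP kQ_fun"
  shows "free_resolution k D F dF kQ_fun \<and>
    finite_free_graded_resolution (Int_vec r) R Rgr
      (\<lambda>i. total_module k r n a (F i)) (\<lambda>i. total_grading r (F i)) (\<lambda>i. total_map r (dF i))
      kQ kQgr"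
proof -
  interpret Q: comm_monoid Q using \<open>affine_semigroup Q\<close> by (simp add: affine_semigroup_def)
  interpret affine Q k r n \<iota> g
    by (intro affine.intro affine_axioms.intro Q.comm_monoid_axioms assms(15,19,20,22))
  interpret betti_setup Q k r n \<iota> g P dP eP
    by (intro betti_setup.intro betti_setup_axioms.intro affine_axioms assms(23)[unfolded assms(1-14)])
  show ?thesis
    unfolding assms(1-14) betti_C by (intro conjI F_free_resolution total_resolution)
qed

end
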